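(* Let $(S,\Omega)$ be a relative Sierpiński carpet such that $\partial\Omega$ consists of finitely many, non-trivial, and disjoint Jordan curves. Suppose that $\Omega$ is bounded and let $f\in\mathcal W^{1,2}(S)$ be a function with bounded boundary values, i.e., there exists $M>0$ such that $|f(x)|\le M$ for all $x\in\partial\Omega$. Then there exists a unique function $u\in\mathcal W^{1,2}(S)$ that minimizes $D_\Omega(g)$ over all $g\in\mathcal W^{1,2}(S)$ with boundary values equal to $f$. The function $u$ is carpet-harmonic. (Here $\mathcal W^{1,2}(S)$ is either the weak Sobolev space throughout, in which case $u$ is weak carpet-harmonic, or the strong Sobolev space throughout, in which case $u$ is strong carpet-harmonic.)
   Context: Relative Sierpiński carpets. Let $\Omega\subset\mathbb C$ be a connected open set and $\{Q_i\}_{i\in\mathbb N}$ open Jordan regions compactly contained in $\Omega$, with pairwise disjoint closures, such that $S:=\Omega\setminus\bigcup_iQ_i$ has empty interior and is locally connected. Then $(S,\Omega)$ is a relative Sierpiński carpet with peripheral disks $Q_i$. Standing assumptions on every relative Sierpiński carpet: (i) $\mathcal H^2(S)=0$; (ii) there is $K_0\ge1$ such that for each $i$ there are concentric balls $B(x,r)\subset Q_i\subset B(x,R)$ with $R/r\le K_0$; (iii) there is $K_1>0$ such that $\mathcal H^2(B(x,r)\cap Q_i)\ge K_1r^2$ for all $i$, $x\in Q_i$, $0<r<\operatorname{diam}(Q_i)$. $\mathcal H^m$ is Hausdorff measure normalized to agree with Lebesgue measure. Notation. $\widehat{\mathbb R}=\mathbb R\cup\{\pm\infty\}$. $V\subset\subset\Omega$: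 $\overline V$ is compact and contained in $\Omega$. $I_V=\{i:Q_i\cap V\ne\emptyset\}$. A path is a continuous map from a bounded interval to $\mathbb C$ with a continuous extension to the closed interval (also its image); it is open if the interval is open; subpaths are restrictions to subintervals. For $g:S\to\widehat{\mathbb R}$: $M_{Q_i}(g)=\sup_{\partial Q_i}g$, $m_{Q_i}(g)=\inf_{\partial Q_i}g$, $\operatorname{osc}_{Q_i}(g)=M_{Q_i}(g)-m_{Q_i}(g)$. Moduli of a path family $\Gamma$ in $\Omega$. $\mathrm{mod}_2(\Gamma)=\inf\int\lambda^2d\mathcal H^2$ over Borel $\lambda\ge0$ with $\int_\gamma\lambda\,ds\ge1$ for all $\gamma\in\Gamma$ (with $\int_\gamma\lambda\,ds:=\infty$ if $\gamma$ is not locally rectifiable). Weak modulus $\mathrm{mod}_w(\Gamma)=\inf\sum_i\rho(Q_i)^2$ over non-negative sequences for which there is $\Gamma_0\subset\Gamma$ with $\mathrm{mod}_2(\Gamma_0)=0$ and $\sum_{i:Q_i\cap\gamma\ne\emptyset}\rho(Q_i)\ge1$ for $\gamma\in\Gamma\setminus\Gamma_0$. Strong modulus $\mathrm{mod}_s(\Gamma)$: the same infimum over sequences satisfying this inequality for all $\gamma\in\Gamma$ with $\mathcal H^1(\gamma\cap S)=0$. Sobolev spaces. $\{\rho(Q_i)\}$ is a weak (strong) upper gradient of $g:S\to\widehat{\mathbb R}$ if there is $\Gamma_0$ with $\mathrm{mod}_w(\Gamma_0)=0$ ($\mathrm{mod}_s(\Gamma_0)=0$) such that for all paths $\gamma\subset\Omega$,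 $\gamma\notin\Gamma_0$, and $x,y\in\gamma\cap S$: $g(x),g(y)\neq\pm\infty$ and $|g(x)-g(y)|\le\sum_{i:Q_i\cap\gamma\ne\emptyset}\rho(Q_i)$. $g$ lies in the weak (strong) space $\mathcal W^{1,2}_{\mathrm{loc}}(S)$ if $M_{Q_i}(g),m_{Q_i}(g)$ are finite for all $i$, $\sum_{i\in I_B}M_{Q_i}(g)^2\operatorname{diam}(Q_i)^2<\infty$ and $\sum_{i\in I_B}\operatorname{osc}_{Q_i}(g)^2<\infty$ for every ball $B\subset\subset\Omega$, and $\{\operatorname{osc}_{Q_i}(g)\}$ is a weak (strong) upper gradient of $g$; $g\in\mathcal W^{1,2}(S)$ if moreover the sums over all $i\in\mathbb N$ are finite. Dirichlet energy: $D_V(g)=\sum_{i\in I_V}\operatorname{osc}_{Q_i}(g)^2$ for open $V\subset\Omega$. $u\in\mathcal W^{1,2}_{\mathrm{loc}}(S)$ is (weak, resp. strong) carpet-harmonic if $D_V(u)\le D_V(u+\zeta)$ for every open $V\subset\subset\Omega$ and every $\zeta\in\mathcal W^{1,2}(S)$ with $\zeta|_{S\setminus V}\equiv0$ (spaces in the weak, resp. strong, version). Boundary values. For $f\in\mathcal W^{1,2}(S)$ a path $\gamma\subset\Omega$ is good for $f$ if: $\mathcal H^1(\gamma\cap S)=0$; for every subpath $\gamma'$ of $\gamma$ and all $x,y\in\gamma'\cap S$, $f(x),f(y)\ne\pm\infty$ and $|f(x)-f(y)|\le\sum_{i:Q_i\cap\gamma'\ne\emptyset}\operatorname{osc}_{Q_i}(f)$;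 and $\sum_{i:Q_i\cap\gamma\ne\emptyset}\operatorname{osc}_{Q_i}(f)<\infty$. A point $x\in\partial\Omega$ is accessible by an open path $\gamma\subset\Omega$ if $x\in\overline\gamma$. If $x\in\partial\Omega$ is accessible by an open path $\gamma$ good for $f$, set $f(x)=\liminf_{Q_i\to x,\,Q_i\cap\gamma\ne\emptyset}M_{Q_i}(f)$ (independent of $\gamma$); for the other points $x\in\partial\Omega$ set $f(x)=\liminf f(y)$ as $y\to x$ through such accessible $y\in\partial\Omega$. A function $g\in\mathcal W^{1,2}(S)$ has boundary values equal to $f$ if there is a path family $\mathcal G_0$ in $\Omega$, whose complement (in the set of all paths in $\Omega$) has weak (strong) modulus zero, such that $g(x)=f(x)$ for all $x\in\partial\Omega$ accessible by paths of $\mathcal G_0$.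
   Formalization: Uniqueness of u is meant up to Sobolev equivalence: sup and inf on each ∂Q_i agree, and values agree on S off the ∂Q_i along all paths outside a family of modulus zero; pointwise uniqueness fails, since u may be changed at a point of S on no ∂Q_i. Paths are taken non-constant. *)

theory Defs
  imports "HOL-Analysis.Analysis"
begin

section \<open>Hausdorff measure and Jordan regions\<close>

text \<open>
  The normalization makes the \<open>m\<close>-dimensional measure (\<open>m \<ge> 1\<close>) agree with Lebesgue measure in
  dimension \<open>m\<close>.  Two-dimensional Hausdorff measure on the plane is therefore rendered below as
  \<^const>\<open>lborel\<close>; all sets to which it is applied are Borel.  The following definition is needed for
  the one-dimensional measure of subsets of the plane.
\<close>

definition hausdorff_content :: "nat \<Rightarrow> real \<Rightarrow> complex set \<Rightarrow> ennreal" where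
  "hausdorff_content m \<delta> A =
     (INF E \<in> {E :: nat \<Rightarrow> complex set. A \<subseteq> (\<Union>i. E i) \<and> (\<forall>i. bounded (E i) \<and> diameter (E i) \<le> \<delta>)}.
        (\<Sum>i. ennreal (unit_ball_vol (real m) * (diameter (E i) / 2) ^ m)))"

definition hausdorff_measure :: "nat \<Rightarrow> complex set \<Rightarrow> ennreal" where
  "hausdorff_measure m A = (SUP \<delta> \<in> {0<..}. hausdorff_content m \<delta> A)"

definition jordan_curve :: "complex set \<Rightarrow> bool" where
  "jordan_curve J \<longleftrightarrow> (\<exists>c. simple_path c \<and> pathfinish c = pathstart c \<and> path_image c = J)"

definition jordan_region :: "complex set \<Rightarrow> bool" where
  "jordan_region D \<longleftrightarrow> (\<exists>J. jordan_curve J \<and> D = inside J)"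

text \<open>A simple closed path is never constant, so these Jordan curves are non-trivial.\<close>

definition bounded_by_jordan_curves :: "complex set \<Rightarrow> bool" where
  "bounded_by_jordan_curves \<Omega> \<longleftrightarrow>
     (\<exists>\<J>. finite \<J> \<and> (\<forall>J\<in>\<J>. jordan_curve J) \<and> pairwise disjnt \<J> \<and> frontier \<Omega> = \<Union>\<J>)"

definition compactly_contained :: "complex set \<Rightarrow> complex set \<Rightarrow> bool"  (infix \<open>\<subset>\<subset>\<close> 50) where
  "V \<subset>\<subset> \<Omega> \<longleftrightarrow> compact (closure V) \<and> closure V \<subseteq> \<Omega>"


section \<open>Relative Sierpinski carpets\<close>

definition carpet :: "complex set \<Rightarrow> (nat \<Rightarrow> complex set) \<Rightarrow> complex set" where
  "carpet \<Omega> Q = \<Omega> - (\<Union>i. Q i)"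

definition relative_sierpinski_carpet :: "complex set \<Rightarrow> (nat \<Rightarrow> complex set) \<Rightarrow> bool" where
  "relative_sierpinski_carpet \<Omega> Q \<longleftrightarrow>
     open \<Omega> \<and> connected \<Omega> \<and>
     (\<forall>i. jordan_region (Q i) \<and> Q i \<subset>\<subset> \<Omega>) \<and>
     (\<forall>i j. i \<noteq> j \<longrightarrow> closure (Q i) \<inter> closure (Q j) = {}) \<and>
     interior (carpet \<Omega> Q) = {} \<and>
     locally connected (carpet \<Omega> Q) \<and>
     emeasure lborel (carpet \<Omega> Q) = 0 \<and>
     (\<exists>K\<^sub>0\<ge>1. \<forall>i. \<exists>x r R. 0 < r \<and> ball x r \<subseteq> Q i \<and> Q i \<subseteq> ball x R \<and> R / r \<le> K\<^sub>0) \<and>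
     (\<exists>K\<^sub>1>0. \<forall>i. \<forall>x\<in>Q i. \<forall>r. 0 < r \<longrightarrow> r < diameter (Q i) \<longrightarrow>
        ennreal (K\<^sub>1 * r\<^sup>2) \<le> emeasure lborel (ball x r \<inter> Q i))"


section \<open>Paths and line integrals\<close>

text \<open>
  A path is a parameter interval together with a map; only the values on the interval matter.
  Paths are non-constant, as is usual for modulus: a constant path through a point of the carpet
  would have infinite modulus, so that no function taking a value \<open>\<pm>\<infinity>\<close> at a point of the carpet
  could have an upper gradient.
\<close>

type_synonym cpath = "real set \<times> (real \<Rightarrow> complex)"

definition path_trace :: "cpath \<Rightarrow> complex set" where
  "path_trace \<gamma> = snd \<gamma> ` fst \<gamma>"

definition is_path :: "cpath \<Rightarrow> bool" where
  "is_path \<gamma> \<longleftrightarrow> is_interval (fst \<gamma>) \<and> bounded (fst \<gamma>) \<and>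
     (\<exists>h. continuous_on (closure (fst \<gamma>)) h \<and> (\<forall>t\<in>fst \<gamma>. h t = snd \<gamma> t)) \<and>
     (\<exists>s\<in>fst \<gamma>. \<exists>t\<in>fst \<gamma>. snd \<gamma> s \<noteq> snd \<gamma> t)"

definition paths_in :: "complex set \<Rightarrow> cpath set" where
  "paths_in \<Omega> = {\<gamma>. is_path \<gamma> \<and> path_trace \<gamma> \<subseteq> \<Omega>}"

definition curve_length :: "(real \<Rightarrow> complex) \<Rightarrow> real \<Rightarrow> real \<Rightarrow> ennreal" where
  "curve_length c a b =
     (SUP ts \<in> {ts. sorted ts \<and> set ts \<subseteq> {a..b}}.
        \<Sum>i<length ts - 1. ennreal (dist (c (ts ! i)) (c (ts ! Suc i))))"

definition locally_rectifiable :: "cpath \<Rightarrow> bool" where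
  "locally_rectifiable \<gamma> \<longleftrightarrow> (\<forall>a b. a \<le> b \<longrightarrow> {a..b} \<subseteq> fst \<gamma> \<longrightarrow> curve_length (snd \<gamma>) a b < \<infinity>)"

text \<open>The value does not depend on the choice of \<open>t\<close>, since \<open>c\<close> is constant where its length does not
  increase.\<close>

definition arclength_param :: "(real \<Rightarrow> complex) \<Rightarrow> real \<Rightarrow> real \<Rightarrow> real \<Rightarrow> complex" where
  "arclength_param c a b \<tau> = c (SOME t. t \<in> {a..b} \<and> curve_length c a t = ennreal \<tau>)"

definition line_integral :: "(complex \<Rightarrow> ennreal) \<Rightarrow> cpath \<Rightarrow> ennreal" where
  "line_integral w \<gamma> =
     (if locally_rectifiable \<gamma> then
        (SUP (a, b) \<in> {(a, b). a \<le> b \<and> {a..b} \<subseteq> fst \<gamma>}.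
           \<integral>\<^sup>+\<tau>. w (arclength_param (snd \<gamma>) a b \<tau>)
               * indicator {0..enn2real (curve_length (snd \<gamma>) a b)} \<tau> \<partial>lborel)
      else \<infinity>)"


section \<open>Moduli of path families\<close>

definition mod2 :: "cpath set \<Rightarrow> ennreal" where
  "mod2 \<Gamma> = (INF w \<in> {w \<in> borel_measurable borel. \<forall>\<gamma>\<in>\<Gamma>. 1 \<le> line_integral w \<gamma>}.
               \<integral>\<^sup>+z. (w z)\<^sup>2 \<partial>lborel)"

definition meeting :: "(nat \<Rightarrow> complex set) \<Rightarrow> complex set \<Rightarrow> nat set" where
  "meeting Q A = {i. Q i \<inter> A \<noteq> {}}"

definition sum_over :: "nat set \<Rightarrow> (nat \<Rightarrow> ennreal) \<Rightarrow> ennreal" where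
  "sum_over I \<rho> = (\<Sum>i. if i \<in> I then \<rho> i else 0)"

text \<open>Sequences are allowed to take the value \<open>\<infinity>\<close>; such sequences have infinite energy and do not
  affect the infima.\<close>

definition weak_mod :: "(nat \<Rightarrow> complex set) \<Rightarrow> cpath set \<Rightarrow> ennreal" where
  "weak_mod Q \<Gamma> =
     (INF \<rho> \<in> {\<rho>. \<exists>\<Gamma>\<^sub>0\<subseteq>\<Gamma>. mod2 \<Gamma>\<^sub>0 = 0 \<and> (\<forall>\<gamma>\<in>\<Gamma> - \<Gamma>\<^sub>0. 1 \<le> sum_over (meeting Q (path_trace \<gamma>)) \<rho>)}.
        (\<Sum>i. (\<rho> i)\<^sup>2))"

definition strong_mod :: "complex set \<Rightarrow> (nat \<Rightarrow> complex set) \<Rightarrow> cpath set \<Rightarrow> ennreal" where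
  "strong_mod \<Omega> Q \<Gamma> =
     (INF \<rho> \<in> {\<rho>. \<forall>\<gamma>\<in>\<Gamma>. hausdorff_measure 1 (path_trace \<gamma> \<inter> carpet \<Omega> Q) = 0
                    \<longrightarrow> 1 \<le> sum_over (meeting Q (path_trace \<gamma>)) \<rho>}.
        (\<Sum>i. (\<rho> i)\<^sup>2))"

datatype version = Weak | Strong

fun carpet_mod :: "version \<Rightarrow> complex set \<Rightarrow> (nat \<Rightarrow> complex set) \<Rightarrow> cpath set \<Rightarrow> ennreal" where
  "carpet_mod Weak \<Omega> Q \<Gamma> = weak_mod Q \<Gamma>"
| "carpet_mod Strong \<Omega> Q \<Gamma> = strong_mod \<Omega> Q \<Gamma>"


section \<open>Sobolev spaces\<close>

text \<open>Functions on the carpet are total functions; only their values on the carpet (which contains all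
  the boundaries of the peripheral disks) are ever used.\<close>

definition bdry_sup :: "(nat \<Rightarrow> complex set) \<Rightarrow> (complex \<Rightarrow> ereal) \<Rightarrow> nat \<Rightarrow> ereal" where
  "bdry_sup Q g i = (SUP x \<in> frontier (Q i). g x)"

definition bdry_inf :: "(nat \<Rightarrow> complex set) \<Rightarrow> (complex \<Rightarrow> ereal) \<Rightarrow> nat \<Rightarrow> ereal" where
  "bdry_inf Q g i = (INF x \<in> frontier (Q i). g x)"

definition osc :: "(nat \<Rightarrow> complex set) \<Rightarrow> (complex \<Rightarrow> ereal) \<Rightarrow> nat \<Rightarrow> ennreal" where
  "osc Q g i = e2ennreal (bdry_sup Q g i - bdry_inf Q g i)"

definition gradient_ineq ::
  "complex set \<Rightarrow> (nat \<Rightarrow> complex set) \<Rightarrow> (nat \<Rightarrow> ennreal) \<Rightarrow> (complex \<Rightarrow> ereal) \<Rightarrow> complex set \<Rightarrow> bool" where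
  "gradient_ineq \<Omega> Q \<rho> g A \<longleftrightarrow>
     (\<forall>x\<in>A \<inter> carpet \<Omega> Q. \<forall>y\<in>A \<inter> carpet \<Omega> Q.
        \<bar>g x\<bar> \<noteq> \<infinity> \<and> \<bar>g y\<bar> \<noteq> \<infinity> \<and> e2ennreal \<bar>g x - g y\<bar> \<le> sum_over (meeting Q A) \<rho>)"

definition upper_gradient ::
  "version \<Rightarrow> complex set \<Rightarrow> (nat \<Rightarrow> complex set) \<Rightarrow> (nat \<Rightarrow> ennreal) \<Rightarrow> (complex \<Rightarrow> ereal) \<Rightarrow> bool" where
  "upper_gradient ver \<Omega> Q \<rho> g \<longleftrightarrow>
     (\<exists>\<Gamma>\<^sub>0\<subseteq>paths_in \<Omega>. carpet_mod ver \<Omega> Q \<Gamma>\<^sub>0 = 0 \<and>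
        (\<forall>\<gamma>\<in>paths_in \<Omega> - \<Gamma>\<^sub>0. gradient_ineq \<Omega> Q \<rho> g (path_trace \<gamma>)))"

definition sobolev_sums_finite ::
  "(nat \<Rightarrow> complex set) \<Rightarrow> (complex \<Rightarrow> ereal) \<Rightarrow> nat set \<Rightarrow> bool" where
  "sobolev_sums_finite Q g I \<longleftrightarrow>
     sum_over I (\<lambda>i. ennreal ((real_of_ereal (bdry_sup Q g i))\<^sup>2 * (diameter (Q i))\<^sup>2)) < \<infinity> \<and>
     sum_over I (\<lambda>i. (osc Q g i)\<^sup>2) < \<infinity>"

definition sobolev_loc ::
  "version \<Rightarrow> complex set \<Rightarrow> (nat \<Rightarrow> complex set) \<Rightarrow> (complex \<Rightarrow> ereal) set" where
  "sobolev_loc ver \<Omega> Q =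
     {g. (\<forall>i. \<bar>bdry_sup Q g i\<bar> \<noteq> \<infinity> \<and> \<bar>bdry_inf Q g i\<bar> \<noteq> \<infinity>) \<and>
         (\<forall>x r. ball x r \<subset>\<subset> \<Omega> \<longrightarrow> sobolev_sums_finite Q g (meeting Q (ball x r))) \<and>
         upper_gradient ver \<Omega> Q (osc Q g) g}"

definition sobolev ::
  "version \<Rightarrow> complex set \<Rightarrow> (nat \<Rightarrow> complex set) \<Rightarrow> (complex \<Rightarrow> ereal) set" where
  "sobolev ver \<Omega> Q = {g \<in> sobolev_loc ver \<Omega> Q. sobolev_sums_finite Q g UNIV}"

text \<open>
  Changing the value of a Sobolev function at one point of the carpet that lies on no peripheral
  circle affects neither membership in the Sobolev space nor energy nor boundary values, because
  the paths through that point have modulus zero.  Uniqueness therefore refers to the usual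
  identification of Sobolev functions that agree up to an exceptional path family; on the
  peripheral circles only the suprema and infima enter the theory, and these must be equal.
\<close>

definition sobolev_eq ::
  "version \<Rightarrow> complex set \<Rightarrow> (nat \<Rightarrow> complex set) \<Rightarrow> (complex \<Rightarrow> ereal) \<Rightarrow> (complex \<Rightarrow> ereal) \<Rightarrow> bool" where
  "sobolev_eq ver \<Omega> Q u v \<longleftrightarrow>
     (\<forall>i. bdry_sup Q u i = bdry_sup Q v i \<and> bdry_inf Q u i = bdry_inf Q v i) \<and>
     (\<exists>\<Gamma>\<^sub>0\<subseteq>paths_in \<Omega>. carpet_mod ver \<Omega> Q \<Gamma>\<^sub>0 = 0 \<and>
        (\<forall>\<gamma>\<in>paths_in \<Omega> - \<Gamma>\<^sub>0. \<forall>x\<in>path_trace \<gamma> \<inter> carpet \<Omega> Q - (\<Union>i. frontier (Q i)). u x = v x))"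


section \<open>Dirichlet energy and carpet-harmonic functions\<close>

definition dirichlet_energy ::
  "(nat \<Rightarrow> complex set) \<Rightarrow> complex set \<Rightarrow> (complex \<Rightarrow> ereal) \<Rightarrow> ennreal" where
  "dirichlet_energy Q V g = sum_over (meeting Q V) (\<lambda>i. (osc Q g i)\<^sup>2)"

text \<open>The energy only sees values on peripheral circles, where Sobolev functions are finite, so the
  value of \<open>\<infinity> + - \<infinity>\<close> is irrelevant here.\<close>

definition carpet_harmonic ::
  "version \<Rightarrow> complex set \<Rightarrow> (nat \<Rightarrow> complex set) \<Rightarrow> (complex \<Rightarrow> ereal) \<Rightarrow> bool" where
  "carpet_harmonic ver \<Omega> Q u \<longleftrightarrow>
     u \<in> sobolev_loc ver \<Omega> Q \<and>
     (\<forall>V. open V \<longrightarrow> V \<subset>\<subset> \<Omega> \<longrightarrow>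
        (\<forall>\<zeta>\<in>sobolev ver \<Omega> Q. (\<forall>x\<in>carpet \<Omega> Q - V. \<zeta> x = 0) \<longrightarrow>
           dirichlet_energy Q V u \<le> dirichlet_energy Q V (\<lambda>x. u x + \<zeta> x)))"


section \<open>Boundary values\<close>

definition good_path ::
  "complex set \<Rightarrow> (nat \<Rightarrow> complex set) \<Rightarrow> (complex \<Rightarrow> ereal) \<Rightarrow> cpath \<Rightarrow> bool" where
  "good_path \<Omega> Q f \<gamma> \<longleftrightarrow>
     \<gamma> \<in> paths_in \<Omega> \<and>
     hausdorff_measure 1 (path_trace \<gamma> \<inter> carpet \<Omega> Q) = 0 \<and>
     (\<forall>J\<subseteq>fst \<gamma>. is_interval J \<longrightarrow> gradient_ineq \<Omega> Q (osc Q f) f (snd \<gamma> ` J)) \<and>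
     sum_over (meeting Q (path_trace \<gamma>)) (osc Q f) < \<infinity>"

definition accessible_by :: "complex \<Rightarrow> cpath \<Rightarrow> bool" where
  "accessible_by x \<gamma> \<longleftrightarrow> open (fst \<gamma>) \<and> x \<in> closure (path_trace \<gamma>)"

definition accessible_good ::
  "complex set \<Rightarrow> (nat \<Rightarrow> complex set) \<Rightarrow> (complex \<Rightarrow> ereal) \<Rightarrow> complex set" where
  "accessible_good \<Omega> Q f = {x \<in> frontier \<Omega>. \<exists>\<gamma>. good_path \<Omega> Q f \<gamma> \<and> accessible_by x \<gamma>}"

text \<open>Here \<open>Q\<^sub>i \<rightarrow> x\<close> means that \<open>Q\<^sub>i\<close> is contained in ever smaller balls centred at \<open>x\<close>.\<close>

definition liminf_along ::
  "(nat \<Rightarrow> complex set) \<Rightarrow> (complex \<Rightarrow> ereal) \<Rightarrow> cpath \<Rightarrow> complex \<Rightarrow> ereal" where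
  "liminf_along Q f \<gamma> x =
     (SUP r \<in> {0<..}. INF i \<in> {i \<in> meeting Q (path_trace \<gamma>). Q i \<subseteq> ball x r}. bdry_sup Q f i)"

definition accessible_value ::
  "complex set \<Rightarrow> (nat \<Rightarrow> complex set) \<Rightarrow> (complex \<Rightarrow> ereal) \<Rightarrow> complex \<Rightarrow> ereal" where
  "accessible_value \<Omega> Q f x =
     liminf_along Q f (SOME \<gamma>. good_path \<Omega> Q f \<gamma> \<and> accessible_by x \<gamma>) x"

definition boundary_value ::
  "complex set \<Rightarrow> (nat \<Rightarrow> complex set) \<Rightarrow> (complex \<Rightarrow> ereal) \<Rightarrow> complex \<Rightarrow> ereal" where
  "boundary_value \<Omega> Q f x =
     (if x \<in> accessible_good \<Omega> Q f then accessible_value \<Omega> Q f x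
      else Liminf (at x within accessible_good \<Omega> Q f) (accessible_value \<Omega> Q f))"

definition has_boundary_values ::
  "version \<Rightarrow> complex set \<Rightarrow> (nat \<Rightarrow> complex set) \<Rightarrow> (complex \<Rightarrow> ereal) \<Rightarrow> (complex \<Rightarrow> ereal) \<Rightarrow> bool" where
  "has_boundary_values ver \<Omega> Q g f \<longleftrightarrow>
     (\<exists>\<G>\<subseteq>paths_in \<Omega>. carpet_mod ver \<Omega> Q (paths_in \<Omega> - \<G>) = 0 \<and>
        (\<forall>x\<in>frontier \<Omega>. (\<exists>\<gamma>\<in>\<G>. accessible_by x \<gamma>) \<longrightarrow>
           boundary_value \<Omega> Q g x = boundary_value \<Omega> Q f x))"

definition dirichlet_minimizer ::
  "version \<Rightarrow> complex set \<Rightarrow> (nat \<Rightarrow> complex set) \<Rightarrow> (complex \<Rightarrow> ereal) \<Rightarrow> (complex \<Rightarrow> ereal) \<Rightarrow> bool" where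
  "dirichlet_minimizer ver \<Omega> Q f u \<longleftrightarrow>
     u \<in> sobolev ver \<Omega> Q \<and> has_boundary_values ver \<Omega> Q u f \<and>
     (\<forall>g\<in>sobolev ver \<Omega> Q. has_boundary_values ver \<Omega> Q g f \<longrightarrow>
        dirichlet_energy Q \<Omega> u \<le> dirichlet_energy Q \<Omega> g)"

end

theory Submission
  imports Defs "HOL-Library.Diagonal_Subsequence"
begin

text \<open>
  By a covering argument along paths, every square-summable upper gradient of \<open>g\<close> may be replaced by the
  oscillation of \<open>g\<close>; hence Lipschitz combinations of Sobolev functions, and limits with a common
  square-summable upper gradient, are again Sobolev functions.  Boundary values are limits along paths:
  two paths with the same end point \<open>x\<close> are linked by arcs of small squares around \<open>x\<close> that meet disks of
  small total oscillation, because the boundary is locally a Jordan arc.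

  For existence, the parallelogram law makes the oscillations of a truncated minimizing sequence Cauchy
  in \<open>\<ell>\<^sup>2\<close>, so that a subsequence has a common square-summable upper gradient, and the pointwise upper limit
  is a minimizer.  The minimizer \<open>u\<close> is carpet-harmonic because \<open>u + \<zeta>\<close> is a competitor whose energy
  differs only on the disks that meet \<open>V\<close>.

  For uniqueness, two minimizers \<open>u\<close> and \<open>v\<close> have the same oscillations, again by the parallelogram law.
  If their suprema differ on a disk of positive oscillation, then for a suitable constant \<open>k\<close> the
  competitor \<open>min v (max u k)\<close> has smaller energy.  If \<open>v - u = a > 0\<close> on a disk without oscillation, then
  \<open>max (v - u) (a / 2)\<close> has no oscillation off finitely many disks; since these do not disconnect the
  domain, it equals \<open>a\<close> along a path to the boundary, where its limit is \<open>a / 2\<close>.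
\<close>


section \<open>A covering bound along paths\<close>

text \<open>The Sobolev space demands that the oscillation itself be an upper gradient, whereas
  sums, maxima and limits of functions come with another sequence (\<open>osc Q u + osc Q v\<close>
  for \<open>u + v\<close>, a supremum for a limit). Exchanging gradients is therefore a
  prerequisite for every construction of competitors. Fubini's theorem shows genericity only for
  segments parallel to the axes; hence linking is done by squares and L-shaped polygons instead of
  circles or general curves. Both moduli are treated at once: null families obey the same closure
  rules, and nullity is always certified by a sequence and a weight of small energy. Boundary values
  are defined through a choice of path and a lower limit over disks; they become usable after
  translation into limits along almost every path. For uniqueness, convexity of the energy alone is
  not enough: the energy determines the oscillations, not the values, so a difference
  \<open>v - u\<close> that is constant on disks has to be carried to the boundary.\<close>

lemma sum_over_mono:
  assumes "I \<subseteq> J" "\<And>i. i \<in> I \<Longrightarrow> \<sigma> i \<le> \<tau> i"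
  shows "sum_over I \<sigma> \<le> sum_over J \<tau>"
  unfolding sum_over_def by (rule suminf_le) (use assms in auto)

lemma sum_over_ge:
  assumes "i \<in> I" shows "\<sigma> i \<le> sum_over I \<sigma>"
proof -
  have "(\<Sum>j\<in>{i}. if j \<in> I then \<sigma> j else 0) \<le> sum_over I \<sigma>"
    unfolding sum_over_def by (rule sum_le_suminf) auto
  then show ?thesis using assms by simp
qed

lemma sum_over_UNIV: "sum_over UNIV \<sigma> = (\<Sum>i. \<sigma> i)"
  by (simp add: sum_over_def)

lemma sum_over_add: "sum_over I (\<lambda>i. \<sigma> i + \<tau> i) = sum_over I \<sigma> + sum_over I \<tau>"
proof -
  have "(\<lambda>i. if i \<in> I then \<sigma> i + \<tau> i else 0) = (\<lambda>i. (if i \<in> I then \<sigma> i else 0) + (if i \<in> I then \<tau> i else 0))"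
    by auto
  then show ?thesis unfolding sum_over_def by (simp add: suminf_add)
qed

lemma sum_over_cmult: "sum_over I (\<lambda>i. k * \<sigma> i) = k * sum_over I \<sigma>"
proof -
  have "(\<lambda>i. if i \<in> I then k * \<sigma> i else 0) = (\<lambda>i. k * (if i \<in> I then \<sigma> i else 0))"
    by auto
  then show ?thesis unfolding sum_over_def by simp
qed

lemma sum_over_eq_0: "(\<And>i. i \<in> I \<Longrightarrow> \<sigma> i = 0) \<Longrightarrow> sum_over I \<sigma> = 0"
  unfolding sum_over_def by (simp cong: if_cong)

lemma sum_over_le_suminf: "sum_over I \<sigma> \<le> (\<Sum>i. \<sigma> i)"
  using sum_over_mono[of I UNIV \<sigma> \<sigma>] by (simp add: sum_over_UNIV)

text \<open>Finitely many disks carry all but \<open>e\<close> of a convergent sum. Points off the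
  closures of these disks have a neighbourhood that meets only the cheap remainder; most local
  estimates below start this way.\<close>

lemma sum_over_tail:
  assumes fin: "sum_over I \<sigma> < \<infinity>" and e: "0 < (e::real)"
  obtains F where "finite F" "sum_over (I - F) \<sigma> < ennreal e"
proof -
  let ?f = "\<lambda>i. if i \<in> I then \<sigma> i else 0"
  have fi: "?f i < \<infinity>" for i
  proof -
    have "?f i \<le> sum_over I \<sigma>" using sum_over_ge[of i I \<sigma>] by auto
    also note fin
    finally show ?thesis .
  qed
  define g where "g i = enn2real (?f i)" for i
  have g0: "g i \<ge> 0" for i by (simp add: g_def)
  have fg: "?f i = ennreal (g i)" for i using fi[of i] unfolding g_def by (simp only: ennreal_enn2real_if) auto
  have sg: "summable g"
  proof (rule summable_suminf_not_top)
    have "(\<Sum>i. ennreal (g i)) = sum_over I \<sigma>" unfolding sum_over_def fg ..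
    then show "(\<Sum>i. ennreal (g i)) \<noteq> top" using fin by auto
  qed (use g0 in auto)
  obtain N where N: "\<And>n. n \<ge> N \<Longrightarrow> norm (\<Sum>i. g (i + n)) < e"
    using suminf_exist_split[OF e sg] by blast
  have "sum_over (I - {..<N}) \<sigma> \<le> (\<Sum>i. if i < N then 0 else ?f i)"
    unfolding sum_over_def by (rule suminf_le) auto
  also have "\<dots> = (\<Sum>i. if i + N < N then 0 else ?f (i + N)) + (\<Sum>i<N. if i < N then 0 else ?f i)"
    by (rule suminf_offset) auto
  also have "\<dots> = (\<Sum>i. ennreal (g (i + N)))" by (simp add: fg[symmetric])
  also have "\<dots> = ennreal (\<Sum>i. g (i + N))"
    by (rule suminf_ennreal2) (use g0 sg in \<open>auto simp: summable_iff_shift\<close>)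
  also have "\<dots> < ennreal e" using N[of N] e by (intro ennreal_lessI) auto
  finally show ?thesis using that[of "{..<N}"] by auto
qed

lemma sum_sum_over_disjoint:
  assumes "finite A" "disjoint_family_on T A" "\<And>a. a \<in> A \<Longrightarrow> T a \<subseteq> W"
  shows "(\<Sum>a\<in>A. sum_over (T a) \<sigma>) \<le> sum_over W \<sigma>"
proof -
  have "(\<Sum>a\<in>A. sum_over (T a) \<sigma>) = (\<Sum>i. \<Sum>a\<in>A. if i \<in> T a then \<sigma> i else 0)"
    unfolding sum_over_def by (subst suminf_sum) auto
  also have "\<dots> \<le> sum_over W \<sigma>" unfolding sum_over_def
  proof (intro suminf_le summableI)
    fix i
    show "(\<Sum>a\<in>A. if i \<in> T a then \<sigma> i else 0) \<le> (if i \<in> W then \<sigma> i else 0)"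
    proof (cases "\<exists>a\<in>A. i \<in> T a")
      case True
      then obtain a where a: "a \<in> A" "i \<in> T a" by blast
      then have *: "\<And>b. b \<in> A \<Longrightarrow> (i \<in> T b) = (b = a)"
        using assms(2) unfolding disjoint_family_on_def by blast
      then have "(\<Sum>b\<in>A. if i \<in> T b then \<sigma> i else 0) = (\<Sum>b\<in>A. if b = a then \<sigma> i else 0)"
        using * by (simp cong: sum.cong)
      then show ?thesis using a assms by auto
    next
      case False
      then show ?thesis by (simp add: sum.neutral)
    qed
  qed
  finally show ?thesis .
qed

lemma meeting_mono: "A \<subseteq> B \<Longrightarrow> meeting Q A \<subseteq> meeting Q B"
  by (auto simp: meeting_def)

lemma frontier_not_in_union:
  assumes op: "\<And>i. open (Q i)" and disj: "\<And>i j. i \<noteq> j \<Longrightarrow> closure (Q i) \<inter> closure (Q j) = {}"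
    and "z \<in> frontier (Q i)"
  shows "z \<notin> (\<Union>j. Q j)"
proof
  assume "z \<in> (\<Union>j. Q j)"
  then obtain j where j: "z \<in> Q j" by blast
  have "z \<in> closure (Q i)" "z \<notin> Q i" using assms(3) op[of i] by (auto simp: frontier_def interior_open)
  then show False using j disj[of i j] closure_subset[of "Q j"] by blast
qed

lemma segment_exit:
  fixes c :: "real \<Rightarrow> 'a::topological_space"
  assumes "continuous_on (closed_segment \<tau> \<tau>') c" "c \<tau> \<in> U" "c \<tau>' \<notin> U"
  obtains \<kappa> where "\<kappa> \<in> closed_segment \<tau> \<tau>'" "c \<kappa> \<in> frontier U"
proof -
  have "connected (c ` closed_segment \<tau> \<tau>')"
    using assms(1) by (intro connected_continuous_image connected_segment)
  moreover have "c ` closed_segment \<tau> \<tau>' \<inter> U \<noteq> {}" "c ` closed_segment \<tau> \<tau>' - U \<noteq> {}"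
    using assms by auto
  ultimately have "c ` closed_segment \<tau> \<tau>' \<inter> frontier U \<noteq> {}"
    by (rule connected_Int_frontier)
  then show ?thesis using that by blast
qed

text \<open>Here \<open>h\<close> stands for the values of a function along the path, given at the parameters \<open>K\<close> of points
  of the carpet, and \<open>var\<close> is the upper gradient inequality on subpaths.\<close>

locale covered_path =
  fixes c :: "real \<Rightarrow> complex" and h :: "real \<Rightarrow> real" and \<sigma> :: "nat \<Rightarrow> ennreal"
    and a b :: "nat \<Rightarrow> real" and Q :: "nat \<Rightarrow> complex set" and s t :: real and K V
  assumes cont: "continuous_on {s..t} c"
    and opQ: "\<And>i. open (Q i)"
    and disj: "\<And>i j. i \<noteq> j \<Longrightarrow> closure (Q i) \<inter> closure (Q j) = {}"
    and K: "K = {\<tau>\<in>{s..t}. c \<tau> \<notin> (\<Union>i. Q i)}"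
    and sK: "s \<in> K" and tK: "t \<in> K"
    and V: "V = meeting Q (c ` {s..t})" and fin: "sum_over V \<sigma> < \<infinity>"
    and var: "\<And>\<tau> \<tau>'. \<tau> \<in> K \<Longrightarrow> \<tau>' \<in> K \<Longrightarrow>
        ennreal \<bar>h \<tau> - h \<tau>'\<bar> \<le> sum_over (meeting Q (c ` closed_segment \<tau> \<tau>')) \<sigma>"
    and ab: "\<And>\<tau> i. \<tau> \<in> K \<Longrightarrow> i \<in> V \<Longrightarrow> c \<tau> \<in> frontier (Q i) \<Longrightarrow> h \<tau> \<in> {a i..b i}"
begin

lemma seg: "\<tau> \<in> {s..t} \<Longrightarrow> \<tau>' \<in> {s..t} \<Longrightarrow> closed_segment \<tau> \<tau>' \<subseteq> {s..t}"
  by (auto simp: closed_segment_eq_real_ivl split: if_splits)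

lemma exit_in_K:
  assumes "\<tau> \<in> {s..t}" "\<tau>' \<in> {s..t}" "c \<tau> \<in> Q i" "c \<tau>' \<notin> Q i"
  obtains \<kappa> where "\<kappa> \<in> closed_segment \<tau> \<tau>'" "\<kappa> \<in> K" "c \<kappa> \<in> frontier (Q i)"
proof -
  have "continuous_on (closed_segment \<tau> \<tau>') c"
    using continuous_on_subset[OF cont seg[OF assms(1,2)]] .
  then obtain \<kappa> where k: "\<kappa> \<in> closed_segment \<tau> \<tau>'" "c \<kappa> \<in> frontier (Q i)"
    using segment_exit assms by metis
  moreover have "\<kappa> \<in> K" unfolding K
    using frontier_not_in_union[of Q, OF opQ disj k(2)] k(1) seg[OF assms(1,2)] by auto
  ultimately show ?thesis using that by blast
qed

text \<open>Extends \<open>h\<close> to every parameter as \<open>h (last_stop \<tau>)\<close>.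
  Inside a disk any stop on its frontier serves, not necessarily the latest one: by
  \<open>ab\<close> the ambiguity stays within \<open>{a i..b i}\<close>, and only levels outside
  these intervals are examined.\<close>

definition last_stop :: "real \<Rightarrow> real" where
  "last_stop \<tau> = (if \<tau> \<in> K then \<tau> else SOME \<kappa>. \<kappa> \<in> K \<and> (\<forall>i. c \<tau> \<in> Q i \<longrightarrow> c \<kappa> \<in> frontier (Q i)))"

lemma last_stop:
  assumes "\<tau> \<in> {s..t}"
  shows "last_stop \<tau> \<in> K" "\<tau> \<in> K \<Longrightarrow> last_stop \<tau> = \<tau>" "c \<tau> \<in> Q i \<Longrightarrow> c (last_stop \<tau>) \<in> frontier (Q i)"
proof -
  have *: "last_stop \<tau> \<in> K \<and> (\<forall>i. c \<tau> \<in> Q i \<longrightarrow> c (last_stop \<tau>) \<in> frontier (Q i))" if nK: "\<tau> \<notin> K"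
  proof -
    obtain j where j: "c \<tau> \<in> Q j" using nK assms unfolding K by auto
    have "s \<in> {s..t}" "c s \<notin> Q j" using sK unfolding K by auto
    then obtain \<kappa> where \<kappa>: "\<kappa> \<in> K" "c \<kappa> \<in> frontier (Q j)" using exit_in_K[OF assms _ j] by blast
    have "i = j" if "c \<tau> \<in> Q i" for i
      using that j disj[of i j] closure_subset by blast
    then have "\<exists>\<kappa>. \<kappa> \<in> K \<and> (\<forall>i. c \<tau> \<in> Q i \<longrightarrow> c \<kappa> \<in> frontier (Q i))" using \<kappa> by blast
    from someI_ex[OF this] show ?thesis using nK by (simp add: last_stop_def)
  qed
  show "last_stop \<tau> \<in> K" using * by (cases "\<tau> \<in> K") (auto simp: last_stop_def)
  show "\<tau> \<in> K \<Longrightarrow> last_stop \<tau> = \<tau>" by (simp add: last_stop_def)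
  show "c (last_stop \<tau>) \<in> frontier (Q i)" if "c \<tau> \<in> Q i" 
  proof -
    have "\<tau> \<notin> K" using that unfolding K by auto
    then show ?thesis using * that by blast
  qed
qed

lemma visited: "\<tau> \<in> {s..t} \<Longrightarrow> c \<tau> \<in> Q i \<Longrightarrow> i \<in> V"
  unfolding V meeting_def by auto

lemma stop_bounds:
  assumes "\<tau> \<in> {s..t}" "c \<tau> \<in> Q i" shows "h (last_stop \<tau>) \<in> {a i..b i}"
  using ab[OF last_stop(1)[OF assms(1)] visited[OF assms] last_stop(3)[OF assms]] .

text \<open>A continuity statement at the level \<open>L\<close>, although \<open>h\<close> may jump
  across disks. At most one disk has \<open>c \<tau>0\<close> in its closure; its interval contains
  \<open>h \<tau>0\<close> and misses \<open>L\<close>, so it lies below \<open>L\<close>. The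
  finitely many other expensive disks stay at positive distance, and the rest contributes less than
  the gap to \<open>L\<close>.\<close>

lemma below_near_stop:
  assumes L: "\<And>i. i \<in> V \<Longrightarrow> L \<notin> {a i..b i}" and \<tau>0: "\<tau>0 \<in> K" "h \<tau>0 < L"
  obtains \<delta> where "\<delta> > 0" "\<And>\<kappa>. \<kappa> \<in> K \<Longrightarrow> \<bar>\<kappa> - \<tau>0\<bar> < \<delta> \<Longrightarrow> h \<kappa> < L"
proof -
  have \<tau>0st: "\<tau>0 \<in> {s..t}" using \<tau>0 unfolding K by auto
  define Z where "Z = {i\<in>V. c \<tau>0 \<in> closure (Q i)}"
  have Zu: "i = j" if "i \<in> Z" "j \<in> Z" for i j using that disj[of i j] unfolding Z_def by auto
  have Zf: "c \<tau>0 \<in> frontier (Q i)" if "i \<in> Z" for i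
    using that \<tau>0 opQ[of i] unfolding Z_def K frontier_def by (auto simp: interior_open)
  \<comment> \<open>\<open>v\<close> bounds \<open>h\<close> from above at \<open>\<tau>0\<close>
    and, if there is a disk in \<open>Z\<close>, at every stop on the frontier of that disk.\<close>
  obtain v where v: "h \<tau>0 \<le> v" "v < L" "\<And>i. i \<in> Z \<Longrightarrow> b i = v"
  proof (cases "Z = {}")
    case True then show ?thesis using that[of "h \<tau>0"] \<tau>0 by auto
  next
    case False
    then obtain i where i: "i \<in> Z" by blast
    then have "h \<tau>0 \<in> {a i..b i}" using ab[OF \<tau>0(1) _ Zf] unfolding Z_def by blast
    moreover have "L \<notin> {a i..b i}" using L i unfolding Z_def by blast
    ultimately have 1: "h \<tau>0 \<le> b i" "b i < L" using \<tau>0(2) by auto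
    have "b j = b i" if "j \<in> Z" for j using Zu[OF that i] by simp
    then show ?thesis using that[of "b i"] 1 by blast
  qed
  obtain F where F: "finite F" "sum_over (V - F) \<sigma> < ennreal (L - v)"
    using sum_over_tail[OF fin, of "L - v"] v by auto
  define W where "W = - (\<Union>j\<in>F-Z. if j \<in> V then closure (Q j) else {})"
  have "open W" unfolding W_def using F(1) by (intro open_Compl closed_UN) auto
  moreover have "c \<tau>0 \<in> W" unfolding W_def Z_def by auto
  ultimately obtain \<delta> where d: "\<delta> > 0" "\<And>\<kappa>. \<kappa> \<in> {s..t} \<Longrightarrow> dist \<kappa> \<tau>0 < \<delta> \<Longrightarrow> c \<kappa> \<in> W"
  proof -
    assume a1: "\<And>\<delta>. \<lbrakk>0 < \<delta>; \<And>\<kappa>. \<kappa> \<in> {s..t} \<Longrightarrow> dist \<kappa> \<tau>0 < \<delta> \<Longrightarrow> c \<kappa> \<in> W\<rbrakk> \<Longrightarrow> thesis"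
    assume "open W" "c \<tau>0 \<in> W"
    then obtain e where e: "e > 0" "\<And>z. dist z (c \<tau>0) < e \<Longrightarrow> z \<in> W" unfolding open_dist by blast
    then obtain d where "d > 0" "\<And>x'. x' \<in> {s..t} \<Longrightarrow> dist x' \<tau>0 < d \<Longrightarrow> dist (c x') (c \<tau>0) < e"
      using cont \<tau>0st unfolding continuous_on_iff by metis
    then show thesis using a1[of d] e by auto
  qed
  have key: "h \<kappa> < L" if \<kappa>: "\<kappa> \<in> K" and lam: "\<nu> \<in> K" "h \<nu> \<le> v" "\<bar>\<kappa> - \<tau>0\<bar> < \<delta>" "\<bar>\<nu> - \<tau>0\<bar> < \<delta>"
      "meeting Q (c ` closed_segment \<nu> \<kappa>) \<inter> Z = {}" for \<kappa> \<nu>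
  proof -
    have st: "\<kappa> \<in> {s..t}" "\<nu> \<in> {s..t}" using \<kappa> lam unfolding K by auto
    have "meeting Q (c ` closed_segment \<nu> \<kappa>) \<subseteq> V - F"
    proof
      fix j assume j: "j \<in> meeting Q (c ` closed_segment \<nu> \<kappa>)"
      then obtain \<mu> where m: "\<mu> \<in> closed_segment \<nu> \<kappa>" "c \<mu> \<in> Q j" unfolding meeting_def by blast
      have must: "\<mu> \<in> {s..t}" using seg[OF st(2,1)] m by blast
      then have jV: "j \<in> V" using visited m by blast
      have "\<bar>\<mu> - \<tau>0\<bar> < \<delta>" using m(1) lam(3,4) by (auto simp: closed_segment_eq_real_ivl split: if_splits)
      then have "c \<mu> \<in> W" using d(2)[OF must] by (simp add: dist_real_def)
      then show "j \<in> V - F" using lam(5) j jV m(2) closure_subset unfolding W_def by fastforce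
    qed
    then have "ennreal \<bar>h \<nu> - h \<kappa>\<bar> \<le> sum_over (V - F) \<sigma>"
      using var[OF lam(1) \<kappa>] sum_over_mono order_trans by (metis order_refl)
    also note F(2)
    finally have "\<bar>h \<nu> - h \<kappa>\<bar> < L - v" by (simp add: ennreal_less_iff)
    then show ?thesis using lam(2) by linarith
  qed
  have "h \<kappa> < L" if \<kappa>: "\<kappa> \<in> K" "\<bar>\<kappa> - \<tau>0\<bar> < \<delta>" for \<kappa>
  proof (cases "meeting Q (c ` closed_segment \<tau>0 \<kappa>) \<inter> Z = {}")
    case True then show ?thesis using key[OF \<kappa>(1) \<tau>0(1) v(1) \<kappa>(2)] d by auto
  next
    case False
    then obtain i where iZ: "i \<in> Z" and im: "i \<in> meeting Q (c ` closed_segment \<tau>0 \<kappa>)" by blast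
    have kst: "\<kappa> \<in> {s..t}" using \<kappa> unfolding K by auto
    note sg = seg[OF \<tau>0st kst]
    have cs: "continuous_on (closed_segment \<tau>0 \<kappa>) c" using continuous_on_subset[OF cont sg] .
    \<comment> \<open>If the segment crosses the disk of \<open>Z\<close>, restart at the parameter
      \<open>\<nu>\<close> nearest to \<open>\<kappa>\<close> at which the path is still in its
      closure. From there on the disk is avoided, and the starting value is at most
      \<open>b i = v\<close>.\<close>
    define A where "A = closed_segment \<tau>0 \<kappa> \<inter> c -` closure (Q i)"
    have "closed A" unfolding A_def using continuous_closed_preimage[OF cs] by auto
    moreover have "A \<noteq> {}" using im closure_subset unfolding A_def meeting_def by fastforce
    ultimately obtain \<nu> where lam: "\<nu> \<in> A" "\<And>y. y \<in> A \<Longrightarrow> dist \<kappa> \<nu> \<le> dist \<kappa> y"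
      using distance_attains_inf by metis
    have lin: "\<nu> \<in> closed_segment \<tau>0 \<kappa>" "c \<nu> \<in> closure (Q i)" using lam unfolding A_def by auto
    have open_seg: "c \<mu> \<notin> closure (Q i)" if "\<mu> \<in> closed_segment \<nu> \<kappa>" "\<mu> \<noteq> \<nu>" for \<mu>
    proof
      assume "c \<mu> \<in> closure (Q i)"
      moreover have "\<mu> \<in> closed_segment \<tau>0 \<kappa>" using that lin
        by (auto simp: closed_segment_eq_real_ivl split: if_splits)
      ultimately have "dist \<kappa> \<nu> \<le> dist \<kappa> \<mu>" using lam(2) unfolding A_def by auto
      then show False using that by (auto simp: closed_segment_eq_real_ivl dist_real_def split: if_splits)
    qed
    have lst: "\<nu> \<in> {s..t}" using lin sg by blast
    have cl: "c \<nu> \<notin> Q i"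
    proof
      assume q: "c \<nu> \<in> Q i"
      have "c \<kappa> \<notin> Q i" using \<kappa> unfolding K by auto
      then obtain \<mu> where m: "\<mu> \<in> closed_segment \<nu> \<kappa>" "c \<mu> \<in> frontier (Q i)"
        using exit_in_K[OF lst kst q] by blast
      then have "\<mu> \<noteq> \<nu>" using q opQ[of i] by (auto simp: frontier_def interior_open)
      then show False using open_seg m by (auto simp: frontier_def)
    qed
    then have fr: "c \<nu> \<in> frontier (Q i)" using lin opQ[of i] by (auto simp: frontier_def interior_open)
    have lK: "\<nu> \<in> K" unfolding K using frontier_not_in_union[of Q, OF opQ disj fr] lst by auto
    have hv: "h \<nu> \<le> v" using ab[OF lK _ fr] iZ v(3)[OF iZ] unfolding Z_def by auto
    have "meeting Q (c ` closed_segment \<nu> \<kappa>) \<inter> Z = {}"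
    proof (rule ccontr)
      assume "\<not> ?thesis"
      then obtain j where "j \<in> Z" "j \<in> meeting Q (c ` closed_segment \<nu> \<kappa>)" by blast
      then obtain \<mu> where "\<mu> \<in> closed_segment \<nu> \<kappa>" "c \<mu> \<in> Q i" using Zu[OF _ iZ] unfolding meeting_def by blast
      then show False using open_seg[of \<mu>] cl closure_subset by blast
    qed
    moreover have "\<bar>\<nu> - \<tau>0\<bar> < \<delta>" using lin(1) \<kappa>(2) by (auto simp: closed_segment_eq_real_ivl split: if_splits)
    ultimately show ?thesis using key[OF \<kappa>(1) lK hv \<kappa>(2)] by blast
  qed
  then show ?thesis using that d(1) by blast
qed

text \<open>Carries \<open>below_near_stop\<close> over to the extended function: between
  \<open>\<tau>0\<close> and a nearby parameter inside a disk there is a stop on the frontier of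
  that disk, with value below \<open>L\<close>. As the interval of the disk misses \<open>L\<close>,
  all of it lies below \<open>L\<close>.\<close>

lemma below_open:
  assumes L: "\<And>i. i \<in> V \<Longrightarrow> L \<notin> {a i..b i}" and \<tau>0: "\<tau>0 \<in> {s..t}" "h (last_stop \<tau>0) < L"
  obtains \<delta> where "\<delta> > 0" "\<And>\<tau>. \<tau> \<in> {s..t} \<Longrightarrow> \<bar>\<tau> - \<tau>0\<bar> < \<delta> \<Longrightarrow> h (last_stop \<tau>) < L"
proof (cases "\<tau>0 \<in> K")
  case False
  then obtain j where j: "c \<tau>0 \<in> Q j" using \<tau>0 unfolding K by auto
  have jV: "j \<in> V" using visited[OF \<tau>0(1) j] .
  have bj: "b j < L" using stop_bounds[OF \<tau>0(1) j] L[OF jV] \<tau>0(2) by auto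
  obtain e where e: "e > 0" "\<And>z. dist z (c \<tau>0) < e \<Longrightarrow> z \<in> Q j" using opQ[of j] j unfolding open_dist by blast
  obtain d where d: "d > 0" "\<And>x'. x' \<in> {s..t} \<Longrightarrow> dist x' \<tau>0 < d \<Longrightarrow> dist (c x') (c \<tau>0) < e"
    using cont \<tau>0 e(1) unfolding continuous_on_iff by metis
  show ?thesis
  proof (rule that[OF d(1)])
    fix \<tau> assume t: "\<tau> \<in> {s..t}" "\<bar>\<tau> - \<tau>0\<bar> < d"
    then have "c \<tau> \<in> Q j" using d e by (auto simp: dist_real_def)
    from stop_bounds[OF t(1) this] show "h (last_stop \<tau>) < L" using bj by auto
  qed
next
  case True
  then have "h \<tau>0 < L" using \<tau>0 last_stop(2) by auto
  then obtain \<delta> where d: "\<delta> > 0" "\<And>\<kappa>. \<kappa> \<in> K \<Longrightarrow> \<bar>\<kappa> - \<tau>0\<bar> < \<delta> \<Longrightarrow> h \<kappa> < L"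
    using below_near_stop[OF L True] by blast
  show ?thesis
  proof (rule that[OF d(1)])
    fix \<tau> assume t: "\<tau> \<in> {s..t}" "\<bar>\<tau> - \<tau>0\<bar> < \<delta>"
    show "h (last_stop \<tau>) < L"
    proof (cases "\<tau> \<in> K")
      case True then show ?thesis using last_stop(2)[OF t(1)] d(2) t by auto
    next
      case False
      then obtain j where j: "c \<tau> \<in> Q j" using t unfolding K by auto
      have "c \<tau>0 \<notin> Q j" using \<open>\<tau>0 \<in> K\<close> unfolding K by auto
      then obtain \<kappa> where \<kappa>: "\<kappa> \<in> closed_segment \<tau> \<tau>0" "\<kappa> \<in> K" "c \<kappa> \<in> frontier (Q j)"
        using exit_in_K[OF t(1) \<tau>0(1) j] by blast
      have "\<bar>\<kappa> - \<tau>0\<bar> < \<delta>" using \<kappa>(1) t(2) by (auto simp: closed_segment_eq_real_ivl split: if_splits)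
      then have "h \<kappa> < L" using d \<kappa> by blast
      moreover have jV: "j \<in> V" using visited[OF t(1) j] .
      ultimately have "b j < L" using ab[OF \<kappa>(2) jV \<kappa>(3)] L[OF jV] by auto
      then show ?thesis using stop_bounds[OF t(1) j] by auto
    qed
  qed
qed

lemma neg: "covered_path c (\<lambda>\<tau>. - h \<tau>) \<sigma> (\<lambda>i. - b i) (\<lambda>i. - a i) Q s t K V"
proof (unfold_locales)
  show "continuous_on {s..t} c" "\<And>i. open (Q i)" "\<And>i j. i \<noteq> j \<Longrightarrow> closure (Q i) \<inter> closure (Q j) = {}"
    "K = {\<tau>\<in>{s..t}. c \<tau> \<notin> (\<Union>i. Q i)}" "s \<in> K" "t \<in> K"
    "V = meeting Q (c ` {s..t})" "sum_over V \<sigma> < \<infinity>"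
    using cont opQ disj K sK tK V fin by auto
  show "ennreal \<bar>- h \<tau> - - h \<tau>'\<bar> \<le> sum_over (meeting Q (c ` closed_segment \<tau> \<tau>')) \<sigma>" if "\<tau> \<in> K" "\<tau>' \<in> K" for \<tau> \<tau>'
    using var[OF that] by (simp add: abs_minus_commute)
  show "- h \<tau> \<in> {- b i..- a i}" if "\<tau> \<in> K" "i \<in> V" "c \<tau> \<in> frontier (Q i)" for \<tau> i
    using ab[OF that] by auto
qed

lemma above_open:
  assumes L: "\<And>i. i \<in> V \<Longrightarrow> L \<notin> {a i..b i}" and \<tau>0: "\<tau>0 \<in> {s..t}" "L < h (last_stop \<tau>0)"
  obtains \<delta> where "\<delta> > 0" "\<And>\<tau>. \<tau> \<in> {s..t} \<Longrightarrow> \<bar>\<tau> - \<tau>0\<bar> < \<delta> \<Longrightarrow> L < h (last_stop \<tau>)"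
proof -
  interpret n: covered_path c "\<lambda>\<tau>. - h \<tau>" \<sigma> "\<lambda>i. - b i" "\<lambda>i. - a i" Q s t K V by (rule neg)
  obtain \<delta> where "\<delta> > 0" "\<And>\<tau>. \<tau> \<in> {s..t} \<Longrightarrow> \<bar>\<tau> - \<tau>0\<bar> < \<delta> \<Longrightarrow> - h (last_stop \<tau>) < - L"
    using n.below_open[of "-L" \<tau>0] L \<tau>0 by (auto simp: conj_commute)
  then show ?thesis using that by auto
qed

text \<open>Take \<open>t'\<close> as the first parameter with extended value at least
  \<open>m\<close> and \<open>s'\<close> as the last one before it with value at most
  \<open>l\<close>. Openness on both sides forces the values to be exactly \<open>m\<close> and
  \<open>l\<close>; as no disk interval contains these levels, both parameters are stops and
  \<open>var\<close> applies between them. There all values lie strictly between \<open>l\<close>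
  and \<open>m\<close>, and so do the intervals of the disks met.\<close>

lemma gap_bound:
  assumes l: "\<And>i. i \<in> V \<Longrightarrow> l \<notin> {a i..b i}" and m: "\<And>i. i \<in> V \<Longrightarrow> m \<notin> {a i..b i}"
    and ineq: "h s < l" "l < m" "m < h t"
  shows "ennreal (m - l) \<le> sum_over {i\<in>V. l < a i \<and> b i < m} \<sigma>"
proof -
  let ?g = "\<lambda>\<tau>. h (last_stop \<tau>)"
  have st: "s \<in> {s..t}" "t \<in> {s..t}" using sK tK unfolding K by auto
  have gs: "?g s = h s" "?g t = h t" using last_stop(2) sK tK st by auto
  define B where "B = {\<tau>\<in>{s..t}. m \<le> ?g \<tau>}"
  define t' where "t' = Inf B"
  have tB: "t \<in> B" using st gs ineq unfolding B_def by auto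
  have bdB: "bdd_below B" unfolding B_def by (rule bdd_belowI[of _ s]) auto
  have "s \<le> t'" unfolding t'_def by (rule cInf_greatest) (use tB in \<open>auto simp: B_def\<close>)
  then have t'st: "t' \<in> {s..t}" using cInf_lower[OF tB bdB] unfolding t'_def by simp
  have before: "?g \<tau> < m" if "\<tau> \<in> {s..t}" "\<tau> < t'" for \<tau>
    using that cInf_lower[OF _ bdB, of \<tau>] unfolding t'_def B_def by force
  have gt': "?g t' = m"
  proof (rule ccontr)
    assume "?g t' \<noteq> m"
    then consider "?g t' < m" | "m < ?g t'" by linarith
    then show False
    proof cases
      case 1
      then obtain \<delta> where d: "\<delta> > 0" "\<And>\<tau>. \<tau> \<in> {s..t} \<Longrightarrow> \<bar>\<tau> - t'\<bar> < \<delta> \<Longrightarrow> ?g \<tau> < m"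
        using below_open[OF m t'st] by blast
      have "\<And>x. x \<in> B \<Longrightarrow> t' + \<delta> \<le> x"
      proof (rule ccontr)
        fix x assume x: "x \<in> B" "\<not> t' + \<delta> \<le> x"
        have "t' \<le> x" unfolding t'_def using cInf_lower[OF x(1) bdB] .
        then have "?g x < m" using d(2)[of x] x unfolding B_def by auto
        then show False using x unfolding B_def by auto
      qed
      then have "t' + \<delta> \<le> t'" unfolding t'_def[of] using cInf_greatest[of B] tB by (metis empty_iff t'_def)
      then show False using d by auto
    next
      case 2
      then obtain \<delta> where d: "\<delta> > 0" "\<And>\<tau>. \<tau> \<in> {s..t} \<Longrightarrow> \<bar>\<tau> - t'\<bar> < \<delta> \<Longrightarrow> m < ?g \<tau>"
        using above_open[OF m t'st] by blast
      have "t' \<noteq> s" using 2 gs ineq by auto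
      then have ts: "s < t'" using t'st by auto
      define \<tau> where "\<tau> = max s (t' - \<delta>/2)"
      have "\<tau> \<in> {s..t}" "\<bar>\<tau> - t'\<bar> < \<delta>" "\<tau> < t'" using ts t'st d(1) unfolding \<tau>_def by (auto simp: max_def)
      then show False using before d(2) by (metis less_asym)
    qed
  qed
  define A where "A = {\<tau>\<in>{s..t'}. ?g \<tau> \<le> l}"
  define s' where "s' = Sup A"
  have sA: "s \<in> A" using t'st gs ineq unfolding A_def by auto
  have bdA: "bdd_above A" unfolding A_def by (rule bdd_aboveI[of _ t']) auto
  have "s' \<le> t'" unfolding s'_def by (rule cSup_least) (use sA in \<open>auto simp: A_def\<close>)
  then have s't': "s' \<in> {s..t'}" using cSup_upper[OF sA bdA] unfolding s'_def by simp
  then have s'st: "s' \<in> {s..t}" using t'st by auto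
  have after: "l < ?g \<tau>" if "\<tau> \<in> {s..t'}" "s' < \<tau>" for \<tau>
    using that cSup_upper[OF _ bdA, of \<tau>] unfolding s'_def A_def by force
  have gs': "?g s' = l"
  proof (rule ccontr)
    assume "?g s' \<noteq> l"
    then consider "?g s' < l" | "l < ?g s'" by linarith
    then show False
    proof cases
      case 2
      then obtain \<delta> where d: "\<delta> > 0" "\<And>\<tau>. \<tau> \<in> {s..t} \<Longrightarrow> \<bar>\<tau> - s'\<bar> < \<delta> \<Longrightarrow> l < ?g \<tau>"
        using above_open[OF l s'st] by blast
      have "\<And>x. x \<in> A \<Longrightarrow> x \<le> s' - \<delta>"
      proof (rule ccontr)
        fix x assume x: "x \<in> A" "\<not> x \<le> s' - \<delta>"
        have "x \<le> s'" unfolding s'_def using cSup_upper[OF x(1) bdA] .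
        then have "l < ?g x" using d(2)[of x] x t'st unfolding A_def by auto
        then show False using x unfolding A_def by auto
      qed
      then have "s' \<le> s' - \<delta>" using cSup_least[of A "s' - \<delta>"] sA by (metis empty_iff s'_def)
      then show False using d by auto
    next
      case 1
      then obtain \<delta> where d: "\<delta> > 0" "\<And>\<tau>. \<tau> \<in> {s..t} \<Longrightarrow> \<bar>\<tau> - s'\<bar> < \<delta> \<Longrightarrow> ?g \<tau> < l"
        using below_open[OF l s'st] by blast
      have "s' \<noteq> t'" using 1 gt' ineq by auto
      then have ts: "s' < t'" using s't' by auto
      define \<tau> where "\<tau> = min t' (s' + \<delta>/2)"
      have "\<tau> \<in> {s..t}" "\<bar>\<tau> - s'\<bar> < \<delta>" "s' < \<tau>" "\<tau> \<in> {s..t'}" using ts t'st s't' d(1) unfolding \<tau>_def by (auto simp: min_def)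
      then show False using after d(2) by (metis less_asym)
    qed
  qed
  have inK: "\<tau> \<in> K" if "\<tau> \<in> {s..t}" "?g \<tau> = L" "\<And>i. i \<in> V \<Longrightarrow> L \<notin> {a i..b i}" for \<tau> L
    using that stop_bounds[OF that(1)] visited[OF that(1)] unfolding K by auto
  have s'K: "s' \<in> K" and t'K: "t' \<in> K" using inK s'st t'st gs' gt' l m by blast+
  then have hs: "h s' = l" "h t' = m" using gs' gt' last_stop(2) s'st t'st by auto
  have "ennreal (m - l) \<le> sum_over (meeting Q (c ` closed_segment s' t')) \<sigma>"
    using var[OF s'K t'K] hs ineq by simp
  also have "\<dots> \<le> sum_over {i\<in>V. l < a i \<and> b i < m} \<sigma>"
  proof (rule sum_over_mono)
    show "meeting Q (c ` closed_segment s' t') \<subseteq> {i\<in>V. l < a i \<and> b i < m}"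
    proof
      fix i assume "i \<in> meeting Q (c ` closed_segment s' t')"
      then obtain \<tau> where "\<tau> \<in> closed_segment s' t'" and tq: "c \<tau> \<in> Q i"
        unfolding meeting_def by blast
      then have t: "\<tau> \<in> {s'..t'}" "c \<tau> \<in> Q i"
        using s't' by (auto simp: closed_segment_eq_real_ivl)
      have tst: "\<tau> \<in> {s..t}" using t s't' t'st by auto
      have iV: "i \<in> V" using visited[OF tst t(2)] .
      have "\<tau> \<notin> K" using t unfolding K by auto
      then have "s' < \<tau>" "\<tau> < t'" using t s'K t'K by (auto simp: less_le)
      then have "l < ?g \<tau>" "?g \<tau> < m" using after before tst t s't' by auto
      then show "i \<in> {i\<in>V. l < a i \<and> b i < m}" using stop_bounds[OF tst t(2)] l[OF iV] m[OF iV] iV by auto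
    qed
  qed simp
  finally show ?thesis .
qed

text \<open>The set \<open>N\<close> of levels missed by all disks is null: levels that separate finitely many disks \<open>F\<close>
  in the same way differ by at most a sum of \<open>\<sigma>\<close> over disks between them, none of which is in \<open>F\<close>.\<close>

lemma bound_increasing:
  assumes lt: "h s < h t"
  shows "ennreal (h t - h s) \<le> sum_over V (\<lambda>i. ennreal (b i - a i))"
proof -
  define N where "N = {h s<..<h t} - (\<Union>i\<in>V. {a i..b i})"
  have Nb: "N \<in> sets lborel" unfolding N_def by auto
  have Nin: "\<And>i. i \<in> V \<Longrightarrow> L \<notin> {a i..b i}" "h s < L" "L < h t" if "L \<in> N" for L
    using that unfolding N_def by auto
  have small: "emeasure lborel N \<le> ennreal e" if e: "e > 0" for e
  proof -
    obtain F where F: "finite F" "sum_over (V - F) \<sigma> < ennreal e" using sum_over_tail[OF fin e] by blast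
    define P where "P G = {L\<in>N. {i\<in>V\<inter>F. b i < L} = G}" for G
    define T' where "T' G = {i\<in>V. \<exists>l\<in>P G. \<exists>m\<in>P G. l < a i \<and> b i < m \<and> l < m}" for G
    have T'sub: "sum_over (T' G) \<sigma> \<le> sum_over V \<sigma>" for G by (rule sum_over_mono) (auto simp: T'_def)
    have Pb: "P G \<in> sets lborel" for G
    proof -
      have "P G = N \<inter> {L. \<forall>i\<in>V\<inter>F. (b i < L) = (i \<in> G)} \<inter> {L. G \<subseteq> V \<inter> F}" unfolding P_def by auto
      moreover have "{L. \<forall>i\<in>V\<inter>F. (b i < L) = (i \<in> G)} =
          (\<Inter>i. if i \<in> V \<inter> F then (if i \<in> G then {b i<..} else {..b i}) else UNIV)"
      proof -
        have "(L \<in> (if i \<in> V \<inter> F then (if i \<in> G then {b i<..} else {..b i}) else UNIV)) =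
            (i \<in> V \<inter> F \<longrightarrow> (b i < L) = (i \<in> G))" for i L by (auto simp: not_less)
        then show ?thesis by blast
      qed
      moreover have "(\<Inter>i. if i \<in> V \<inter> F then (if i \<in> G then {b i<..} else {..b i}) else UNIV) \<in> sets lborel"
        by (rule sets.countable_INT) auto
      ultimately show ?thesis using Nb by auto
    qed
    have ne: "a i \<le> b i" if iV: "i \<in> V" for i
    proof -
      obtain \<tau> where "\<tau> \<in> {s..t}" "c \<tau> \<in> Q i" using iV unfolding V meeting_def by blast
      from stop_bounds[OF this] show ?thesis by auto
    qed
    have PT: "emeasure lborel (P G) \<le> sum_over (T' G) \<sigma>" for G
    proof (cases "P G = {}")
      case False
      have bd: "P G \<subseteq> {h s..h t}" unfolding P_def using Nin by force
      have bds: "bdd_below (P G)" "bdd_above (P G)" using bd by (meson bdd_below_mono bdd_above_mono bdd_below_Icc bdd_above_Icc)+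
      have sub: "P G \<subseteq> {Inf (P G)..Sup (P G)}" using bds by (auto intro: cInf_lower cSup_upper)
      have le: "Inf (P G) \<le> Sup (P G)" using False bds by (simp add: cInf_le_cSup)
      have fT: "sum_over (T' G) \<sigma> < \<infinity>" using T'sub fin by (metis order_le_less_trans)
      define R where "R = enn2real (sum_over (T' G) \<sigma>)"
      have R: "sum_over (T' G) \<sigma> = ennreal R" "R \<ge> 0" unfolding R_def using fT by (auto simp: less_top)
      have diam: "m - l \<le> R" if "l \<in> P G" "m \<in> P G" for l m
      proof (cases "l < m")
        case True
        have lN: "l \<in> N" "m \<in> N" using that unfolding P_def by auto
        have "ennreal (m - l) \<le> sum_over {i\<in>V. l < a i \<and> b i < m} \<sigma>"
          by (rule gap_bound) (use Nin lN True in blast)+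
        also have "\<dots> \<le> sum_over (T' G) \<sigma>" by (rule sum_over_mono) (use that True in \<open>auto simp: T'_def\<close>)
        finally show ?thesis using R by (simp add: ennreal_le_iff)
      next
        case False then show ?thesis using R by auto
      qed
      have "Sup (P G) \<le> R + l" if "l \<in> P G" for l
        by (rule cSup_least[OF False]) (use diam that in force)
      then have "Sup (P G) - R \<le> Inf (P G)" by (intro cInf_greatest[OF False]) force
      then have "Sup (P G) - Inf (P G) \<le> R" by simp
      have "emeasure lborel (P G) \<le> emeasure lborel {Inf (P G)..Sup (P G)}" by (rule emeasure_mono[OF sub]) auto
      also have "\<dots> = ennreal (Sup (P G) - Inf (P G))" using le by simp
      also have "\<dots> \<le> ennreal R" using \<open>Sup (P G) - Inf (P G) \<le> R\<close> by (rule ennreal_leI)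
      finally show ?thesis using R by simp
    qed simp
    have T'F: "T' G \<subseteq> V - F" for G
    proof
      fix i assume i: "i \<in> T' G"
      then obtain l m where lm: "l \<in> P G" "m \<in> P G" "l < a i" "b i < m" "i \<in> V" unfolding T'_def by blast
      show "i \<in> V - F"
      proof (rule ccontr)
        assume "i \<notin> V - F"
        then have "i \<in> {i\<in>V\<inter>F. b i < m}" using lm by auto
        also have "\<dots> = {i\<in>V\<inter>F. b i < l}" using lm unfolding P_def by auto
        finally show False using lm(3) ne[OF lm(5)] by auto
      qed
    qed
    \<comment> \<open>A disk in \<open>T' G\<close> remembers \<open>G\<close>: no disk of
      \<open>F\<close> has the upper end of its interval between the two surrounding levels, so
      \<open>G\<close> consists of the disks of \<open>V \<inter> F\<close> whose intervals end
      below \<open>a i\<close>.\<close>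
    have Tdisj: "disjoint_family_on T' A" for A
    proof -
      have eq: "G = {j\<in>V\<inter>F. b j < a i}" if iT: "i \<in> T' G" for i G
      proof -
        obtain l m where lm: "l \<in> P G" "m \<in> P G" "l < a i" "b i < m" "i \<in> V" using iT unfolding T'_def by blast
        have "{j\<in>V\<inter>F. b j < l} \<subseteq> {j\<in>V\<inter>F. b j < a i}" "{j\<in>V\<inter>F. b j < a i} \<subseteq> {j\<in>V\<inter>F. b j < m}"
          using lm ne[OF lm(5)] by auto
        then show ?thesis using lm(1,2) unfolding P_def by auto
      qed
      show ?thesis unfolding disjoint_family_on_def using eq by blast
    qed
    have "L \<in> P {i\<in>V\<inter>F. b i < L}" if "L \<in> N" for L using that unfolding P_def by simp
    then have "N \<subseteq> (\<Union>G\<in>Pow F. P G)" by (intro subsetI UN_I[of "{i\<in>V\<inter>F. b i < _}"]) auto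
    then have "emeasure lborel N \<le> emeasure lborel (\<Union>G\<in>Pow F. P G)"
      by (rule emeasure_mono) (use Pb F in auto)
    also have "\<dots> \<le> (\<Sum>G\<in>Pow F. emeasure lborel (P G))"
      by (rule emeasure_subadditive_finite) (use Pb F in auto)
    also have "\<dots> \<le> (\<Sum>G\<in>Pow F. sum_over (T' G) \<sigma>)" by (rule sum_mono) (rule PT)
    also have "\<dots> \<le> sum_over (V - F) \<sigma>"
      by (rule sum_sum_over_disjoint) (use F Tdisj T'F in auto)
    finally show ?thesis using F(2) by auto
  qed
  have "emeasure lborel N = 0"
  proof (rule ccontr)
    assume "emeasure lborel N \<noteq> 0"
    then have "0 < emeasure lborel N" by (simp add: zero_less_iff_neq_zero)
    then obtain e where "e > 0" "ennreal e < emeasure lborel N"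
      by (metis dense ennreal_cases ennreal_less_zero_iff ennreal_neq_top less_imp_neq not_less_iff_gr_or_eq top.not_eq_extremum)
    then show False using small[of e] by auto
  qed
  \<comment> \<open>Up to the null set \<open>N\<close> the disk intervals cover all levels between
    \<open>h s\<close> and \<open>h t\<close>, so their lengths add up to at least the
    increment.\<close>
  have "ennreal (h t - h s) = emeasure lborel {h s<..<h t}" using lt by simp
  also have "\<dots> \<le> emeasure lborel (N \<union> (\<Union>i. if i \<in> V then {a i..b i} else {}))"
    by (rule emeasure_mono) (use Nb in \<open>auto simp: N_def\<close>)
  also have "\<dots> \<le> emeasure lborel N + emeasure lborel (\<Union>i. if i \<in> V then {a i..b i} else {})"
    by (rule emeasure_subadditive) (use Nb in auto)
  also have "\<dots> = emeasure lborel (\<Union>i. if i \<in> V then {a i..b i} else {})" using \<open>emeasure lborel N = 0\<close> by simp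
  also have "\<dots> \<le> (\<Sum>i. emeasure lborel (if i \<in> V then {a i..b i} else {}))"
    by (rule emeasure_subadditive_countably) auto
  also have "\<dots> \<le> sum_over V (\<lambda>i. ennreal (b i - a i))"
    unfolding sum_over_def by (rule suminf_le) (auto simp: emeasure_lborel_Icc_eq)
  finally show ?thesis .
qed

lemma bound: "ennreal \<bar>h s - h t\<bar> \<le> sum_over V (\<lambda>i. ennreal (b i - a i))"
proof -
  consider "h s < h t" | "h s = h t" | "h t < h s" by linarith
  then show ?thesis
  proof cases
    case 1 then show ?thesis using bound_increasing by simp
  next
    case 3
    interpret n: covered_path c "\<lambda>\<tau>. - h \<tau>" \<sigma> "\<lambda>i. - b i" "\<lambda>i. - a i" Q s t K V by (rule neg)
    show ?thesis using n.bound_increasing 3 by simp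
  qed simp
qed

end

section \<open>Null sets and arc length\<close>

text \<open>For \<open>m = 1\<close> the normalizing factor turns the summand into the diameter. The
  mesh restriction disappears for null sets, because a sum of diameters at most
  \<open>\<delta>\<close> bounds each of them by \<open>\<delta>\<close>.\<close>

lemma hausdorff1_null_iff:
  "hausdorff_measure 1 A = 0 \<longleftrightarrow>
    (\<forall>e>0. \<exists>E. A \<subseteq> (\<Union>i::nat. E i) \<and> (\<forall>i. bounded (E i)) \<and> (\<Sum>i. ennreal (diameter (E i))) \<le> ennreal e)"
  (is "_ \<longleftrightarrow> (\<forall>e>0. \<exists>E. ?P e E)")
proof -
  have c: "hausdorff_content 1 \<delta> A = (INF E \<in> {E :: nat \<Rightarrow> complex set. A \<subseteq> (\<Union>i. E i) \<and>
      (\<forall>i. bounded (E i) \<and> diameter (E i) \<le> \<delta>)}. (\<Sum>i. ennreal (diameter (E i))))" for \<delta>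
    unfolding hausdorff_content_def by simp
  show ?thesis
  proof
    assume "hausdorff_measure 1 A = 0"
    then have "hausdorff_content 1 1 A \<le> 0"
      unfolding hausdorff_measure_def by (metis SUP_upper greaterThan_iff zero_less_one)
    then have z: "hausdorff_content 1 1 A = 0" by simp
    show "\<forall>e>0. \<exists>E. ?P e E"
    proof (intro allI impI)
      fix e :: real assume "e > 0"
      then have "hausdorff_content 1 1 A < ennreal e" using z by simp
      then show "\<exists>E. ?P e E" unfolding c INF_less_iff using less_imp_le by blast
    qed
  next
    assume *: "\<forall>e>0. \<exists>E. ?P e E"
    have "hausdorff_content 1 \<delta> A \<le> 0" if d: "\<delta> > 0" for \<delta>
    proof (rule ennreal_le_epsilon)
      fix e :: real assume e: "e > 0"
      obtain E where E: "?P (min \<delta> e) E" using *[rule_format, of "min \<delta> e"] d e by auto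
      have "diameter (E i) \<le> \<delta>" for i
      proof -
        have "ennreal (diameter (E i)) \<le> (\<Sum>i. ennreal (diameter (E i)))"
          using sum_over_ge[of i UNIV "\<lambda>i. ennreal (diameter (E i))"] by (simp add: sum_over_UNIV)
        also have "\<dots> \<le> ennreal (min \<delta> e)" using E by blast
        finally show ?thesis using d e by (simp add: ennreal_le_iff)
      qed
      then have "hausdorff_content 1 \<delta> A \<le> (\<Sum>i. ennreal (diameter (E i)))"
        unfolding c using E by (intro INF_lower) auto
      also have "\<dots> \<le> ennreal e" using E by (meson ennreal_leI min.cobounded2 order_trans)
      finally show "hausdorff_content 1 \<delta> A \<le> 0 + ennreal e" by simp
    qed
    then show "hausdorff_measure 1 A = 0"
      unfolding hausdorff_measure_def by (simp add: SUP_eq_const)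
  qed
qed

lemma hausdorff1_null_subset:
  assumes "hausdorff_measure 1 B = 0" "A \<subseteq> B" shows "hausdorff_measure 1 A = 0"
  using assms unfolding hausdorff1_null_iff by (meson order_trans)

lemma hausdorff1_null_UN:
  assumes A: "\<And>n::nat. hausdorff_measure 1 (A n) = 0" shows "hausdorff_measure 1 (\<Union>n. A n) = 0"
  unfolding hausdorff1_null_iff
proof (intro allI impI)
  fix e :: real assume e: "e > 0"
  have "\<exists>E. A n \<subseteq> (\<Union>i::nat. E i) \<and> (\<forall>i. bounded (E i)) \<and> (\<Sum>i. ennreal (diameter (E i))) \<le> ennreal (e * (1/2)^Suc n)" for n
    using A[of n] e unfolding hausdorff1_null_iff by simp
  then obtain E where E: "\<And>n. A n \<subseteq> (\<Union>i::nat. E n i)" "\<And>n i. bounded (E n i)"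
      "\<And>n. (\<Sum>i. ennreal (diameter (E n i))) \<le> ennreal (e * (1/2)^Suc n)" by metis
  let ?F = "\<lambda>k. case prod_decode k of (n, i) \<Rightarrow> E n i"
  have "(\<Sum>k. (\<lambda>p. ennreal (diameter (E (fst p) (snd p)))) (prod_decode k)) = (\<Sum>n. \<Sum>i. ennreal (diameter (E n i)))"
    by (rule suminf_ennreal_2dimen) simp
  also have "\<dots> \<le> (\<Sum>n. ennreal (e * (1/2)^Suc n))" by (rule suminf_le) (use E in auto)
  also have "\<dots> = ennreal e"
    by (rule suminf_ennreal_eq) (use e power_half_series sums_mult[OF power_half_series, of e] in auto)
  finally have s: "(\<Sum>k. ennreal (diameter (?F k))) \<le> ennreal e" by (simp add: case_prod_beta)
  have "(\<Union>n. A n) \<subseteq> (\<Union>k. ?F k)"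
  proof
    fix z assume "z \<in> (\<Union>n. A n)"
    then obtain n i where "z \<in> E n i" using E(1) by blast
    then have "z \<in> ?F (prod_encode (n, i))" by simp
    then show "z \<in> (\<Union>k. ?F k)" by (rule UN_I[OF UNIV_I])
  qed
  then show "\<exists>E. (\<Union>n. A n) \<subseteq> (\<Union>i::nat. E i) \<and> (\<forall>i. bounded (E i)) \<and> (\<Sum>i. ennreal (diameter (E i))) \<le> ennreal e"
    using s E(2) by (intro exI[of _ ?F]) (auto split: prod.split)
qed

text \<open>The components of an open superset of small measure are intervals. A 1-Lipschitz map
  does not increase distances, so the images of the pieces of \<open>A\<close> in these intervals
  form a cover of small total diameter.\<close>

lemma hausdorff1_null_lipschitz_image:
  fixes f :: "real \<Rightarrow> complex"
  assumes A: "A \<in> null_sets lborel" and f: "\<And>x y. x \<in> A \<Longrightarrow> y \<in> A \<Longrightarrow> dist (f x) (f y) \<le> dist x y"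
  shows "hausdorff_measure 1 (f ` A) = 0"
  unfolding hausdorff1_null_iff
proof (intro allI impI)
  fix e :: real assume e: "e > 0"
  have Ab: "A \<in> sets borel" and A0: "emeasure lborel A = 0" using A by auto
  obtain U where U: "open U" "A \<subseteq> U" "emeasure lborel (U - A) < ennreal e"
    using outer_regular_lborel[OF Ab e] by blast
  have "emeasure lborel U = emeasure lborel (U - A) + emeasure lborel A"
    using U Ab by (subst plus_emeasure) (auto simp: Un_absorb2)
  then have Ue: "emeasure lborel U < ennreal e" using A0 U by simp
  define D where "D = components U"
  have Dop: "\<And>K. K \<in> D \<Longrightarrow> open K" unfolding D_def using open_components U(1) by blast
  have cD: "countable D" unfolding D_def
    by (rule countable_disjoint_open_subsets)
      (use Dop D_def pairwise_disjoint_components[of U] in \<open>auto simp: pairwise_def disjnt_def\<close>)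
  \<comment> \<open>The countable set of components, indexed by all naturals; indices that number no
    component give the empty set, which keeps the family disjoint.\<close>
  define E where "E n = (if n \<in> to_nat_on D ` D then from_nat_into D n else {})" for n
  have ED: "E n \<in> D \<or> E n = {}" for n unfolding E_def using cD by auto
  have EU: "(\<Union>n. E n) = U"
  proof -
    have "(\<Union>n. E n) = \<Union>D"
    proof (rule antisym)
      show "(\<Union>n. E n) \<subseteq> \<Union>D" using ED by blast
      show "\<Union>D \<subseteq> (\<Union>n. E n)"
      proof
        fix z assume "z \<in> \<Union>D"
        then obtain K where K: "K \<in> D" "z \<in> K" by blast
        then have "z \<in> E (to_nat_on D K)" unfolding E_def using cD by simp
        then show "z \<in> (\<Union>n. E n)" by blast
      qed
    qed
    then show ?thesis unfolding D_def by simp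
  qed
  have Edis: "disjoint_family E"
    unfolding disjoint_family_on_def
  proof (intro ballI impI)
    fix m n :: nat assume mn: "m \<noteq> n"
    show "E m \<inter> E n = {}"
    proof (cases "m \<in> to_nat_on D ` D \<and> n \<in> to_nat_on D ` D")
      case True
      then have "E m \<noteq> E n" using mn cD unfolding E_def by auto
      moreover have "E m \<in> D" "E n \<in> D" using True cD unfolding E_def by auto
      ultimately show ?thesis unfolding D_def by (metis components_nonoverlap)
    qed (auto simp: E_def)
  qed
  have Eop: "open (E n)" for n using ED[of n] Dop by auto
  have Ecn: "connected (E n)" for n using ED[of n] in_components_connected unfolding D_def by auto
  have sE: "(\<Sum>n. emeasure lborel (E n)) = emeasure lborel U"
    unfolding EU[symmetric] by (rule suminf_emeasure) (use Eop Edis in auto)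
  have dE: "ennreal (dist x y) \<le> emeasure lborel (E n)" if "x \<in> E n" "y \<in> E n" for x y n
  proof -
    have "closed_segment x y \<subseteq> E n" using Ecn[of n] that convex_contains_segment is_interval_connected_1 is_interval_convex by metis
    then have "emeasure lborel (closed_segment x y) \<le> emeasure lborel (E n)" using Eop by (intro emeasure_mono) auto
    moreover have "emeasure lborel (closed_segment x y) = ennreal (dist x y)"
      by (auto simp: closed_segment_eq_real_ivl dist_real_def)
    ultimately show ?thesis by simp
  qed
  have fin: "emeasure lborel (E n) < top" for n
    using emeasure_mono[of "E n" U lborel] EU Ue U(1) by (metis UN_upper UNIV_I ennreal_less_top order_le_less_trans order_less_trans borel_open sets_lborel)
  define G where "G n = f ` (A \<inter> E n)" for n
  have G: "norm (x - y) \<le> enn2real (emeasure lborel (E n))" if xy: "x \<in> G n" "y \<in> G n" for x y n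
  proof -
    obtain u v where uv: "u \<in> A" "u \<in> E n" "v \<in> A" "v \<in> E n" "x = f u" "y = f v" using xy unfolding G_def by blast
    have "dist u v \<le> enn2real (emeasure lborel (E n))"
      using dE[OF uv(2,4)] fin[of n] by (metis ennreal_enn2real ennreal_le_iff enn2real_nonneg)
    then show ?thesis using f[OF uv(1,3)] uv by (simp add: dist_norm)
  qed
  have Gb: "bounded (G n)" for n
    using G[of _ n] unfolding bounded_def dist_norm by (cases "G n = {}") blast+
  have dG: "ennreal (diameter (G n)) \<le> emeasure lborel (E n)" for n
  proof -
    have "diameter (G n) \<le> enn2real (emeasure lborel (E n))" by (rule diameter_le) (use G in \<open>auto simp: enn2real_nonneg\<close>)
    then have "ennreal (diameter (G n)) \<le> ennreal (enn2real (emeasure lborel (E n)))" by (rule ennreal_leI)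
    then show ?thesis using fin[of n] by simp
  qed
  have "(\<Sum>n. ennreal (diameter (G n))) \<le> (\<Sum>n. emeasure lborel (E n))" by (rule suminf_le) (use dG in auto)
  then have "(\<Sum>n. ennreal (diameter (G n))) \<le> ennreal e" using sE Ue by simp
  moreover have "f ` A \<subseteq> (\<Union>n. G n)" unfolding G_def using EU U(2) by blast
  ultimately show "\<exists>E. f ` A \<subseteq> (\<Union>i::nat. E i) \<and> (\<forall>i. bounded (E i)) \<and> (\<Sum>i. ennreal (diameter (E i))) \<le> ennreal e"
    using Gb by blast
qed

text \<open>The distance from \<open>p\<close> is 1-Lipschitz and maps a connected \<open>A\<close>
  onto a set containing \<open>{0..dist p q}\<close>, which a cover of total diameter
  \<open>dist p q / 2\<close> cannot fill.\<close>

lemma hausdorff1_null_connected: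
  assumes H: "hausdorff_measure 1 A = 0" and A: "connected A" and pq: "p \<in> A" "q \<in> A"
  shows "p = q"
proof (rule ccontr)
  assume "p \<noteq> q"
  then have d: "dist p q / 2 > 0" by simp
  obtain E where E: "A \<subseteq> (\<Union>i::nat. E i)" "\<And>i. bounded (E i)" "(\<Sum>i. ennreal (diameter (E i))) \<le> ennreal (dist p q / 2)"
    using H[unfolded hausdorff1_null_iff, rule_format, OF d] by blast
  define z where "z i = (SOME z. z \<in> E i)" for i
  let ?I = "\<lambda>i. {Inf (dist p ` E i)..Sup (dist p ` E i)}"
  have bd: "bdd_below (dist p ` E i)" "bdd_above (dist p ` E i)" for i
    using bounded_imp_bdd_above bounded_imp_bdd_below bounded_dist_comp[of "\<lambda>x. x"] E(2)[of i]
    by (auto intro!: bdd_belowI[of _ 0] simp: bounded_any_center[of _ p] bdd_above_def)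
  have sub: "dist p ` E i \<subseteq> ?I i" for i using cInf_lower[OF _ bd(1)] cSup_upper[OF _ bd(2)] by force
  have m: "emeasure lborel (if E i = {} then {} else ?I i) \<le> ennreal (diameter (E i))" for i
  proof (cases "E i = {}")
    case False
    have "dist p x \<le> diameter (E i) + dist p y" if "x \<in> E i" "y \<in> E i" for x y
      using diameter_bounded_bound[OF E(2) that] dist_triangle[of p x y] by (simp add: dist_commute)
    then have "Sup (dist p ` E i) \<le> diameter (E i) + dist p y" if "y \<in> E i" for y
      using False that by (intro cSUP_least) auto
    then have "Sup (dist p ` E i) - diameter (E i) \<le> Inf (dist p ` E i)"
      using False by (intro cINF_greatest) force+
    then show ?thesis using False by (auto simp: emeasure_lborel_Icc_eq intro!: ennreal_leI)
  qed simp
  have "{0..dist p q} \<subseteq> dist p ` A"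
  proof
    fix r assume r: "r \<in> {0..dist p q}"
    have "connected (dist p ` A)" by (intro connected_continuous_image A continuous_intros)
    moreover have "0 \<in> dist p ` A" "dist p q \<in> dist p ` A" using pq by (auto intro: rev_image_eqI)
    ultimately show "r \<in> dist p ` A" using r connectedD_interval by (metis atLeastAtMost_iff)
  qed
  also have "\<dots> \<subseteq> (\<Union>i. if E i = {} then {} else ?I i)"
  proof
    fix r assume "r \<in> dist p ` A"
    then obtain i where "r \<in> dist p ` E i" using E(1) by blast
    then show "r \<in> (\<Union>i. if E i = {} then {} else ?I i)" using sub[of i] by (intro UN_I[of i]) auto
  qed
  finally have "emeasure lborel {0..dist p q} \<le> emeasure lborel (\<Union>i. if E i = {} then {} else ?I i)"
    by (rule emeasure_mono) auto
  also have "\<dots> \<le> (\<Sum>i. emeasure lborel (if E i = {} then {} else ?I i))"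
    by (rule emeasure_subadditive_countably) auto
  also have "\<dots> \<le> (\<Sum>i. ennreal (diameter (E i)))" by (rule suminf_le) (use m in auto)
  also have "\<dots> \<le> ennreal (dist p q / 2)" using E by simp
  finally have "dist p q \<le> dist p q / 2" by (simp add: ennreal_le_iff)
  then show False using d by simp
qed

section \<open>Lengths of curves, through a recursive form of polygonal length suited to induction
  on partitions\<close>

fun chain_length :: "(real \<Rightarrow> complex) \<Rightarrow> real list \<Rightarrow> ennreal" where
  "chain_length c (x # y # zs) = ennreal (dist (c x) (c y)) + chain_length c (y # zs)"
| "chain_length c _ = 0"

lemma chain_length_eq: "(\<Sum>i<length ts - 1. ennreal (dist (c (ts ! i)) (c (ts ! Suc i)))) = chain_length c ts"
proof (induction c ts rule: chain_length.induct)
  case (1 c x y zs)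
  have "(\<Sum>i<length (x # y # zs) - 1. ennreal (dist (c ((x # y # zs) ! i)) (c ((x # y # zs) ! Suc i))))
    = (\<Sum>i<Suc (length (y # zs) - 1). ennreal (dist (c ((x # y # zs) ! i)) (c ((y # zs) ! i))))" by simp
  also have "\<dots> = ennreal (dist (c x) (c y)) + (\<Sum>i<length (y # zs) - 1. ennreal (dist (c ((y # zs) ! i)) (c ((y # zs) ! Suc i))))"
    by (subst sum.lessThan_Suc_shift) simp
  finally show ?case using 1 by simp
qed auto

lemma curve_length_eq: "curve_length c a b = (SUP ts \<in> {ts. sorted ts \<and> set ts \<subseteq> {a..b}}. chain_length c ts)"
  unfolding curve_length_def chain_length_eq ..

lemma chain_length_le: "sorted ts \<Longrightarrow> set ts \<subseteq> {a..b} \<Longrightarrow> chain_length c ts \<le> curve_length c a b"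
  unfolding curve_length_eq by (rule SUP_upper) simp

lemma chain_length_join: "chain_length c (xs @ [m] @ ys) = chain_length c (xs @ [m]) + chain_length c (m # ys)"
proof (induction xs)
  case (Cons x xs)
  then show ?case by (cases xs) (auto simp: add.assoc)
qed simp

lemma chain_length_Cons_ge: "chain_length c ys \<le> chain_length c (y # ys)"
  by (cases ys) auto

lemma chain_length_insert: "chain_length c (xs @ ys) \<le> chain_length c (xs @ [m] @ ys)"
proof (induction xs)
  case Nil then show ?case using chain_length_Cons_ge by simp
next
  case (Cons x xs)
  show ?case
  proof (cases xs)
    case Nil
    show ?thesis
    proof (cases ys)
      case (Cons y zs)
      have "ennreal (dist (c x) (c y)) \<le> ennreal (dist (c x) (c m)) + ennreal (dist (c m) (c y))"
        by (metis ennreal_leI dist_triangle ennreal_plus zero_le_dist)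
      then show ?thesis using Nil Cons by (simp add: add.assoc[symmetric] add_right_mono)
    qed (use Nil in simp)
  next
    case (Cons x' xs')
    then show ?thesis using Cons.IH by (auto intro: add_left_mono)
  qed
qed

lemma chain_length_append: "chain_length c xs + chain_length c ys \<le> chain_length c (xs @ ys)"
proof (induction xs)
  case (Cons x xs)
  show ?case
  proof (cases xs)
    case Nil then show ?thesis using chain_length_Cons_ge by simp
  next
    case (Cons x' xs')
    then show ?thesis using Cons.IH by (auto simp: add.assoc intro: add_left_mono)
  qed
qed simp

lemma curve_length_add:
  assumes "a \<le> m" "m \<le> b"
  shows "curve_length c a b = curve_length c a m + curve_length c m b"
proof (rule antisym)
  show "curve_length c a b \<le> curve_length c a m + curve_length c m b"
    unfolding curve_length_eq[of c a b]
  proof (rule SUP_least)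
    fix ts assume "ts \<in> {ts. sorted ts \<and> set ts \<subseteq> {a..b}}"
    then have ts: "sorted ts" "set ts \<subseteq> {a..b}" by auto
    define xs where "xs = takeWhile (\<lambda>t. t \<le> m) ts"
    define ys where "ys = dropWhile (\<lambda>t. t \<le> m) ts"
    have e: "ts = xs @ ys" by (simp add: xs_def ys_def)
    have xm: "\<And>x. x \<in> set xs \<Longrightarrow> x \<le> m" unfolding xs_def by (auto dest: set_takeWhileD)
    have so: "sorted xs" "sorted ys" using ts(1) unfolding e by (auto simp: sorted_append)
    have ym: "m \<le> y" if "y \<in> set ys" for y
    proof (cases ys)
      case (Cons y0 zs)
      have "\<not> y0 \<le> m" using Cons unfolding ys_def by (metis dropWhile_eq_Cons_conv)
      then show ?thesis using that so(2) Cons by fastforce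
    qed (use that in simp)
    have "chain_length c ts \<le> chain_length c (xs @ [m] @ ys)" unfolding e by (rule chain_length_insert)
    also have "\<dots> = chain_length c (xs @ [m]) + chain_length c (m # ys)" by (rule chain_length_join)
    also have "\<dots> \<le> curve_length c a m + curve_length c m b"
      using so xm ym ts(2) assms unfolding e by (intro add_mono chain_length_le) (auto simp: sorted_append)
    finally show "chain_length c ts \<le> curve_length c a m + curve_length c m b" .
  qed
  have ne: "{ts. sorted ts \<and> set ts \<subseteq> {x..y::real}} \<noteq> {}" for x y by (auto intro: exI[of _ "[]"])
  show "curve_length c a m + curve_length c m b \<le> curve_length c a b"
    unfolding curve_length_eq[of c a m] ennreal_SUP_add_left[OF ne, symmetric]
  proof (rule SUP_least)
    fix xs assume xs: "xs \<in> {ts. sorted ts \<and> set ts \<subseteq> {a..m}}"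
    show "chain_length c xs + curve_length c m b \<le> curve_length c a b"
      unfolding curve_length_eq[of c m b] ennreal_SUP_add_right[OF ne]
    proof (rule SUP_least)
      fix ys assume ys: "ys \<in> {ts. sorted ts \<and> set ts \<subseteq> {m..b}}"
      have "chain_length c (xs @ ys) \<le> curve_length c a b"
        using xs ys assms by (intro chain_length_le) (force simp: sorted_append)+
      then show "chain_length c xs + chain_length c ys \<le> curve_length c a b"
        using chain_length_append order_trans by blast
    qed
  qed
qed

lemma curve_length_ge_dist: "a \<le> b \<Longrightarrow> ennreal (dist (c a) (c b)) \<le> curve_length c a b"
  using chain_length_le[of "[a, b]" a b c] by simp

lemma chain_length_around:
  assumes "set xs \<subseteq> {p}"
  shows "chain_length c (t # xs @ [t']) \<le> ennreal (dist (c t) (c p)) + ennreal (dist (c p) (c t'))"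
  using assms
proof (induction xs arbitrary: t)
  case Nil
  have "ennreal (dist (c t) (c t')) \<le> ennreal (dist (c t) (c p) + dist (c p) (c t'))"
    by (intro ennreal_leI dist_triangle)
  then show ?case by simp
next
  case (Cons x xs)
  then have "x = p" "chain_length c (p # xs @ [t']) \<le> ennreal (dist (c p) (c p)) + ennreal (dist (c p) (c t'))"
    using Cons.IH[of p] by auto
  then show ?case by (simp add: add_left_mono)
qed

text \<open>Fix a partition that is optimal up to \<open>e/2\<close>. An interval shorter than the
  smallest gap between its distinct points contains at most one of them, so the polygon inserted
  there is short by uniform continuity. The lengths on both sides account for the rest of the
  optimal sum, which leaves at most \<open>e\<close> for the interval.\<close>

lemma curve_length_uniform:
  assumes fin: "curve_length c a b < \<infinity>" and cont: "continuous_on {a..b} c" and e: "e > 0"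
  obtains \<delta> where "\<delta> > 0" "\<And>t t'. a \<le> t \<Longrightarrow> t \<le> t' \<Longrightarrow> t' \<le> b \<Longrightarrow> t' - t < \<delta> \<Longrightarrow> curve_length c t t' \<le> ennreal e"
proof (cases "a \<le> b")
  case False then show ?thesis using that[of 1] by auto
next
  case True
  have "\<exists>ts. sorted ts \<and> set ts \<subseteq> {a..b} \<and> curve_length c a b \<le> chain_length c ts + ennreal (e/2)"
  proof (cases "curve_length c a b = 0")
    case True then show ?thesis by (intro exI[of _ "[]"]) simp
  next
    case False
    have "curve_length c a b - ennreal (e/2) < curve_length c a b"
      using False fin e by (intro ennreal_between) (auto simp: less_top zero_less_iff_neq_zero)
    then obtain ts where "sorted ts" "set ts \<subseteq> {a..b}" "curve_length c a b - ennreal (e/2) < chain_length c ts"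
      unfolding curve_length_eq less_SUP_iff by blast
    then show ?thesis by (metis add.commute ennreal_minus_le_iff less_imp_le)
  qed
  then obtain ts where ts: "sorted ts" "set ts \<subseteq> {a..b}" "curve_length c a b \<le> chain_length c ts + ennreal (e/2)" by blast
  obtain \<delta>1 where d1: "\<delta>1 > 0" "\<And>x y. x \<in> {a..b} \<Longrightarrow> y \<in> {a..b} \<Longrightarrow> dist y x < \<delta>1 \<Longrightarrow> dist (c y) (c x) < e/4"
    using compact_uniformly_continuous[OF cont] e unfolding uniformly_continuous_on_def by (metis compact_Icc divide_pos_pos zero_less_numeral)
  \<comment> \<open>The smallest gap between distinct partition points; the inserted 1 keeps the
    minimum defined when there are no two of them.\<close>
  obtain \<delta>2 where d2: "\<delta>2 > 0" "\<And>x y. x \<in> set ts \<Longrightarrow> y \<in> set ts \<Longrightarrow> x \<noteq> y \<Longrightarrow> \<delta>2 \<le> dist x y"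
  proof -
    let ?D = "(\<lambda>(x, y). dist x y) ` {p \<in> set ts \<times> set ts. fst p \<noteq> snd p}"
    have f: "finite ?D" by (intro finite_imageI) auto
    have "Min (insert 1 ?D) > 0" using f by (subst Min_gr_iff) auto
    moreover have "Min (insert 1 ?D) \<le> dist x y" if "x \<in> set ts" "y \<in> set ts" "x \<noteq> y" for x y
      using that f by (intro Min_le) force+
    ultimately show ?thesis using that by blast
  qed
  show ?thesis
  proof (rule that[of "min \<delta>1 \<delta>2"])
    show "min \<delta>1 \<delta>2 > 0" using d1 d2 by simp
    fix t t' assume t: "a \<le> t" "t \<le> t'" "t' \<le> b" "t' - t < min \<delta>1 \<delta>2"
    define xs where "xs = takeWhile (\<lambda>x. x \<le> t) ts"
    define rs where "rs = dropWhile (\<lambda>x. x \<le> t) ts"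
    define zs where "zs = takeWhile (\<lambda>x. x \<le> t') rs"
    define ys where "ys = dropWhile (\<lambda>x. x \<le> t') rs"
    have e1: "ts = xs @ zs @ ys" unfolding xs_def zs_def ys_def rs_def by simp
    have so: "sorted xs" "sorted (zs @ ys)" "sorted ys" using ts(1) unfolding e1 by (auto simp: sorted_append)
    have rs: "rs = zs @ ys" unfolding zs_def ys_def by simp
    have gt: "r \<le> y" if yr: "y \<in> set (dropWhile (\<lambda>x. x \<le> r) us)" "sorted us" for r y :: real and us
    proof -
      obtain u vs where uv: "dropWhile (\<lambda>x. x \<le> r) us = u # vs" using yr(1) by (cases "dropWhile (\<lambda>x. x \<le> r) us") auto
      then have "\<not> u \<le> r" by (metis dropWhile_eq_Cons_conv)
      moreover have "sorted (u # vs)" using yr(2) uv by (metis sorted_dropWhile)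
      ultimately show ?thesis using yr(1) uv by auto
    qed
    have xt: "\<And>x. x \<in> set xs \<Longrightarrow> x \<le> t" unfolding xs_def by (auto dest: set_takeWhileD)
    have zt: "\<And>x. x \<in> set zs \<Longrightarrow> x \<le> t'" unfolding zs_def by (auto dest: set_takeWhileD)
    have tz: "\<And>x. x \<in> set zs \<Longrightarrow> t \<le> x" using gt[of _ t ts] ts(1) rs unfolding rs_def[symmetric] by auto
    have yt: "\<And>x. x \<in> set ys \<Longrightarrow> t' \<le> x" using gt[of _ t' rs] so(2) rs unfolding ys_def by auto
    have "\<exists>p\<in>{t..t'}. set zs \<subseteq> {p}"
    proof (cases zs)
      case Nil then show ?thesis using t by (intro bexI[of _ t]) auto
    next
      case (Cons p qs)
      have p: "p \<in> {t..t'}" using Cons zt tz by auto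
      have "q = p" if q: "q \<in> set zs" for q
      proof (rule ccontr)
        assume "q \<noteq> p"
        then have "\<delta>2 \<le> dist q p" using d2(2)[of q p] q Cons unfolding e1 by auto
        moreover have "dist q p < \<delta>2" using zt[OF q] tz[OF q] p t(4) by (auto simp: dist_real_def)
        ultimately show False by simp
      qed
      then show ?thesis using p by blast
    qed
    then obtain p where p: "p \<in> {t..t'}" "set zs \<subseteq> {p}" by blast
    have "chain_length c (t # zs @ [t']) \<le> ennreal (dist (c t) (c p)) + ennreal (dist (c p) (c t'))"
      by (rule chain_length_around[OF p(2)])
    also have "\<dots> = ennreal (dist (c t) (c p) + dist (c p) (c t'))" by simp
    also have "\<dots> \<le> ennreal (e/2)"
    proof (rule ennreal_leI)
      have "dist (c t) (c p) < e/4" "dist (c p) (c t') < e/4"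
        using p t d1(2)[of p t] d1(2)[of t' p] by (auto simp: dist_real_def)
      then show "dist (c t) (c p) + dist (c p) (c t') \<le> e/2" by simp
    qed
    finally have mid: "chain_length c (t # zs @ [t']) \<le> ennreal (e/2)" .
    have "chain_length c ts \<le> chain_length c (xs @ [t] @ (zs @ ys))" unfolding e1 by (rule chain_length_insert)
    also have "\<dots> = chain_length c (xs @ [t]) + chain_length c ((t # zs) @ ys)" using chain_length_join[of c xs t "zs @ ys"] by simp
    also have "\<dots> \<le> chain_length c (xs @ [t]) + chain_length c ((t # zs) @ [t'] @ ys)"
      by (intro add_left_mono chain_length_insert)
    also have "\<dots> = chain_length c (xs @ [t]) + (chain_length c ((t # zs) @ [t']) + chain_length c (t' # ys))"
      unfolding chain_length_join ..
    also have "\<dots> \<le> curve_length c a t + (ennreal (e/2) + curve_length c t' b)"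
      using so xt yt ts(2) t mid unfolding e1
      by (intro add_mono chain_length_le) (auto simp: sorted_append)
    finally have "curve_length c a b \<le> curve_length c a t + (ennreal (e/2) + curve_length c t' b) + ennreal (e/2)"
      using ts(3) by (meson add_right_mono order_trans)
    moreover have eq: "curve_length c a b = curve_length c a t + (curve_length c t' b + curve_length c t t')"
      using curve_length_add[of a t b c] curve_length_add[of t t' b c] t by (simp add: add.commute)
    moreover have "curve_length c a t + (ennreal (e/2) + curve_length c t' b) + ennreal (e/2)
        = curve_length c a t + (curve_length c t' b + ennreal e)"
    proof -
      have "ennreal e = ennreal (e/2) + ennreal (e/2)" using e by (simp flip: ennreal_plus)
      then show ?thesis by (simp add: ac_simps)
    qed
    ultimately have "curve_length c a t + (curve_length c t' b + curve_length c t t') \<le> curve_length c a t + (curve_length c t' b + ennreal e)"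
      by metis
    moreover have "curve_length c a t \<noteq> \<infinity>" "curve_length c t' b \<noteq> \<infinity>" using eq fin by auto
    ultimately show "curve_length c t t' \<le> ennreal e" by (simp add: ennreal_add_left_cancel_le)
  qed
qed

lemma curve_length_self [simp]: "curve_length c a a = 0"
proof -
  have "chain_length c ts = 0" if "set ts \<subseteq> {a}" for ts
    using that by (induction c ts rule: chain_length.induct) auto
  then show ?thesis unfolding curve_length_eq by (auto intro!: antisym SUP_least)
qed

lemma arclength_param_eq:
  assumes fin: "curve_length c a b < \<infinity>" and t: "t \<in> {a..b}" and V: "curve_length c a t = ennreal \<tau>"
  shows "arclength_param c a b \<tau> = c t"
proof -
  let ?s = "SOME t. t \<in> {a..b} \<and> curve_length c a t = ennreal \<tau>"
  have s: "?s \<in> {a..b}" "curve_length c a ?s = ennreal \<tau>"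
    using someI[of "\<lambda>t. t \<in> {a..b} \<and> curve_length c a t = ennreal \<tau>" t] t V by blast+
  have "c x = c y" if xy: "x \<in> {a..b}" "y \<in> {a..b}" "x \<le> y" "curve_length c a x = ennreal \<tau>" "curve_length c a y = ennreal \<tau>" for x y
  proof -
    have "ennreal \<tau> + curve_length c x y = ennreal \<tau> + 0" using curve_length_add[of a x y c] xy by simp
    then have "curve_length c x y = 0" unfolding ennreal_add_left_cancel by simp
    then have "ennreal (dist (c x) (c y)) \<le> 0" using curve_length_ge_dist[OF xy(3), of c] by simp
    then show ?thesis by simp
  qed
  then have "c ?s = c t" using s t V by (metis linear)
  then show ?thesis unfolding arclength_param_def .
qed

text \<open>By \<open>curve_length_uniform\<close> the length up to \<open>t\<close> is continuous
  in \<open>t\<close>, so the intermediate value theorem applies. This makes the choice in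
  \<open>arclength_param\<close> meaningful for all lengths up to the total one.\<close>

lemma arclength_surj:
  assumes fin: "curve_length c a b < \<infinity>" and cont: "continuous_on {a..b} c" and ab: "a \<le> b"
    and \<tau>: "0 \<le> \<tau>" "ennreal \<tau> \<le> curve_length c a b"
  obtains t where "t \<in> {a..b}" "curve_length c a t = ennreal \<tau>"
proof -
  define v where "v t = enn2real (curve_length c a t)" for t
  have fin': "curve_length c s t < \<infinity>" if "a \<le> s" "s \<le> t" "t \<le> b" for s t
    using curve_length_add[of a s b c] curve_length_add[of s t b c] that fin by (auto simp: less_top)
  have v: "curve_length c a t = ennreal (v t)" if "t \<in> {a..b}" for t
    using fin'[of a t] that unfolding v_def by simp
  have "continuous_on {a..b} v"
    unfolding continuous_on_iff
  proof (intro ballI allI impI)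
    fix x e :: real assume x: "x \<in> {a..b}" and e: "0 < e"
    obtain \<delta> where d: "\<delta> > 0" "\<And>t t'. a \<le> t \<Longrightarrow> t \<le> t' \<Longrightarrow> t' \<le> b \<Longrightarrow> t' - t < \<delta> \<Longrightarrow> curve_length c t t' \<le> ennreal (e/2)"
      using curve_length_uniform[OF fin cont, of "e/2"] e by auto
    have *: "\<bar>v s - v t\<bar> < e" if st: "s \<in> {a..b}" "t \<in> {a..b}" "s \<le> t" "t - s < \<delta>" for s t
    proof -
      have "ennreal (v t) = ennreal (v s) + curve_length c s t"
        using curve_length_add[of a s t c] v st by simp
      moreover have "curve_length c s t \<le> ennreal (e/2)" using d(2) st by auto
      ultimately have "ennreal (v s) \<le> ennreal (v t)" "ennreal (v t) \<le> ennreal (v s) + ennreal (e/2)"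
        by (auto intro: add_left_mono)
      moreover have "v s \<ge> 0" "v t \<ge> 0" by (auto simp: v_def)
      ultimately have "v s \<le> v t" "v t \<le> v s + e/2"
        using e by (auto simp: ennreal_le_iff simp flip: ennreal_plus)
      then show ?thesis using e by auto
    qed
    show "\<exists>d>0. \<forall>x'\<in>{a..b}. dist x' x < d \<longrightarrow> dist (v x') (v x) < e"
    proof (intro exI[of _ \<delta>] conjI ballI impI d(1))
      fix y assume y: "y \<in> {a..b}" "dist y x < \<delta>"
      then show "dist (v y) (v x) < e"
        using *[of x y] *[of y x] x by (cases "x \<le> y") (auto simp: dist_real_def abs_minus_commute)
    qed
  qed
  moreover have "v a \<le> \<tau>" using \<tau> unfolding v_def by simp
  moreover have "\<tau> \<le> v b"
  proof -
    have "ennreal \<tau> \<le> ennreal (v b)" using \<tau>(2) v[of b] ab by simp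
    moreover have "v b \<ge> 0" unfolding v_def by simp
    ultimately show ?thesis by (simp add: ennreal_le_iff)
  qed
  ultimately obtain t where "t \<in> {a..b}" "v t = \<tau>" using IVT'[of v a \<tau> b] ab by auto
  then show ?thesis using that v by metis
qed

lemma arclength_param_lipschitz:
  assumes fin: "curve_length c a b = ennreal l" "l \<ge> 0" and cont: "continuous_on {a..b} c" and ab: "a \<le> b"
    and \<tau>: "\<tau> \<in> {0..l}" "\<tau>' \<in> {0..l}"
  shows "dist (arclength_param c a b \<tau>) (arclength_param c a b \<tau>') \<le> dist \<tau> \<tau>'"
proof -
  have f: "curve_length c a b < \<infinity>" using fin by simp
  have *: "dist (arclength_param c a b \<tau>) (arclength_param c a b \<tau>') \<le> dist \<tau> \<tau>'"
    if t: "\<tau> \<in> {0..l}" "\<tau>' \<in> {0..l}" "\<tau> \<le> \<tau>'" for \<tau> \<tau>'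
  proof -
    obtain t where t1: "t \<in> {a..b}" "curve_length c a t = ennreal \<tau>"
      using arclength_surj[OF f cont ab, of \<tau>] t fin by (auto simp: ennreal_le_iff)
    obtain t' where t2: "t' \<in> {a..b}" "curve_length c a t' = ennreal \<tau>'"
      using arclength_surj[OF f cont ab, of \<tau>'] t fin by (auto simp: ennreal_le_iff)
    have "ennreal (dist (c t) (c t')) \<le> ennreal (\<tau>' - \<tau>)"
    proof (cases "t \<le> t'")
      case True
      have "ennreal \<tau>' = ennreal \<tau> + curve_length c t t'" using curve_length_add[of a t t' c] t1 t2 True by simp
      then have "curve_length c t t' = ennreal \<tau>' - ennreal \<tau>" by simp
      also have "\<dots> = ennreal (\<tau>' - \<tau>)" using t by (simp add: ennreal_minus)
      finally show ?thesis using curve_length_ge_dist[OF True, of c] by simp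
    next
      case False
      then have "ennreal \<tau> = ennreal \<tau>' + curve_length c t' t" using curve_length_add[of a t' t c] t1 t2 by simp
      then have "curve_length c t' t = ennreal \<tau> - ennreal \<tau>'" by simp
      also have "\<dots> = 0" using t by (simp add: ennreal_minus ennreal_neg)
      finally show ?thesis using curve_length_ge_dist[of t' t c] False by (simp add: dist_commute)
    qed
    then show ?thesis using arclength_param_eq[OF f t1] arclength_param_eq[OF f t2] t by (simp add: dist_real_def ennreal_le_iff)
  qed
  show ?thesis using *[of \<tau> \<tau>'] *[of \<tau>' \<tau>] \<tau> by (cases "\<tau> \<le> \<tau>'") (auto simp: dist_commute)
qed

text \<open>A finite integral of \<open>\<infinity>\<close> times an indicator makes the set
  \<open>Z\<close> of arclength parameters of points of \<open>S\<close> null. The arclength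
  parametrization is 1-Lipschitz, so the image of \<open>Z\<close>, which contains the part of the
  trace in \<open>S\<close>, is null as well.\<close>

lemma hausdorff1_null_if_line_integral_finite:
  assumes S: "S \<in> sets borel" and cont: "continuous_on {a..b} c" and ab: "a \<le> b"
    and fin: "curve_length c a b < \<infinity>"
    and int: "(\<integral>\<^sup>+\<tau>. (\<infinity> * indicator S (arclength_param c a b \<tau>)) *
        indicator {0..enn2real (curve_length c a b)} \<tau> \<partial>lborel) < \<infinity>"
  shows "hausdorff_measure 1 (c ` {a..b} \<inter> S) = 0"
proof -
  define l where "l = enn2real (curve_length c a b)"
  have l: "curve_length c a b = ennreal l" "l \<ge> 0" using fin unfolding l_def by auto
  define \<alpha> where "\<alpha> = arclength_param c a b"
  have lip: "dist (\<alpha> x) (\<alpha> y) \<le> dist x y" if "x \<in> {0..l}" "y \<in> {0..l}" for x y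
    using arclength_param_lipschitz[OF l cont ab that] unfolding \<alpha>_def .
  have ca: "continuous_on {0..l} \<alpha>"
    unfolding continuous_on_iff by (meson lip order_le_less_trans)
  define Z where "Z = {0..l} \<inter> \<alpha> -` S"
  have Zb: "Z \<in> sets lborel"
  proof -
    have "\<alpha> \<in> borel_measurable (restrict_space borel {0..l})" by (rule borel_measurable_continuous_on_restrict[OF ca])
    from measurable_sets[OF this S] have "\<alpha> -` S \<inter> {0..l} \<in> sets (restrict_space borel {0..l})" by (simp add: space_restrict_space)
    then have "\<alpha> -` S \<inter> {0..l} \<in> sets borel" by (subst (asm) sets_restrict_space_iff) auto
    then show ?thesis unfolding Z_def by (simp add: Int_commute)
  qed
  have "(\<integral>\<^sup>+\<tau>. (\<infinity> * indicator S (\<alpha> \<tau>)) * indicator {0..l} \<tau> \<partial>lborel) = (\<integral>\<^sup>+\<tau>. \<infinity> * indicator Z \<tau> \<partial>lborel)"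
    by (rule nn_integral_cong) (auto simp: Z_def indicator_def)
  also have "\<dots> = \<infinity> * emeasure lborel Z" by (rule nn_integral_cmult_indicator[OF Zb])
  finally have "\<infinity> * emeasure lborel Z < \<infinity>" using int unfolding l_def \<alpha>_def by simp
  then have "emeasure lborel Z = 0" by (auto simp: ennreal_top_mult split: if_splits)
  then have "Z \<in> null_sets lborel" using Zb by auto
  then have "hausdorff_measure 1 (\<alpha> ` Z) = 0"
    by (rule hausdorff1_null_lipschitz_image) (use lip in \<open>auto simp: Z_def\<close>)
  moreover have "c ` {a..b} \<inter> S \<subseteq> \<alpha> ` Z"
  proof
    fix z assume "z \<in> c ` {a..b} \<inter> S"
    then obtain t where t: "t \<in> {a..b}" "z = c t" "z \<in> S" by auto
    have le: "curve_length c a t \<le> ennreal l" using curve_length_add[of a t b c] t l by (metis atLeastAtMost_iff le_iff_add)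
    define \<tau> where "\<tau> = enn2real (curve_length c a t)"
    have \<tau>: "curve_length c a t = ennreal \<tau>" "\<tau> \<ge> 0" unfolding \<tau>_def using le by (auto simp: top_unique less_top[symmetric] intro!: ennreal_enn2real[symmetric] order_le_less_trans[OF le])
    have "\<alpha> \<tau> = z" unfolding \<alpha>_def using arclength_param_eq[OF fin t(1) \<tau>(1)] t by simp
    moreover have "\<tau> \<in> {0..l}" using \<tau> le l by (simp add: ennreal_le_iff)
    ultimately show "z \<in> \<alpha> ` Z" using t unfolding Z_def by (intro image_eqI[of _ _ \<tau>]) auto
  qed
  ultimately show ?thesis using hausdorff1_null_subset by blast
qed

section \<open>Null path families\<close>

text \<open>The square of the supremum is the supremum of the products \<open>f i * f j\<close>,
  each of which is at most the larger of the two squares.\<close>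

lemma SUP_square_leI:
  fixes f :: "nat \<Rightarrow> ennreal"
  assumes "\<And>n. (f n)\<^sup>2 \<le> X" shows "(SUP n. f n)\<^sup>2 \<le> X"
proof -
  have "f i * f j \<le> X" for i j
  proof (cases "f i \<le> f j")
    case True then show ?thesis using assms[of j] by (metis mult_right_mono order_trans power2_eq_square zero_le)
  next
    case False then show ?thesis using assms[of i] by (metis linear mult_left_mono order_trans power2_eq_square zero_le)
  qed
  then show ?thesis
    unfolding power2_eq_square[of "SUP n. f n"] SUP_mult_left_ennreal SUP_mult_right_ennreal
    by (intro SUP_least) simp
qed

lemma SUP_square_le:
  fixes f :: "nat \<Rightarrow> ennreal"
  shows "(SUP n. f n)\<^sup>2 \<le> (\<Sum>n. (f n)\<^sup>2)"
  using sum_over_ge[of _ UNIV "\<lambda>n. (f n)\<^sup>2"] by (intro SUP_square_leI) (simp add: sum_over_UNIV)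

text \<open>A weighted Young inequality. Summed or integrated with a well chosen \<open>k\<close>,
  it does the work of the Cauchy-Schwarz inequality without conditions of finiteness.\<close>

lemma ennreal_mult_le_squares:
  fixes a b :: ennreal
  assumes "k > 0"
  shows "a * b \<le> ennreal k * a\<^sup>2 + ennreal (1/k) * b\<^sup>2"
proof (cases "a = top \<or> b = top")
  case True
  then have "ennreal k * a\<^sup>2 = top \<or> ennreal (1/k) * b\<^sup>2 = top"
    using assms by (auto simp: power2_eq_square ennreal_mult_top)
  then show ?thesis by auto
next
  case False
  then obtain x y where xy: "a = ennreal x" "b = ennreal y" "x \<ge> 0" "y \<ge> 0"
    by (metis ennreal_cases)
  have "0 \<le> (k * x - y)\<^sup>2 + (k * x)\<^sup>2 + y\<^sup>2" by simp
  then have "2 * (k * x * y) \<le> 2 * ((k * x)\<^sup>2 + y\<^sup>2)" by (simp add: power2_diff)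
  then have "k * (x * y) \<le> k * (k * x\<^sup>2 + 1/k * y\<^sup>2)"
    using assms by (simp add: algebra_simps power2_eq_square)
  then have "x * y \<le> k * x\<^sup>2 + 1/k * y\<^sup>2" using assms by simp
  then show ?thesis using xy assms
    by (simp add: ennreal_power flip: ennreal_mult ennreal_plus)
qed

lemma line_integral_mono: "(\<And>z. w z \<le> w' z) \<Longrightarrow> line_integral w \<gamma> \<le> line_integral w' \<gamma>"
  unfolding line_integral_def
  by (auto intro!: SUP_mono' nn_integral_mono mult_right_mono split: prod.split)

lemma line_integral_subpath:
  assumes "J \<subseteq> fst \<gamma>" shows "line_integral w (J, snd \<gamma>) \<le> line_integral w \<gamma>"
proof (cases "locally_rectifiable \<gamma>")
  case True
  then have "locally_rectifiable (J, snd \<gamma>)" using assms unfolding locally_rectifiable_def by auto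
  with True show ?thesis unfolding line_integral_def using assms by (auto intro!: SUP_subset_mono)
next
  case False then show ?thesis unfolding line_integral_def by simp
qed

lemma mod2_le:
  assumes "w \<in> borel_measurable borel" "\<And>\<gamma>. \<gamma> \<in> \<Gamma> \<Longrightarrow> 1 \<le> line_integral w \<gamma>"
  shows "mod2 \<Gamma> \<le> (\<integral>\<^sup>+z. (w z)\<^sup>2 \<partial>lborel)"
  unfolding mod2_def by (rule INF_lower) (use assms in auto)

lemma mod2_lessE:
  assumes "mod2 \<Gamma> < e"
  obtains w where "w \<in> borel_measurable borel" "\<And>\<gamma>. \<gamma> \<in> \<Gamma> \<Longrightarrow> 1 \<le> line_integral w \<gamma>"
    "(\<integral>\<^sup>+z. (w z)\<^sup>2 \<partial>lborel) < e"
  using assms unfolding mod2_def INF_less_iff by auto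

lemma mod2_null_superpaths:
  assumes "mod2 \<Gamma> = 0" "\<And>\<gamma>. \<gamma> \<in> \<Gamma>' \<Longrightarrow> \<exists>J\<subseteq>fst \<gamma>. (J, snd \<gamma>) \<in> \<Gamma>"
  shows "mod2 \<Gamma>' = 0"
proof -
  have "mod2 \<Gamma>' \<le> mod2 \<Gamma>" unfolding mod2_def
  proof (rule INF_superset_mono)
    show "{w \<in> borel_measurable borel. \<forall>\<gamma>\<in>\<Gamma>. 1 \<le> line_integral w \<gamma>}
        \<subseteq> {w \<in> borel_measurable borel. \<forall>\<gamma>\<in>\<Gamma>'. 1 \<le> line_integral w \<gamma>}"
    proof clarify
      fix w a b assume w: "w \<in> borel_measurable borel" "\<forall>\<gamma>\<in>\<Gamma>. 1 \<le> line_integral w \<gamma>" and g: "(a, b) \<in> \<Gamma>'"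
      obtain J where J: "J \<subseteq> fst (a, b)" "(J, snd (a, b)) \<in> \<Gamma>" using assms(2)[OF g] by blast
      show "1 \<le> line_integral w (a, b)"
        by (rule order_trans[OF bspec[OF w(2) J(2)] line_integral_subpath[OF J(1)]])
    qed
  qed simp
  then show ?thesis using assms by simp
qed

lemma mod2_empty: "mod2 {} = 0"
proof -
  have "mod2 {} \<le> (\<integral>\<^sup>+z. ((\<lambda>_::complex. 0::ennreal) z)\<^sup>2 \<partial>lborel)" by (rule mod2_le) auto
  then show ?thesis by simp
qed

lemma ennreal_half_series: "0 < e \<Longrightarrow> (\<Sum>n. ennreal (e * (1/2)^Suc n)) = ennreal e"
  by (rule suminf_ennreal_eq) (use power_half_series sums_mult[OF power_half_series, of e] in auto)

text \<open>The pointwise supremum of weights of energies below \<open>e * (1/2)^Suc n\<close> is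
  admissible for the whole union. Suprema rather than sums of weights keep the energy below the
  plain sum of the energies.\<close>

lemma mod2_null_UN:
  assumes "\<And>n::nat. mod2 (\<Gamma> n) = 0" shows "mod2 (\<Union>n. \<Gamma> n) = 0"
proof -
  have "mod2 (\<Union>n. \<Gamma> n) \<le> 0"
  proof (rule ennreal_le_epsilon)
    fix e :: real assume e: "0 < e"
    have "\<exists>w. w \<in> borel_measurable borel \<and> (\<forall>\<gamma>\<in>\<Gamma> n. 1 \<le> line_integral w \<gamma>) \<and>
        (\<integral>\<^sup>+z. (w z)\<^sup>2 \<partial>lborel) < ennreal (e * (1/2)^Suc n)" for n
    proof -
      have "mod2 (\<Gamma> n) < ennreal (e * (1/2)^Suc n)" using assms e by (simp add: ennreal_less_zero_iff)
      from mod2_lessE[OF this] show ?thesis by metis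
    qed
    then obtain w where w: "\<And>n. w n \<in> borel_measurable borel" "\<And>n \<gamma>. \<gamma> \<in> \<Gamma> n \<Longrightarrow> 1 \<le> line_integral (w n) \<gamma>"
      "\<And>n. (\<integral>\<^sup>+z. (w n z)\<^sup>2 \<partial>lborel) < ennreal (e * (1/2)^Suc n)" by metis
    note [measurable] = w(1)
    have "mod2 (\<Union>n. \<Gamma> n) \<le> (\<integral>\<^sup>+z. ((SUP n. w n z))\<^sup>2 \<partial>lborel)"
    proof (rule mod2_le)
      fix \<gamma> assume "\<gamma> \<in> (\<Union>n. \<Gamma> n)"
      then obtain n where "\<gamma> \<in> \<Gamma> n" by blast
      then have "1 \<le> line_integral (w n) \<gamma>" by (rule w)
      also have "\<dots> \<le> line_integral (\<lambda>z. SUP n. w n z) \<gamma>" by (rule line_integral_mono) (auto intro: SUP_upper)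
      finally show "1 \<le> line_integral (\<lambda>z. SUP n. w n z) \<gamma>" .
    qed measurable
    also have "\<dots> \<le> (\<integral>\<^sup>+z. (\<Sum>n. (w n z)\<^sup>2) \<partial>lborel)" by (intro nn_integral_mono SUP_square_le)
    also have "\<dots> = (\<Sum>n. \<integral>\<^sup>+z. (w n z)\<^sup>2 \<partial>lborel)" by (rule nn_integral_suminf) measurable
    also have "\<dots> \<le> (\<Sum>n. ennreal (e * (1/2)^Suc n))" by (rule suminf_le) (use w(3) less_imp_le in auto)
    also have "\<dots> = ennreal e" by (rule ennreal_half_series[OF e])
    finally show "mod2 (\<Union>n. \<Gamma> n) \<le> 0 + ennreal e" by simp
  qed
  then show ?thesis by simp
qed

lemma weak_modI:
  assumes "\<Gamma>0 \<subseteq> \<Gamma>" "mod2 \<Gamma>0 = 0" "\<And>\<gamma>. \<gamma> \<in> \<Gamma> - \<Gamma>0 \<Longrightarrow> 1 \<le> sum_over (meeting Q (path_trace \<gamma>)) \<rho>"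
  shows "weak_mod Q \<Gamma> \<le> (\<Sum>i. (\<rho> i)\<^sup>2)"
  unfolding weak_mod_def by (rule INF_lower) (use assms in blast)

lemma weak_mod_lessE:
  assumes "weak_mod Q \<Gamma> < e"
  obtains \<rho> \<Gamma>0 where "\<Gamma>0 \<subseteq> \<Gamma>" "mod2 \<Gamma>0 = 0" "(\<Sum>i. (\<rho> i)\<^sup>2) < e"
    "\<And>\<gamma>. \<gamma> \<in> \<Gamma> - \<Gamma>0 \<Longrightarrow> 1 \<le> sum_over (meeting Q (path_trace \<gamma>)) \<rho>"
proof -
  obtain \<rho> where r: "\<rho> \<in> {\<rho>. \<exists>\<Gamma>\<^sub>0\<subseteq>\<Gamma>. mod2 \<Gamma>\<^sub>0 = 0 \<and> (\<forall>\<gamma>\<in>\<Gamma> - \<Gamma>\<^sub>0. 1 \<le> sum_over (meeting Q (path_trace \<gamma>)) \<rho>)}"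
    "(\<Sum>i. (\<rho> i)\<^sup>2) < e" using assms unfolding weak_mod_def INF_less_iff by (elim bexE)
  then show ?thesis using that by blast
qed

lemma strong_modI:
  assumes "\<And>\<gamma>. \<gamma> \<in> \<Gamma> \<Longrightarrow> hausdorff_measure 1 (path_trace \<gamma> \<inter> carpet \<Omega> Q) = 0 \<Longrightarrow> 1 \<le> sum_over (meeting Q (path_trace \<gamma>)) \<rho>"
  shows "strong_mod \<Omega> Q \<Gamma> \<le> (\<Sum>i. (\<rho> i)\<^sup>2)"
  unfolding strong_mod_def by (rule INF_lower) (use assms in blast)

lemma strong_mod_lessE:
  assumes "strong_mod \<Omega> Q \<Gamma> < e"
  obtains \<rho> where "(\<Sum>i. (\<rho> i)\<^sup>2) < e"
    "\<And>\<gamma>. \<gamma> \<in> \<Gamma> \<Longrightarrow> hausdorff_measure 1 (path_trace \<gamma> \<inter> carpet \<Omega> Q) = 0 \<Longrightarrow> 1 \<le> sum_over (meeting Q (path_trace \<gamma>)) \<rho>"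
proof -
  obtain \<rho> where r: "\<rho> \<in> {\<rho>. \<forall>\<gamma>\<in>\<Gamma>. hausdorff_measure 1 (path_trace \<gamma> \<inter> carpet \<Omega> Q) = 0
                    \<longrightarrow> 1 \<le> sum_over (meeting Q (path_trace \<gamma>)) \<rho>}"
    "(\<Sum>i. (\<rho> i)\<^sup>2) < e" using assms unfolding strong_mod_def INF_less_iff by (elim bexE)
  then show ?thesis using that by blast
qed

lemma sum_over_mono_set: "I \<subseteq> J \<Longrightarrow> sum_over I \<sigma> \<le> sum_over J \<sigma>"
  by (rule sum_over_mono) auto

lemma meeting_subpath:
  "J \<subseteq> fst \<gamma> \<Longrightarrow> meeting Q (path_trace (J, snd \<gamma>)) \<subseteq> meeting Q (path_trace \<gamma>)"
  unfolding path_trace_def by (intro meeting_mono) auto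

text \<open>Longer paths have larger integrals and meet more disks, so whatever is admissible for
  the subpaths is admissible for them. The use is contrapositive: almost every path has no
  exceptional subpath.\<close>

lemma carpet_mod_null_superpaths:
  assumes null: "carpet_mod ver \<Omega> Q \<Gamma> = 0" and sup: "\<And>\<gamma>. \<gamma> \<in> \<Gamma>' \<Longrightarrow> \<exists>J\<subseteq>fst \<gamma>. (J, snd \<gamma>) \<in> \<Gamma>"
  shows "carpet_mod ver \<Omega> Q \<Gamma>' = 0"
proof (cases ver)
  case Weak
  have "weak_mod Q \<Gamma>' \<le> 0"
  proof (rule ennreal_le_epsilon)
    fix e :: real assume e: "0 < e"
    then have "weak_mod Q \<Gamma> < ennreal e" using null Weak by simp
    then obtain \<rho> \<Gamma>0 where r: "\<Gamma>0 \<subseteq> \<Gamma>" "mod2 \<Gamma>0 = 0" "(\<Sum>i. (\<rho> i)\<^sup>2) < ennreal e"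
      "\<And>\<gamma>. \<gamma> \<in> \<Gamma> - \<Gamma>0 \<Longrightarrow> 1 \<le> sum_over (meeting Q (path_trace \<gamma>)) \<rho>" by (rule weak_mod_lessE) blast
    let ?\<Gamma>0 = "{\<gamma>\<in>\<Gamma>'. \<exists>J\<subseteq>fst \<gamma>. (J, snd \<gamma>) \<in> \<Gamma>0}"
    have "weak_mod Q \<Gamma>' \<le> (\<Sum>i. (\<rho> i)\<^sup>2)"
    proof (rule weak_modI)
      show "mod2 ?\<Gamma>0 = 0" by (rule mod2_null_superpaths[OF r(2)]) blast
      fix \<gamma> assume g: "\<gamma> \<in> \<Gamma>' - ?\<Gamma>0"
      then obtain J where J: "J \<subseteq> fst \<gamma>" "(J, snd \<gamma>) \<in> \<Gamma>" using sup[of \<gamma>] by auto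
      then have J: "J \<subseteq> fst \<gamma>" "(J, snd \<gamma>) \<in> \<Gamma> - \<Gamma>0" using g by auto
      from r(4)[OF J(2)] show "1 \<le> sum_over (meeting Q (path_trace \<gamma>)) \<rho>"
        using sum_over_mono_set[OF meeting_subpath[OF J(1)]] order_trans by blast
    qed blast
    then show "weak_mod Q \<Gamma>' \<le> 0 + ennreal e" using r(3) by simp
  qed
  then show ?thesis using Weak by simp
next
  case Strong
  have "strong_mod \<Omega> Q \<Gamma>' \<le> 0"
  proof (rule ennreal_le_epsilon)
    fix e :: real assume e: "0 < e"
    then have "strong_mod \<Omega> Q \<Gamma> < ennreal e" using null Strong by simp
    then obtain \<rho> where r: "(\<Sum>i. (\<rho> i)\<^sup>2) < ennreal e"
      "\<And>\<gamma>. \<gamma> \<in> \<Gamma> \<Longrightarrow> hausdorff_measure 1 (path_trace \<gamma> \<inter> carpet \<Omega> Q) = 0 \<Longrightarrow> 1 \<le> sum_over (meeting Q (path_trace \<gamma>)) \<rho>"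
      by (rule strong_mod_lessE) blast
    have "strong_mod \<Omega> Q \<Gamma>' \<le> (\<Sum>i. (\<rho> i)\<^sup>2)"
    proof (rule strong_modI)
      fix \<gamma> assume g: "\<gamma> \<in> \<Gamma>'" "hausdorff_measure 1 (path_trace \<gamma> \<inter> carpet \<Omega> Q) = 0"
      obtain J where J: "J \<subseteq> fst \<gamma>" "(J, snd \<gamma>) \<in> \<Gamma>" using sup g by blast
      have "hausdorff_measure 1 (path_trace (J, snd \<gamma>) \<inter> carpet \<Omega> Q) = 0"
        by (rule hausdorff1_null_subset[OF g(2)]) (use J in \<open>auto simp: path_trace_def\<close>)
      from r(2)[OF J(2) this] show "1 \<le> sum_over (meeting Q (path_trace \<gamma>)) \<rho>"
        using sum_over_mono_set[OF meeting_subpath[OF J(1)]] order_trans by blast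
    qed
    then show "strong_mod \<Omega> Q \<Gamma>' \<le> 0 + ennreal e" using r(1) by simp
  qed
  then show ?thesis using Strong by simp
qed

lemma carpet_mod_null_subset:
  "carpet_mod ver \<Omega> Q \<Gamma> = 0 \<Longrightarrow> \<Gamma>' \<subseteq> \<Gamma> \<Longrightarrow> carpet_mod ver \<Omega> Q \<Gamma>' = 0"
proof (rule carpet_mod_null_superpaths)
  fix \<gamma> assume "\<Gamma>' \<subseteq> \<Gamma>" "\<gamma> \<in> \<Gamma>'"
  then have "(fst \<gamma>, snd \<gamma>) \<in> \<Gamma>" by auto
  then show "\<exists>J\<subseteq>fst \<gamma>. (J, snd \<gamma>) \<in> \<Gamma>" by blast
qed

lemma sup_energy:
  assumes "e > 0" "\<And>n. (\<Sum>i. (\<rho> n i)\<^sup>2) < ennreal (e * (1/2)^Suc n)"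
  shows "(\<Sum>i. (SUP n. \<rho> n i)\<^sup>2) \<le> ennreal e"
proof -
  have "(\<Sum>i. (SUP n. \<rho> n i)\<^sup>2) \<le> (\<Sum>i. \<Sum>n. (\<rho> n i)\<^sup>2)" by (intro suminf_le summableI SUP_square_le)
  also have "\<dots> = (\<integral>\<^sup>+i. (\<Sum>n. (\<rho> n i)\<^sup>2) \<partial>count_space UNIV)" by (simp add: nn_integral_count_space_nat)
  also have "\<dots> = (\<Sum>n. \<integral>\<^sup>+i. (\<rho> n i)\<^sup>2 \<partial>count_space UNIV)" by (rule nn_integral_suminf) simp
  also have "\<dots> = (\<Sum>n. \<Sum>i. (\<rho> n i)\<^sup>2)" by (simp add: nn_integral_count_space_nat)
  also have "\<dots> \<le> (\<Sum>n. ennreal (e * (1/2)^Suc n))" by (rule suminf_le) (use assms less_imp_le in auto)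
  also have "\<dots> = ennreal e" by (rule ennreal_half_series[OF assms(1)])
  finally show ?thesis .
qed

lemma carpet_mod_null_UN:
  assumes null: "\<And>n::nat. carpet_mod ver \<Omega> Q (\<Gamma> n) = 0" shows "carpet_mod ver \<Omega> Q (\<Union>n. \<Gamma> n) = 0"
proof (cases ver)
  case Weak
  have "weak_mod Q (\<Union>n. \<Gamma> n) \<le> 0"
  proof (rule ennreal_le_epsilon)
    fix e :: real assume e: "0 < e"
    have "\<exists>\<rho> \<Gamma>0. \<Gamma>0 \<subseteq> \<Gamma> n \<and> mod2 \<Gamma>0 = 0 \<and> (\<Sum>i. (\<rho> i)\<^sup>2) < ennreal (e * (1/2)^Suc n) \<and>
      (\<forall>\<gamma>. \<gamma> \<in> \<Gamma> n - \<Gamma>0 \<longrightarrow> 1 \<le> sum_over (meeting Q (path_trace \<gamma>)) \<rho>)" for n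
    proof -
      have "weak_mod Q (\<Gamma> n) < ennreal (e * (1/2)^Suc n)" using null[of n] Weak e by (simp add: ennreal_less_zero_iff)
      from weak_mod_lessE[OF this] show ?thesis by metis
    qed
    then obtain \<rho> \<Gamma>0 where r: "\<And>n. \<Gamma>0 n \<subseteq> \<Gamma> n" "\<And>n. mod2 (\<Gamma>0 n) = 0" "\<And>n. (\<Sum>i. (\<rho> n i)\<^sup>2) < ennreal (e * (1/2)^Suc n)"
      "\<And>n \<gamma>. \<gamma> \<in> \<Gamma> n - \<Gamma>0 n \<Longrightarrow> 1 \<le> sum_over (meeting Q (path_trace \<gamma>)) (\<rho> n)" by metis
    have "weak_mod Q (\<Union>n. \<Gamma> n) \<le> (\<Sum>i. (SUP n. \<rho> n i)\<^sup>2)"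
    proof (rule weak_modI)
      show "mod2 (\<Union>n. \<Gamma>0 n) = 0" by (rule mod2_null_UN[OF r(2)])
      show "(\<Union>n. \<Gamma>0 n) \<subseteq> (\<Union>n. \<Gamma> n)" using r(1) by blast
      fix \<gamma> assume "\<gamma> \<in> (\<Union>n. \<Gamma> n) - (\<Union>n. \<Gamma>0 n)"
      then obtain n where "\<gamma> \<in> \<Gamma> n - \<Gamma>0 n" by blast
      from r(4)[OF this] show "1 \<le> sum_over (meeting Q (path_trace \<gamma>)) (\<lambda>i. SUP n. \<rho> n i)"
        by (rule order_trans) (intro sum_over_mono order_refl SUP_upper UNIV_I)
    qed
    then show "weak_mod Q (\<Union>n. \<Gamma> n) \<le> 0 + ennreal e" using sup_energy[OF e r(3)] by simp
  qed
  then show ?thesis using Weak by simp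
next
  case Strong
  have "strong_mod \<Omega> Q (\<Union>n. \<Gamma> n) \<le> 0"
  proof (rule ennreal_le_epsilon)
    fix e :: real assume e: "0 < e"
    have "\<exists>\<rho>. (\<Sum>i. (\<rho> i)\<^sup>2) < ennreal (e * (1/2)^Suc n) \<and>
      (\<forall>\<gamma>. \<gamma> \<in> \<Gamma> n \<longrightarrow> hausdorff_measure 1 (path_trace \<gamma> \<inter> carpet \<Omega> Q) = 0 \<longrightarrow> 1 \<le> sum_over (meeting Q (path_trace \<gamma>)) \<rho>)" for n
    proof -
      have "strong_mod \<Omega> Q (\<Gamma> n) < ennreal (e * (1/2)^Suc n)" using null[of n] Strong e by (simp add: ennreal_less_zero_iff)
      from strong_mod_lessE[OF this] show ?thesis by metis
    qed
    then obtain \<rho> where r: "\<And>n. (\<Sum>i. (\<rho> n i)\<^sup>2) < ennreal (e * (1/2)^Suc n)"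
      "\<And>n \<gamma>. \<gamma> \<in> \<Gamma> n \<Longrightarrow> hausdorff_measure 1 (path_trace \<gamma> \<inter> carpet \<Omega> Q) = 0 \<Longrightarrow> 1 \<le> sum_over (meeting Q (path_trace \<gamma>)) (\<rho> n)" by metis
    have "strong_mod \<Omega> Q (\<Union>n. \<Gamma> n) \<le> (\<Sum>i. (SUP n. \<rho> n i)\<^sup>2)"
    proof (rule strong_modI)
      fix \<gamma> assume g: "\<gamma> \<in> (\<Union>n. \<Gamma> n)" "hausdorff_measure 1 (path_trace \<gamma> \<inter> carpet \<Omega> Q) = 0"
      then obtain n where "\<gamma> \<in> \<Gamma> n" by blast
      from r(2)[OF this g(2)] show "1 \<le> sum_over (meeting Q (path_trace \<gamma>)) (\<lambda>i. SUP n. \<rho> n i)"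
        by (rule order_trans) (intro sum_over_mono order_refl SUP_upper UNIV_I)
    qed
    then show "strong_mod \<Omega> Q (\<Union>n. \<Gamma> n) \<le> 0 + ennreal e" using sup_energy[OF e r(1)] by simp
  qed
  then show ?thesis using Strong by simp
qed

lemma weak_mod_null_if_mod2_null: "mod2 \<Gamma> = 0 \<Longrightarrow> weak_mod Q \<Gamma> = 0"
  using weak_modI[of \<Gamma> \<Gamma> Q "\<lambda>_. 0"] by simp

text \<open>Every positive multiple of \<open>\<sigma>\<close> still has infinite sum along the
  paths of \<open>\<Gamma>\<close>, hence is admissible, and its energy can be made as small as
  desired.\<close>

lemma carpet_mod_null_sum_infinite:
  assumes "(\<Sum>i. (\<sigma> i)\<^sup>2) < \<infinity>" "\<And>\<gamma>. \<gamma> \<in> \<Gamma> \<Longrightarrow> sum_over (meeting Q (path_trace \<gamma>)) \<sigma> = \<infinity>"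
  shows "carpet_mod ver \<Omega> Q \<Gamma> = 0"
proof -
  have "carpet_mod ver \<Omega> Q \<Gamma> \<le> 0"
  proof (rule ennreal_le_epsilon)
    fix e :: real assume e: "0 < e"
    obtain s where s: "(\<Sum>i. (\<sigma> i)\<^sup>2) = ennreal s" "s \<ge> 0" using assms(1) by (metis ennreal_cases infinity_ennreal_def less_irrefl)
    define k where "k = sqrt (e / (s + 1))"
    have k: "k > 0" "k\<^sup>2 * s \<le> e" unfolding k_def using e s(2) by (auto simp: field_simps)
    have sq: "(\<Sum>i. (ennreal k * \<sigma> i)\<^sup>2) \<le> ennreal e"
    proof -
      have "(\<Sum>i. (ennreal k * \<sigma> i)\<^sup>2) = ennreal (k\<^sup>2) * ennreal s"
        using s k by (simp add: power_mult_distrib ennreal_power)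
      also have "\<dots> = ennreal (k\<^sup>2 * s)" using s by (simp add: ennreal_mult)
      finally show ?thesis using k by (simp add: ennreal_leI)
    qed
    have one: "1 \<le> sum_over (meeting Q (path_trace \<gamma>)) (\<lambda>i. ennreal k * \<sigma> i)" if "\<gamma> \<in> \<Gamma>" for \<gamma>
      unfolding sum_over_cmult using assms(2)[OF that] k by (simp add: ennreal_mult_top)
    have "carpet_mod ver \<Omega> Q \<Gamma> \<le> (\<Sum>i. (ennreal k * \<sigma> i)\<^sup>2)"
      using weak_modI[of "{}" \<Gamma> Q "\<lambda>i. ennreal k * \<sigma> i"] strong_modI[of \<Gamma> \<Omega> Q "\<lambda>i. ennreal k * \<sigma> i"] one mod2_empty
      by (cases ver) auto
    then show "carpet_mod ver \<Omega> Q \<Gamma> \<le> 0 + ennreal e" using sq by simp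
  qed
  then show ?thesis by simp
qed

text \<open>End points that belong to \<open>I\<close> must be reached exactly, which is why they
  join the rationals in \<open>D\<close>; on an open side the rationals suffice. Pairs in the wrong
  order contribute empty intervals.\<close>

lemma interval_countable_exhaustion:
  fixes I :: "real set"
  assumes I: "is_interval I"
  obtains p q :: "nat \<Rightarrow> real" where "\<And>n. p n \<le> q n \<Longrightarrow> {p n..q n} \<subseteq> I" "I \<subseteq> (\<Union>n. {p n..q n})"
proof (cases "I = {}")
  case True then show ?thesis using that[of "\<lambda>_. 1" "\<lambda>_. 0"] by auto
next
  case False
  define D where "D = (I \<inter> \<rat>) \<union> ({Inf I, Sup I} \<inter> I)"
  have cD: "countable D" unfolding D_def using countable_rat by auto
  have up: "\<exists>d\<in>D. t \<le> d" if t: "t \<in> I" for t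
  proof (cases "\<exists>u\<in>I. t < u")
    case True
    then obtain u where u: "u \<in> I" "t < u" by blast
    then obtain r where r: "r \<in> \<rat>" "t < r" "r < u" using Rats_dense_in_real by blast
    then have "r \<in> I" using I t u unfolding is_interval_1 by (meson less_imp_le)
    then show ?thesis using r unfolding D_def by (intro bexI[of _ r]) auto
  next
    case False
    then have "Sup I = t" using t by (intro cSup_eq_maximum) (auto simp: not_less)
    then show ?thesis using t unfolding D_def by auto
  qed
  have down: "\<exists>d\<in>D. d \<le> t" if t: "t \<in> I" for t
  proof (cases "\<exists>u\<in>I. u < t")
    case True
    then obtain u where u: "u \<in> I" "u < t" by blast
    then obtain r where r: "r \<in> \<rat>" "u < r" "r < t" using Rats_dense_in_real by blast
    then have "r \<in> I" using I t u unfolding is_interval_1 by (meson less_imp_le)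
    then show ?thesis using r unfolding D_def by (intro bexI[of _ r]) auto
  next
    case False
    then have "Inf I = t" using t by (intro cInf_eq_minimum) (auto simp: not_less)
    then show ?thesis using t unfolding D_def by auto
  qed
  have "D \<times> D \<noteq> {}" using up False by auto
  moreover have "countable (D \<times> D)" using cD by auto
  ultimately obtain f :: "nat \<Rightarrow> real \<times> real" where f: "range f = D \<times> D" by (metis range_from_nat_into)
  show ?thesis
  proof (rule that[of "\<lambda>n. fst (f n)" "\<lambda>n. snd (f n)"])
    fix n
    have "f n \<in> D \<times> D" using f by blast
    then have "fst (f n) \<in> I" "snd (f n) \<in> I" unfolding D_def by auto
    then show "{fst (f n)..snd (f n)} \<subseteq> I" using mem_is_interval_1_I[OF I] by (meson atLeastAtMost_iff subsetI)
  next
    show "I \<subseteq> (\<Union>n. {fst (f n)..snd (f n)})"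
    proof
      fix t assume "t \<in> I"
      then obtain d d' where "d \<in> D" "d' \<in> D" "d \<le> t" "t \<le> d'" using up down by blast
      moreover from this obtain n where "f n = (d, d')" using f by (metis mem_Sigma_iff rangeE)
      ultimately show "t \<in> (\<Union>n. {fst (f n)..snd (f n)})" by (intro UN_I[of n]) auto
    qed
  qed
qed

lemma is_path_continuous:
  assumes "is_path \<gamma>" shows "continuous_on (fst \<gamma>) (snd \<gamma>)"
proof -
  obtain h where h: "continuous_on (closure (fst \<gamma>)) h" "\<forall>t\<in>fst \<gamma>. h t = snd \<gamma> t"
    using assms unfolding is_path_def by blast
  then have "continuous_on (fst \<gamma>) h" using continuous_on_subset closure_subset by blast
  then show ?thesis using h(2) continuous_on_cong by metis
qed

lemma hausdorff1_null_empty: "hausdorff_measure 1 {} = 0"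
  unfolding hausdorff1_null_iff by (auto intro!: exI[of _ "\<lambda>_. {}"])

text \<open>The weight \<open>\<infinity>\<close> on \<open>S\<close> costs nothing since
  \<open>S\<close> has measure zero. A path of finite integral meets \<open>S\<close> in a null set
  on each of countably many compact pieces, hence altogether.\<close>

lemma mod2_null_carpet_paths:
  assumes S: "S \<in> sets borel" "emeasure lborel S = 0"
    and \<Gamma>: "\<And>\<gamma>. \<gamma> \<in> \<Gamma> \<Longrightarrow> is_path \<gamma> \<and> hausdorff_measure 1 (path_trace \<gamma> \<inter> S) \<noteq> 0"
  shows "mod2 \<Gamma> = 0"
proof -
  let ?w = "\<lambda>z. \<infinity> * indicator S z :: ennreal"
  have "1 \<le> line_integral ?w \<gamma>" if g: "\<gamma> \<in> \<Gamma>" for \<gamma>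
  proof (rule ccontr)
    assume n1: "\<not> ?thesis"
    then have lr: "locally_rectifiable \<gamma>" unfolding line_integral_def by (auto split: if_splits)
    have ip: "is_path \<gamma>" using \<Gamma>[OF g] by blast
    have ii: "is_interval (fst \<gamma>)" using ip unfolding is_path_def by blast
    obtain p q where pq: "\<And>n. p n \<le> q n \<Longrightarrow> {p n..q n} \<subseteq> fst \<gamma>" "fst \<gamma> \<subseteq> (\<Union>n::nat. {p n..q n})"
      by (rule interval_countable_exhaustion[OF ii]) blast
    have "hausdorff_measure 1 (snd \<gamma> ` {p n..q n} \<inter> S) = 0" for n
    proof (cases "p n \<le> q n")
      case False then show ?thesis using hausdorff1_null_empty by (metis atLeastatMost_empty_iff image_empty Int_empty_left)
    next
      case True
      have fin: "curve_length (snd \<gamma>) (p n) (q n) < \<infinity>" using lr True pq(1) unfolding locally_rectifiable_def by blast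
      have "(\<integral>\<^sup>+\<tau>. ?w (arclength_param (snd \<gamma>) (p n) (q n) \<tau>)
               * indicator {0..enn2real (curve_length (snd \<gamma>) (p n) (q n))} \<tau> \<partial>lborel) \<le> line_integral ?w \<gamma>"
        unfolding line_integral_def using lr True pq(1)[OF True] by (auto intro!: SUP_upper2[of "(p n, q n)"])
      also have "\<dots> < \<infinity>" using n1 by (auto simp: not_le intro: order_less_trans)
      finally show ?thesis
        using hausdorff1_null_if_line_integral_finite[OF S(1) _ True fin]
          continuous_on_subset[OF is_path_continuous[OF ip] pq(1)[OF True]] by blast
    qed
    then have "hausdorff_measure 1 (\<Union>n. snd \<gamma> ` {p n..q n} \<inter> S) = 0" by (rule hausdorff1_null_UN)
    moreover have "path_trace \<gamma> \<subseteq> (\<Union>n. snd \<gamma> ` {p n..q n})"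
      using image_mono[OF pq(2), of "snd \<gamma>"] unfolding path_trace_def image_UN .
    then have "path_trace \<gamma> \<inter> S \<subseteq> (\<Union>n. snd \<gamma> ` {p n..q n} \<inter> S)" by auto
    ultimately have "hausdorff_measure 1 (path_trace \<gamma> \<inter> S) = 0"
      by (rule hausdorff1_null_subset)
    then show False using \<Gamma>[OF g] by blast
  qed
  then have "mod2 \<Gamma> \<le> (\<integral>\<^sup>+z. (?w z)\<^sup>2 \<partial>lborel)" by (intro mod2_le) (use S in measurable)
  also have "\<dots> = (\<integral>\<^sup>+z. \<infinity> * indicator S z \<partial>lborel)"
    by (rule nn_integral_cong) (auto simp: indicator_def power2_eq_square)
  also have "\<dots> = 0" using S by (subst nn_integral_cmult_indicator) auto
  finally show ?thesis by simp
qed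

section \<open>Unit speed lines and Fubini's theorem in the complex plane\<close>

lemma curve_length_isometric:
  assumes c: "\<And>x y. dist (c x) (c y) = \<bar>x - y\<bar>" and ab: "a \<le> b"
  shows "curve_length c a b = ennreal (b - a)"
proof (rule antisym)
  have *: "chain_length c (x # ts) \<le> ennreal (b - x)" if "sorted (x # ts)" "set (x # ts) \<subseteq> {a..b}" for x ts
    using that
  proof (induction ts arbitrary: x)
    case (Cons y ts)
    then have "chain_length c (y # ts) \<le> ennreal (b - y)" by auto
    then have "chain_length c (x # y # ts) \<le> ennreal (y - x) + ennreal (b - y)"
      using Cons.prems by (auto simp: c intro: add_left_mono)
    also have "\<dots> = ennreal (b - x)" using Cons.prems by (subst ennreal_plus[symmetric]) auto
    finally show ?case .
  qed simp
  show "curve_length c a b \<le> ennreal (b - a)"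
    unfolding curve_length_eq
  proof (rule SUP_least)
    fix ts assume ts: "ts \<in> {ts. sorted ts \<and> set ts \<subseteq> {a..b}}"
    show "chain_length c ts \<le> ennreal (b - a)"
    proof (cases ts)
      case (Cons x xs)
      have "chain_length c ts \<le> ennreal (b - x)" using * ts Cons by blast
      also have "\<dots> \<le> ennreal (b - a)" using ts Cons by (intro ennreal_leI) auto
      finally show ?thesis .
    qed simp
  qed
  show "ennreal (b - a) \<le> curve_length c a b" using curve_length_ge_dist[OF ab, of c] c[of a b] ab by simp
qed

lemma line_integral_isometric_le:
  assumes c: "\<And>x y. dist (c x) (c y) = \<bar>x - y\<bar>" and w: "(\<lambda>y. w (c y)) \<in> borel_measurable borel"
    and B: "B \<in> sets borel" "c ` I \<subseteq> B" and cm: "c \<in> borel_measurable borel"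
  shows "line_integral w (I, c) \<le> (\<integral>\<^sup>+y. w (c y) * indicator B (c y) \<partial>lborel)"
proof -
  have lr: "locally_rectifiable (I, c)" unfolding locally_rectifiable_def using curve_length_isometric[OF c] by auto
  have "(\<integral>\<^sup>+\<tau>. w (arclength_param c a b \<tau>) * indicator {0..enn2real (curve_length c a b)} \<tau> \<partial>lborel)
      \<le> (\<integral>\<^sup>+y. w (c y) * indicator B (c y) \<partial>lborel)" if ab: "a \<le> b" "{a..b} \<subseteq> I" for a b
  proof -
    have "(\<integral>\<^sup>+\<tau>. w (arclength_param c a b \<tau>) * indicator {0..enn2real (curve_length c a b)} \<tau> \<partial>lborel)
      = (\<integral>\<^sup>+\<tau>. w (c (a + \<tau>)) * indicator {a..b} (a + \<tau>) \<partial>lborel)"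
    proof (rule nn_integral_cong)
      fix \<tau>
      show "w (arclength_param c a b \<tau>) * indicator {0..enn2real (curve_length c a b)} \<tau> = w (c (a + \<tau>)) * indicator {a..b} (a + \<tau>)"
      proof (cases "\<tau> \<in> {0..b - a}")
        case True
        have "arclength_param c a b \<tau> = c (a + \<tau>)"
          by (rule arclength_param_eq) (use True ab curve_length_isometric[OF c] in auto)
        then show ?thesis using True curve_length_isometric[OF c ab(1)] ab(1) by (simp add: indicator_def)
      next
        case False then show ?thesis using curve_length_isometric[OF c ab(1)] ab(1) by (auto simp: indicator_def)
      qed
    qed
    also have "\<dots> = (\<integral>\<^sup>+y. w (c y) * indicator {a..b} y \<partial>lborel)"
      using nn_integral_real_affine[of "\<lambda>y. w (c y) * indicator {a..b} y" 1 a] w by simp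
    also have "\<dots> \<le> (\<integral>\<^sup>+y. w (c y) * indicator B (c y) \<partial>lborel)"
    proof (rule nn_integral_mono)
      fix y
      show "w (c y) * indicator {a..b} y \<le> w (c y) * indicator B (c y)"
      proof (cases "y \<in> {a..b}")
        case True
        then have "c y \<in> B" using ab(2) B(2) by blast
        then show ?thesis using True by simp
      qed simp
    qed
    finally show ?thesis .
  qed
  then show ?thesis unfolding line_integral_def using lr by (auto intro!: SUP_least)
qed

lemma measurable_Complex [measurable (raw)]:
  assumes "f \<in> borel_measurable M" "g \<in> borel_measurable M"
  shows "(\<lambda>x. Complex (f x) (g x)) \<in> borel_measurable M"
proof -
  have "(\<lambda>x. complex_of_real (f x) + \<i> * complex_of_real (g x)) \<in> borel_measurable M"
    using assms by measurable
  then show ?thesis by (simp add: Complex_eq)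
qed

text \<open>Lebesgue measure on the complex type is not a product by definition; agreement on boxes
  identifies it with one and opens the way to Fubini's theorem.\<close>

lemma lborel_complex_eq: "(lborel :: complex measure) = distr (lborel \<Otimes>\<^sub>M lborel) borel (\<lambda>(x, y). Complex x y)"
proof (rule lborel_eqI)
  fix l u :: complex assume le: "\<And>b. b \<in> Basis \<Longrightarrow> l \<bullet> b \<le> u \<bullet> b"
  have lu: "Re l \<le> Re u" "Im l \<le> Im u" using le[of 1] le[of \<i>] by (auto simp: Basis_complex_def)
  have m: "(\<lambda>(x, y). Complex x y) \<in> measurable (lborel \<Otimes>\<^sub>M lborel) borel" by measurable
  have "emeasure (distr (lborel \<Otimes>\<^sub>M lborel) borel (\<lambda>(x, y). Complex x y)) (box l u)
    = emeasure (lborel \<Otimes>\<^sub>M lborel) ((\<lambda>(x, y). Complex x y) -` box l u \<inter> space (lborel \<Otimes>\<^sub>M lborel))"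
    by (rule emeasure_distr[OF m]) simp
  also have "(\<lambda>(x, y). Complex x y) -` box l u \<inter> space (lborel \<Otimes>\<^sub>M lborel) = {Re l<..<Re u} \<times> {Im l<..<Im u}"
    by (auto simp: box_def Basis_complex_def space_pair_measure)
  also have "emeasure (lborel \<Otimes>\<^sub>M lborel) ({Re l<..<Re u} \<times> {Im l<..<Im u}) = ennreal (Re u - Re l) * ennreal (Im u - Im l)"
    using lu by (subst lborel.emeasure_pair_measure_Times) auto
  also have "\<dots> = ennreal (\<Prod>b\<in>Basis. (u - l) \<bullet> b)"
    using lu by (simp add: Basis_complex_def ennreal_mult)
  finally show "emeasure (distr (lborel \<Otimes>\<^sub>M lborel) borel (\<lambda>(x, y). Complex x y)) (box l u) = ennreal (\<Prod>b\<in>Basis. (u - l) \<bullet> b)" .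
qed simp

lemma nn_integral_complex:
  assumes [measurable]: "w \<in> borel_measurable borel"
  shows "(\<integral>\<^sup>+z. w z \<partial>lborel) = (\<integral>\<^sup>+x. \<integral>\<^sup>+y. w (Complex x y) \<partial>lborel \<partial>lborel)"
    and "(\<integral>\<^sup>+z. w z \<partial>lborel) = (\<integral>\<^sup>+y. \<integral>\<^sup>+x. w (Complex x y) \<partial>lborel \<partial>lborel)"
proof -
  have "(\<integral>\<^sup>+z. w z \<partial>lborel) = (\<integral>\<^sup>+p. w (case p of (x, y) \<Rightarrow> Complex x y) \<partial>(lborel \<Otimes>\<^sub>M lborel))"
    by (subst lborel_complex_eq, subst nn_integral_distr) auto
  also have "\<dots> = (\<integral>\<^sup>+x. \<integral>\<^sup>+y. w (Complex x y) \<partial>lborel \<partial>lborel)"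
    by (subst lborel.nn_integral_fst[symmetric]) auto
  finally show 1: "(\<integral>\<^sup>+z. w z \<partial>lborel) = (\<integral>\<^sup>+x. \<integral>\<^sup>+y. w (Complex x y) \<partial>lborel \<partial>lborel)" .
  also have "\<dots> = (\<integral>\<^sup>+y. \<integral>\<^sup>+x. w (Complex x y) \<partial>lborel \<partial>lborel)"
    by (rule lborel_pair.Fubini') measurable
  finally show "(\<integral>\<^sup>+z. w z \<partial>lborel) = (\<integral>\<^sup>+y. \<integral>\<^sup>+x. w (Complex x y) \<partial>lborel \<partial>lborel)" .
qed

section \<open>Almost every path in a carpet\<close>

lemma lipschitz_image_in_interval:
  fixes \<pi> :: "complex \<Rightarrow> real"
  assumes E: "bounded E" "E \<noteq> {}" and \<pi>: "\<And>z z'. \<bar>\<pi> z - \<pi> z'\<bar> \<le> dist z z'"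
  obtains l u where "\<pi> ` E \<subseteq> {l..u}" "u - l \<le> diameter E"
proof -
  obtain z0 where z0: "z0 \<in> E" using E by blast
  have d: "\<bar>\<pi> z - \<pi> z'\<bar> \<le> diameter E" if "z \<in> E" "z' \<in> E" for z z'
    using \<pi>[of z z'] diameter_bounded_bound[OF E(1) that] by simp
  have bd: "bdd_below (\<pi> ` E)" "bdd_above (\<pi> ` E)"
    using d[OF z0] by (force intro!: bdd_belowI[of _ "\<pi> z0 - diameter E"] bdd_aboveI[of _ "\<pi> z0 + diameter E"])+
  have "Sup (\<pi> ` E) \<le> diameter E + \<pi> y" if "y \<in> E" for y
    using E(2) d[OF _ that] by (intro cSUP_least) force+
  then have "Sup (\<pi> ` E) - diameter E \<le> Inf (\<pi> ` E)"
    using E(2) by (intro cINF_greatest) force+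
  moreover have "\<pi> ` E \<subseteq> {Inf (\<pi> ` E)..Sup (\<pi> ` E)}"
    using cInf_lower[OF _ bd(1)] cSup_upper[OF _ bd(2)] by force
  ultimately show ?thesis using that by force
qed

locale carpet_domain =
  fixes \<Omega> :: "complex set" and Q :: "nat \<Rightarrow> complex set" and ver :: version
  assumes carpet: "relative_sierpinski_carpet \<Omega> Q" and bdd: "bounded \<Omega>"
begin

abbreviation "S \<equiv> carpet \<Omega> Q"

lemma open_Omega: "open \<Omega>" and connected_Omega: "connected \<Omega>"
  and closure_Q_subset: "closure (Q i) \<subseteq> \<Omega>" and compact_closure_Q: "compact (closure (Q i))"
  and disjoint_closure_Q: "\<And>i j. i \<noteq> j \<Longrightarrow> closure (Q i) \<inter> closure (Q j) = {}"
  using carpet unfolding relative_sierpinski_carpet_def compactly_contained_def by auto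

lemma Q_jordan:
  obtains c where "simple_path c" "pathfinish c = pathstart c" "Q i = inside (path_image c)"
  using carpet unfolding relative_sierpinski_carpet_def jordan_region_def jordan_curve_def by blast

lemma open_Q: "open (Q i)" and connected_Q: "connected (Q i)" and Q_nonempty: "Q i \<noteq> {}"
  and connected_Compl_closure_Q: "connected (- closure (Q i))" and frontier_Q_nonempty: "frontier (Q i) \<noteq> {}"
proof -
  obtain c where c: "simple_path c" "pathfinish c = pathstart c" "Q i = inside (path_image c)" by (rule Q_jordan)
  note J = Jordan_inside_outside[OF c(1,2)]
  show "open (Q i)" "connected (Q i)" "Q i \<noteq> {}" using J c(3) by auto
  have f: "frontier (Q i) = path_image c" using J c(3) by auto
  then show "frontier (Q i) \<noteq> {}" by simp
  have "closure (Q i) = inside (path_image c) \<union> path_image c"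
    using f c(3) J closure_Un_frontier by metis
  then have "- closure (Q i) = outside (path_image c)"
    using inside_Un_outside[of "path_image c"] inside_Int_outside[of "path_image c"] outside_no_overlap[of "path_image c"]
    by blast
  then show "connected (- closure (Q i))" using J by simp
qed

lemma bounded_Q: "bounded (Q i)"
  by (meson compact_closure_Q closure_subset bounded_subset compact_imp_bounded)

lemma Q_subset: "Q i \<subseteq> \<Omega>" using closure_Q_subset closure_subset by blast

lemma frontier_Q_subset: "frontier (Q i) \<subseteq> S"
proof
  fix z assume z: "z \<in> frontier (Q i)"
  then have "z \<in> \<Omega>" using closure_Q_subset[of i] unfolding frontier_def by auto
  then show "z \<in> S" using frontier_not_in_union[of Q, OF open_Q disjoint_closure_Q z] unfolding carpet_def by blast
qed

lemma Q_disjoint: "z \<in> Q i \<Longrightarrow> z \<in> Q j \<Longrightarrow> i = j"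
  using disjoint_closure_Q[of i j] closure_subset by blast

lemma Q_not_S: "z \<in> Q i \<Longrightarrow> z \<notin> S" unfolding carpet_def by blast

lemma S_borel: "S \<in> sets borel" unfolding carpet_def using open_Omega open_Q by auto

lemma S_null: "emeasure lborel S = 0" using carpet unfolding relative_sierpinski_carpet_def by simp

lemma meeting_Omega: "meeting Q \<Omega> = UNIV" unfolding meeting_def using Q_nonempty Q_subset by blast

lemma fatness:
  "\<exists>K>0. \<forall>i. \<forall>x\<in>Q i. \<forall>r. 0 < r \<longrightarrow> r < diameter (Q i) \<longrightarrow>
    ennreal (K * r\<^sup>2) \<le> emeasure lborel (ball x r \<inter> Q i)"
  using carpet unfolding relative_sierpinski_carpet_def by blast

lemma diameter_Q_pos: "0 < diameter (Q i)"
proof -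
  obtain x where "x \<in> Q i" using Q_nonempty by blast
  then obtain e where e: "e > 0" "ball x e \<subseteq> Q i" using open_Q open_contains_ball by blast
  have "x + of_real (e/2) \<in> ball x e" using e by (simp add: dist_norm)
  then have "dist x (x + of_real (e/2)) \<le> diameter (Q i)"
    using e \<open>x \<in> Q i\<close> by (intro diameter_bounded_bound bounded_Q) auto
  then show ?thesis using e by (simp add: dist_norm)
qed

lemma emeasure_Omega: "emeasure lborel \<Omega> < \<infinity>"
  using emeasure_bounded_finite[OF bdd] by simp

lemma disjoint_family_Q: "disjoint_family Q"
  unfolding disjoint_family_on_def using Q_disjoint by blast

lemma sum_emeasure_Q_le:
  assumes "U \<in> sets borel" shows "(\<Sum>i. emeasure lborel (Q i \<inter> U)) \<le> emeasure lborel U"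
proof -
  have "(\<Sum>i. emeasure lborel (Q i \<inter> U)) = emeasure lborel (\<Union>i. Q i \<inter> U)"
    by (rule suminf_emeasure) (use open_Q assms disjoint_family_Q in \<open>auto simp: disjoint_family_on_def\<close>)
  also have "\<dots> \<le> emeasure lborel U" by (rule emeasure_mono) (use assms in auto)
  finally show ?thesis .
qed

text \<open>Fatness at radius \<open>diameter (Q i) / 2\<close> bounds the squared diameter by a
  multiple of the area of the disk, and the disks are disjoint subsets of a bounded domain.\<close>

lemma sum_diameter_finite: "(\<Sum>i. ennreal ((diameter (Q i))\<^sup>2)) < \<infinity>"
proof -
  obtain K where K: "K > 0"
    "\<And>i x r. x \<in> Q i \<Longrightarrow> 0 < r \<Longrightarrow> r < diameter (Q i) \<Longrightarrow> ennreal (K * r\<^sup>2) \<le> emeasure lborel (ball x r \<inter> Q i)"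
    using fatness by blast
  have *: "ennreal ((diameter (Q i))\<^sup>2) \<le> ennreal (4/K) * emeasure lborel (Q i \<inter> \<Omega>)" for i
  proof -
    obtain x where x: "x \<in> Q i" using Q_nonempty by blast
    have "ennreal (K * (diameter (Q i) / 2)\<^sup>2) \<le> emeasure lborel (ball x (diameter (Q i) / 2) \<inter> Q i)"
      using K(2)[OF x] diameter_Q_pos[of i] by simp
    also have "\<dots> \<le> emeasure lborel (Q i \<inter> \<Omega>)" using Q_subset open_Q open_Omega by (intro emeasure_mono) auto
    finally have "ennreal (4/K) * ennreal (K * (diameter (Q i) / 2)\<^sup>2) \<le> ennreal (4/K) * emeasure lborel (Q i \<inter> \<Omega>)"
      by (rule mult_left_mono) simp
    then show ?thesis using K by (simp add: power_divide flip: ennreal_mult)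
  qed
  have "(\<Sum>i. ennreal ((diameter (Q i))\<^sup>2)) \<le> (\<Sum>i. ennreal (4/K) * emeasure lborel (Q i \<inter> \<Omega>))"
    by (intro suminf_le summableI *)
  also have "\<dots> = ennreal (4/K) * (\<Sum>i. emeasure lborel (Q i \<inter> \<Omega>))" by simp
  also have "\<dots> \<le> ennreal (4/K) * emeasure lborel \<Omega>"
    by (intro mult_left_mono sum_emeasure_Q_le) (use open_Omega in auto)
  also have "\<dots> < \<infinity>" using emeasure_Omega by (simp add: ennreal_mult_less_top)
  finally show ?thesis .
qed

text \<open>Almost every path, in the modulus selected by \<open>ver\<close>. The rules below
  (monotonicity, countable conjunction, passage to subpaths) read the same for both moduli and hide
  the difference.\<close>

definition aep :: "(cpath \<Rightarrow> bool) \<Rightarrow> bool" where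
  "aep P \<longleftrightarrow> carpet_mod ver \<Omega> Q {\<gamma>\<in>paths_in \<Omega>. \<not> P \<gamma>} = 0"

lemma aep_mono: "aep P \<Longrightarrow> (\<And>\<gamma>. \<gamma> \<in> paths_in \<Omega> \<Longrightarrow> P \<gamma> \<Longrightarrow> R \<gamma>) \<Longrightarrow> aep R"
  unfolding aep_def by (rule carpet_mod_null_subset) auto

lemma aep_all_nat: "(\<And>n::nat. aep (P n)) \<Longrightarrow> aep (\<lambda>\<gamma>. \<forall>n. P n \<gamma>)"
proof -
  assume "\<And>n. aep (P n)"
  then have "carpet_mod ver \<Omega> Q (\<Union>n. {\<gamma>\<in>paths_in \<Omega>. \<not> P n \<gamma>}) = 0"
    unfolding aep_def by (rule carpet_mod_null_UN)
  then show ?thesis unfolding aep_def by (rule carpet_mod_null_subset) blast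
qed

lemma aep_conj: "aep P \<Longrightarrow> aep R \<Longrightarrow> aep (\<lambda>\<gamma>. P \<gamma> \<and> R \<gamma>)"
proof -
  assume a: "aep P" "aep R"
  have "aep (\<lambda>\<gamma>. \<forall>n. (if n = (0::nat) then P else R) \<gamma>)" by (rule aep_all_nat) (use a in auto)
  then show ?thesis by (rule aep_mono) (metis zero_neq_one)
qed

lemma aep_ex_iff:
  "(\<exists>\<Gamma>\<^sub>0\<subseteq>paths_in \<Omega>. carpet_mod ver \<Omega> Q \<Gamma>\<^sub>0 = 0 \<and> (\<forall>\<gamma>\<in>paths_in \<Omega> - \<Gamma>\<^sub>0. P \<gamma>)) \<longleftrightarrow> aep P"
proof
  assume "\<exists>\<Gamma>\<^sub>0\<subseteq>paths_in \<Omega>. carpet_mod ver \<Omega> Q \<Gamma>\<^sub>0 = 0 \<and> (\<forall>\<gamma>\<in>paths_in \<Omega> - \<Gamma>\<^sub>0. P \<gamma>)"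
  then obtain \<Gamma>0 where G: "carpet_mod ver \<Omega> Q \<Gamma>0 = 0" "\<forall>\<gamma>\<in>paths_in \<Omega> - \<Gamma>0. P \<gamma>" by blast
  show "aep P" unfolding aep_def by (rule carpet_mod_null_subset[OF G(1)]) (use G(2) in auto)
next
  assume "aep P"
  then show "\<exists>\<Gamma>\<^sub>0\<subseteq>paths_in \<Omega>. carpet_mod ver \<Omega> Q \<Gamma>\<^sub>0 = 0 \<and> (\<forall>\<gamma>\<in>paths_in \<Omega> - \<Gamma>\<^sub>0. P \<gamma>)"
    unfolding aep_def by (intro exI[of _ "{\<gamma>\<in>paths_in \<Omega>. \<not> P \<gamma>}"]) auto
qed

lemma aep_subpaths:
  assumes "aep P"
  shows "aep (\<lambda>\<gamma>. \<forall>J\<subseteq>fst \<gamma>. (J, snd \<gamma>) \<in> paths_in \<Omega> \<longrightarrow> P (J, snd \<gamma>))"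
  unfolding aep_def
  by (rule carpet_mod_null_superpaths[OF assms[unfolded aep_def]]) blast

lemma aep_sum_finite:
  assumes "(\<Sum>i. (\<sigma> i)\<^sup>2) < \<infinity>"
  shows "aep (\<lambda>\<gamma>. sum_over (meeting Q (path_trace \<gamma>)) \<sigma> < \<infinity>)"
  unfolding aep_def by (rule carpet_mod_null_sum_infinite[OF assms]) (simp add: not_less top_unique)

text \<open>For the strong modulus nothing is demanded of the other paths, so the zero sequence is
  admissible for them. For the weak modulus they have vanishing 2-modulus because the carpet has
  measure zero.\<close>

lemma aep_hausdorff: "aep (\<lambda>\<gamma>. hausdorff_measure 1 (path_trace \<gamma> \<inter> S) = 0)"
proof (cases ver)
  case Weak
  have "mod2 {\<gamma>\<in>paths_in \<Omega>. hausdorff_measure 1 (path_trace \<gamma> \<inter> S) \<noteq> 0} = 0"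
    by (rule mod2_null_carpet_paths[OF S_borel S_null]) (auto simp: paths_in_def)
  then show ?thesis unfolding aep_def by (subst Weak) (simp only: carpet_mod.simps weak_mod_null_if_mod2_null)
next
  case Strong
  have "strong_mod \<Omega> Q {\<gamma>\<in>paths_in \<Omega>. hausdorff_measure 1 (path_trace \<gamma> \<inter> S) \<noteq> 0} \<le> (\<Sum>i. (0::ennreal)\<^sup>2)"
    by (rule strong_modI) auto
  then have "strong_mod \<Omega> Q {\<gamma>\<in>paths_in \<Omega>. hausdorff_measure 1 (path_trace \<gamma> \<inter> S) \<noteq> 0} = 0" by simp
  then show ?thesis unfolding aep_def by (subst Strong) (simp only: carpet_mod.simps)
qed

text \<open>A common certificate of nullity: the weak version needs the weight \<open>w\<close> to
  dispose of its exceptional family, the strong version takes \<open>w = 0\<close>.\<close>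

lemma null_small:
  assumes null: "carpet_mod ver \<Omega> Q \<Gamma> = 0" and e: "0 < (e::real)"
  obtains \<rho> w where "w \<in> borel_measurable borel" "(\<Sum>i. (\<rho> i)\<^sup>2) \<le> ennreal e" "(\<integral>\<^sup>+z. (w z)\<^sup>2 \<partial>lborel) \<le> ennreal e"
    "\<And>\<gamma>. \<gamma> \<in> \<Gamma> \<Longrightarrow> hausdorff_measure 1 (path_trace \<gamma> \<inter> S) = 0 \<Longrightarrow>
      1 \<le> sum_over (meeting Q (path_trace \<gamma>)) \<rho> \<or> 1 \<le> line_integral w \<gamma>"
proof (cases ver)
  case Weak
  have "weak_mod Q \<Gamma> < ennreal e" using null Weak e by simp
  then obtain \<rho> \<Gamma>0 where r: "\<Gamma>0 \<subseteq> \<Gamma>" "mod2 \<Gamma>0 = 0" "(\<Sum>i. (\<rho> i)\<^sup>2) < ennreal e"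
    "\<And>\<gamma>. \<gamma> \<in> \<Gamma> - \<Gamma>0 \<Longrightarrow> 1 \<le> sum_over (meeting Q (path_trace \<gamma>)) \<rho>" by (rule weak_mod_lessE) blast
  have "mod2 \<Gamma>0 < ennreal e" using r(2) e by simp
  then obtain w where w: "w \<in> borel_measurable borel" "\<And>\<gamma>. \<gamma> \<in> \<Gamma>0 \<Longrightarrow> 1 \<le> line_integral w \<gamma>"
    "(\<integral>\<^sup>+z. (w z)\<^sup>2 \<partial>lborel) < ennreal e" by (rule mod2_lessE) blast
  show ?thesis by (rule that[OF w(1) less_imp_le[OF r(3)] less_imp_le[OF w(3)]]) (use r(4) w(2) in blast)
next
  case Strong
  have "strong_mod \<Omega> Q \<Gamma> < ennreal e" using null Strong e by simp
  then obtain \<rho> where r: "(\<Sum>i. (\<rho> i)\<^sup>2) < ennreal e"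
    "\<And>\<gamma>. \<gamma> \<in> \<Gamma> \<Longrightarrow> hausdorff_measure 1 (path_trace \<gamma> \<inter> S) = 0 \<Longrightarrow> 1 \<le> sum_over (meeting Q (path_trace \<gamma>)) \<rho>"
    by (rule strong_mod_lessE) blast
  show ?thesis by (rule that[of "\<lambda>_. 0", OF _ less_imp_le[OF r(1)]]) (use r(2) in auto)
qed

text \<open>The lines \<open>c x\<close> are the fibres of \<open>\<pi>\<close>. Certify that the
  bad paths are null by \<open>\<rho>\<close> and \<open>w\<close> of energy at most
  \<open>1 / (n + 1)^2\<close>. Then every bad segment on the fibre over \<open>x\<close> forces
  \<open>F n x \<ge> 1\<close>, where \<open>F n x\<close> depends on the whole fibre and not on the
  segment. The integral of \<open>F n\<close> is of order \<open>1 / (n + 1)\<close>, so almost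
  every fibre carries no bad segment at all.\<close>

lemma aep_lines:
  fixes c :: "real \<Rightarrow> real \<Rightarrow> complex"
  assumes P: "aep P"
    and iso: "\<And>x y y'. dist (c x y) (c x y') = \<bar>y - y'\<bar>"
    and fub: "\<And>w. w \<in> borel_measurable borel \<Longrightarrow> (\<integral>\<^sup>+z. w z \<partial>lborel) = (\<integral>\<^sup>+x. \<integral>\<^sup>+y. w (c x y) \<partial>lborel \<partial>lborel)"
    and cm [measurable]: "(\<lambda>p. c (fst p) (snd p)) \<in> borel_measurable (lborel \<Otimes>\<^sub>M lborel)"
    and \<pi>: "\<And>x y. \<pi> (c x y) = x" "\<And>z z'. \<bar>\<pi> z - \<pi> z'\<bar> \<le> dist z z'"
  shows "AE x in lborel. \<forall>I. (I, c x) \<in> paths_in \<Omega> \<longrightarrow> P (I, c x)"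
proof -
  define \<Gamma> where "\<Gamma> = {\<gamma>\<in>paths_in \<Omega>. \<not> P \<gamma>}"
  have null: "carpet_mod ver \<Omega> Q \<Gamma> = 0" using P unfolding aep_def \<Gamma>_def .
  have cxm [measurable]: "c x \<in> borel_measurable borel" for x
    using measurable_compose[of "\<lambda>y. (x, y)" lborel "lborel \<Otimes>\<^sub>M lborel", OF _ cm] by simp
  have [measurable]: "\<Omega> \<in> sets borel" using open_Omega by simp
  have AE_H: "AE x in lborel. \<forall>I. hausdorff_measure 1 (c x ` I \<inter> S) = 0"
  proof -
    note [measurable] = S_borel
    have "(\<integral>\<^sup>+x. \<integral>\<^sup>+y. indicator S (c x y) \<partial>lborel \<partial>lborel) = (\<integral>\<^sup>+z. indicator S z \<partial>lborel)"
      by (rule fub[symmetric]) simp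
    also have "\<dots> = 0" using S_null S_borel by simp
    finally have "AE x in lborel. (\<integral>\<^sup>+y. indicator S (c x y) \<partial>lborel) = 0"
      by (subst (asm) nn_integral_0_iff_AE) measurable
    then show ?thesis
    proof (rule AE_mp, intro AE_I2 impI allI)
      fix x I assume "(\<integral>\<^sup>+y. indicator S (c x y) \<partial>lborel) = 0"
      moreover have "(\<integral>\<^sup>+y. indicator S (c x y) \<partial>lborel) = emeasure lborel (c x -` S)"
      proof -
        have "(\<integral>\<^sup>+y. indicator S (c x y) \<partial>lborel) = (\<integral>\<^sup>+y. indicator (c x -` S) y \<partial>lborel)"
          by (rule nn_integral_cong) (simp add: indicator_def)
        also have "\<dots> = emeasure lborel (c x -` S)"
          by (rule nn_integral_indicator) (use measurable_sets[OF cxm S_borel, of x] in simp)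
        finally show ?thesis .
      qed
      ultimately have "c x -` S \<in> null_sets lborel" using measurable_sets[OF cxm S_borel, of x] by auto
      then have "hausdorff_measure 1 (c x ` (c x -` S)) = 0"
        by (rule hausdorff1_null_lipschitz_image) (simp add: iso dist_real_def)
      then show "hausdorff_measure 1 (c x ` I \<inter> S) = 0" by (rule hausdorff1_null_subset) blast
    qed
  qed
  have "\<exists>l u. \<pi> ` Q i \<subseteq> {l..u} \<and> u - l \<le> diameter (Q i)" for i
    using lipschitz_image_in_interval[OF bounded_Q Q_nonempty \<pi>(2)] by metis
  then obtain l u where lu: "\<And>i. \<pi> ` Q i \<subseteq> {l i..u i}" "\<And>i. u i - l i \<le> diameter (Q i)" by metis
  have "\<exists>\<rho> w. w \<in> borel_measurable borel \<and> (\<Sum>i. (\<rho> i)\<^sup>2) \<le> ennreal (1 / (real n + 1)\<^sup>2) \<and>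
     (\<integral>\<^sup>+z. (w z)\<^sup>2 \<partial>lborel) \<le> ennreal (1 / (real n + 1)\<^sup>2) \<and>
    (\<forall>\<gamma>. \<gamma> \<in> \<Gamma> \<longrightarrow> hausdorff_measure 1 (path_trace \<gamma> \<inter> S) = 0 \<longrightarrow>
      1 \<le> sum_over (meeting Q (path_trace \<gamma>)) \<rho> \<or> 1 \<le> line_integral w \<gamma>)" for n :: nat
    using null_small[OF null, of "1 / (real n + 1)\<^sup>2"] by (metis of_nat_0_le_iff add_nonneg_pos zero_less_divide_1_iff zero_less_one zero_less_power)
  then obtain \<rho> w where rw: "\<And>n::nat. w n \<in> borel_measurable borel" "\<And>n. (\<Sum>i. (\<rho> n i)\<^sup>2) \<le> ennreal (1 / (real n + 1)\<^sup>2)"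
    "\<And>n. (\<integral>\<^sup>+z. (w n z)\<^sup>2 \<partial>lborel) \<le> ennreal (1 / (real n + 1)\<^sup>2)"
    "\<And>n \<gamma>. \<gamma> \<in> \<Gamma> \<Longrightarrow> hausdorff_measure 1 (path_trace \<gamma> \<inter> S) = 0 \<Longrightarrow>
      1 \<le> sum_over (meeting Q (path_trace \<gamma>)) (\<rho> n) \<or> 1 \<le> line_integral (w n) \<gamma>" by metis
  note [measurable] = rw(1)
  \<comment> \<open>The sum runs over all disks whose projection interval contains \<open>x\<close>,
    in particular over every disk that the line meets.\<close>
  define F where "F n x = (\<Sum>i. \<rho> n i * indicator {l i..u i} x) + (\<integral>\<^sup>+y. w n (c x y) * indicator \<Omega> (c x y) \<partial>lborel)" for n x
  have Fm [measurable]: "F n \<in> borel_measurable borel" for n unfolding F_def by measurable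
  obtain C where C: "C \<ge> 0" "(\<Sum>i. ennreal ((diameter (Q i))\<^sup>2)) + emeasure lborel \<Omega> = ennreal C"
    using sum_diameter_finite emeasure_Omega by (metis ennreal_cases ennreal_add_eq_top infinity_ennreal_def less_irrefl)
  have IF: "(\<integral>\<^sup>+x. F n x \<partial>lborel) \<le> ennreal ((2 + C) / (real n + 1))" for n
  proof -
    \<comment> \<open>Young's inequality with weight \<open>n + 1\<close> balances energies of order
      \<open>1 / (n + 1)^2\<close> against the fixed sum of squared diameters and the fixed area of
      the domain.\<close>
    define k where "k = real n + 1"
    have k: "k > 0" unfolding k_def by simp
    have kk: "ennreal k * ennreal (1 / k\<^sup>2) = ennreal (1/k)"
      using k by (simp add: power2_eq_square flip: ennreal_mult)
    let ?D = "\<Sum>i. ennreal ((diameter (Q i))\<^sup>2)"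
    have "(\<integral>\<^sup>+x. (\<Sum>i. \<rho> n i * indicator {l i..u i} x) \<partial>lborel) = (\<Sum>i. \<rho> n i * emeasure lborel {l i..u i})"
      by (subst nn_integral_suminf) (simp_all add: nn_integral_cmult_indicator)
    also have "\<dots> \<le> (\<Sum>i. ennreal k * (\<rho> n i)\<^sup>2 + ennreal (1/k) * ennreal ((diameter (Q i))\<^sup>2))"
    proof (intro suminf_le summableI)
      fix i
      have "emeasure lborel {l i..u i} \<le> ennreal (diameter (Q i))"
        using lu(2)[of i] by (auto simp: emeasure_lborel_Icc_eq intro!: ennreal_leI)
      then have "\<rho> n i * emeasure lborel {l i..u i} \<le> \<rho> n i * ennreal (diameter (Q i))" by (rule mult_left_mono) simp
      also have "\<dots> \<le> ennreal k * (\<rho> n i)\<^sup>2 + ennreal (1/k) * (ennreal (diameter (Q i)))\<^sup>2" by (rule ennreal_mult_le_squares[OF k])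
      finally show "\<rho> n i * emeasure lborel {l i..u i} \<le> ennreal k * (\<rho> n i)\<^sup>2 + ennreal (1/k) * ennreal ((diameter (Q i))\<^sup>2)"
        using diameter_Q_pos[of i] by (simp add: ennreal_power)
    qed
    also have "\<dots> = ennreal k * (\<Sum>i. (\<rho> n i)\<^sup>2) + ennreal (1/k) * ?D"
      by (subst suminf_add[symmetric]) simp_all
    also have "\<dots> \<le> ennreal (1/k) + ennreal (1/k) * ?D"
      using mult_left_mono[OF rw(2)[of n], of "ennreal k"] kk unfolding k_def by (intro add_right_mono) simp
    finally have p1: "(\<integral>\<^sup>+x. (\<Sum>i. \<rho> n i * indicator {l i..u i} x) \<partial>lborel) \<le> ennreal (1/k) + ennreal (1/k) * ?D" .
    have "(\<integral>\<^sup>+x. \<integral>\<^sup>+y. w n (c x y) * indicator \<Omega> (c x y) \<partial>lborel \<partial>lborel) = (\<integral>\<^sup>+z. w n z * indicator \<Omega> z \<partial>lborel)"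
      by (rule fub[symmetric]) measurable
    also have "\<dots> \<le> (\<integral>\<^sup>+z. ennreal k * (w n z)\<^sup>2 + ennreal (1/k) * indicator \<Omega> z \<partial>lborel)"
    proof (rule nn_integral_mono)
      fix z show "w n z * indicator \<Omega> z \<le> ennreal k * (w n z)\<^sup>2 + ennreal (1/k) * indicator \<Omega> z"
        using ennreal_mult_le_squares[OF k, of "w n z" 1] by (auto simp: indicator_def)
    qed
    also have "\<dots> = ennreal k * (\<integral>\<^sup>+z. (w n z)\<^sup>2 \<partial>lborel) + ennreal (1/k) * emeasure lborel \<Omega>"
      by (subst nn_integral_add) (simp_all add: nn_integral_cmult nn_integral_cmult_indicator)
    also have "\<dots> \<le> ennreal (1/k) + ennreal (1/k) * emeasure lborel \<Omega>"
      using mult_left_mono[OF rw(3)[of n], of "ennreal k"] kk unfolding k_def by (intro add_right_mono) simp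
    finally have p2: "(\<integral>\<^sup>+x. \<integral>\<^sup>+y. w n (c x y) * indicator \<Omega> (c x y) \<partial>lborel \<partial>lborel) \<le> ennreal (1/k) + ennreal (1/k) * emeasure lborel \<Omega>" .
    have "(\<integral>\<^sup>+x. F n x \<partial>lborel) = (\<integral>\<^sup>+x. (\<Sum>i. \<rho> n i * indicator {l i..u i} x) \<partial>lborel) + (\<integral>\<^sup>+x. \<integral>\<^sup>+y. w n (c x y) * indicator \<Omega> (c x y) \<partial>lborel \<partial>lborel)"
      unfolding F_def by (rule nn_integral_add) measurable
    also have "\<dots> \<le> ennreal (1/k) + ennreal (1/k) * ?D + (ennreal (1/k) + ennreal (1/k) * emeasure lborel \<Omega>)"
      using p1 p2 by (rule add_mono)
    also have "\<dots> = ennreal (1/k) * (2 + (?D + emeasure lborel \<Omega>))"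
      by (simp add: distrib_left distrib_right ac_simps flip: one_add_one)
    also have "\<dots> = ennreal (1/k) * ennreal (2 + C)"
      using C by (metis ennreal_numeral ennreal_plus zero_le_numeral)
    also have "\<dots> = ennreal ((2 + C) / k)" using k C by (subst ennreal_mult[symmetric]) auto
    finally show ?thesis unfolding k_def .
  qed
  define Z where "Z = {x. \<forall>n. 1 \<le> F n x}"
  have Zm: "Z \<in> sets lborel" unfolding Z_def by measurable
  have "emeasure lborel Z \<le> 0"
  proof (rule ennreal_le_epsilon)
    fix e :: real assume e: "e > 0"
    obtain n :: nat where n: "(2 + C) / e < real n" using reals_Archimedean2 by blast
    have "emeasure lborel Z = (\<integral>\<^sup>+x. indicator Z x \<partial>lborel)" using Zm by simp
    also have "\<dots> \<le> (\<integral>\<^sup>+x. F n x \<partial>lborel)" by (rule nn_integral_mono) (auto simp: indicator_def Z_def)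
    also have "\<dots> \<le> ennreal ((2 + C) / (real n + 1))" by (rule IF)
    also have "\<dots> \<le> ennreal e"
    proof (rule ennreal_leI)
      have "2 + C \<le> e * (real n + 1)" using n e by (simp add: field_simps)
      then show "(2 + C) / (real n + 1) \<le> e" by (simp add: divide_le_eq)
    qed
    finally show "emeasure lborel Z \<le> 0 + ennreal e" by simp
  qed
  then have "Z \<in> null_sets lborel" using Zm by auto
  then have "AE x in lborel. x \<notin> Z" by (rule AE_not_in)
  with AE_H show ?thesis
  proof eventually_elim
    case (elim x)
    show ?case
    proof (intro allI impI, rule ccontr)
      fix I assume I: "(I, c x) \<in> paths_in \<Omega>" "\<not> P (I, c x)"
      then have G: "(I, c x) \<in> \<Gamma>" unfolding \<Gamma>_def by blast
      have tr: "path_trace (I, c x) = c x ` I" unfolding path_trace_def by simp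
      have sub: "c x ` I \<subseteq> \<Omega>" using I unfolding paths_in_def path_trace_def by simp
      have "1 \<le> F n x" for n
      proof -
        have H: "hausdorff_measure 1 (path_trace (I, c x) \<inter> S) = 0" unfolding tr using elim(1) by blast
        consider "1 \<le> sum_over (meeting Q (path_trace (I, c x))) (\<rho> n)" | "1 \<le> line_integral (w n) (I, c x)"
          using rw(4)[OF G H] by blast
        then show ?thesis
        proof cases
          case 1
          also have "sum_over (meeting Q (path_trace (I, c x))) (\<rho> n) \<le> (\<Sum>i. \<rho> n i * indicator {l i..u i} x)"
            unfolding sum_over_def tr
          proof (intro suminf_le summableI)
            fix i
            have "x \<in> {l i..u i}" if iI: "i \<in> meeting Q (c x ` I)"
            proof -
              obtain y where "c x y \<in> Q i" using iI unfolding meeting_def by blast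
              then have "\<pi> (c x y) \<in> {l i..u i}" using lu(1) by blast
              then show ?thesis using \<pi>(1) by simp
            qed
            then show "(if i \<in> meeting Q (c x ` I) then \<rho> n i else 0) \<le> \<rho> n i * indicator {l i..u i} x" by auto
          qed
          also have "\<dots> \<le> F n x" unfolding F_def by simp
          finally show ?thesis .
        next
          case 2
          also have "line_integral (w n) (I, c x) \<le> (\<integral>\<^sup>+y. w n (c x y) * indicator \<Omega> (c x y) \<partial>lborel)"
            by (rule line_integral_isometric_le[OF iso]) (use sub in measurable)
          also have "\<dots> \<le> F n x" unfolding F_def by simp
          finally show ?thesis .
        qed
      qed
      then show False using elim(2) unfolding Z_def by blast
    qed
  qed
qed

lemma aep_vertical:
  assumes "aep P" shows "AE x in lborel. \<forall>I. (I, \<lambda>y. Complex x y) \<in> paths_in \<Omega> \<longrightarrow> P (I, \<lambda>y. Complex x y)"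
proof (rule aep_lines[OF assms, where \<pi> = Re])
  show "\<bar>Re z - Re z'\<bar> \<le> dist z z'" for z z' using abs_Re_le_cmod[of "z - z'"] by (simp add: dist_norm)
qed (simp_all add: nn_integral_complex(1) dist_norm cmod_def)

lemma aep_horizontal:
  assumes "aep P" shows "AE y in lborel. \<forall>I. (I, \<lambda>x. Complex x y) \<in> paths_in \<Omega> \<longrightarrow> P (I, \<lambda>x. Complex x y)"
proof (rule aep_lines[OF assms, where \<pi> = Im])
  show "\<bar>Im z - Im z'\<bar> \<le> dist z z'" for z z' using abs_Im_le_cmod[of "z - z'"] by (simp add: dist_norm)
qed (simp_all add: nn_integral_complex(2) dist_norm cmod_def)

end

section \<open>Upper gradients and Sobolev functions\<close>

lemma sum_finite_iff:
  fixes f :: "nat \<Rightarrow> real"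
  assumes "\<And>i. f i \<ge> 0" shows "(\<Sum>i. ennreal (f i)) < \<infinity> \<longleftrightarrow> summable f"
proof
  assume "(\<Sum>i. ennreal (f i)) < \<infinity>"
  then have "(\<Sum>i. ennreal (f i)) \<noteq> top" by simp
  then show "summable f" using summable_suminf_not_top assms by blast
next
  assume "summable f"
  then have "(\<Sum>i. ennreal (f i)) = ennreal (suminf f)" using assms by (intro suminf_ennreal2)
  then show "(\<Sum>i. ennreal (f i)) < \<infinity>" by simp
qed

declare abs_real_of_ereal [simp del]

abbreviation val :: "(complex \<Rightarrow> ereal) \<Rightarrow> complex \<Rightarrow> real" where
  "val g x \<equiv> real_of_ereal (g x)"

lemma (in carpet_domain) subpath_in:
  assumes "\<gamma> \<in> paths_in \<Omega>" "J \<subseteq> fst \<gamma>" "is_interval J" "s \<in> J" "t \<in> J" "snd \<gamma> s \<noteq> snd \<gamma> t"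
  shows "(J, snd \<gamma>) \<in> paths_in \<Omega>"
proof -
  obtain h where h: "continuous_on (closure (fst \<gamma>)) h" "\<forall>t\<in>fst \<gamma>. h t = snd \<gamma> t"
    and b: "bounded (fst \<gamma>)" and tr: "path_trace \<gamma> \<subseteq> \<Omega>"
    using assms(1) unfolding paths_in_def is_path_def by blast
  have "continuous_on (closure J) h" using h(1) closure_mono[OF assms(2)] continuous_on_subset by blast
  moreover have "bounded J" using b assms(2) bounded_subset by blast
  moreover have "\<forall>t\<in>J. h t = snd \<gamma> t" using h(2) assms(2) by blast
  moreover have "snd \<gamma> ` J \<subseteq> \<Omega>" using tr assms(2) unfolding path_trace_def by blast
  ultimately show ?thesis unfolding paths_in_def is_path_def path_trace_def using assms by auto
qed

context carpet_domain
begin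

text \<open>With \<open>\<sigma> = osc Q g\<close> these are the good paths of the boundary value
  theory. The free \<open>\<sigma>\<close> serves sequences of functions, whose members share one
  gradient that dominates all their oscillations.\<close>

definition nice :: "(nat \<Rightarrow> ennreal) \<Rightarrow> (complex \<Rightarrow> ereal) \<Rightarrow> cpath \<Rightarrow> bool" where
  "nice \<sigma> g \<gamma> \<longleftrightarrow> \<gamma> \<in> paths_in \<Omega> \<and> hausdorff_measure 1 (path_trace \<gamma> \<inter> S) = 0 \<and>
     (\<forall>J\<subseteq>fst \<gamma>. is_interval J \<longrightarrow> gradient_ineq \<Omega> Q \<sigma> g (snd \<gamma> ` J)) \<and>
     sum_over (meeting Q (path_trace \<gamma>)) \<sigma> < \<infinity>"

lemma good_path_iff: "good_path \<Omega> Q g \<gamma> \<longleftrightarrow> nice (osc Q g) g \<gamma>"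
  unfolding good_path_def nice_def ..

lemma upper_gradient_iff:
  "upper_gradient ver \<Omega> Q \<sigma> g \<longleftrightarrow> aep (\<lambda>\<gamma>. gradient_ineq \<Omega> Q \<sigma> g (path_trace \<gamma>))"
  unfolding upper_gradient_def by (rule aep_ex_iff)

lemma gradient_ineqD:
  assumes "gradient_ineq \<Omega> Q \<sigma> g A" "x \<in> A \<inter> S" "y \<in> A \<inter> S"
  shows "\<bar>g x\<bar> \<noteq> \<infinity>" "\<bar>g y\<bar> \<noteq> \<infinity>" "e2ennreal \<bar>g x - g y\<bar> \<le> sum_over (meeting Q A) \<sigma>"
  using assms(1)[unfolded gradient_ineq_def, rule_format, OF assms(2,3)] by simp_all

lemma e2ennreal_abs_diff:
  assumes "\<bar>a\<bar> \<noteq> \<infinity>" "\<bar>b\<bar> \<noteq> \<infinity>"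
  shows "e2ennreal \<bar>a - b\<bar> = ennreal \<bar>real_of_ereal a - real_of_ereal b\<bar>"
  using assms by (cases a; cases b) (auto simp: ennreal.rep_eq e2ennreal_ereal)

lemma aep_nice:
  assumes "upper_gradient ver \<Omega> Q \<sigma> g" "(\<Sum>i. (\<sigma> i)\<^sup>2) < \<infinity>"
  shows "aep (nice \<sigma> g)"
proof -
  let ?P = "\<lambda>\<gamma>. gradient_ineq \<Omega> Q \<sigma> g (path_trace \<gamma>)"
  have P: "aep ?P" using assms(1) upper_gradient_iff by simp
  have "aep (\<lambda>\<gamma>. (?P \<gamma> \<and> (\<forall>J\<subseteq>fst \<gamma>. (J, snd \<gamma>) \<in> paths_in \<Omega> \<longrightarrow> ?P (J, snd \<gamma>))) \<and>
      (hausdorff_measure 1 (path_trace \<gamma> \<inter> S) = 0 \<and> sum_over (meeting Q (path_trace \<gamma>)) \<sigma> < \<infinity>))"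
    by (intro aep_conj P aep_subpaths[OF P] aep_hausdorff aep_sum_finite[OF assms(2)])
  then show ?thesis
  proof (rule aep_mono)
    fix \<gamma> assume g: "\<gamma> \<in> paths_in \<Omega>" and A: "(?P \<gamma> \<and> (\<forall>J\<subseteq>fst \<gamma>. (J, snd \<gamma>) \<in> paths_in \<Omega> \<longrightarrow> ?P (J, snd \<gamma>))) \<and>
      (hausdorff_measure 1 (path_trace \<gamma> \<inter> S) = 0 \<and> sum_over (meeting Q (path_trace \<gamma>)) \<sigma> < \<infinity>)"
    have "gradient_ineq \<Omega> Q \<sigma> g (snd \<gamma> ` J)" if J: "J \<subseteq> fst \<gamma>" "is_interval J" for J
    proof (cases "\<exists>s\<in>J. \<exists>t\<in>J. snd \<gamma> s \<noteq> snd \<gamma> t")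
      case True
      then have "(J, snd \<gamma>) \<in> paths_in \<Omega>" using subpath_in[OF g J] by blast
      then have "?P (J, snd \<gamma>)" using A J by blast
      then show ?thesis unfolding path_trace_def by simp
    next
      \<comment> \<open>A constant restriction is not a path, so the null family says nothing about
        it. The inequality is trivial there, and finiteness comes from the inequality along the
        whole of \<open>\<gamma>\<close>.\<close>
      case False
      show ?thesis unfolding gradient_ineq_def
      proof (intro ballI)
        fix x y assume xy: "x \<in> snd \<gamma> ` J \<inter> S" "y \<in> snd \<gamma> ` J \<inter> S"
        then have "x = y" using False by blast
        moreover have x: "x \<in> path_trace \<gamma> \<inter> S" using xy J(1) unfolding path_trace_def by blast
        moreover have "gradient_ineq \<Omega> Q \<sigma> g (path_trace \<gamma>)" using A by blast
        ultimately have "\<bar>g x\<bar> \<noteq> \<infinity>" "x = y" using gradient_ineqD(1)[OF _ x x] by simp_all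
        then show "\<bar>g x\<bar> \<noteq> \<infinity> \<and> \<bar>g y\<bar> \<noteq> \<infinity> \<and> e2ennreal \<bar>g x - g y\<bar> \<le> sum_over (meeting Q (snd \<gamma> ` J)) \<sigma>"
          by (simp add: e2ennreal_neg)
      qed
    qed
    then show "nice \<sigma> g \<gamma>" unfolding nice_def using A g by blast
  qed
qed

lemma nice_finite:
  assumes n: "nice \<sigma> g \<gamma>" and t: "t \<in> fst \<gamma>" "snd \<gamma> t \<in> S"
  shows "\<bar>g (snd \<gamma> t)\<bar> \<noteq> \<infinity>"
proof -
  have "is_interval (fst \<gamma>)" using n unfolding nice_def paths_in_def is_path_def by blast
  then have "gradient_ineq \<Omega> Q \<sigma> g (snd \<gamma> ` fst \<gamma>)" using n unfolding nice_def by blast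
  moreover have "snd \<gamma> t \<in> snd \<gamma> ` fst \<gamma> \<inter> S" using t by blast
  ultimately show ?thesis using gradient_ineqD(1) by simp
qed

lemma nice_interval:
  assumes n: "nice \<sigma> g \<gamma>" and J: "J \<subseteq> fst \<gamma>" "is_interval J" "s \<in> J" "t \<in> J" "snd \<gamma> s \<in> S" "snd \<gamma> t \<in> S"
  shows "ennreal \<bar>val g (snd \<gamma> s) - val g (snd \<gamma> t)\<bar> \<le> sum_over (meeting Q (snd \<gamma> ` J)) \<sigma>"
proof -
  have "gradient_ineq \<Omega> Q \<sigma> g (snd \<gamma> ` J)" using n J unfolding nice_def by blast
  then have "\<bar>g (snd \<gamma> s)\<bar> \<noteq> \<infinity>" "\<bar>g (snd \<gamma> t)\<bar> \<noteq> \<infinity>"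
    "e2ennreal \<bar>g (snd \<gamma> s) - g (snd \<gamma> t)\<bar> \<le> sum_over (meeting Q (snd \<gamma> ` J)) \<sigma>"
    using gradient_ineqD[of \<sigma> g "snd \<gamma> ` J" "snd \<gamma> s" "snd \<gamma> t"] J by simp_all
  then show ?thesis by (simp add: e2ennreal_abs_diff)
qed

lemma path_interval: "\<gamma> \<in> paths_in \<Omega> \<Longrightarrow> is_interval (fst \<gamma>)"
  unfolding paths_in_def is_path_def by blast

lemma path_continuous: "\<gamma> \<in> paths_in \<Omega> \<Longrightarrow> continuous_on (fst \<gamma>) (snd \<gamma>)"
  unfolding paths_in_def using is_path_continuous by blast

lemma path_range: "\<gamma> \<in> paths_in \<Omega> \<Longrightarrow> t \<in> fst \<gamma> \<Longrightarrow> snd \<gamma> t \<in> \<Omega>"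
  unfolding paths_in_def path_trace_def by blast

lemma interval_segment: "is_interval I \<Longrightarrow> s \<in> I \<Longrightarrow> t \<in> I \<Longrightarrow> closed_segment s t \<subseteq> (I::real set)"
  using closed_segment_subset is_interval_convex by blast

lemma nice_segment:
  assumes n: "nice \<sigma> g \<gamma>" and J: "s \<in> fst \<gamma>" "t \<in> fst \<gamma>" "snd \<gamma> s \<in> S" "snd \<gamma> t \<in> S"
  shows "ennreal \<bar>val g (snd \<gamma> s) - val g (snd \<gamma> t)\<bar> \<le> sum_over (meeting Q (snd \<gamma> ` closed_segment s t)) \<sigma>"
proof (rule nice_interval[OF n])
  show "closed_segment s t \<subseteq> fst \<gamma>"
    using interval_segment[OF path_interval] n J unfolding nice_def by blast
  show "is_interval (closed_segment s t)" by (simp add: is_interval_convex_1)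
qed (use J in auto)

lemma S_iff: "z \<in> \<Omega> \<Longrightarrow> z \<in> S \<longleftrightarrow> z \<notin> (\<Union>i. Q i)" unfolding carpet_def by blast

section \<open>Suprema, infima and oscillations over peripheral circles as real numbers\<close>

abbreviation rM :: "(complex \<Rightarrow> ereal) \<Rightarrow> nat \<Rightarrow> real" where "rM g i \<equiv> real_of_ereal (bdry_sup Q g i)"
abbreviation rm :: "(complex \<Rightarrow> ereal) \<Rightarrow> nat \<Rightarrow> real" where "rm g i \<equiv> real_of_ereal (bdry_inf Q g i)"
abbreviation ro :: "(complex \<Rightarrow> ereal) \<Rightarrow> nat \<Rightarrow> real" where "ro g i \<equiv> rM g i - rm g i"

definition fin :: "(complex \<Rightarrow> ereal) \<Rightarrow> bool" where
  "fin g \<longleftrightarrow> (\<forall>i. \<bar>bdry_sup Q g i\<bar> \<noteq> \<infinity> \<and> \<bar>bdry_inf Q g i\<bar> \<noteq> \<infinity>)"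

lemma fin_bounds:
  assumes "fin g" "x \<in> frontier (Q i)"
  shows "\<bar>g x\<bar> \<noteq> \<infinity>" "rm g i \<le> val g x" "val g x \<le> rM g i"
proof -
  have "bdry_inf Q g i \<le> g x" "g x \<le> bdry_sup Q g i"
    unfolding bdry_inf_def bdry_sup_def using assms by (auto intro: INF_lower SUP_upper)
  moreover have "\<bar>bdry_sup Q g i\<bar> \<noteq> \<infinity>" "\<bar>bdry_inf Q g i\<bar> \<noteq> \<infinity>" using assms unfolding fin_def by auto
  ultimately show "\<bar>g x\<bar> \<noteq> \<infinity>" "rm g i \<le> val g x" "val g x \<le> rM g i"
    by (cases "g x"; cases "bdry_inf Q g i"; cases "bdry_sup Q g i"; auto)+
qed

lemma frontier_point: obtains x where "x \<in> frontier (Q i)" using frontier_Q_nonempty by blast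

lemma ro_nonneg: "fin g \<Longrightarrow> 0 \<le> ro g i"
  using fin_bounds by (metis frontier_point diff_ge_0_iff_ge order_trans)

lemma osc_eq: "fin g \<Longrightarrow> osc Q g i = ennreal (ro g i)"
proof -
  assume "fin g"
  then have "\<bar>bdry_sup Q g i\<bar> \<noteq> \<infinity>" "\<bar>bdry_inf Q g i\<bar> \<noteq> \<infinity>" unfolding fin_def by auto
  then show ?thesis unfolding osc_def by (cases "bdry_inf Q g i"; cases "bdry_sup Q g i") (auto simp: e2ennreal_ereal)
qed

lemma rM_least: "fin g \<Longrightarrow> (\<And>x. x \<in> frontier (Q i) \<Longrightarrow> val g x \<le> c) \<Longrightarrow> rM g i \<le> c"
proof -
  assume f: "fin g" and c: "\<And>x. x \<in> frontier (Q i) \<Longrightarrow> val g x \<le> c"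
  have "bdry_sup Q g i \<le> ereal c" unfolding bdry_sup_def
  proof (rule SUP_least)
    fix x assume x: "x \<in> frontier (Q i)"
    show "g x \<le> ereal c" using fin_bounds(1)[OF f x] c[OF x] by (cases "g x") auto
  qed
  then show ?thesis using f[unfolded fin_def, rule_format, of i] by (cases "bdry_sup Q g i") auto
qed

lemma rm_greatest: "fin g \<Longrightarrow> (\<And>x. x \<in> frontier (Q i) \<Longrightarrow> c \<le> val g x) \<Longrightarrow> c \<le> rm g i"
proof -
  assume f: "fin g" and c: "\<And>x. x \<in> frontier (Q i) \<Longrightarrow> c \<le> val g x"
  have "ereal c \<le> bdry_inf Q g i" unfolding bdry_inf_def
  proof (rule INF_greatest)
    fix x assume x: "x \<in> frontier (Q i)"
    show "ereal c \<le> g x" using fin_bounds(1)[OF f x] c[OF x] by (cases "g x") auto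
  qed
  then show ?thesis using f unfolding fin_def by (metis abs_ereal.simps(1) ereal_less_eq(3) ereal_real)
qed

lemma ro_le:
  assumes f: "fin g" and d: "\<And>x y. x \<in> frontier (Q i) \<Longrightarrow> y \<in> frontier (Q i) \<Longrightarrow> val g x - val g y \<le> d"
  shows "ro g i \<le> d"
proof -
  have "rM g i \<le> d + val g y" if "y \<in> frontier (Q i)" for y
    by (rule rM_least[OF f]) (use d that in force)
  then have "rM g i - d \<le> rm g i" by (intro rm_greatest[OF f]) force
  then show ?thesis by simp
qed

lemma finI:
  assumes "\<And>i. \<exists>c d. \<forall>x\<in>frontier (Q i). ereal c \<le> g x \<and> g x \<le> ereal d"
  shows "fin g"
  unfolding fin_def
proof
  fix i
  obtain c d where cd: "\<forall>x\<in>frontier (Q i). ereal c \<le> g x \<and> g x \<le> ereal d" using assms by blast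
  obtain x where x: "x \<in> frontier (Q i)" by (rule frontier_point)
  have "ereal c \<le> bdry_inf Q g i" unfolding bdry_inf_def using cd by (intro INF_greatest) auto
  moreover have "bdry_inf Q g i \<le> g x" unfolding bdry_inf_def using x by (rule INF_lower)
  moreover have "g x \<le> bdry_sup Q g i" unfolding bdry_sup_def using x by (rule SUP_upper)
  moreover have "bdry_sup Q g i \<le> ereal d" unfolding bdry_sup_def using cd by (intro SUP_least) auto
  moreover have "g x \<le> ereal d" "ereal c \<le> g x" using cd x by auto
  ultimately show "\<bar>bdry_sup Q g i\<bar> \<noteq> \<infinity> \<and> \<bar>bdry_inf Q g i\<bar> \<noteq> \<infinity>"
    by (cases "g x"; cases "bdry_inf Q g i"; cases "bdry_sup Q g i"; auto)
qed

text \<open>By the covering bound, any square-summable upper gradient may be replaced by the oscillation,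
  even where it exceeds the given one.\<close>

lemma nice_imp_gradient_osc:
  assumes n: "nice \<sigma> g \<gamma>" and f: "fin g"
  shows "gradient_ineq \<Omega> Q (osc Q g) g (path_trace \<gamma>)"
proof -
  have g: "\<gamma> \<in> paths_in \<Omega>" using n unfolding nice_def by blast
  have *: "ennreal \<bar>val g (snd \<gamma> s) - val g (snd \<gamma> t)\<bar> \<le> sum_over (meeting Q (path_trace \<gamma>)) (osc Q g)"
    if st: "s \<in> fst \<gamma>" "t \<in> fst \<gamma>" "snd \<gamma> s \<in> S" "snd \<gamma> t \<in> S" "s \<le> t" for s t
  proof -
    have sub: "{s..t} \<subseteq> fst \<gamma>" using interval_segment[OF path_interval[OF g] st(1,2)] st(5) by (simp add: closed_segment_eq_real_ivl)
    have inS: "snd \<gamma> \<tau> \<in> S \<longleftrightarrow> snd \<gamma> \<tau> \<notin> (\<Union>i. Q i)" if "\<tau> \<in> {s..t}" for \<tau>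
      using S_iff path_range[OF g] sub that by blast
    have sub': "meeting Q (snd \<gamma> ` {s..t}) \<subseteq> meeting Q (path_trace \<gamma>)"
      unfolding path_trace_def using sub by (intro meeting_mono) auto
    interpret c: covered_path "snd \<gamma>" "\<lambda>\<tau>. val g (snd \<gamma> \<tau>)" \<sigma> "rm g" "rM g" Q s t
      "{\<tau>\<in>{s..t}. snd \<gamma> \<tau> \<notin> (\<Union>i. Q i)}" "meeting Q (snd \<gamma> ` {s..t})"
    proof
      show "continuous_on {s..t} (snd \<gamma>)" using continuous_on_subset[OF path_continuous[OF g] sub] .
      show "sum_over (meeting Q (snd \<gamma> ` {s..t})) \<sigma> < \<infinity>"
        using n sum_over_mono_set[OF sub'] unfolding nice_def by (meson order_le_less_trans)
      show "ennreal \<bar>val g (snd \<gamma> \<tau>) - val g (snd \<gamma> \<tau>')\<bar> \<le> sum_over (meeting Q (snd \<gamma> ` closed_segment \<tau> \<tau>')) \<sigma>"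
        if "\<tau> \<in> {\<tau>\<in>{s..t}. snd \<gamma> \<tau> \<notin> (\<Union>i. Q i)}" "\<tau>' \<in> {\<tau>\<in>{s..t}. snd \<gamma> \<tau> \<notin> (\<Union>i. Q i)}" for \<tau> \<tau>'
        using that sub inS by (intro nice_segment[OF n]) blast+
      show "val g (snd \<gamma> \<tau>) \<in> {rm g i..rM g i}" if "snd \<gamma> \<tau> \<in> frontier (Q i)" for \<tau> i
        using fin_bounds[OF f that] by simp
    qed (use open_Q disjoint_closure_Q st inS in auto)
    have "sum_over (meeting Q (snd \<gamma> ` {s..t})) (\<lambda>i. ennreal (ro g i)) \<le> sum_over (meeting Q (path_trace \<gamma>)) (osc Q g)"
      by (rule sum_over_mono[OF sub']) (simp add: osc_eq[OF f])
    then show ?thesis using c.bound by (rule order_trans[rotated])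
  qed
  show ?thesis unfolding gradient_ineq_def
  proof (intro ballI)
    fix x y assume "x \<in> path_trace \<gamma> \<inter> S" "y \<in> path_trace \<gamma> \<inter> S"
    then obtain s t where st: "s \<in> fst \<gamma>" "t \<in> fst \<gamma>" "x = snd \<gamma> s" "y = snd \<gamma> t" "x \<in> S" "y \<in> S"
      unfolding path_trace_def by blast
    have fi: "\<bar>g x\<bar> \<noteq> \<infinity>" "\<bar>g y\<bar> \<noteq> \<infinity>" using nice_finite[OF n] st by auto
    have "ennreal \<bar>val g x - val g y\<bar> \<le> sum_over (meeting Q (path_trace \<gamma>)) (osc Q g)"
      using *[of s t] *[of t s] st by (cases "s \<le> t") (auto simp: abs_minus_commute)
    then show "\<bar>g x\<bar> \<noteq> \<infinity> \<and> \<bar>g y\<bar> \<noteq> \<infinity> \<and> e2ennreal \<bar>g x - g y\<bar> \<le> sum_over (meeting Q (path_trace \<gamma>)) (osc Q g)"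
      using fi e2ennreal_abs_diff by auto
  qed
qed

lemma upper_gradient_osc:
  assumes "upper_gradient ver \<Omega> Q \<sigma> g" "(\<Sum>i. (\<sigma> i)\<^sup>2) < \<infinity>" "fin g"
  shows "upper_gradient ver \<Omega> Q (osc Q g) g"
  unfolding upper_gradient_iff by (rule aep_mono[OF aep_nice[OF assms(1,2)]]) (rule nice_imp_gradient_osc[OF _ assms(3)])

lemma summable_diameter: "summable (\<lambda>i. (diameter (Q i))\<^sup>2)"
  using sum_diameter_finite by (subst (asm) sum_finite_iff) auto

lemma osc_square_sum: "fin g \<Longrightarrow> (\<Sum>i. (osc Q g i)\<^sup>2) = (\<Sum>i. ennreal ((ro g i)\<^sup>2))"
  using ro_nonneg[of g] by (simp add: osc_eq ennreal_power)

text \<open>The conditions on compactly contained balls concern partial sums of the global series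
  and disappear. For finite suprema and infima the rest becomes summability of real series.\<close>

lemma sobolev_iff:
  "g \<in> sobolev ver \<Omega> Q \<longleftrightarrow> fin g \<and> upper_gradient ver \<Omega> Q (osc Q g) g \<and>
     summable (\<lambda>i. (rM g i)\<^sup>2 * (diameter (Q i))\<^sup>2) \<and> summable (\<lambda>i. (ro g i)\<^sup>2)"
proof -
  have "sobolev_sums_finite Q g UNIV \<longleftrightarrow> summable (\<lambda>i. (rM g i)\<^sup>2 * (diameter (Q i))\<^sup>2) \<and> summable (\<lambda>i. (ro g i)\<^sup>2)" if "fin g"
    unfolding sobolev_sums_finite_def sum_over_UNIV osc_square_sum[OF that]
    by (subst (1 2) sum_finite_iff) auto
  moreover have "sobolev_sums_finite Q g I" if fU: "sobolev_sums_finite Q g UNIV" for I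
    using fU sum_over_mono_set[of I UNIV] unfolding sobolev_sums_finite_def by (meson order_le_less_trans subset_UNIV)
  ultimately show ?thesis unfolding sobolev_def sobolev_loc_def fin_def[symmetric] by auto
qed

definition En :: "(complex \<Rightarrow> ereal) \<Rightarrow> real" where "En g = (\<Sum>i. (ro g i)\<^sup>2)"

lemma dirichlet_energy_eq: "g \<in> sobolev ver \<Omega> Q \<Longrightarrow> dirichlet_energy Q \<Omega> g = ennreal (En g)"
  unfolding dirichlet_energy_def meeting_Omega sum_over_UNIV En_def sobolev_iff
  by (subst osc_square_sum) (auto intro: suminf_ennreal2)

lemma En_nonneg: "g \<in> sobolev ver \<Omega> Q \<Longrightarrow> 0 \<le> En g"
  unfolding En_def sobolev_iff by (intro suminf_nonneg) auto

lemma sobolev_nice: "g \<in> sobolev ver \<Omega> Q \<Longrightarrow> aep (nice (osc Q g) g)"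
proof (rule aep_nice)
  assume g: "g \<in> sobolev ver \<Omega> Q"
  then show "upper_gradient ver \<Omega> Q (osc Q g) g" unfolding sobolev_iff by blast
  have f: "fin g" and s: "summable (\<lambda>i. (ro g i)\<^sup>2)" using g unfolding sobolev_iff by auto
  show "(\<Sum>i. (osc Q g i)\<^sup>2) < \<infinity>" unfolding osc_square_sum[OF f] by (subst sum_finite_iff) (use s in auto)
qed

lemma sobolev_fin: "g \<in> sobolev ver \<Omega> Q \<Longrightarrow> fin g" unfolding sobolev_iff by blast

lemma gradient_ineq_transfer:
  assumes g: "gradient_ineq \<Omega> Q \<sigma> g A" and h: "gradient_ineq \<Omega> Q \<tau> h A"
    and \<Phi>: "\<And>a b a' b'. \<bar>\<Phi> a b - \<Phi> a' b'\<bar> \<le> \<bar>a - a'\<bar> + \<bar>b - b'\<bar>"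
    and k: "\<And>x. \<bar>g x\<bar> \<noteq> \<infinity> \<Longrightarrow> \<bar>h x\<bar> \<noteq> \<infinity> \<Longrightarrow> k x = ereal (\<Phi> (val g x) (val h x))"
  shows "gradient_ineq \<Omega> Q (\<lambda>i. \<sigma> i + \<tau> i) k A"
  unfolding gradient_ineq_def
proof (intro ballI)
  fix x y assume xy: "x \<in> A \<inter> S" "y \<in> A \<inter> S"
  have G: "\<bar>g x\<bar> \<noteq> \<infinity>" "\<bar>g y\<bar> \<noteq> \<infinity>" "e2ennreal \<bar>g x - g y\<bar> \<le> sum_over (meeting Q A) \<sigma>"
    using gradient_ineqD[OF g xy] by simp_all
  have H: "\<bar>h x\<bar> \<noteq> \<infinity>" "\<bar>h y\<bar> \<noteq> \<infinity>" "e2ennreal \<bar>h x - h y\<bar> \<le> sum_over (meeting Q A) \<tau>"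
    using gradient_ineqD[OF h xy] by simp_all
  have K: "k x = ereal (\<Phi> (val g x) (val h x))" "k y = ereal (\<Phi> (val g y) (val h y))" using k G H by auto
  have "e2ennreal \<bar>k x - k y\<bar> = ennreal \<bar>\<Phi> (val g x) (val h x) - \<Phi> (val g y) (val h y)\<bar>"
    unfolding K by (simp add: e2ennreal_ereal)
  also have "\<dots> \<le> ennreal (\<bar>val g x - val g y\<bar> + \<bar>val h x - val h y\<bar>)" by (intro ennreal_leI \<Phi>)
  also have "\<dots> = ennreal \<bar>val g x - val g y\<bar> + ennreal \<bar>val h x - val h y\<bar>" by simp
  also have "\<dots> \<le> sum_over (meeting Q A) \<sigma> + sum_over (meeting Q A) \<tau>"
    using G H by (intro add_mono) (simp_all add: e2ennreal_abs_diff)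
  finally show "\<bar>k x\<bar> \<noteq> \<infinity> \<and> \<bar>k y\<bar> \<noteq> \<infinity> \<and> e2ennreal \<bar>k x - k y\<bar> \<le> sum_over (meeting Q A) (\<lambda>i. \<sigma> i + \<tau> i)"
    using K by (simp add: sum_over_add)
qed

lemma sq_sum5: "(a + b + c + d + e)\<^sup>2 \<le> 5 * (a\<^sup>2 + b\<^sup>2 + c\<^sup>2 + d\<^sup>2 + (e::real)\<^sup>2)"
proof -
  have "0 \<le> (a-b)\<^sup>2 + (a-c)\<^sup>2 + (a-d)\<^sup>2 + (a-e)\<^sup>2 + (b-c)\<^sup>2 + (b-d)\<^sup>2 + (b-e)\<^sup>2 + (c-d)\<^sup>2 + (c-e)\<^sup>2 + (d-e)\<^sup>2" by simp
  then show ?thesis by (simp add: power2_eq_square algebra_simps)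
qed

text \<open>One statement for sums, averages, truncations, maxima and minima. The functions
  \<open>g\<close> and \<open>h\<close> give \<open>k\<close> the upper gradient
  \<open>osc Q g + osc Q h\<close>, which \<open>upper_gradient_osc\<close> exchanges for
  \<open>osc Q k\<close>. The formula for \<open>k\<close> is demanded only where both values are
  finite, as they are at the carpet points of almost every path and on the circles.\<close>

lemma sobolev_compose:
  assumes g: "g \<in> sobolev ver \<Omega> Q" and h: "h \<in> sobolev ver \<Omega> Q"
    and \<Phi>: "\<And>a b a' b'. \<bar>\<Phi> a b - \<Phi> a' b'\<bar> \<le> \<bar>a - a'\<bar> + \<bar>b - b'\<bar>"
    and k: "\<And>x. \<bar>g x\<bar> \<noteq> \<infinity> \<Longrightarrow> \<bar>h x\<bar> \<noteq> \<infinity> \<Longrightarrow> k x = ereal (\<Phi> (val g x) (val h x))"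
  shows "k \<in> sobolev ver \<Omega> Q"
proof -
  note fg = sobolev_fin[OF g] and fh = sobolev_fin[OF h]
  have kx: "k x = ereal (\<Phi> (val g x) (val h x))" if "x \<in> frontier (Q i)" for x i
    by (rule k[OF fin_bounds(1)[OF fg that] fin_bounds(1)[OF fh that]])
  have near: "\<bar>\<Phi> (val g x) (val h x) - \<Phi> (val g y) (val h y)\<bar> \<le> ro g i + ro h i"
    if "x \<in> frontier (Q i)" "y \<in> frontier (Q i)" for x y i
    using \<Phi>[of "val g x" "val h x" "val g y" "val h y"] fin_bounds(2,3)[OF fg that(1)] fin_bounds(2,3)[OF fh that(1)]
      fin_bounds(2,3)[OF fg that(2)] fin_bounds(2,3)[OF fh that(2)] by linarith
  have fk: "fin k"
  proof (rule finI)
    fix i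
    obtain y where y: "y \<in> frontier (Q i)" by (rule frontier_point)
    have "ereal (\<Phi> (val g y) (val h y) - (ro g i + ro h i)) \<le> k x \<and> k x \<le> ereal (\<Phi> (val g y) (val h y) + (ro g i + ro h i))"
      if x: "x \<in> frontier (Q i)" for x
      using near[OF x y] unfolding kx[OF x] by (simp add: abs_le_iff)
    then show "\<exists>c d. \<forall>x\<in>frontier (Q i). ereal c \<le> k x \<and> k x \<le> ereal d" by blast
  qed
  have rok: "ro k i \<le> ro g i + ro h i" for i
  proof (rule ro_le[OF fk])
    fix x y assume xy: "x \<in> frontier (Q i)" "y \<in> frontier (Q i)"
    show "val k x - val k y \<le> ro g i + ro h i"
      using near[OF xy] unfolding kx[OF xy(1)] kx[OF xy(2)] by (simp add: abs_le_iff)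
  qed
  have sg: "summable (\<lambda>i. (rM g i)\<^sup>2 * (diameter (Q i))\<^sup>2)" "summable (\<lambda>i. (ro g i)\<^sup>2)"
    and sh: "summable (\<lambda>i. (rM h i)\<^sup>2 * (diameter (Q i))\<^sup>2)" "summable (\<lambda>i. (ro h i)\<^sup>2)"
    using g h unfolding sobolev_iff by blast+
  have sq2: "(a + b)\<^sup>2 \<le> 2 * a\<^sup>2 + 2 * b\<^sup>2" for a b :: real
    using zero_le_power2[of "a - b"] by (simp add: power2_eq_square algebra_simps)
  have s2: "summable (\<lambda>i. 2 * (ro g i)\<^sup>2 + 2 * (ro h i)\<^sup>2)" using sg sh by (intro summable_add summable_mult)
  have sk2: "summable (\<lambda>i. (ro k i)\<^sup>2)"
  proof (rule summable_comparison_test_ev[OF always_eventually s2], rule allI)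
    fix i
    have "(ro k i)\<^sup>2 \<le> (ro g i + ro h i)\<^sup>2" using rok ro_nonneg[OF fk] by (intro power_mono) auto
    then show "norm ((ro k i)\<^sup>2) \<le> 2 * (ro g i)\<^sup>2 + 2 * (ro h i)\<^sup>2" using sq2[of "ro g i" "ro h i"] by simp
  qed
  define D where "D = diameter \<Omega>"
  have D: "diameter (Q i) \<le> D" for i unfolding D_def by (rule diameter_subset[OF Q_subset bdd])
  \<comment> \<open>On a circle \<open>k\<close> is bounded by \<open>\<Phi> 0 0\<close> plus
    suprema and oscillations of \<open>g\<close> and \<open>h\<close>. Terms with an oscillation
    become summable once the diameter is replaced by its bound \<open>D\<close>; the constant term
    uses the summability of the squared diameters.\<close>
  let ?B = "\<lambda>i. 5 * ((\<Phi> 0 0)\<^sup>2 * (diameter (Q i))\<^sup>2 + (rM g i)\<^sup>2 * (diameter (Q i))\<^sup>2 + (rM h i)\<^sup>2 * (diameter (Q i))\<^sup>2 + (ro g i)\<^sup>2 * D\<^sup>2 + (ro h i)\<^sup>2 * D\<^sup>2)"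
  have sB: "summable ?B"
    using sg sh summable_diameter by (intro summable_mult summable_add) (auto intro: summable_mult summable_mult2)
  have sk1: "summable (\<lambda>i. (rM k i)\<^sup>2 * (diameter (Q i))\<^sup>2)"
  proof (rule summable_comparison_test_ev[OF always_eventually sB], rule allI)
    fix i
    have bnd: "\<bar>val k x\<bar> \<le> \<bar>\<Phi> 0 0\<bar> + \<bar>rM g i\<bar> + \<bar>rM h i\<bar> + ro g i + ro h i" if x: "x \<in> frontier (Q i)" for x
      using \<Phi>[of "val g x" "val h x" 0 0] fin_bounds(2,3)[OF fg x] fin_bounds(2,3)[OF fh x]
      unfolding kx[OF x] real_of_ereal.simps by linarith
    obtain y where y: "y \<in> frontier (Q i)" by (rule frontier_point)
    have "rM k i \<le> \<bar>\<Phi> 0 0\<bar> + \<bar>rM g i\<bar> + \<bar>rM h i\<bar> + ro g i + ro h i"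
      using rM_least[OF fk] bnd by (meson abs_le_D1)
    moreover have "- (\<bar>\<Phi> 0 0\<bar> + \<bar>rM g i\<bar> + \<bar>rM h i\<bar> + ro g i + ro h i) \<le> rM k i"
      using bnd[OF y] fin_bounds(3)[OF fk y] by linarith
    ultimately have "\<bar>rM k i\<bar> \<le> \<bar>\<bar>\<Phi> 0 0\<bar> + \<bar>rM g i\<bar> + \<bar>rM h i\<bar> + ro g i + ro h i\<bar>" by linarith
    then have "(rM k i)\<^sup>2 \<le> (\<bar>\<Phi> 0 0\<bar> + \<bar>rM g i\<bar> + \<bar>rM h i\<bar> + ro g i + ro h i)\<^sup>2" by (rule abs_le_square_iff[THEN iffD1])
    also have "\<dots> \<le> 5 * ((\<Phi> 0 0)\<^sup>2 + (rM g i)\<^sup>2 + (rM h i)\<^sup>2 + (ro g i)\<^sup>2 + (ro h i)\<^sup>2)"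
      using sq_sum5[of "\<bar>\<Phi> 0 0\<bar>" "\<bar>rM g i\<bar>" "\<bar>rM h i\<bar>" "ro g i" "ro h i"] by simp
    finally have "(rM k i)\<^sup>2 * (diameter (Q i))\<^sup>2 \<le> 5 * ((\<Phi> 0 0)\<^sup>2 + (rM g i)\<^sup>2 + (rM h i)\<^sup>2 + (ro g i)\<^sup>2 + (ro h i)\<^sup>2) * (diameter (Q i))\<^sup>2"
      by (rule mult_right_mono) simp
    also have "\<dots> = 5 * ((\<Phi> 0 0)\<^sup>2 * (diameter (Q i))\<^sup>2 + (rM g i)\<^sup>2 * (diameter (Q i))\<^sup>2 + (rM h i)\<^sup>2 * (diameter (Q i))\<^sup>2 + (ro g i)\<^sup>2 * (diameter (Q i))\<^sup>2 + (ro h i)\<^sup>2 * (diameter (Q i))\<^sup>2)"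
      by (simp add: algebra_simps)
    also have "\<dots> \<le> ?B i"
    proof -
      have "(diameter (Q i))\<^sup>2 \<le> D\<^sup>2" using D diameter_Q_pos[of i] by (intro power_mono) auto
      then have "(ro g i)\<^sup>2 * (diameter (Q i))\<^sup>2 \<le> (ro g i)\<^sup>2 * D\<^sup>2" "(ro h i)\<^sup>2 * (diameter (Q i))\<^sup>2 \<le> (ro h i)\<^sup>2 * D\<^sup>2"
        by (auto intro: mult_left_mono)
      then show ?thesis by simp
    qed
    finally show "norm ((rM k i)\<^sup>2 * (diameter (Q i))\<^sup>2) \<le> ?B i" by simp
  qed
  have "upper_gradient ver \<Omega> Q (osc Q k) k"
  proof (rule upper_gradient_osc[OF _ _ fk])
    show "upper_gradient ver \<Omega> Q (\<lambda>i. osc Q g i + osc Q h i) k"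
      unfolding upper_gradient_iff
    proof (rule aep_mono[OF aep_conj])
      show "aep (\<lambda>\<gamma>. gradient_ineq \<Omega> Q (osc Q g) g (path_trace \<gamma>))" "aep (\<lambda>\<gamma>. gradient_ineq \<Omega> Q (osc Q h) h (path_trace \<gamma>))"
        using g h unfolding sobolev_iff upper_gradient_iff by blast+
      fix \<gamma> assume "gradient_ineq \<Omega> Q (osc Q g) g (path_trace \<gamma>) \<and> gradient_ineq \<Omega> Q (osc Q h) h (path_trace \<gamma>)"
      then show "gradient_ineq \<Omega> Q (\<lambda>i. osc Q g i + osc Q h i) k (path_trace \<gamma>)"
        by (elim conjE) (rule gradient_ineq_transfer[OF _ _ \<Phi> k])
    qed
    have "(osc Q g i + osc Q h i)\<^sup>2 \<le> ennreal (2 * (ro g i)\<^sup>2 + 2 * (ro h i)\<^sup>2)" for i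
    proof -
      have "(osc Q g i + osc Q h i)\<^sup>2 = ennreal ((ro g i + ro h i)\<^sup>2)"
        using ro_nonneg[OF fg, of i] ro_nonneg[OF fh, of i]
        unfolding osc_eq[OF fg] osc_eq[OF fh] by (simp add: ennreal_power flip: ennreal_plus)
      then show ?thesis using sq2 by (simp only: ennreal_leI)
    qed
    then have "(\<Sum>i. (osc Q g i + osc Q h i)\<^sup>2) \<le> (\<Sum>i. ennreal (2 * (ro g i)\<^sup>2 + 2 * (ro h i)\<^sup>2))"
      by (intro suminf_le summableI)
    also have "\<dots> < \<infinity>" using s2 by (subst sum_finite_iff) auto
    finally show "(\<Sum>i. (osc Q g i + osc Q h i)\<^sup>2) < \<infinity>" .
  qed
  then show ?thesis unfolding sobolev_iff using fk sk1 sk2 by blast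
qed

subsection \<open>Limits at the end of a path\<close>

text \<open>The end parameter \<open>e\<close> is recorded besides the point because both ends of an
  open path may converge to the same \<open>x\<close>. Being in the closure of the parameter
  interval but not in it, \<open>e\<close> is one of its missing end points.\<close>

definition ends_at :: "cpath \<Rightarrow> real \<Rightarrow> complex \<Rightarrow> bool" where
  "ends_at \<gamma> e x \<longleftrightarrow> x \<in> frontier \<Omega> \<and> e \<in> closure (fst \<gamma>) - fst \<gamma> \<and> (snd \<gamma> \<longlongrightarrow> x) (at e within fst \<gamma>)"

definition stops :: "cpath \<Rightarrow> real set" where "stops \<gamma> = {t\<in>fst \<gamma>. snd \<gamma> t \<in> S}"

definition end_limit :: "(complex \<Rightarrow> ereal) \<Rightarrow> cpath \<Rightarrow> real \<Rightarrow> real \<Rightarrow> bool" where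
  "end_limit g \<gamma> e L \<longleftrightarrow> ((\<lambda>t. val g (snd \<gamma> t)) \<longlongrightarrow> L) (at e within stops \<gamma>)"

definition tail :: "cpath \<Rightarrow> real \<Rightarrow> real \<Rightarrow> complex set" where
  "tail \<gamma> e \<delta> = snd \<gamma> ` (fst \<gamma> \<inter> ball e \<delta>)"

lemma frontier_disjoint: "x \<in> frontier \<Omega> \<Longrightarrow> x \<notin> \<Omega>"
  using open_Omega by (simp add: frontier_def interior_open)

text \<open>The continuous extension to the closed interval has a compact image, which contains the
  closure of the trace. A frontier point of the open domain is not on the trace itself, so it is
  attained at a missing end point.\<close>

lemma accessible_iff:
  assumes g: "\<gamma> \<in> paths_in \<Omega>" and x: "x \<in> frontier \<Omega>"
  shows "accessible_by x \<gamma> \<longleftrightarrow> open (fst \<gamma>) \<and> (\<exists>e. ends_at \<gamma> e x)"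
proof -
  obtain h where h: "continuous_on (closure (fst \<gamma>)) h" "\<forall>t\<in>fst \<gamma>. h t = snd \<gamma> t" and b: "bounded (fst \<gamma>)"
    and ne: "fst \<gamma> \<noteq> {}"
    using g unfolding paths_in_def is_path_def by blast
  have tr: "path_trace \<gamma> = h ` fst \<gamma>" unfolding path_trace_def using h(2) by auto
  have "compact (h ` closure (fst \<gamma>))" using h(1) b by (intro compact_continuous_image) (auto simp: compact_closure)
  then have cl: "closure (path_trace \<gamma>) \<subseteq> h ` closure (fst \<gamma>)"
    unfolding tr by (intro closure_minimal image_mono closure_subset compact_imp_closed)
  have "\<exists>e. ends_at \<gamma> e x" if a: "x \<in> closure (path_trace \<gamma>)"
  proof -
    obtain e where e: "e \<in> closure (fst \<gamma>)" "x = h e" using cl a by blast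
    have "e \<notin> fst \<gamma>" using e h(2) path_range[OF g] frontier_disjoint[OF x] by auto
    moreover have "(h \<longlongrightarrow> h e) (at e within closure (fst \<gamma>))"
      using h(1) e(1) unfolding continuous_on_def by blast
    then have "(h \<longlongrightarrow> h e) (at e within fst \<gamma>)" by (rule tendsto_within_subset[OF _ closure_subset])
    then have "(snd \<gamma> \<longlongrightarrow> h e) (at e within fst \<gamma>)"
      by (rule Lim_transform_within[of _ _ _ _ 1]) (use h(2) in auto)
    ultimately show ?thesis unfolding ends_at_def using e x by blast
  qed
  moreover have "x \<in> closure (path_trace \<gamma>)" if a: "ends_at \<gamma> e x" for e
  proof (rule Lim_in_closed_set[of _ "snd \<gamma>" "at e within fst \<gamma>"])
    show "eventually (\<lambda>t. snd \<gamma> t \<in> closure (path_trace \<gamma>)) (at e within fst \<gamma>)"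
      using closure_subset[of "path_trace \<gamma>"] unfolding path_trace_def by (auto simp: eventually_at intro!: exI[of _ 1])
    show "at e within fst \<gamma> \<noteq> bot" using a unfolding ends_at_def by (metis DiffD1 DiffD2 Diff_empty Diff_insert0 at_within_eq_bot_iff)
    show "(snd \<gamma> \<longlongrightarrow> x) (at e within fst \<gamma>)" using a unfolding ends_at_def by blast
  qed simp
  ultimately show ?thesis unfolding accessible_by_def by blast
qed

lemma tail_interval: "\<gamma> \<in> paths_in \<Omega> \<Longrightarrow> is_interval (fst \<gamma> \<inter> ball e \<delta>)"
  using path_interval by (intro is_interval_Int) (auto simp: is_interval_convex_1)

lemma tail_near:
  assumes "ends_at \<gamma> e x" "open W" "x \<in> W"
  obtains \<delta> where "\<delta> > 0" "tail \<gamma> e \<delta> \<subseteq> W"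
proof -
  have "(snd \<gamma> \<longlongrightarrow> x) (at e within fst \<gamma>)" "e \<notin> fst \<gamma>" using assms unfolding ends_at_def by auto
  then have "eventually (\<lambda>t. snd \<gamma> t \<in> W) (at e within fst \<gamma>)" using assms topological_tendstoD by blast
  then obtain \<delta> where d: "\<delta> > 0" "\<And>t. t \<in> fst \<gamma> \<Longrightarrow> t \<noteq> e \<Longrightarrow> dist t e < \<delta> \<Longrightarrow> snd \<gamma> t \<in> W"
    unfolding eventually_at by blast
  have "tail \<gamma> e \<delta> \<subseteq> W"
  proof
    fix z assume "z \<in> tail \<gamma> e \<delta>"
    then obtain t where "t \<in> fst \<gamma>" "dist e t < \<delta>" "z = snd \<gamma> t" unfolding tail_def by auto
    then show "z \<in> W" using d(2)[of t] \<open>e \<notin> fst \<gamma>\<close> by (metis dist_commute)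
  qed
  then show ?thesis using d(1) that by blast
qed

lemma tail_nonempty:
  assumes "ends_at \<gamma> e x" "\<delta> > 0" shows "fst \<gamma> \<inter> ball e \<delta> \<noteq> {}"
proof -
  have "e \<in> closure (fst \<gamma>)" using assms unfolding ends_at_def by blast
  then obtain t where "t \<in> fst \<gamma>" "dist t e < \<delta>" using assms(2) unfolding closure_approachable by blast
  then show ?thesis by (auto simp: dist_commute)
qed

text \<open>The finitely many expensive disks have closures inside the domain, hence away from
  \<open>x\<close>, and the end of the path avoids them.\<close>

lemma tail_sum:
  assumes e: "ends_at \<gamma> e x" and fin: "sum_over (meeting Q (path_trace \<gamma>)) \<sigma> < \<infinity>" and \<epsilon>: "\<epsilon> > 0"
  obtains \<delta> where "\<delta> > 0" "sum_over (meeting Q (tail \<gamma> e \<delta>)) \<sigma> < ennreal \<epsilon>"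
proof -
  obtain F where F: "finite F" "sum_over (meeting Q (path_trace \<gamma>) - F) \<sigma> < ennreal \<epsilon>" using sum_over_tail[OF fin \<epsilon>] .
  let ?W = "- (\<Union>i\<in>F. closure (Q i))"
  have "open ?W" using F by (intro open_Compl closed_UN) auto
  moreover have "x \<in> ?W" using e frontier_disjoint closure_Q_subset unfolding ends_at_def by blast
  ultimately obtain \<delta> where d: "\<delta> > 0" "tail \<gamma> e \<delta> \<subseteq> ?W" using tail_near[OF e] by metis
  have "meeting Q (tail \<gamma> e \<delta>) \<subseteq> meeting Q (path_trace \<gamma>) - F"
  proof
    fix i assume "i \<in> meeting Q (tail \<gamma> e \<delta>)"
    then obtain z where "z \<in> tail \<gamma> e \<delta>" "z \<in> Q i" unfolding meeting_def by blast
    moreover from this have "i \<notin> F" using d(2) closure_subset[of "Q i"] by blast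
    ultimately show "i \<in> meeting Q (path_trace \<gamma>) - F" unfolding meeting_def path_trace_def tail_def by blast
  qed
  then show ?thesis using that[OF d(1)] F(2) sum_over_mono_set order_le_less_trans by blast
qed

text \<open>Without stops the end of the path would remain in a single disk, whose closure does not
  contain \<open>x\<close>.\<close>

lemma tail_stop:
  assumes g: "\<gamma> \<in> paths_in \<Omega>" and e: "ends_at \<gamma> e x" and d: "\<delta> > 0"
  obtains t where "t \<in> stops \<gamma>" "t \<in> ball e \<delta>"
proof (rule ccontr)
  assume "\<not> thesis"
  then have no: "\<And>t. t \<in> fst \<gamma> \<inter> ball e \<delta> \<Longrightarrow> snd \<gamma> t \<notin> S" using that unfolding stops_def by blast
  let ?J = "fst \<gamma> \<inter> ball e \<delta>"
  obtain t0 where t0: "t0 \<in> ?J" using tail_nonempty[OF e d] by blast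
  obtain i where i: "snd \<gamma> t0 \<in> Q i" using no[OF t0] S_iff path_range[OF g] t0 by blast
  have all: "snd \<gamma> t \<in> Q i" if t: "t \<in> ?J" for t
  proof (rule ccontr)
    assume n: "snd \<gamma> t \<notin> Q i"
    have sub: "closed_segment t0 t \<subseteq> ?J" using interval_segment[OF tail_interval[OF g] t0 t] .
    then have "continuous_on (closed_segment t0 t) (snd \<gamma>)" using continuous_on_subset[OF path_continuous[OF g]] by blast
    then obtain \<kappa> where "\<kappa> \<in> closed_segment t0 t" "snd \<gamma> \<kappa> \<in> frontier (Q i)" using segment_exit i n by metis
    then show False using no sub frontier_Q_subset by blast
  qed
  have "x \<in> - closure (Q i)" using e frontier_disjoint closure_Q_subset unfolding ends_at_def by blast
  then obtain \<delta>' where d': "\<delta>' > 0" "tail \<gamma> e \<delta>' \<subseteq> - closure (Q i)" using tail_near[OF e, of "- closure (Q i)"] by auto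
  have "min \<delta> \<delta>' > 0" using d d' by simp
  from tail_nonempty[OF e this] obtain t where "t \<in> fst \<gamma> \<inter> ball e (min \<delta> \<delta>')" by blast
  then have "snd \<gamma> t \<in> Q i" "snd \<gamma> t \<in> tail \<gamma> e \<delta>'" using all unfolding tail_def by auto
  then show False using d'(2) closure_subset by blast
qed

lemma stops_at_nontrivial:
  assumes g: "\<gamma> \<in> paths_in \<Omega>" and e: "ends_at \<gamma> e x"
  shows "at e within stops \<gamma> \<noteq> bot"
proof -
  have "e \<notin> stops \<gamma>" using e unfolding ends_at_def stops_def by blast
  moreover have "e \<in> closure (stops \<gamma>)" unfolding closure_approachable
    using tail_stop[OF g e] by (metis dist_commute mem_ball)
  ultimately show ?thesis by (simp add: at_within_eq_bot_iff)
qed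

lemma eventually_tail:
  assumes "\<delta> > 0" shows "eventually (\<lambda>t. t \<in> fst \<gamma> \<inter> ball e \<delta> \<and> snd \<gamma> t \<in> S) (at e within stops \<gamma>)"
  unfolding eventually_at using assms by (intro exI[of _ \<delta>]) (auto simp: stops_def dist_commute)

lemma tail_bound:
  assumes n: "nice \<sigma> g \<gamma>" and t: "t \<in> fst \<gamma> \<inter> ball e \<delta>" "snd \<gamma> t \<in> S" "s \<in> fst \<gamma> \<inter> ball e \<delta>" "snd \<gamma> s \<in> S"
  shows "ennreal \<bar>val g (snd \<gamma> t) - val g (snd \<gamma> s)\<bar> \<le> sum_over (meeting Q (tail \<gamma> e \<delta>)) \<sigma>"
  unfolding tail_def using n t tail_interval by (intro nice_interval[OF n]) (auto simp: nice_def)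

lemma end_limit_bound:
  assumes n: "nice \<sigma> g \<gamma>" and e: "ends_at \<gamma> e x" and L: "end_limit g \<gamma> e L"
    and t: "t \<in> fst \<gamma> \<inter> ball e \<delta>" "snd \<gamma> t \<in> S"
  shows "ennreal \<bar>val g (snd \<gamma> t) - L\<bar> \<le> sum_over (meeting Q (tail \<gamma> e \<delta>)) \<sigma>"
proof (rule tendsto_upperbound)
  have g: "\<gamma> \<in> paths_in \<Omega>" using n unfolding nice_def by blast
  show "at e within stops \<gamma> \<noteq> bot" by (rule stops_at_nontrivial[OF g e])
  show "((\<lambda>s. ennreal \<bar>val g (snd \<gamma> t) - val g (snd \<gamma> s)\<bar>) \<longlongrightarrow> ennreal \<bar>val g (snd \<gamma> t) - L\<bar>) (at e within stops \<gamma>)"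
    by (intro tendsto_ennrealI tendsto_rabs tendsto_diff tendsto_const L[unfolded end_limit_def])
  have "\<delta> > 0" using t by (auto intro: order_le_less_trans[OF zero_le_dist])
  from eventually_tail[OF this, of \<gamma> e]
  show "eventually (\<lambda>s. ennreal \<bar>val g (snd \<gamma> t) - val g (snd \<gamma> s)\<bar> \<le> sum_over (meeting Q (tail \<gamma> e \<delta>)) \<sigma>) (at e within stops \<gamma>)"
    by eventually_elim (use tail_bound[OF n t] in blast)
qed

text \<open>The sums over the tails tend to zero, so the values at stops satisfy Cauchy's condition.
  A sequence \<open>T\<close> of stops that approaches \<open>e\<close> supplies the limit.\<close>

lemma end_limit_exists:
  assumes n: "nice \<sigma> g \<gamma>" and e: "ends_at \<gamma> e x"
  obtains L where "end_limit g \<gamma> e L"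
proof -
  have g: "\<gamma> \<in> paths_in \<Omega>" and fs: "sum_over (meeting Q (path_trace \<gamma>)) \<sigma> < \<infinity>" using n unfolding nice_def by auto
  have small: "\<exists>\<delta>>0. \<forall>t s. t \<in> fst \<gamma> \<inter> ball e \<delta> \<longrightarrow> snd \<gamma> t \<in> S \<longrightarrow> s \<in> fst \<gamma> \<inter> ball e \<delta> \<longrightarrow> snd \<gamma> s \<in> S \<longrightarrow>
      \<bar>val g (snd \<gamma> t) - val g (snd \<gamma> s)\<bar> < \<epsilon>" if eps: "\<epsilon> > 0" for \<epsilon>
  proof -
    obtain \<delta> where d: "\<delta> > 0" "sum_over (meeting Q (tail \<gamma> e \<delta>)) \<sigma> < ennreal \<epsilon>" using tail_sum[OF e fs eps] .
    show ?thesis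
    proof (intro exI[of _ \<delta>] conjI d(1) allI impI)
      fix t s assume "t \<in> fst \<gamma> \<inter> ball e \<delta>" "snd \<gamma> t \<in> S" "s \<in> fst \<gamma> \<inter> ball e \<delta>" "snd \<gamma> s \<in> S"
      from tail_bound[OF n this] d(2) have "ennreal \<bar>val g (snd \<gamma> t) - val g (snd \<gamma> s)\<bar> < ennreal \<epsilon>" by (rule order_le_less_trans)
      then show "\<bar>val g (snd \<gamma> t) - val g (snd \<gamma> s)\<bar> < \<epsilon>" by (simp add: ennreal_less_iff)
    qed
  qed
  have "\<exists>t. t \<in> stops \<gamma> \<and> t \<in> ball e (1 / real (Suc k))" for k using tail_stop[OF g e, of "1 / real (Suc k)"] by auto
  then obtain T where T: "\<And>k. T k \<in> stops \<gamma>" "\<And>k. T k \<in> ball e (1 / real (Suc k))" by metis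
  have T': "T k \<in> fst \<gamma>" "snd \<gamma> (T k) \<in> S" for k using T(1) unfolding stops_def by auto
  have Tb: "\<exists>N. \<forall>k\<ge>N. T k \<in> ball e \<delta>" if dd: "\<delta> > 0" for \<delta>
  proof -
    obtain N where N: "1 / real (Suc N) < \<delta>" using reals_Archimedean[OF dd] by (auto simp: inverse_eq_divide)
    have "T k \<in> ball e \<delta>" if "k \<ge> N" for k
    proof -
      have "1 / real (Suc k) \<le> 1 / real (Suc N)" using that by (simp add: frac_le)
      then show ?thesis using T(2)[of k] N by auto
    qed
    then show ?thesis by blast
  qed
  have "Cauchy (\<lambda>k. val g (snd \<gamma> (T k)))"
    unfolding Cauchy_def
  proof (intro allI impI)
    fix \<epsilon> :: real assume "\<epsilon> > 0"
    from small[OF this] obtain \<delta> where d: "\<delta> > 0" "\<And>t s. t \<in> fst \<gamma> \<inter> ball e \<delta> \<Longrightarrow> snd \<gamma> t \<in> S \<Longrightarrow> s \<in> fst \<gamma> \<inter> ball e \<delta> \<Longrightarrow> snd \<gamma> s \<in> S \<Longrightarrow>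
      \<bar>val g (snd \<gamma> t) - val g (snd \<gamma> s)\<bar> < \<epsilon>" by blast
    obtain N where "\<forall>k\<ge>N. T k \<in> ball e \<delta>" using Tb[OF d(1)] by blast
    then show "\<exists>M. \<forall>m\<ge>M. \<forall>k\<ge>M. dist (val g (snd \<gamma> (T m))) (val g (snd \<gamma> (T k))) < \<epsilon>"
      using d(2) T' by (intro exI[of _ N]) (auto simp: dist_real_def)
  qed
  then obtain L where L: "(\<lambda>k. val g (snd \<gamma> (T k))) \<longlonglongrightarrow> L" using real_Cauchy_convergent convergentD by blast
  have "end_limit g \<gamma> e L" unfolding end_limit_def tendsto_iff
  proof (intro allI impI)
    fix \<epsilon> :: real assume "\<epsilon> > 0"
    then have e2: "\<epsilon>/2 > 0" by simp
    from small[OF this] obtain \<delta> where d: "\<delta> > 0" "\<And>t s. t \<in> fst \<gamma> \<inter> ball e \<delta> \<Longrightarrow> snd \<gamma> t \<in> S \<Longrightarrow> s \<in> fst \<gamma> \<inter> ball e \<delta> \<Longrightarrow> snd \<gamma> s \<in> S \<Longrightarrow>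
      \<bar>val g (snd \<gamma> t) - val g (snd \<gamma> s)\<bar> < \<epsilon>/2" by blast
    obtain N where N: "\<forall>k\<ge>N. T k \<in> ball e \<delta>" using Tb[OF d(1)] by blast
    obtain N' where N': "\<forall>k\<ge>N'. dist (val g (snd \<gamma> (T k))) L < \<epsilon>/2" using L e2 unfolding lim_sequentially by blast
    let ?k = "max N N'"
    have a: "\<bar>val g (snd \<gamma> (T ?k)) - L\<bar> < \<epsilon>/2" using N' by (simp add: dist_real_def)
    show "eventually (\<lambda>t. dist (val g (snd \<gamma> t)) L < \<epsilon>) (at e within stops \<gamma>)"
      using eventually_tail[OF d(1), of \<gamma> e]
    proof eventually_elim
      case (elim t)
      then have "\<bar>val g (snd \<gamma> t) - val g (snd \<gamma> (T ?k))\<bar> < \<epsilon>/2" using d(2)[of t "T ?k"] T'[of ?k] N by auto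
      then show ?case using a unfolding dist_real_def by linarith
    qed
  qed
  then show ?thesis using that by blast
qed

lemma end_limit_unique:
  assumes "\<gamma> \<in> paths_in \<Omega>" "ends_at \<gamma> e x" "end_limit g \<gamma> e L" "end_limit g \<gamma> e L'"
  shows "L = L'"
  using assms(3,4) stops_at_nontrivial[OF assms(1,2)] unfolding end_limit_def by (metis tendsto_unique)

lemma end_limit_compose:
  assumes g: "nice \<sigma> g \<gamma>" and h: "nice \<tau> h \<gamma>" and L: "end_limit g \<gamma> e L" "end_limit h \<gamma> e L'"
    and \<Phi>: "\<And>a b a' b'. \<bar>\<Phi> a b - \<Phi> a' b'\<bar> \<le> \<bar>a - a'\<bar> + \<bar>b - b'\<bar>"
    and k: "\<And>x. \<bar>g x\<bar> \<noteq> \<infinity> \<Longrightarrow> \<bar>h x\<bar> \<noteq> \<infinity> \<Longrightarrow> k x = ereal (\<Phi> (val g x) (val h x))"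
  shows "end_limit k \<gamma> e (\<Phi> L L')"
proof -
  have "((\<lambda>t. \<bar>val g (snd \<gamma> t) - L\<bar> + \<bar>val h (snd \<gamma> t) - L'\<bar>) \<longlongrightarrow> \<bar>L - L\<bar> + \<bar>L' - L'\<bar>) (at e within stops \<gamma>)"
    by (intro tendsto_add tendsto_rabs tendsto_diff tendsto_const L[unfolded end_limit_def])
  then have "((\<lambda>t. \<bar>val g (snd \<gamma> t) - L\<bar> + \<bar>val h (snd \<gamma> t) - L'\<bar>) \<longlongrightarrow> 0) (at e within stops \<gamma>)" by simp
  then have "((\<lambda>t. val k (snd \<gamma> t) - \<Phi> L L') \<longlongrightarrow> 0) (at e within stops \<gamma>)"
  proof (rule Lim_null_comparison[rotated])
    show "eventually (\<lambda>t. norm (val k (snd \<gamma> t) - \<Phi> L L') \<le> \<bar>val g (snd \<gamma> t) - L\<bar> + \<bar>val h (snd \<gamma> t) - L'\<bar>) (at e within stops \<gamma>)"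
      using eventually_tail[of 1 \<gamma> e, simplified]
    proof eventually_elim
      case (elim t)
      then have "k (snd \<gamma> t) = ereal (\<Phi> (val g (snd \<gamma> t)) (val h (snd \<gamma> t)))"
        using nice_finite[OF g] nice_finite[OF h] by (intro k) auto
      then show ?case using \<Phi> by simp
    qed
  qed
  then show ?thesis unfolding end_limit_def by (simp add: LIM_zero_iff)
qed

end

section \<open>Squares and Jordan curves\<close>

text \<open>The maximum norm: its spheres are squares with sides parallel to the axes, to which the
  genericity of almost every vertical and horizontal line applies.\<close>

definition snorm :: "complex \<Rightarrow> real" where "snorm z = max \<bar>Re z\<bar> \<bar>Im z\<bar>"

lemma snorm_bounds: "snorm z \<le> cmod z" "cmod z \<le> 2 * snorm z"
  unfolding snorm_def using abs_Re_le_cmod abs_Im_le_cmod cmod_le[of z] by auto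

lemma snorm_lipschitz: "\<bar>snorm z - snorm w\<bar> \<le> dist z w"
proof -
  have "\<bar>Re z - Re w\<bar> \<le> dist z w" "\<bar>Im z - Im w\<bar> \<le> dist z w"
    using abs_Re_le_cmod[of "z - w"] abs_Im_le_cmod[of "z - w"] by (auto simp: dist_norm)
  then show ?thesis unfolding snorm_def by (auto simp: max_def abs_if split: if_splits)
qed

lemma continuous_on_snorm [continuous_intros]:
  assumes "continuous_on A f" shows "continuous_on A (\<lambda>x. snorm (f x))"
  unfolding snorm_def using assms by (intro continuous_intros)

text \<open>The boundary of the square of side \<open>2 * s\<close> around \<open>x\<close>, parametrized by the angle.\<close>

definition sqp :: "complex \<Rightarrow> real \<Rightarrow> real \<Rightarrow> complex" where
  "sqp x s \<theta> = x + of_real (s / max \<bar>cos \<theta>\<bar> \<bar>sin \<theta>\<bar>) * cis \<theta>"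

lemma max_cos_sin_pos: "0 < max \<bar>cos \<theta>\<bar> \<bar>sin (\<theta>::real)\<bar>"
  using sin_zero_abs_cos_one[of \<theta>] by (auto simp: less_max_iff_disj)

lemma snorm_sqp: "s > 0 \<Longrightarrow> snorm (sqp x s \<theta> - x) = s"
proof -
  assume s: "s > 0"
  let ?m = "max \<bar>cos \<theta>\<bar> \<bar>sin \<theta>\<bar>"
  have m: "?m > 0" by (rule max_cos_sin_pos)
  have "snorm (sqp x s \<theta> - x) = max (s / ?m * \<bar>cos \<theta>\<bar>) (s / ?m * \<bar>sin \<theta>\<bar>)"
    using s m unfolding snorm_def sqp_def by (simp add: abs_mult)
  also have "\<dots> = s / ?m * ?m" using s m by (simp add: max_mult_distrib_left)
  finally show ?thesis using m by simp
qed

lemma continuous_on_sqp: "continuous_on A (sqp x s)"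
  unfolding sqp_def using max_cos_sin_pos by (intro continuous_intros) (auto simp: less_le)

lemma sqp_periodic: "sqp x s (\<theta> + 2 * pi * of_int k) = sqp x s \<theta>"
proof -
  have "cos (\<theta> + 2 * pi * of_int k) = cos \<theta>" "sin (\<theta> + 2 * pi * of_int k) = sin \<theta>"
    unfolding cos_add sin_add cos_int_2pin sin_int_2pin by simp_all
  then show ?thesis unfolding sqp_def by (simp add: complex_eq_iff)
qed

lemma sqp_eqD:
  assumes "s > 0" "sqp x s \<theta> = sqp x s \<theta>'" obtains k :: int where "\<theta> = \<theta>' + 2 * pi * of_int k"
proof -
  define r where "r \<theta> = s / max \<bar>cos \<theta>\<bar> \<bar>sin \<theta>\<bar>" for \<theta> :: real
  have r: "r \<theta> > 0" "r \<theta>' > 0" unfolding r_def using assms(1) max_cos_sin_pos by auto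
  have e: "of_real (r \<theta>) * cis \<theta> = of_real (r \<theta>') * cis \<theta>'" using assms(2) unfolding sqp_def r_def by (simp only: add_left_cancel)
  then have "cmod (of_real (r \<theta>) * cis \<theta>) = cmod (of_real (r \<theta>') * cis \<theta>')" by simp
  then have "r \<theta> = r \<theta>'" using r by (simp add: norm_mult)
  then have "cis \<theta> = cis \<theta>'" using e r by simp
  then have "sin \<theta> = sin \<theta>' \<and> cos \<theta> = cos \<theta>'" by (simp add: complex_eq_iff)
  then obtain n :: int where "\<theta> = \<theta>' + 2 * pi * of_int n"
    unfolding sin_cos_eq_iff by (auto simp: mult.commute)
  then show ?thesis using that by blast
qed

lemma sqp_surj:
  assumes "s > 0" "snorm (z - x) = s" obtains \<theta> where "\<theta> \<in> {0..2*pi}" "z = sqp x s \<theta>"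
proof -
  have z: "z - x \<noteq> 0" using assms unfolding snorm_def by auto
  define r where "r = cmod (z - x)"
  define \<theta> where "\<theta> = Arg2pi (z - x)"
  have r: "r > 0" unfolding r_def using z by simp
  have e: "z - x = of_real r * cis \<theta>" unfolding r_def \<theta>_def by (metis Arg2pi_eq cis_conv_exp mult.commute)
  then have "s = r * max \<bar>cos \<theta>\<bar> \<bar>sin \<theta>\<bar>"
    using assms(2) r unfolding snorm_def by (simp add: abs_mult max_mult_distrib_left)
  then have "s / max \<bar>cos \<theta>\<bar> \<bar>sin \<theta>\<bar> = r" using max_cos_sin_pos[of \<theta>] by (simp add: field_simps)
  then have "z = sqp x s \<theta>" unfolding sqp_def using e by (metis add.commute diff_add_cancel)
  moreover have "\<theta> \<in> {0..2*pi}" unfolding \<theta>_def using Arg2pi[of "z - x"] by auto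
  ultimately show ?thesis using that by blast
qed

section \<open>Jordan curves near one of their points\<close>

lemma snorm_crossing:
  assumes "connected T" "a \<in> T" "b \<in> T" "snorm (a - x) < s" "s < snorm (b - x)"
  shows "\<exists>z\<in>T. snorm (z - x) = s"
proof -
  have "connected ((\<lambda>z. snorm (z - x)) ` T)"
    by (intro connected_continuous_image assms(1) continuous_intros)
  then have "s \<in> (\<lambda>z. snorm (z - x)) ` T"
    using connectedD_interval[of "(\<lambda>z. snorm (z - x)) ` T" "snorm (a - x)" "snorm (b - x)" s] assms by auto
  then show ?thesis by auto
qed

lemma convex_open_square: "convex {z. snorm (z - x) < s}" "open {z. snorm (z - x) < s}" "bounded {z. snorm (z - x) < s}"
proof -
  have e: "{z. snorm (z - x) < s} = box (x - Complex s s) (x + Complex s s)"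
    unfolding snorm_def by (auto simp: in_box_complex_iff abs_less_iff)
  show "convex {z. snorm (z - x) < s}" "open {z. snorm (z - x) < s}" "bounded {z. snorm (z - x) < s}" unfolding e by auto
qed

text \<open>Local accessibility of a Jordan curve from a complementary region, by Janiszewski's theorem: the
  arc of the curve away from \<open>x\<close> together with the complement of \<open>N\<close> is connected.\<close>

lemma jordan_locally_connected:
  fixes c :: "real \<Rightarrow> complex"
  assumes c: "simple_path c" "pathfinish c = pathstart c" and x: "x \<in> path_image c"
    and U: "connected U" "U \<inter> path_image c = {}"
    and N: "open N" "convex N" "bounded N" "x \<in> N" "\<not> path_image c \<subseteq> N"
  obtains \<delta> where "\<delta> > 0" "\<And>a b. a \<in> U \<inter> ball x \<delta> \<Longrightarrow> b \<in> U \<inter> ball x \<delta> \<Longrightarrow> connected_component (N - path_image c) a b"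
proof -
  obtain t0 where t0: "t0 \<in> {0..1}" "c t0 = x" using x unfolding path_image_def by blast
  define d where "d = shiftpath t0 c"
  have d: "simple_path d" "path_image d = path_image c" "d 0 = x" "d 1 = x"
  proof -
    show "simple_path d" unfolding d_def using c t0 by (intro simple_path_shiftpath) auto
    show "path_image d = path_image c" unfolding d_def using c t0 by (intro path_image_shiftpath) auto
    show "d 0 = x" using t0 pathstart_shiftpath[of t0 c] unfolding d_def pathstart_def by auto
    show "d 1 = x" using t0 pathfinish_shiftpath[of t0 c] c unfolding d_def pathfinish_def by auto
  qed
  have contd: "continuous_on {0..1} d" using d(1) simple_path_imp_path path_def by blast
  obtain e where e: "e > 0" "\<And>z. dist z x < e \<Longrightarrow> z \<in> N" using N(1,4) unfolding open_dist by blast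
  obtain \<eta>0 where h0: "\<eta>0 > 0" "\<And>t. t \<in> {0..1} \<Longrightarrow> dist t 0 < \<eta>0 \<Longrightarrow> dist (d t) x < e"
    using contd[unfolded continuous_on_iff, rule_format, of 0 e] e(1) d(3) by auto
  obtain \<eta>1 where h1: "\<eta>1 > 0" "\<And>t. t \<in> {0..1} \<Longrightarrow> dist t 1 < \<eta>1 \<Longrightarrow> dist (d t) x < e"
    using contd[unfolded continuous_on_iff, rule_format, of 1 e] e(1) d(4) by auto
  define \<eta> where "\<eta> = min (min \<eta>0 \<eta>1) 1 / 3"
  have h: "0 < \<eta>" "\<eta> < \<eta>0" "\<eta> < \<eta>1" "\<eta> < 1/2" unfolding \<eta>_def using h0(1) h1(1) by (auto simp: min_def)
  define A where "A = d ` {\<eta>..1-\<eta>}"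
  have sub: "{\<eta>..1-\<eta>} \<subseteq> {0..1}" using h by auto
  have A: "compact A" "connected A" "A \<subseteq> path_image c"
    unfolding A_def using continuous_on_subset[OF contd sub] d(2) sub
    by (auto intro: compact_continuous_image connected_continuous_image simp: path_image_def)
  have xA: "x \<notin> A"
  proof
    assume "x \<in> A"
    then obtain t where t: "t \<in> {\<eta>..1-\<eta>}" "d t = x" unfolding A_def by blast
    have "0 < t" "t < 1" using t(1) h by auto
    then show False using d(1,3) t(2) unfolding simple_path_def loop_free_def
      by (metis atLeastAtMost_iff less_eq_real_def less_irrefl zero_less_one)
  qed
  have out: "z \<in> A" if z: "z \<in> path_image c" "z \<notin> N" for z
  proof -
    have "z \<in> d ` {0..1}" using z(1) d(2) unfolding path_image_def by simp
    then obtain t where t: "t \<in> {0..1}" "z = d t" by blast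
    have "\<not> dist t 0 < \<eta>0" "\<not> dist t 1 < \<eta>1" using t h0(2) h1(2) e(2) z(2) by blast+
    then have "t \<in> {\<eta>..1-\<eta>}" using t(1) h by (auto simp: dist_real_def)
    then show ?thesis using t unfolding A_def by blast
  qed
  obtain z0 where z0: "z0 \<in> path_image c" "z0 \<notin> N" using N(5) by blast
  define T where "T = A \<union> - N"
  have "connected (- N)" using N(2,3) connected_complement_bounded_convex[of N] by simp
  then have conT: "connected T" unfolding T_def using A(2) out[OF z0] z0 by (intro connected_Un) auto
  have cloT: "closed T" unfolding T_def using A(1) N(1) by (simp add: closed_Un compact_imp_closed closed_Compl)
  have "open (N - A)" using N(1) A(1) compact_imp_closed by blast
  then obtain \<delta> where \<delta>: "\<delta> > 0" "ball x \<delta> \<subseteq> N - A" using xA N(4) unfolding open_contains_ball by blast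
  show ?thesis
  proof (rule that[OF \<delta>(1)])
    fix a b assume a: "a \<in> U \<inter> ball x \<delta>" and b: "b \<in> U \<inter> ball x \<delta>"
    have "connected_component (- (path_image c \<union> T)) a b"
    proof (rule Janiszewski)
      show "compact (path_image c)" using c(1) by (simp add: compact_simple_path_image)
      show "closed T" by (rule cloT)
      have "path_image c \<inter> T = A" unfolding T_def using A(3) out by blast
      then show "connected (path_image c \<inter> T)" using A(2) by simp
      show "connected_component (- path_image c) a b"
        unfolding connected_component_def using U a b by (intro exI[of _ U]) auto
      show "connected_component (- T) a b"
        unfolding connected_component_def using \<delta>(2) a b by (intro exI[of _ "ball x \<delta>"]) (auto simp: T_def)
    qed
    then show "connected_component (N - path_image c) a b"
      by (rule connected_component_of_subset) (auto simp: T_def)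
  qed
qed

text \<open>Suppose no arc of the square of size \<open>s\<close> joins \<open>G1\<close> to
  \<open>G2\<close> off the curve. Split the angles off the curve into \<open>E\<close>, reachable
  from \<open>G1\<close>, and the rest \<open>E'\<close>; let \<open>K1\<close> be the curve with
  the part of the square outside \<open>E\<close>, and \<open>K2\<close> likewise with
  \<open>E'\<close>. Then \<open>G1\<close> avoids \<open>K1\<close> and joins a point
  \<open>b1\<close> inside the square to a point \<open>a1\<close> outside it. The detour from
  \<open>b1\<close> to \<open>b2\<close> inside, along \<open>G2\<close> to \<open>a2\<close>, and
  back to \<open>a1\<close> outside avoids \<open>K2\<close>. Since \<open>K1 \<inter> K2\<close> is
  the connected curve, Janiszewski's theorem joins \<open>b1\<close> to \<open>a1\<close> off
  \<open>K1 \<union> K2\<close>, which contains the whole square: a contradiction.\<close>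

lemma crossing_arc:
  fixes c :: "real \<Rightarrow> complex"
  assumes c: "simple_path c" "pathfinish c = pathstart c" and x: "x \<in> path_image c"
    and U: "open U" "connected U" "U \<inter> path_image c = {}"
    and G1: "connected G1" "G1 \<subseteq> U" "x \<in> closure G1" and G2: "connected G2" "G2 \<subseteq> U" "x \<in> closure G2"
  obtains s0 where "s0 > 0" "\<And>s. 0 < s \<Longrightarrow> s < s0 \<Longrightarrow>
     \<exists>\<theta>1 \<theta>2. sqp x s \<theta>1 \<in> G1 \<and> sqp x s \<theta>2 \<in> G2 \<and> sqp x s ` closed_segment \<theta>1 \<theta>2 \<inter> path_image c = {}"
proof -
  let ?J = "path_image c"
  have xU: "x \<notin> U" using U(3) x by blast
  obtain a1 a2 where a: "a1 \<in> G1" "a2 \<in> G2" using G1(3) G2(3) by (metis closure_empty empty_iff ex_in_conv)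
  have "path_connected U" using U connected_open_path_connected by blast
  then obtain g where g: "path g" "path_image g \<subseteq> U" "pathstart g = a1" "pathfinish g = a2"
    using a G1(2) G2(2) unfolding path_connected_def by blast
  define B where "B = path_image g"
  have B: "compact B" "connected B" "a1 \<in> B" "a2 \<in> B" "B \<subseteq> U" unfolding B_def using g by auto
  have "x \<in> - B" "open (- B)" using xU B compact_imp_closed by auto
  then obtain \<epsilon>1 where e1: "\<epsilon>1 > 0" "ball x \<epsilon>1 \<subseteq> - B" unfolding open_contains_ball by blast
  obtain x' where x': "x' \<in> ?J" "x' \<noteq> x"
  proof -
    have "loop_free c" using c(1) simple_path_def by blast
    then have "c 0 \<noteq> c (1/2)" using \<open>loop_free c\<close>[unfolded loop_free_def, rule_format, of 0 "1/2"] by auto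
    moreover have "c 0 \<in> ?J" "c (1/2) \<in> ?J" unfolding path_image_def by auto
    ultimately show ?thesis using that by metis
  qed
  \<comment> \<open>The first bound keeps the connecting path \<open>B\<close> outside the square,
    as \<open>cmod\<close> is at most twice \<open>snorm\<close>. The second keeps another point of
    the curve out of its interior, as \<open>jordan_locally_connected\<close> requires.\<close>
  define s0 where "s0 = min (\<epsilon>1/2) (snorm (x' - x))"
  have "snorm (x' - x) > 0" using x' unfolding snorm_def by (auto simp: less_max_iff_disj complex_eq_iff)
  then have s0: "s0 > 0" unfolding s0_def using e1 by auto
  show ?thesis
  proof (rule that[OF s0])
    fix s assume s: "0 < s" "s < s0"
    let ?p = "sqp x s"
    let ?N = "{z. snorm (z - x) < s}"
    show "\<exists>\<theta>1 \<theta>2. ?p \<theta>1 \<in> G1 \<and> ?p \<theta>2 \<in> G2 \<and> ?p ` closed_segment \<theta>1 \<theta>2 \<inter> ?J = {}"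
    proof (rule ccontr)
      assume no: "\<not> ?thesis"
      have outB: "s < snorm (z - x)" if "z \<in> B" for z
      proof (rule ccontr)
        assume "\<not> s < snorm (z - x)"
        then have "cmod (z - x) < \<epsilon>1" using snorm_bounds(2)[of "z - x"] s unfolding s0_def by simp
        then have "z \<in> ball x \<epsilon>1" by (simp add: dist_norm norm_minus_commute)
        then show False using e1(2) that by blast
      qed
      obtain \<delta> where \<delta>: "\<delta> > 0" "\<And>a b. a \<in> U \<inter> ball x \<delta> \<Longrightarrow> b \<in> U \<inter> ball x \<delta> \<Longrightarrow> connected_component (?N - ?J) a b"
      proof (rule jordan_locally_connected[OF c x U(2,3), of ?N])
        show "x \<in> ?N" using s by (simp add: snorm_def)
        show "\<not> ?J \<subseteq> ?N" using x' s unfolding s0_def by auto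
      qed (use convex_open_square in auto)
      obtain b1 b2 where b: "b1 \<in> G1" "dist b1 x < \<delta>" "b2 \<in> G2" "dist b2 x < \<delta>"
        using G1(3) G2(3) \<delta>(1) unfolding closure_approachable by blast
      define E where "E = {\<theta>. \<exists>\<theta>0. ?p \<theta>0 \<in> G1 \<and> ?p ` closed_segment \<theta>0 \<theta> \<inter> ?J = {}}"
      define E' where "E' = {\<theta>. ?p \<theta> \<notin> ?J} - E"
      have extend: "\<theta>' \<in> E" if "\<theta> \<in> E" "?p ` closed_segment \<theta> \<theta>' \<inter> ?J = {}" for \<theta> \<theta>'
      proof -
        obtain \<theta>0 where t: "?p \<theta>0 \<in> G1" "?p ` closed_segment \<theta>0 \<theta> \<inter> ?J = {}" using \<open>\<theta> \<in> E\<close> unfolding E_def by blast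
        have "closed_segment \<theta>0 \<theta>' \<subseteq> closed_segment \<theta>0 \<theta> \<union> closed_segment \<theta> \<theta>'"
          by (auto simp: closed_segment_eq_real_ivl)
        then have "?p ` closed_segment \<theta>0 \<theta>' \<inter> ?J = {}" using t(2) that(2) by blast
        then show ?thesis unfolding E_def using t(1) by blast
      qed
      have opO: "open {\<theta>. ?p \<theta> \<notin> ?J}"
      proof -
        have "open (?p -` (- ?J))" using c(1) continuous_on_sqp[of UNIV x s]
          by (intro open_vimage) (auto simp: compact_simple_path_image compact_imp_closed)
        then show ?thesis by (simp add: vimage_def)
      qed
      have nbhd: "\<exists>r>0. \<forall>\<theta>'\<in>ball \<theta> r. ?p ` closed_segment \<theta> \<theta>' \<inter> ?J = {} \<and> ?p ` closed_segment \<theta>' \<theta> \<inter> ?J = {}" if tJ: "?p \<theta> \<notin> ?J" for \<theta>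
      proof -
        obtain r where r: "r > 0" "ball \<theta> r \<subseteq> {\<theta>. ?p \<theta> \<notin> ?J}" using opO tJ unfolding open_contains_ball by blast
        have "closed_segment \<theta> \<theta>' \<subseteq> ball \<theta> r" "closed_segment \<theta>' \<theta> \<subseteq> ball \<theta> r" if "\<theta>' \<in> ball \<theta> r" for \<theta>'
          using that r(1) by (intro closed_segment_subset convex_ball; simp)+
        then show ?thesis using r by (intro exI[of _ r]) blast
      qed
      have EO: "\<theta> \<in> E \<Longrightarrow> ?p \<theta> \<notin> ?J" for \<theta> unfolding E_def by auto
      have opE: "open E" unfolding open_contains_ball
      proof
        fix \<theta> assume t: "\<theta> \<in> E"
        obtain r where "r > 0" "\<forall>\<theta>'\<in>ball \<theta> r. ?p ` closed_segment \<theta> \<theta>' \<inter> ?J = {}" using nbhd[OF EO[OF t]] by blast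
        then show "\<exists>e>0. ball \<theta> e \<subseteq> E" using extend[OF t] by blast
      qed
      have opE': "open E'" unfolding open_contains_ball
      proof
        fix \<theta> assume t: "\<theta> \<in> E'"
        then have tJ: "?p \<theta> \<notin> ?J" "\<theta> \<notin> E" unfolding E'_def by auto
        obtain r where r: "r > 0" "\<forall>\<theta>'\<in>ball \<theta> r. ?p ` closed_segment \<theta> \<theta>' \<inter> ?J = {} \<and> ?p ` closed_segment \<theta>' \<theta> \<inter> ?J = {}" using nbhd[OF tJ(1)] by blast
        have "\<theta>' \<in> E'" if "\<theta>' \<in> ball \<theta> r" for \<theta>'
        proof -
          have "?p \<theta>' \<notin> ?J" using r(2) that ends_in_segment(2)[of \<theta> \<theta>'] by blast
          moreover have "\<theta>' \<notin> E" using extend[of \<theta>' \<theta>] r(2) that tJ(2) by blast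
          ultimately show ?thesis unfolding E'_def by blast
        qed
        then show "\<exists>e>0. ball \<theta> e \<subseteq> E'" using r(1) by blast
      qed
      \<comment> \<open>Membership in \<open>E\<close> does not depend on the angle chosen modulo
        full turns; this is what makes \<open>K1\<close> and \<open>K2\<close> meet in the curve
        alone.\<close>
      have perE: "\<theta> + 2 * pi * of_int k \<in> E" if tE: "\<theta> \<in> E" for \<theta> and k :: int
      proof -
        let ?h = "2 * pi * of_int k :: real"
        obtain \<theta>0 where t: "?p \<theta>0 \<in> G1" "?p ` closed_segment \<theta>0 \<theta> \<inter> ?J = {}" using tE unfolding E_def by blast
        have "closed_segment (\<theta>0 + ?h) (\<theta> + ?h) = (\<lambda>y. y + ?h) ` closed_segment \<theta>0 \<theta>"
          using closed_segment_translation[of ?h \<theta>0 \<theta>] by (simp add: add.commute image_def)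
        then have "?p ` closed_segment (\<theta>0 + ?h) (\<theta> + ?h) = ?p ` closed_segment \<theta>0 \<theta>"
          by (simp add: image_image sqp_periodic)
        then show ?thesis unfolding E_def using t sqp_periodic by (metis (mono_tags, lifting) mem_Collect_eq)
      qed
      define K1 where "K1 = ?J \<union> ?p ` ({0..2*pi} - E)"
      define K2 where "K2 = ?J \<union> ?p ` ({0..2*pi} - E')"
      have cK: "compact (?p ` ({0..2*pi} - X))" if "open X" for X
        using that by (intro compact_continuous_image continuous_on_sqp compact_diff) auto
      have cJ: "compact ?J" using c(1) by (simp add: compact_simple_path_image)
      have comp: "compact K1" "closed K2"
        unfolding K1_def K2_def using cJ cK[OF opE] cK[OF opE'] by (auto intro: compact_Un compact_imp_closed)
      have int: "K1 \<inter> K2 = ?J"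
      proof
        show "?J \<subseteq> K1 \<inter> K2" unfolding K1_def K2_def by blast
        show "K1 \<inter> K2 \<subseteq> ?J"
        proof
          fix z assume z: "z \<in> K1 \<inter> K2"
          show "z \<in> ?J"
          proof (rule ccontr)
            assume zJ: "z \<notin> ?J"
            then obtain \<theta> \<theta>' where t: "\<theta> \<notin> E" "\<theta>' \<notin> E'" "z = ?p \<theta>" "z = ?p \<theta>'" using z unfolding K1_def K2_def by blast
            have "\<theta>' \<in> E" using t(2,4) zJ unfolding E'_def by blast
            moreover obtain k :: int where "\<theta> = \<theta>' + 2 * pi * of_int k" using sqp_eqD[OF s(1), of x \<theta> \<theta>'] t by metis
            ultimately show False using perE t(1) by blast
          qed
        qed
      qed
      have G1K: "G1 \<inter> K1 = {}"
      proof (rule ccontr)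
        assume "\<not> ?thesis"
        then obtain z where z: "z \<in> G1" "z \<in> K1" by blast
        have zJ: "z \<notin> ?J" using z G1(2) U(3) by blast
        then obtain \<theta> where "\<theta> \<notin> E" "z = ?p \<theta>" using z unfolding K1_def by blast
        then show False using z(1) zJ unfolding E_def by (auto intro!: exI[of _ \<theta>])
      qed
      have G2K: "G2 \<inter> K2 = {}"
      proof (rule ccontr)
        assume "\<not> ?thesis"
        then obtain z where z: "z \<in> G2" "z \<in> K2" by blast
        have zJ: "z \<notin> ?J" using z G2(2) U(3) by blast
        then obtain \<theta> where t: "\<theta> \<notin> E'" "z = ?p \<theta>" using z unfolding K2_def by blast
        then have "\<theta> \<in> E" using zJ unfolding E'_def by blast
        then show False using no z(1) t(2) unfolding E_def by blast
      qed
      have onC: "snorm (z - x) = s" if "z \<in> K1 \<union> K2" "z \<notin> ?J" for z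
        using that snorm_sqp[OF s(1)] unfolding K1_def K2_def by auto
      have BK: "B \<inter> (K1 \<union> K2) = {}"
      proof (rule ccontr)
        assume "\<not> ?thesis"
        then obtain z where z: "z \<in> B" "z \<in> K1 \<union> K2" by blast
        then have "z \<notin> ?J" using B(5) U(3) by blast
        then show False using onC[OF z(2)] outB[OF z(1)] by simp
      qed
      have cB: "connected_component (- (K1 \<union> K2)) a1 a2" unfolding connected_component_def using B BK by (intro exI[of _ B]) auto
      have "connected_component (?N - ?J) b1 b2" using \<delta>(2) b G1(2) G2(2) by (simp add: dist_commute subset_iff)
      moreover have "?N - ?J \<subseteq> - (K1 \<union> K2)" using onC by auto
      ultimately have cb: "connected_component (- (K1 \<union> K2)) b1 b2" using connected_component_of_subset by blast
      have s1: "connected_component (- K1) b1 a1"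
        unfolding connected_component_def using G1 G1K b a by (intro exI[of _ G1]) auto
      have s2: "connected_component (- K2) b2 a2"
        unfolding connected_component_def using G2 G2K b a by (intro exI[of _ G2]) auto
      have "connected_component (- K2) b1 b2" "connected_component (- K2) a1 a2"
        using cb cB connected_component_of_subset[of "- (K1 \<union> K2)" _ _ "- K2"] by auto
      then have s2': "connected_component (- K2) b1 a1" using s2 by (meson connected_component_sym connected_component_trans)
      have "connected_component (- (K1 \<union> K2)) b1 a1"
        by (rule Janiszewski[OF comp]) (use s1 s2' int c(1) connected_simple_path_image in auto)
      then obtain T where T: "connected T" "T \<subseteq> - (K1 \<union> K2)" "b1 \<in> T" "a1 \<in> T" unfolding connected_component_def by blast
      have "snorm (b1 - x) < s" using connected_component_in[OF \<open>connected_component (?N - ?J) b1 b2\<close>] by auto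
      moreover have "s < snorm (a1 - x)" using outB B by blast
      ultimately obtain z where z: "z \<in> T" "snorm (z - x) = s" using snorm_crossing[OF T(1,3,4)] by blast
      then obtain \<theta> where t: "\<theta> \<in> {0..2*pi}" "z = ?p \<theta>" using sqp_surj[OF s(1)] by metis
      have "E \<inter> E' = {}" unfolding E'_def by blast
      then have "z \<in> K1 \<union> K2" unfolding K1_def K2_def using t by blast
      then show False using z(1) T(2) by blast
    qed
  qed
qed

text \<open>The corners of the square are the zeros of \<open>cos (2 * \<theta>)\<close>.\<close>

lemma sqp_side:
  assumes s: "s > 0" and t: "\<theta> \<le> \<theta>'" and ne: "\<And>\<tau>. \<theta> < \<tau> \<Longrightarrow> \<tau> < \<theta>' \<Longrightarrow> cos (2 * \<tau>) \<noteq> 0"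
  shows "(\<exists>\<epsilon>\<in>{1,-1}. \<forall>\<tau>\<in>{\<theta>..\<theta>'}. Re (sqp x s \<tau>) = Re x + \<epsilon> * s) \<or>
         (\<exists>\<epsilon>\<in>{1,-1}. \<forall>\<tau>\<in>{\<theta>..\<theta>'}. Im (sqp x s \<tau>) = Im x + \<epsilon> * s)"
proof (cases "\<theta> = \<theta>'")
  case True
  have "\<bar>Re (sqp x s \<theta>) - Re x\<bar> = s \<or> \<bar>Im (sqp x s \<theta>) - Im x\<bar> = s"
    using snorm_sqp[OF s, of x \<theta>] unfolding snorm_def by (auto simp: max_def split: if_splits)
  then show ?thesis using True by (auto simp: abs_if split: if_splits)
next
  case False
  then have lt: "\<theta> < \<theta>'" using t by simp
  have sgn: "(\<forall>\<tau>\<in>{\<theta><..<\<theta>'}. 0 < cos (2 * \<tau>)) \<or> (\<forall>\<tau>\<in>{\<theta><..<\<theta>'}. cos (2 * \<tau>) < 0)"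
  proof (rule ccontr)
    assume "\<not> ?thesis"
    then obtain u v where uv: "u \<in> {\<theta><..<\<theta>'}" "v \<in> {\<theta><..<\<theta>'}" "cos (2 * u) < 0" "0 < cos (2 * v)"
      using ne by (metis greaterThanLessThan_iff linorder_neqE_linordered_idom)
    have "connected ((\<lambda>\<tau>. cos (2 * \<tau>)) ` {\<theta><..<\<theta>'})" by (intro connected_continuous_image continuous_intros) auto
    then have "0 \<in> (\<lambda>\<tau>. cos (2 * \<tau>)) ` {\<theta><..<\<theta>'}"
      using connectedD_interval[of _ "cos (2 * u)" "cos (2 * v)" 0] uv by (meson imageI less_imp_le)
    then show False using ne by auto
  qed
  have cl: "closure {\<theta><..<\<theta>'} = {\<theta>..\<theta>'}" using lt by simp
  have dc: "cos (2 * \<tau>) = (cos \<tau>)\<^sup>2 - (sin \<tau>)\<^sup>2" for \<tau> :: real by (rule cos_double)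
  have const: "\<exists>\<epsilon>\<in>{1,-1}. \<forall>\<tau>\<in>{\<theta>..\<theta>'}. q \<tau> = \<epsilon>" if q: "continuous_on {\<theta>..\<theta>'} q" "\<And>\<tau>. \<tau> \<in> {\<theta>..\<theta>'} \<Longrightarrow> q \<tau> \<in> {1,-1}" for q :: "real \<Rightarrow> real"
  proof -
    have "finite (q ` {\<theta>..\<theta>'})" by (rule finite_subset[OF image_subsetI[OF q(2)]]) auto
    then have "q constant_on {\<theta>..\<theta>'}" using continuous_finite_range_constant[OF _ q(1)] by auto
    then obtain y where "\<forall>\<tau>\<in>{\<theta>..\<theta>'}. q \<tau> = y" unfolding constant_on_def by blast
    then show ?thesis using q(2)[of \<theta>] lt by (intro bexI[of _ y]) auto
  qed
  have contR: "continuous_on {\<theta>..\<theta>'} (\<lambda>\<tau>. (Re (sqp x s \<tau>) - Re x) / s)" "continuous_on {\<theta>..\<theta>'} (\<lambda>\<tau>. (Im (sqp x s \<tau>) - Im x) / s)"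
    using s by (auto intro!: continuous_intros continuous_on_sqp)
  from sgn show ?thesis
  proof
    assume pos: "\<forall>\<tau>\<in>{\<theta><..<\<theta>'}. 0 < cos (2 * \<tau>)"
    have "closed {\<tau>::real. 0 \<le> cos (2 * \<tau>)}" by (intro closed_Collect_le continuous_intros)
    then have "{\<theta>..\<theta>'} \<subseteq> {\<tau>. 0 \<le> cos (2 * \<tau>)}" unfolding cl[symmetric] by (rule closure_minimal[rotated]) (use pos less_imp_le in auto)
    then have le: "\<bar>sin \<tau>\<bar> \<le> \<bar>cos \<tau>\<bar>" if "\<tau> \<in> {\<theta>..\<theta>'}" for \<tau> using that dc[of \<tau>] by (auto simp: abs_le_square_iff)
    have "(Re (sqp x s \<tau>) - Re x) / s \<in> {1,-1}" if "\<tau> \<in> {\<theta>..\<theta>'}" for \<tau>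
    proof -
      have m: "max \<bar>cos \<tau>\<bar> \<bar>sin \<tau>\<bar> = \<bar>cos \<tau>\<bar>" using le[OF that] by (rule max.absorb1)
      then have p: "\<bar>cos \<tau>\<bar> > 0" using max_cos_sin_pos[of \<tau>] by simp
      have "(Re (sqp x s \<tau>) - Re x) / s = cos \<tau> / \<bar>cos \<tau>\<bar>" using s unfolding sqp_def m by simp
      then show ?thesis using p by (cases "cos \<tau> > 0") auto
    qed
    then obtain \<epsilon> where "\<epsilon> \<in> {1,-1}" "\<forall>\<tau>\<in>{\<theta>..\<theta>'}. (Re (sqp x s \<tau>) - Re x) / s = \<epsilon>" using const[OF contR(1)] by blast
    then show ?thesis using s by (intro disjI1 bexI[of _ \<epsilon>]) (auto simp: field_simps)
  next
    assume pos: "\<forall>\<tau>\<in>{\<theta><..<\<theta>'}. cos (2 * \<tau>) < 0"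
    have "closed {\<tau>::real. cos (2 * \<tau>) \<le> 0}" by (intro closed_Collect_le continuous_intros)
    then have "{\<theta>..\<theta>'} \<subseteq> {\<tau>. cos (2 * \<tau>) \<le> 0}" unfolding cl[symmetric] by (rule closure_minimal[rotated]) (use pos less_imp_le in auto)
    then have le: "\<bar>cos \<tau>\<bar> \<le> \<bar>sin \<tau>\<bar>" if "\<tau> \<in> {\<theta>..\<theta>'}" for \<tau> using that dc[of \<tau>] by (auto simp: abs_le_square_iff)
    have "(Im (sqp x s \<tau>) - Im x) / s \<in> {1,-1}" if "\<tau> \<in> {\<theta>..\<theta>'}" for \<tau>
    proof -
      have m: "max \<bar>cos \<tau>\<bar> \<bar>sin \<tau>\<bar> = \<bar>sin \<tau>\<bar>" using le[OF that] by (rule max.absorb2)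
      then have p: "\<bar>sin \<tau>\<bar> > 0" using max_cos_sin_pos[of \<tau>] by simp
      have "(Im (sqp x s \<tau>) - Im x) / s = sin \<tau> / \<bar>sin \<tau>\<bar>" using s unfolding sqp_def m by simp
      then show ?thesis using p by (cases "sin \<tau> > 0") auto
    qed
    then obtain \<epsilon> where "\<epsilon> \<in> {1,-1}" "\<forall>\<tau>\<in>{\<theta>..\<theta>'}. (Im (sqp x s \<tau>) - Im x) / s = \<epsilon>" using const[OF contR(2)] by blast
    then show ?thesis using s by (intro disjI2 bexI[of _ \<epsilon>]) (auto simp: field_simps)
  qed
qed

text \<open>Both doubled angles are odd multiples of a right angle, so they differ by an even one.
  Thus at most one corner lies strictly inside an arc of a quarter turn.\<close>

lemma cos_double_zeros:
  assumes "cos (2 * u) = 0" "cos (2 * v) = 0" "\<bar>u - v\<bar> < pi / 2" shows "u = (v::real)"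
proof -
  obtain m n :: int where mn: "odd m" "2 * u = of_int m * (pi/2)" "odd n" "2 * v = of_int n * (pi/2)"
    using assms(1,2) unfolding cos_zero_iff_int by blast
  then have "2 * (u - v) = of_int (m - n) * (pi/2)" by (simp add: algebra_simps)
  then have "\<bar>2 * (u - v)\<bar> = \<bar>of_int (m - n)\<bar> * (pi/2)" by (simp only: abs_mult) simp
  moreover have "\<bar>2 * (u - v)\<bar> = 2 * \<bar>u - v\<bar>" by (simp add: abs_mult del: right_diff_distrib_numeral)
  ultimately have "\<bar>of_int (m - n)\<bar> * (pi/2) = 2 * \<bar>u - v\<bar>" by metis
  also have "\<dots> < 2 * (pi/2)" using assms(3) by simp
  finally have "\<bar>of_int (m - n)\<bar> * (pi/2) < 2 * (pi/2)" .
  then have "\<bar>of_int (m - n) :: real\<bar> < 2" using mult_less_cancel_right_pos[of "pi/2" "\<bar>of_int (m - n)\<bar>" 2] pi_gt_zero by simp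
  then have "\<bar>m - n\<bar> < 2" by linarith
  moreover have "even (m - n)" using mn by simp
  ultimately have "m = n" by presburger
  then show ?thesis using mn by simp
qed

section \<open>Estimates along generic segments\<close>

context carpet_domain
begin

text \<open>Paths and squares may start or end inside a disk, where \<open>g\<close> carries no
  information. Any number between infimum and supremum over the circle would do at the cost of one
  oscillation; the supremum is the one that enters the boundary values.\<close>

definition hat :: "(complex \<Rightarrow> ereal) \<Rightarrow> complex \<Rightarrow> real" where
  "hat g z = (if \<exists>i. z \<in> Q i then rM g (THE i. z \<in> Q i) else val g z)"

lemma hat_Q: "z \<in> Q i \<Longrightarrow> hat g z = rM g i"
proof -
  assume z: "z \<in> Q i"
  then have "(THE i. z \<in> Q i) = i" using Q_disjoint by blast
  then show ?thesis unfolding hat_def using z by auto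
qed

lemma hat_S: "z \<in> S \<Longrightarrow> hat g z = val g z"
  unfolding hat_def using Q_not_S by auto

lemma path_in_one_disk:
  assumes g: "\<gamma> \<in> paths_in \<Omega>" and J: "J \<subseteq> fst \<gamma>" "is_interval J" "t0 \<in> J" and no: "\<And>t. t \<in> J \<Longrightarrow> snd \<gamma> t \<notin> S"
  obtains i where "\<And>t. t \<in> J \<Longrightarrow> snd \<gamma> t \<in> Q i"
proof -
  obtain i where i: "snd \<gamma> t0 \<in> Q i" using no[OF J(3)] S_iff path_range[OF g] J by blast
  have "snd \<gamma> t \<in> Q i" if t: "t \<in> J" for t
  proof (rule ccontr)
    assume n: "snd \<gamma> t \<notin> Q i"
    have sub: "closed_segment t0 t \<subseteq> J" using interval_segment[OF J(2,3) t] .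
    then have "continuous_on (closed_segment t0 t) (snd \<gamma>)" using continuous_on_subset[OF path_continuous[OF g]] J(1) by blast
    then obtain \<kappa> where "\<kappa> \<in> closed_segment t0 t" "snd \<gamma> \<kappa> \<in> frontier (Q i)" using segment_exit i n by metis
    then show False using no sub frontier_Q_subset by blast
  qed
  then show ?thesis using that by blast
qed

lemma exit_stop:
  assumes g: "\<gamma> \<in> paths_in \<Omega>" and J: "J \<subseteq> fst \<gamma>" "is_interval J" "t \<in> J" "s \<in> J" and q: "snd \<gamma> t \<in> Q i" "snd \<gamma> s \<notin> Q i"
  obtains \<kappa> where "\<kappa> \<in> J" "snd \<gamma> \<kappa> \<in> frontier (Q i)" "snd \<gamma> \<kappa> \<in> S"
proof -
  have sub: "closed_segment t s \<subseteq> J" using interval_segment[OF J(2,3,4)] .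
  then have "continuous_on (closed_segment t s) (snd \<gamma>)" using continuous_on_subset[OF path_continuous[OF g]] J(1) by blast
  then obtain \<kappa> where "\<kappa> \<in> closed_segment t s" "snd \<gamma> \<kappa> \<in> frontier (Q i)" using segment_exit q by metis
  then show ?thesis using that sub frontier_Q_subset by blast
qed

text \<open>The factor 2 pays once for the oscillation of the disk around
  \<open>snd \<gamma> t\<close> and once for the way from its frontier to the stop.\<close>

lemma hat_near_stop:
  assumes n: "nice (osc Q g) g \<gamma>" and f: "fin g" and J: "J \<subseteq> fst \<gamma>" "is_interval J" "t \<in> J" "s \<in> J" "snd \<gamma> s \<in> S"
  shows "ennreal \<bar>hat g (snd \<gamma> t) - val g (snd \<gamma> s)\<bar> \<le> 2 * sum_over (meeting Q (snd \<gamma> ` J)) (osc Q g)"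
proof -
  let ?X = "sum_over (meeting Q (snd \<gamma> ` J)) (osc Q g)"
  have g: "\<gamma> \<in> paths_in \<Omega>" using n unfolding nice_def by blast
  show ?thesis
  proof (cases "snd \<gamma> t \<in> S")
    case True
    have "ennreal \<bar>hat g (snd \<gamma> t) - val g (snd \<gamma> s)\<bar> \<le> ?X"
      unfolding hat_S[OF True] by (rule nice_interval[OF n J(1-4) True J(5)])
    also have "\<dots> \<le> 2 * ?X" by (simp add: mult_2)
    finally show ?thesis .
  next
    case False
    then obtain i where i: "snd \<gamma> t \<in> Q i" using S_iff path_range[OF g] J by blast
    obtain \<kappa> where k: "\<kappa> \<in> J" "snd \<gamma> \<kappa> \<in> frontier (Q i)" "snd \<gamma> \<kappa> \<in> S"
      using exit_stop[OF g J(1-4) i] Q_not_S J(5) by blast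
    have "\<bar>rM g i - val g (snd \<gamma> \<kappa>)\<bar> \<le> ro g i" using fin_bounds[OF f k(2)] by auto
    then have "ennreal \<bar>rM g i - val g (snd \<gamma> \<kappa>)\<bar> \<le> osc Q g i" unfolding osc_eq[OF f] by (rule ennreal_leI)
    also have "\<dots> \<le> ?X" by (rule sum_over_ge) (use i J in \<open>auto simp: meeting_def\<close>)
    finally have 1: "ennreal \<bar>rM g i - val g (snd \<gamma> \<kappa>)\<bar> \<le> ?X" .
    have 2: "ennreal \<bar>val g (snd \<gamma> \<kappa>) - val g (snd \<gamma> s)\<bar> \<le> ?X"
      by (rule nice_interval[OF n J(1,2) k(1) J(4) k(3) J(5)])
    have "ennreal \<bar>rM g i - val g (snd \<gamma> s)\<bar> \<le> ennreal (\<bar>rM g i - val g (snd \<gamma> \<kappa>)\<bar> + \<bar>val g (snd \<gamma> \<kappa>) - val g (snd \<gamma> s)\<bar>)"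
      by (rule ennreal_leI) linarith
    also have "\<dots> = ennreal \<bar>rM g i - val g (snd \<gamma> \<kappa>)\<bar> + ennreal \<bar>val g (snd \<gamma> \<kappa>) - val g (snd \<gamma> s)\<bar>" by simp
    also have "\<dots> \<le> ?X + ?X" using 1 2 by (rule add_mono)
    finally show ?thesis unfolding hat_Q[OF i] by (simp add: mult_2)
  qed
qed

lemma hat_path:
  assumes n: "nice (osc Q g) g \<gamma>" and f: "fin g" and J: "J \<subseteq> fst \<gamma>" "is_interval J" "t \<in> J" "s \<in> J"
  shows "ennreal \<bar>hat g (snd \<gamma> t) - hat g (snd \<gamma> s)\<bar> \<le> 4 * sum_over (meeting Q (snd \<gamma> ` J)) (osc Q g)"
proof (cases "\<exists>\<kappa>\<in>J. snd \<gamma> \<kappa> \<in> S")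
  case True
  let ?X = "sum_over (meeting Q (snd \<gamma> ` J)) (osc Q g)"
  obtain \<kappa> where k: "\<kappa> \<in> J" "snd \<gamma> \<kappa> \<in> S" using True by blast
  have "ennreal \<bar>hat g (snd \<gamma> t) - hat g (snd \<gamma> s)\<bar> \<le> ennreal (\<bar>hat g (snd \<gamma> t) - val g (snd \<gamma> \<kappa>)\<bar> + \<bar>hat g (snd \<gamma> s) - val g (snd \<gamma> \<kappa>)\<bar>)"
    by (rule ennreal_leI) linarith
  also have "\<dots> = ennreal \<bar>hat g (snd \<gamma> t) - val g (snd \<gamma> \<kappa>)\<bar> + ennreal \<bar>hat g (snd \<gamma> s) - val g (snd \<gamma> \<kappa>)\<bar>" by simp
  also have "\<dots> \<le> 2 * ?X + 2 * ?X"
    by (rule add_mono) (rule hat_near_stop[OF n f J(1,2) _ k]; use J in simp)+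
  also have "\<dots> = 4 * ?X" by (simp add: mult_2[symmetric] mult.assoc[symmetric] flip: distrib_right)
  finally show ?thesis .
next
  case False
  then obtain i where "\<And>t. t \<in> J \<Longrightarrow> snd \<gamma> t \<in> Q i"
    using path_in_one_disk[OF _ J(1,2,3)] n unfolding nice_def by metis
  then have "snd \<gamma> t \<in> Q i" "snd \<gamma> s \<in> Q i" using J by auto
  then have "hat g (snd \<gamma> t) = rM g i" "hat g (snd \<gamma> s) = rM g i" by (simp_all add: hat_Q)
  then show ?thesis by simp
qed

definition generic_x :: "(cpath \<Rightarrow> bool) \<Rightarrow> real \<Rightarrow> bool" where
  "generic_x P x \<longleftrightarrow> (\<forall>I. (I, \<lambda>y. Complex x y) \<in> paths_in \<Omega> \<longrightarrow> P (I, \<lambda>y. Complex x y))"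

definition generic_y :: "(cpath \<Rightarrow> bool) \<Rightarrow> real \<Rightarrow> bool" where
  "generic_y P y \<longleftrightarrow> (\<forall>I. (I, \<lambda>x. Complex x y) \<in> paths_in \<Omega> \<longrightarrow> P (I, \<lambda>x. Complex x y))"

lemma AE_generic: "aep P \<Longrightarrow> AE x in lborel. generic_x P x" "aep P \<Longrightarrow> AE y in lborel. generic_y P y"
  using aep_vertical aep_horizontal unfolding generic_x_def generic_y_def by auto

lemma line_path:
  assumes c: "continuous_on UNIV c" and I: "is_interval I" "bounded I" "a \<in> I" "b \<in> I" "c a \<noteq> c b" "c ` I \<subseteq> \<Omega>"
  shows "(I, c) \<in> paths_in \<Omega>"
proof -
  have "continuous_on (closure I) c" using c continuous_on_subset by blast
  then show ?thesis using I unfolding paths_in_def is_path_def path_trace_def by auto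
qed

lemma continuous_Complex: "continuous_on UNIV (\<lambda>y. Complex x y)" "continuous_on UNIV (\<lambda>x. Complex x y)"
  by (auto simp: Complex_eq intro!: continuous_intros)

text \<open>The map \<open>p\<close> may run back and forth along its line. Its coordinate
  \<open>q\<close> takes all values between \<open>q s\<close> and \<open>q t\<close>, so the line
  in its standard parametrization between these coordinates stays in the image of \<open>p\<close>
  and is a path to which genericity applies.\<close>

lemma hat_segment:
  assumes P: "P = (\<lambda>\<gamma>. nice (osc Q g) g \<gamma>)" and f: "fin g"
    and gen: "(\<exists>x. generic_x P x \<and> (\<forall>\<tau>\<in>I. Re (p \<tau>) = x)) \<or> (\<exists>y. generic_y P y \<and> (\<forall>\<tau>\<in>I. Im (p \<tau>) = y))"
    and p: "continuous_on I p" "is_interval I" "p ` I \<subseteq> \<Omega>" "p ` I \<subseteq> C" and st: "s \<in> I" "(t::real) \<in> I"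
  shows "ennreal \<bar>hat g (p s) - hat g (p t)\<bar> \<le> 4 * sum_over (meeting Q C) (osc Q g)"
proof (cases "p s = p t")
  case False
  have con: "connected I" using p(2) is_interval_connected by blast
  have seg: "closed_segment (q s) (q t) \<subseteq> q ` I" if "continuous_on I q" for q :: "real \<Rightarrow> real"
  proof -
    have "connected (q ` I)" using con that by (intro connected_continuous_image)
    then show ?thesis using st by (intro interval_segment) (auto simp: is_interval_connected_1)
  qed
  have main: "ennreal \<bar>hat g (p s) - hat g (p t)\<bar> \<le> 4 * sum_over (meeting Q C) (osc Q g)"
    if c: "continuous_on UNIV c" and q: "continuous_on I q" "\<And>\<tau>. \<tau> \<in> I \<Longrightarrow> p \<tau> = c (q \<tau>)"
      and gc: "\<And>J. (J, c) \<in> paths_in \<Omega> \<Longrightarrow> nice (osc Q g) g (J, c)" for c and q :: "real \<Rightarrow> real"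
  proof -
    let ?J = "closed_segment (q s) (q t)"
    have sub: "c ` ?J \<subseteq> p ` I" using seg[OF q(1)] q(2) by force
    have Ji: "is_interval ?J" by (simp add: is_interval_convex_1)
    have "(?J, c) \<in> paths_in \<Omega>"
      by (rule line_path[OF c Ji _ ends_in_segment]) (use False q(2) st sub p(3) in \<open>auto simp: compact_imp_bounded\<close>)
    from hat_path[OF gc[OF this] f _ Ji, of "q s" "q t"]
    have "ennreal \<bar>hat g (p s) - hat g (p t)\<bar> \<le> 4 * sum_over (meeting Q (c ` ?J)) (osc Q g)" using q(2) st by simp
    also have "\<dots> \<le> 4 * sum_over (meeting Q C) (osc Q g)"
      using sub p(4) by (intro mult_left_mono sum_over_mono_set meeting_mono) auto
    finally show ?thesis .
  qed
  from gen show ?thesis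
  proof
    assume "\<exists>x. generic_x P x \<and> (\<forall>\<tau>\<in>I. Re (p \<tau>) = x)"
    then obtain x where x: "generic_x P x" "\<forall>\<tau>\<in>I. Re (p \<tau>) = x" by blast
    show ?thesis by (rule main[OF continuous_Complex(1)[of x], of "\<lambda>\<tau>. Im (p \<tau>)"])
      (use x p P in \<open>auto simp: complex_eq_iff generic_x_def intro!: continuous_intros\<close>)
  next
    assume "\<exists>y. generic_y P y \<and> (\<forall>\<tau>\<in>I. Im (p \<tau>) = y)"
    then obtain y where y: "generic_y P y" "\<forall>\<tau>\<in>I. Im (p \<tau>) = y" by blast
    show ?thesis by (rule main[OF continuous_Complex(2)[of y], of "\<lambda>\<tau>. Re (p \<tau>)"])
      (use y p P in \<open>auto simp: complex_eq_iff generic_y_def intro!: continuous_intros\<close>)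
  qed
qed simp

definition generic_square :: "(cpath \<Rightarrow> bool) \<Rightarrow> complex \<Rightarrow> real \<Rightarrow> bool" where
  "generic_square P x s \<longleftrightarrow> generic_x P (Re x + s) \<and> generic_x P (Re x - s) \<and> generic_y P (Im x + s) \<and> generic_y P (Im x - s)"

abbreviation "square x s \<equiv> {z. snorm (z - x) = s}"

text \<open>A quarter turn has at most one corner inside, hence consists of at most two segments on
  generic lines, each costing \<open>4 * ?X\<close>; \<open>n\<close> counts quarter turns.\<close>

lemma hat_square_arc:
  assumes f: "fin g" and gen: "generic_square (\<lambda>\<gamma>. nice (osc Q g) g \<gamma>) x s" and s: "s > 0"
    and arc: "sqp x s ` {\<theta>..\<theta>'} \<subseteq> \<Omega>" and t: "\<theta> \<le> \<theta>'" "\<theta>' \<le> \<theta> + real n * (pi/2)"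
  shows "ennreal \<bar>hat g (sqp x s \<theta>) - hat g (sqp x s \<theta>')\<bar> \<le> of_nat (8 * n) * sum_over (meeting Q (square x s)) (osc Q g)"
proof -
  let ?X = "sum_over (meeting Q (square x s)) (osc Q g)"
  let ?d = "\<lambda>\<theta> \<theta>'. ennreal \<bar>hat g (sqp x s \<theta>) - hat g (sqp x s \<theta>')\<bar>"
  have tri: "?d a c \<le> ?d a b + ?d b c" for a b c
  proof -
    have "?d a c \<le> ennreal (\<bar>hat g (sqp x s a) - hat g (sqp x s b)\<bar> + \<bar>hat g (sqp x s b) - hat g (sqp x s c)\<bar>)" by (rule ennreal_leI) linarith
    then show ?thesis by simp
  qed
  have side: "?d a b \<le> 4 * ?X" if ab: "a \<le> b" "{a..b} \<subseteq> {\<theta>..\<theta>'}" and ne: "\<And>\<tau>. a < \<tau> \<Longrightarrow> \<tau> < b \<Longrightarrow> cos (2 * \<tau>) \<noteq> 0" for a b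
  proof (rule hat_segment[OF refl f, of "{a..b}"])
    show "(\<exists>u. generic_x (\<lambda>\<gamma>. nice (osc Q g) g \<gamma>) u \<and> (\<forall>\<tau>\<in>{a..b}. Re (sqp x s \<tau>) = u)) \<or>
      (\<exists>u. generic_y (\<lambda>\<gamma>. nice (osc Q g) g \<gamma>) u \<and> (\<forall>\<tau>\<in>{a..b}. Im (sqp x s \<tau>) = u))"
      using sqp_side[OF s ab(1) ne, of x] gen unfolding generic_square_def by fastforce
    show "sqp x s ` {a..b} \<subseteq> \<Omega>" using arc ab by blast
    show "sqp x s ` {a..b} \<subseteq> square x s" using snorm_sqp[OF s] by auto
  qed (use ab continuous_on_sqp in auto)
  have two: "?d a b \<le> 8 * ?X" if ab: "a \<le> b" "{a..b} \<subseteq> {\<theta>..\<theta>'}" "b \<le> a + pi/2" for a b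
  proof (cases "\<exists>c. a < c \<and> c < b \<and> cos (2 * c) = 0")
    case True
    then obtain c where c: "a < c" "c < b" "cos (2 * c) = 0" by blast
    have ne: "cos (2 * \<tau>) \<noteq> 0" if "a < \<tau>" "\<tau> < b" "\<tau> \<noteq> c" for \<tau>
    proof -
      have "\<bar>\<tau> - c\<bar> < pi / 2" using that ab(3) c by linarith
      then show ?thesis using cos_double_zeros[OF _ c(3), of \<tau>] that(3) by blast
    qed
    have "?d a c \<le> 4 * ?X" "?d c b \<le> 4 * ?X" using c ab ne by (auto intro!: side)
    then have "?d a b \<le> 4 * ?X + 4 * ?X" using tri[of a b c] by (meson add_mono order_trans)
    also have "\<dots> = 8 * ?X" by (simp flip: distrib_right)
    finally show ?thesis .
  next
    case False
    then have "?d a b \<le> 4 * ?X" using ab by (intro side) auto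
    also have "\<dots> \<le> 8 * ?X" by (rule mult_right_mono) auto
    finally show ?thesis .
  qed
  have "?d a b \<le> of_nat (8 * n) * ?X" if "a \<le> b" "{a..b} \<subseteq> {\<theta>..\<theta>'}" "b \<le> a + real n * (pi/2)" for a b
    using that
  proof (induction n arbitrary: a)
    case (Suc n)
    show ?case
    proof (cases "b \<le> a + pi/2")
      case True
      then have "?d a b \<le> 8 * ?X" using two Suc.prems by blast
      also have "\<dots> \<le> of_nat (8 * Suc n) * ?X" by (rule mult_right_mono) (auto intro: order_trans[of _ "8 + 0"] add_left_mono)
      finally show ?thesis .
    next
      case False
      let ?c = "a + pi/2"
      have c: "a \<le> ?c" "?c \<le> b" using False pi_gt_zero by auto
      have 1: "?d a ?c \<le> 8 * ?X" using two[of a ?c] c Suc.prems by auto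
      have "\<theta> \<le> a" "b \<le> \<theta>'" using Suc.prems by auto
      then have sub: "{?c..b} \<subseteq> {\<theta>..\<theta>'}" using c(1) by (metis atLeastatMost_subset_iff order_trans)
      have 2: "?d ?c b \<le> of_nat (8 * n) * ?X" using sub c(2) Suc.prems by (intro Suc.IH) (auto simp: algebra_simps add_divide_distrib)
      have "?d a b \<le> 8 * ?X + of_nat (8 * n) * ?X" using tri[of a b ?c] 1 2 by (meson add_mono order_trans)
      also have "\<dots> = of_nat (8 * Suc n) * ?X" by (simp add: distrib_right)
      finally show ?thesis .
    qed
  qed simp
  from this[OF t(1) order_refl t(2)] show ?thesis .
qed

end

section \<open>Boundary values as limits along paths\<close>

lemma null_sets_affine:
  assumes N: "N \<in> null_sets lborel" and c: "c \<noteq> (0::real)"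
  shows "{s. t + c * s \<in> N} \<in> null_sets lborel"
proof -
  have Nb: "N \<in> sets borel" "emeasure lborel N = 0" using N by auto
  have m: "{s. t + c * s \<in> N} \<in> sets borel"
    using measurable_sets[of "\<lambda>s. t + c * s" borel borel N] Nb(1) by (auto simp: vimage_def)
  have "0 = (\<integral>\<^sup>+s. indicator N s \<partial>lborel)" using Nb by simp
  also have "\<dots> = ennreal \<bar>c\<bar> * (\<integral>\<^sup>+s. indicator N (t + c * s) \<partial>lborel)"
    by (rule nn_integral_real_affine) (use Nb c in auto)
  also have "(\<integral>\<^sup>+s. indicator N (t + c * s) \<partial>lborel) = (\<integral>\<^sup>+s. indicator {s. t + c * s \<in> N} s \<partial>lborel)"
    by (rule nn_integral_cong) (simp add: indicator_def)
  also have "\<dots> = emeasure lborel {s. t + c * s \<in> N}" using m by simp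
  finally have "emeasure lborel {s. t + c * s \<in> N} = 0" using c by simp
  then show ?thesis using m by auto
qed

lemma AE_affine:
  assumes "AE x in lborel. R x" "c \<noteq> (0::real)" shows "AE s in lborel. R (t + c * s)"
proof -
  obtain N where N: "N \<in> null_sets lborel" "{x \<in> space lborel. \<not> R x} \<subseteq> N"
    using assms(1) unfolding eventually_ae_filter by blast
  show ?thesis unfolding eventually_ae_filter
    by (rule bexI[OF _ null_sets_affine[OF N(1) assms(2)]]) (use N(2) in auto)
qed

context carpet_domain
begin

lemma AE_generic_square: "aep P \<Longrightarrow> AE s in lborel. generic_square P x s"
proof -
  assume P: "aep P"
  have "AE s in lborel. generic_x P (Re x + 1 * s)" "AE s in lborel. generic_x P (Re x + (-1) * s)"
    "AE s in lborel. generic_y P (Im x + 1 * s)" "AE s in lborel. generic_y P (Im x + (-1) * s)"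
    by (rule AE_affine[OF AE_generic(1)[OF P]] AE_affine[OF AE_generic(2)[OF P]]; simp)+
  then show ?thesis by eventually_elim (simp add: generic_square_def)
qed

text \<open>By fatness, the truncated squared sizes are comparable to areas of disjoint subsets of a ball.\<close>

lemma truncated_sizes:
  obtains C where "C > 0" "\<And>x r. r > 0 \<Longrightarrow>
    sum_over (meeting Q {z. snorm (z - x) \<le> r}) (\<lambda>i. ennreal ((min (diameter (Q i)) r)\<^sup>2)) \<le> ennreal (C * r\<^sup>2)"
proof -
  obtain K where K: "K > 0"
    "\<And>i x r. x \<in> Q i \<Longrightarrow> 0 < r \<Longrightarrow> r < diameter (Q i) \<Longrightarrow> ennreal (K * r\<^sup>2) \<le> emeasure lborel (ball x r \<inter> Q i)"
    using fatness by blast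
  show ?thesis
  proof (rule that[of "4/K * (9 * pi)"])
    show "4/K * (9 * pi) > 0" using K by simp
    fix x :: complex and r :: real assume r: "r > 0"
    let ?I = "meeting Q {z. snorm (z - x) \<le> r}"
    have *: "ennreal ((min (diameter (Q i)) r)\<^sup>2) \<le> ennreal (4/K) * emeasure lborel (Q i \<inter> cball x (3 * r))" if i: "i \<in> ?I" for i
    proof -
      obtain y where y: "y \<in> Q i" "snorm (y - x) \<le> r" using i unfolding meeting_def by blast
      \<comment> \<open>Half the truncated size is below the diameter, as fatness requires, and
        small enough for the ball around \<open>y\<close> to stay within distance
        \<open>3 * r\<close> of \<open>x\<close>.\<close>
      let ?t = "min (diameter (Q i)) r / 2"
      have t: "0 < ?t" "?t < diameter (Q i)" using diameter_Q_pos[of i] r by (auto simp: min_def)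
      have "dist x y \<le> 2 * r" using y(2) snorm_bounds(2)[of "y - x"] by (simp add: dist_norm norm_minus_commute)
      moreover have "?t \<le> r" using r by (simp add: min_def)
      ultimately have "dist x z \<le> 3 * r" if "dist y z < ?t" for z using that dist_triangle[of x z y] by linarith
      then have "ball y ?t \<subseteq> cball x (3 * r)" by auto
      then have sub: "ball y ?t \<inter> Q i \<subseteq> Q i \<inter> cball x (3 * r)" by blast
      have "ennreal (K * ?t\<^sup>2) \<le> emeasure lborel (Q i \<inter> cball x (3 * r))"
        using K(2)[OF y(1) t] by (rule order_trans) (intro emeasure_mono sub; use open_Q in simp)
      then have "ennreal (4/K) * ennreal (K * ?t\<^sup>2) \<le> ennreal (4/K) * emeasure lborel (Q i \<inter> cball x (3 * r))"
        by (rule mult_left_mono) simp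
      moreover have "ennreal (4/K) * ennreal (K * ?t\<^sup>2) = ennreal ((min (diameter (Q i)) r)\<^sup>2)"
        using K(1) by (simp add: power_divide flip: ennreal_mult)
      ultimately show ?thesis by simp
    qed
    have "sum_over ?I (\<lambda>i. ennreal ((min (diameter (Q i)) r)\<^sup>2)) \<le> sum_over UNIV (\<lambda>i. ennreal (4/K) * emeasure lborel (Q i \<inter> cball x (3 * r)))"
      by (rule sum_over_mono) (use * in auto)
    also have "\<dots> = ennreal (4/K) * (\<Sum>i. emeasure lborel (Q i \<inter> cball x (3 * r)))" by (simp add: sum_over_UNIV)
    also have "\<dots> \<le> ennreal (4/K) * emeasure lborel (cball x (3 * r))"
      by (intro mult_left_mono sum_emeasure_Q_le) auto
    also have "emeasure lborel (cball x (3 * r)) = ennreal (pi * (3 * r)\<^sup>2)"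
      using r by (simp add: emeasure_cball unit_ball_vol_2)
    also have "ennreal (4/K) * ennreal (pi * (3 * r)\<^sup>2) = ennreal (4/K * (9 * pi) * r\<^sup>2)"
      using K(1) by (subst ennreal_mult[symmetric]) (auto simp: power2_eq_square algebra_simps)
    finally show "sum_over ?I (\<lambda>i. ennreal ((min (diameter (Q i)) r)\<^sup>2)) \<le> ennreal (4/K * (9 * pi) * r\<^sup>2)" .
  qed
qed

text \<open>By Cauchy-Schwarz and fatness, the mean over \<open>s < r\<close> of the sums along the squares is controlled by
  the square sum of \<open>\<sigma>\<close> over the disks near \<open>x\<close>, which tends to \<open>0\<close> with \<open>r\<close> since \<open>x\<close> is off all disks.\<close>

lemma small_square:
  assumes x: "x \<notin> \<Omega>" and \<sigma>: "(\<Sum>i. (\<sigma> i)\<^sup>2) < \<infinity>" and P: "aep P" and e: "\<epsilon> > 0" and r0: "r0 > 0"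
  obtains s where "0 < s" "s < r0" "generic_square P x s" "sum_over (meeting Q (square x s)) \<sigma> < ennreal \<epsilon>"
proof (rule ccontr)
  assume "\<not> thesis"
  note outer = that
  have big: "ennreal \<epsilon> \<le> sum_over (meeting Q (square x s)) \<sigma>" if s: "0 < s" "s < r0" "generic_square P x s" for s
  proof (rule ccontr)
    assume "\<not> ?thesis"
    then have "sum_over (meeting Q (square x s)) \<sigma> < ennreal \<epsilon>" by (simp add: not_le)
    from outer[OF s this] show False using \<open>\<not> thesis\<close> by simp
  qed
  obtain C where C: "C > 0" "\<And>x r. r > 0 \<Longrightarrow>
    sum_over (meeting Q {z. snorm (z - x) \<le> r}) (\<lambda>i. ennreal ((min (diameter (Q i)) r)\<^sup>2)) \<le> ennreal (C * r\<^sup>2)"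
    by (rule truncated_sizes) blast
  \<comment> \<open>With this weight in Young's inequality each of the two terms becomes
    \<open>r * \<epsilon> / 4\<close>, once the square sum near \<open>x\<close> is at most
    \<open>\<epsilon> / (4 * \<kappa>)\<close>. Together they stay below the lower bound
    \<open>\<epsilon> * r\<close> for the integral.\<close>
  define \<kappa> where "\<kappa> = 4 * C / \<epsilon>"
  have \<kappa>: "\<kappa> > 0" "C / \<kappa> = \<epsilon> / 4" unfolding \<kappa>_def using C(1) e by (auto simp: field_simps)
  let ?sq = "\<lambda>i. (\<sigma> i)\<^sup>2"
  have "sum_over UNIV ?sq < \<infinity>" using \<sigma> by (simp add: sum_over_UNIV)
  then obtain F where F: "finite F" "sum_over (UNIV - F) ?sq < ennreal (\<epsilon> / (4 * \<kappa>))"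
    using sum_over_tail[of UNIV ?sq "\<epsilon> / (4 * \<kappa>)"] e \<kappa> by auto
  have "open (- (\<Union>i\<in>F. closure (Q i)))" using F by (intro open_Compl closed_UN) auto
  moreover have "x \<in> - (\<Union>i\<in>F. closure (Q i))" using x closure_Q_subset by blast
  ultimately obtain d where d: "d > 0" "ball x d \<subseteq> - (\<Union>i\<in>F. closure (Q i))" unfolding open_contains_ball by blast
  define r where "r = min (d / 3) (r0 / 2)"
  have r: "0 < r" "r < r0" "2 * r < d" unfolding r_def using d(1) r0 by (auto simp: min_def)
  let ?I = "meeting Q {z. snorm (z - x) \<le> r}"
  have "?I \<subseteq> UNIV - F"
  proof
    fix i assume "i \<in> ?I"
    then obtain y where y: "y \<in> Q i" "snorm (y - x) \<le> r" unfolding meeting_def by blast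
    then have "y \<in> ball x d" using snorm_bounds(2)[of "y - x"] r(3) by (simp add: dist_norm norm_minus_commute)
    then show "i \<in> UNIV - F" using d(2) y(1) closure_subset by blast
  qed
  then have I: "sum_over ?I ?sq \<le> ennreal (\<epsilon> / (4 * \<kappa>))"
    by (rule order_trans[OF sum_over_mono_set less_imp_le[OF F(2)]])
  have "\<exists>l u. (\<lambda>z. snorm (z - x)) ` Q i \<subseteq> {l..u} \<and> u - l \<le> diameter (Q i)" for i
  proof -
    have "\<bar>snorm (z - x) - snorm (z' - x)\<bar> \<le> dist z z'" for z z' using snorm_lipschitz[of "z - x" "z' - x"] by (simp add: dist_norm)
    from lipschitz_image_in_interval[OF bounded_Q Q_nonempty this] show ?thesis by metis
  qed
  then obtain l u where lu: "\<And>i. (\<lambda>z. snorm (z - x)) ` Q i \<subseteq> {l i..u i}" "\<And>i. u i - l i \<le> diameter (Q i)" by metis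
  define \<tau> where "\<tau> i = (if i \<in> ?I then \<sigma> i else 0)" for i
  define H where "H s = (\<Sum>i. \<tau> i * indicator ({l i..u i} \<inter> {0..r}) s)" for s
  have HS: "sum_over (meeting Q (square x s)) \<sigma> \<le> H s" if s: "0 < s" "s < r" for s
    unfolding sum_over_def H_def
  proof (intro suminf_le summableI)
    fix i
    show "(if i \<in> meeting Q (square x s) then \<sigma> i else 0) \<le> \<tau> i * indicator ({l i..u i} \<inter> {0..r}) s"
    proof (cases "i \<in> meeting Q (square x s)")
      case True
      then obtain z where z: "z \<in> Q i" "snorm (z - x) = s" unfolding meeting_def by blast
      then have "i \<in> ?I" "s \<in> {l i..u i}" using lu(1)[of i] s unfolding meeting_def by auto
      then show ?thesis using True s unfolding \<tau>_def by (simp add: indicator_def)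
    qed simp
  qed
  have "ennreal (\<epsilon> * r) = (\<integral>\<^sup>+s. ennreal \<epsilon> * indicator {0<..<r} s \<partial>lborel)"
    using e r by (simp add: nn_integral_cmult_indicator ennreal_mult)
  also have "\<dots> \<le> (\<integral>\<^sup>+s. H s \<partial>lborel)"
  proof (rule nn_integral_mono_AE)
    show "AE s in lborel. ennreal \<epsilon> * indicator {0<..<r} s \<le> H s"
      using AE_generic_square[OF P, of x]
    proof eventually_elim
      case (elim s)
      show ?case
      proof (cases "s \<in> {0<..<r}")
        case True
        then have "ennreal \<epsilon> \<le> sum_over (meeting Q (square x s)) \<sigma>" using big elim r by auto
        also have "\<dots> \<le> H s" using HS True by auto
        finally show ?thesis using True by simp
      qed simp
    qed
  qed
  also have "\<dots> = (\<Sum>i. \<tau> i * emeasure lborel ({l i..u i} \<inter> {0..r}))"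
    unfolding H_def by (subst nn_integral_suminf) (simp_all add: nn_integral_cmult_indicator)
  also have "\<dots> \<le> sum_over ?I (\<lambda>i. ennreal (\<kappa> * r) * (\<sigma> i)\<^sup>2 + ennreal (1 / (\<kappa> * r)) * ennreal ((min (diameter (Q i)) r)\<^sup>2))"
    unfolding sum_over_def
  proof (intro suminf_le summableI)
    fix i
    show "\<tau> i * emeasure lborel ({l i..u i} \<inter> {0..r}) \<le>
      (if i \<in> ?I then ennreal (\<kappa> * r) * (\<sigma> i)\<^sup>2 + ennreal (1 / (\<kappa> * r)) * ennreal ((min (diameter (Q i)) r)\<^sup>2) else 0)"
    proof (cases "i \<in> ?I")
      case True
      have m0: "0 \<le> min (diameter (Q i)) r" using diameter_Q_pos[of i] r by simp
      have "emeasure lborel ({l i..u i} \<inter> {0..r}) \<le> emeasure lborel {l i..u i}" by (rule emeasure_mono) auto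
      also have "\<dots> \<le> ennreal (diameter (Q i))" using lu(2)[of i] by (auto simp: emeasure_lborel_Icc_eq intro!: ennreal_leI)
      finally have "emeasure lborel ({l i..u i} \<inter> {0..r}) \<le> ennreal (diameter (Q i))" .
      moreover have "emeasure lborel ({l i..u i} \<inter> {0..r}) \<le> emeasure lborel {0..r}" by (rule emeasure_mono) auto
      then have "emeasure lborel ({l i..u i} \<inter> {0..r}) \<le> ennreal r" using r by simp
      ultimately have "emeasure lborel ({l i..u i} \<inter> {0..r}) \<le> ennreal (min (diameter (Q i)) r)" by (simp add: min_def)
      then have "\<sigma> i * emeasure lborel ({l i..u i} \<inter> {0..r}) \<le> \<sigma> i * ennreal (min (diameter (Q i)) r)" by (rule mult_left_mono) simp
      also have "\<dots> \<le> ennreal (\<kappa> * r) * (\<sigma> i)\<^sup>2 + ennreal (1 / (\<kappa> * r)) * (ennreal (min (diameter (Q i)) r))\<^sup>2"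
        by (rule ennreal_mult_le_squares) (use \<kappa> r in simp)
      also have "(ennreal (min (diameter (Q i)) r))\<^sup>2 = ennreal ((min (diameter (Q i)) r)\<^sup>2)" using m0 by (rule ennreal_power)
      finally show ?thesis using True unfolding \<tau>_def by simp
    qed (simp add: \<tau>_def)
  qed
  also have "\<dots> = ennreal (\<kappa> * r) * sum_over ?I ?sq + ennreal (1 / (\<kappa> * r)) * sum_over ?I (\<lambda>i. ennreal ((min (diameter (Q i)) r)\<^sup>2))"
    by (simp only: sum_over_add sum_over_cmult)
  also have "\<dots> \<le> ennreal (\<kappa> * r) * ennreal (\<epsilon> / (4 * \<kappa>)) + ennreal (1 / (\<kappa> * r)) * ennreal (C * r\<^sup>2)"
    by (intro add_mono mult_left_mono I C(2) r) auto
  also have "\<dots> = ennreal (r * \<epsilon> / 4 + r * (C / \<kappa>))"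
    using \<kappa>(1) r C(1) e by (simp add: power2_eq_square field_simps flip: ennreal_mult ennreal_plus)
  finally have "\<epsilon> * r \<le> r * \<epsilon> / 4 + r * (C / \<kappa>)" using r e \<kappa>(1) C(1) by (subst (asm) ennreal_le_iff) auto
  then have "\<epsilon> * r \<le> r * \<epsilon> / 4 + r * (\<epsilon> / 4)" unfolding \<kappa>(2) .
  then show False using r e by (simp add: field_simps)
qed

lemma hat_tail:
  assumes n: "nice (osc Q g) g \<gamma>" and f: "fin g" and e: "ends_at \<gamma> e x" and L: "end_limit g \<gamma> e L"
    and t: "t \<in> fst \<gamma> \<inter> ball e \<delta>"
  shows "ennreal \<bar>hat g (snd \<gamma> t) - L\<bar> \<le> 3 * sum_over (meeting Q (tail \<gamma> e \<delta>)) (osc Q g)"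
proof -
  let ?X = "sum_over (meeting Q (tail \<gamma> e \<delta>)) (osc Q g)"
  have g: "\<gamma> \<in> paths_in \<Omega>" using n unfolding nice_def by blast
  have "\<delta> > 0" using t by (auto intro: order_le_less_trans[OF zero_le_dist])
  then obtain s where s: "s \<in> stops \<gamma>" "s \<in> ball e \<delta>" using tail_stop[OF g e] by blast
  have s': "s \<in> fst \<gamma> \<inter> ball e \<delta>" "snd \<gamma> s \<in> S" using s unfolding stops_def by auto
  have 1: "ennreal \<bar>hat g (snd \<gamma> t) - val g (snd \<gamma> s)\<bar> \<le> 2 * ?X"
    unfolding tail_def by (rule hat_near_stop[OF n f _ tail_interval[OF g] t s']) auto
  have 2: "ennreal \<bar>val g (snd \<gamma> s) - L\<bar> \<le> ?X" by (rule end_limit_bound[OF n e L s'])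
  have "ennreal \<bar>hat g (snd \<gamma> t) - L\<bar> \<le> ennreal (\<bar>hat g (snd \<gamma> t) - val g (snd \<gamma> s)\<bar> + \<bar>val g (snd \<gamma> s) - L\<bar>)"
    by (rule ennreal_leI) linarith
  also have "\<dots> = ennreal \<bar>hat g (snd \<gamma> t) - val g (snd \<gamma> s)\<bar> + ennreal \<bar>val g (snd \<gamma> s) - L\<bar>" by simp
  also have "\<dots> \<le> 2 * ?X + ?X" using 1 2 by (rule add_mono)
  also have "\<dots> = 3 * ?X" using distrib_right[of 2 1 ?X] by simp
  finally show ?thesis .
qed

end

section \<open>Independence of boundary limits from the path\<close>

locale jordan_carpet_domain = carpet_domain +
  assumes jordan: "bounded_by_jordan_curves \<Omega>"
begin

text \<open>The other boundary curves are finitely many compact sets that do not contain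
  \<open>x\<close>, hence at positive distance from it.\<close>

lemma boundary_curve:
  assumes x: "x \<in> frontier \<Omega>"
  obtains c d where "simple_path c" "pathfinish c = pathstart c" "x \<in> path_image c" "path_image c \<subseteq> frontier \<Omega>"
    "d > 0" "ball x d \<inter> frontier \<Omega> \<subseteq> path_image c"
proof -
  obtain \<J> where J: "finite \<J>" "\<And>J. J \<in> \<J> \<Longrightarrow> jordan_curve J" "pairwise disjnt \<J>" "frontier \<Omega> = \<Union>\<J>"
    using jordan unfolding bounded_by_jordan_curves_def by blast
  obtain J where Jx: "J \<in> \<J>" "x \<in> J" using x J(4) by blast
  obtain c where c: "simple_path c" "pathfinish c = pathstart c" "path_image c = J"
    using J(2)[OF Jx(1)] unfolding jordan_curve_def by blast
  have "closed J'" if "J' \<in> \<J>" for J'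
    using J(2)[OF that] unfolding jordan_curve_def by (auto simp: compact_imp_closed compact_simple_path_image)
  then have "open (- \<Union>(\<J> - {J}))" using J(1) by (intro open_Compl closed_Union) auto
  moreover have "x \<in> - \<Union>(\<J> - {J})" using J(3) Jx unfolding pairwise_def disjnt_def by blast
  ultimately obtain d where d: "d > 0" "ball x d \<subseteq> - \<Union>(\<J> - {J})" unfolding open_contains_ball by blast
  show ?thesis by (rule that[OF c(1,2) _ _ d(1)]) (use c(3) Jx J(4) d(2) in auto)
qed

text \<open>The arc from \<open>crossing_arc\<close> may wind around several times. Removing full
  turns leaves at most four quarter turns between the same two points of the square, inside the old
  range of angles.\<close>

lemma sqp_shorten:
  assumes "\<theta> \<le> \<theta>'" obtains \<theta>'' where "\<theta> \<le> \<theta>''" "\<theta>'' \<le> \<theta>'" "\<theta>' \<le> \<theta>'' + 2 * pi" "sqp x s \<theta>'' = sqp x s \<theta>"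
proof -
  define k where "k = \<lfloor>(\<theta>' - \<theta>) / (2 * pi)\<rfloor>"
  have k: "of_int k \<le> (\<theta>' - \<theta>) / (2 * pi)" "(\<theta>' - \<theta>) / (2 * pi) < of_int k + 1" unfolding k_def by linarith+
  have k0: "0 \<le> k" unfolding k_def using assms by simp
  have "2 * pi * of_int k \<le> \<theta>' - \<theta>" using k(1) by (simp add: field_simps)
  moreover have "\<theta>' - \<theta> < 2 * pi * (of_int k + 1)" using k(2) by (simp add: field_simps)
  moreover have "0 \<le> 2 * pi * of_int k" using k0 by simp
  ultimately show ?thesis by (intro that[of "\<theta> + 2 * pi * of_int k"] sqp_periodic) (auto simp: algebra_simps)
qed

lemma end_limit_independent:
  assumes g: "g \<in> sobolev ver \<Omega> Q"
    and n1: "nice (osc Q g) g \<gamma>1" and e1: "ends_at \<gamma>1 e1 x" and L1: "end_limit g \<gamma>1 e1 L1"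
    and n2: "nice (osc Q g) g \<gamma>2" and e2: "ends_at \<gamma>2 e2 x" and L2: "end_limit g \<gamma>2 e2 L2"
  shows "L1 = L2"
proof (rule ccontr)
  assume "L1 \<noteq> L2"
  \<comment> \<open>The estimates below cost \<open>3 * \<epsilon>\<close> at each tail and
    \<open>32 * \<epsilon>\<close> along the square; any denominator of at least 38 would
    do.\<close>
  define \<epsilon> where "\<epsilon> = \<bar>L1 - L2\<bar> / 100"
  have \<epsilon>: "\<epsilon> > 0" unfolding \<epsilon>_def using \<open>L1 \<noteq> L2\<close> by simp
  have f: "fin g" using sobolev_fin[OF g] .
  have x: "x \<in> frontier \<Omega>" "x \<notin> \<Omega>" using e1 frontier_disjoint unfolding ends_at_def by auto
  have tails: "\<exists>\<delta>>0. \<forall>t\<in>fst \<gamma> \<inter> ball e \<delta>. \<bar>hat g (snd \<gamma> t) - L\<bar> < 3 * \<epsilon>"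
    if n: "nice (osc Q g) g \<gamma>" and e: "ends_at \<gamma> e x" and L: "end_limit g \<gamma> e L" for \<gamma> e L
  proof -
    obtain \<delta> where d: "\<delta> > 0" "sum_over (meeting Q (tail \<gamma> e \<delta>)) (osc Q g) < ennreal \<epsilon>"
      using tail_sum[OF e _ \<epsilon>] n unfolding nice_def by metis
    have "\<bar>hat g (snd \<gamma> t) - L\<bar> < 3 * \<epsilon>" if t: "t \<in> fst \<gamma> \<inter> ball e \<delta>" for t
    proof -
      have "ennreal \<bar>hat g (snd \<gamma> t) - L\<bar> \<le> 3 * sum_over (meeting Q (tail \<gamma> e \<delta>)) (osc Q g)" by (rule hat_tail[OF n f e L t])
      also have "\<dots> < 3 * ennreal \<epsilon>" using d(2) by (intro ennreal_mult_strict_left_mono) auto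
      also have "\<dots> = ennreal (3 * \<epsilon>)" using \<epsilon> by (simp add: ennreal_mult)
      finally show ?thesis by (simp add: ennreal_less_iff)
    qed
    then show ?thesis using d(1) by blast
  qed
  obtain \<delta>1 where d1: "\<delta>1 > 0" "\<And>t. t \<in> fst \<gamma>1 \<inter> ball e1 \<delta>1 \<Longrightarrow> \<bar>hat g (snd \<gamma>1 t) - L1\<bar> < 3 * \<epsilon>"
    using tails[OF n1 e1 L1] by blast
  obtain \<delta>2 where d2: "\<delta>2 > 0" "\<And>t. t \<in> fst \<gamma>2 \<inter> ball e2 \<delta>2 \<Longrightarrow> \<bar>hat g (snd \<gamma>2 t) - L2\<bar> < 3 * \<epsilon>"
    using tails[OF n2 e2 L2] by blast
  have tail_props: "connected (tail \<gamma> e \<delta>)" "tail \<gamma> e \<delta> \<subseteq> \<Omega>" "x \<in> closure (tail \<gamma> e \<delta>)"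
    if n: "nice (osc Q g) g \<gamma>" and e: "ends_at \<gamma> e x" and d: "\<delta> > 0" for \<gamma> e \<delta>
  proof -
    have p: "\<gamma> \<in> paths_in \<Omega>" using n unfolding nice_def by blast
    show "connected (tail \<gamma> e \<delta>)" unfolding tail_def
      using tail_interval[OF p] continuous_on_subset[OF path_continuous[OF p]]
      by (intro connected_continuous_image is_interval_connected) auto
    show "tail \<gamma> e \<delta> \<subseteq> \<Omega>" unfolding tail_def using path_range[OF p] by auto
    show "x \<in> closure (tail \<gamma> e \<delta>)" unfolding closure_approachable
    proof (intro allI impI)
      fix r :: real assume r: "r > 0"
      obtain \<delta>' where d': "\<delta>' > 0" "tail \<gamma> e \<delta>' \<subseteq> ball x r" using tail_near[OF e, of "ball x r"] r by auto
      obtain t where "t \<in> fst \<gamma> \<inter> ball e (min \<delta> \<delta>')" using tail_nonempty[OF e, of "min \<delta> \<delta>'"] d d'(1) by (metis all_not_in_conv min_less_iff_conj)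
      then have "snd \<gamma> t \<in> tail \<gamma> e \<delta>" "snd \<gamma> t \<in> tail \<gamma> e \<delta>'" unfolding tail_def by auto
      then show "\<exists>y\<in>tail \<gamma> e \<delta>. dist y x < r" using d'(2) by (intro bexI[of _ "snd \<gamma> t"]) (auto simp: dist_commute)
    qed
  qed
  obtain c d where c: "simple_path c" "pathfinish c = pathstart c" "x \<in> path_image c" "path_image c \<subseteq> frontier \<Omega>"
    and d: "d > 0" "ball x d \<inter> frontier \<Omega> \<subseteq> path_image c" using boundary_curve[OF x(1)] .
  have dis: "\<Omega> \<inter> path_image c = {}" using c(4) frontier_disjoint by blast
  obtain s0 where s0: "s0 > 0" "\<And>s. 0 < s \<Longrightarrow> s < s0 \<Longrightarrow>
     \<exists>\<theta>1 \<theta>2. sqp x s \<theta>1 \<in> tail \<gamma>1 e1 \<delta>1 \<and> sqp x s \<theta>2 \<in> tail \<gamma>2 e2 \<delta>2 \<and> sqp x s ` closed_segment \<theta>1 \<theta>2 \<inter> path_image c = {}"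
    using crossing_arc[OF c(1-3) open_Omega connected_Omega dis tail_props[OF n1 e1 d1(1)] tail_props[OF n2 e2 d2(1)]] by metis
  have os: "(\<Sum>i. (osc Q g i)\<^sup>2) < \<infinity>"
    using g unfolding sobolev_iff osc_square_sum[OF f] by (subst sum_finite_iff) auto
  obtain s where s: "0 < s" "s < min s0 (d/2)" "generic_square (\<lambda>\<gamma>. nice (osc Q g) g \<gamma>) x s"
      "sum_over (meeting Q (square x s)) (osc Q g) < ennreal \<epsilon>"
    using small_square[OF x(2) os sobolev_nice[OF g] \<epsilon>, of "min s0 (d/2)"] s0(1) d(1) by (metis half_gt_zero min_less_iff_conj)
  obtain \<theta>1 \<theta>2 where t: "sqp x s \<theta>1 \<in> tail \<gamma>1 e1 \<delta>1" "sqp x s \<theta>2 \<in> tail \<gamma>2 e2 \<delta>2" "sqp x s ` closed_segment \<theta>1 \<theta>2 \<inter> path_image c = {}"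
    using s0(2)[of s] s by auto
  have inball: "sqp x s \<theta> \<in> ball x d" for \<theta>
    using snorm_bounds(2)[of "sqp x s \<theta> - x"] snorm_sqp[OF s(1), of x \<theta>] s(2) by (simp add: dist_norm norm_minus_commute)
  have "sqp x s ` closed_segment \<theta>1 \<theta>2 \<inter> frontier \<Omega> = {}" using t(3) inball d(2) by blast
  moreover have "connected (sqp x s ` closed_segment \<theta>1 \<theta>2)" by (intro connected_continuous_image continuous_on_sqp connected_segment)
  moreover have "sqp x s ` closed_segment \<theta>1 \<theta>2 \<inter> \<Omega> \<noteq> {}" using t(1) tail_props(2)[OF n1 e1 d1(1)] by blast
  \<comment> \<open>Off the curve and inside \<open>ball x d\<close>, the arc avoids the whole
    boundary; it starts in the domain and therefore stays there.\<close>
  ultimately have arc: "sqp x s ` closed_segment \<theta>1 \<theta>2 \<subseteq> \<Omega>" using connected_Int_frontier by blast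
  have key: "\<bar>hat g (sqp x s a) - hat g (sqp x s b)\<bar> < 32 * \<epsilon>" if ab: "a \<le> b" "sqp x s ` {a..b} \<subseteq> \<Omega>" for a b
  proof -
    obtain a' where a': "a \<le> a'" "a' \<le> b" "b \<le> a' + 2 * pi" "sqp x s a' = sqp x s a" using sqp_shorten[OF ab(1)] .
    have "ennreal \<bar>hat g (sqp x s a') - hat g (sqp x s b)\<bar> \<le> of_nat (8 * 4) * sum_over (meeting Q (square x s)) (osc Q g)"
      by (rule hat_square_arc[OF f s(3,1)]) (use a' ab(2) in auto)
    also have "\<dots> < of_nat (8 * 4) * ennreal \<epsilon>" using s(4) by (intro ennreal_mult_strict_left_mono) auto
    also have "\<dots> = ennreal (32 * \<epsilon>)" using \<epsilon> by (simp add: ennreal_mult)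
    finally show ?thesis using a'(4) by (simp add: ennreal_less_iff)
  qed
  have "\<bar>hat g (sqp x s \<theta>1) - hat g (sqp x s \<theta>2)\<bar> < 32 * \<epsilon>"
    using key[of \<theta>1 \<theta>2] key[of \<theta>2 \<theta>1] arc by (auto simp: closed_segment_eq_real_ivl abs_minus_commute split: if_splits)
  moreover have "\<bar>hat g (sqp x s \<theta>1) - L1\<bar> < 3 * \<epsilon>" "\<bar>hat g (sqp x s \<theta>2) - L2\<bar> < 3 * \<epsilon>"
    using t(1,2) d1(2) d2(2) unfolding tail_def by auto
  ultimately have "\<bar>L1 - L2\<bar> < 38 * \<epsilon>" by linarith
  then show False unfolding \<epsilon>_def using \<open>L1 \<noteq> L2\<close> by simp
qed

text \<open>Upper bound: disks met by the end of \<open>\<gamma>\<close> have suprema close to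
  \<open>L\<close>, and some of them lie in any given ball around \<open>x\<close>. Lower bound:
  away from the ends that converge to \<open>x\<close> the trace keeps a positive distance from
  \<open>x\<close>, so a disk in a small ball that meets \<open>\<gamma>\<close> is met near such an
  end. As both ends may converge to \<open>x\<close>, the limit is assumed at each of them.\<close>

lemma liminf_along_eq:
  assumes n: "nice (osc Q g) g \<gamma>" and f: "fin g" and x: "ends_at \<gamma> e0 x"
    and L: "\<And>e. ends_at \<gamma> e x \<Longrightarrow> end_limit g \<gamma> e L"
  shows "liminf_along Q g \<gamma> x = ereal L"
proof -
  have p: "\<gamma> \<in> paths_in \<Omega>" and H: "hausdorff_measure 1 (path_trace \<gamma> \<inter> S) = 0"
    and fs: "sum_over (meeting Q (path_trace \<gamma>)) (osc Q g) < \<infinity>" using n unfolding nice_def by auto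
  have xO: "x \<notin> \<Omega>" using x frontier_disjoint unfolding ends_at_def by auto
  have rMe: "bdry_sup Q g i = ereal (rM g i)" for i
    using f[unfolded fin_def, rule_format, of i] by (cases "bdry_sup Q g i") auto
  have close: "\<exists>\<delta>>0. \<forall>t\<in>fst \<gamma> \<inter> ball e \<delta>. \<bar>hat g (snd \<gamma> t) - L\<bar> < \<epsilon>" if e: "ends_at \<gamma> e x" and \<epsilon>: "\<epsilon> > 0" for e \<epsilon>
  proof -
    have "\<epsilon>/3 > 0" using \<epsilon> by simp
    from tail_sum[OF e fs this] obtain \<delta> where d: "\<delta> > 0" "sum_over (meeting Q (tail \<gamma> e \<delta>)) (osc Q g) < ennreal (\<epsilon>/3)" by metis
    have "\<bar>hat g (snd \<gamma> t) - L\<bar> < \<epsilon>" if t: "t \<in> fst \<gamma> \<inter> ball e \<delta>" for t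
    proof -
      have "ennreal \<bar>hat g (snd \<gamma> t) - L\<bar> \<le> 3 * sum_over (meeting Q (tail \<gamma> e \<delta>)) (osc Q g)" by (rule hat_tail[OF n f e L[OF e] t])
      also have "\<dots> < 3 * ennreal (\<epsilon>/3)" using d(2) by (intro ennreal_mult_strict_left_mono) auto
      also have "\<dots> = ennreal (3 * (\<epsilon>/3))" using \<epsilon> by (subst ennreal_mult) auto
      finally show ?thesis by (simp add: ennreal_less_iff)
    qed
    then show ?thesis using d(1) by blast
  qed
  let ?A = "\<lambda>r. {i \<in> meeting Q (path_trace \<gamma>). Q i \<subseteq> ball x r}"
  have up: "(INF i \<in> ?A r. bdry_sup Q g i) \<le> ereal L" if r: "r > 0" for r
  proof (rule ereal_le_epsilon2)
    fix \<epsilon> :: real assume "0 < \<epsilon>"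
    then obtain \<delta> where d: "\<delta> > 0" "\<And>t. t \<in> fst \<gamma> \<inter> ball e0 \<delta> \<Longrightarrow> \<bar>hat g (snd \<gamma> t) - L\<bar> < \<epsilon>" using close[OF x] by blast
    \<comment> \<open>Only finitely many disks are too large: a disk outside \<open>F\<close> with a
      point in \<open>ball x (r/2)\<close> lies in \<open>ball x r\<close>.\<close>
    define F where "F = {i. r / 2 \<le> diameter (Q i)}"
    have finF: "finite F"
    proof -
      have "eventually (\<lambda>i. (diameter (Q i))\<^sup>2 < (r/2)\<^sup>2) sequentially"
        by (rule order_tendstoD(2)[OF summable_LIMSEQ_zero[OF summable_diameter]]) (use r in simp)
      then obtain N where N: "\<And>i. i \<ge> N \<Longrightarrow> (diameter (Q i))\<^sup>2 < (r/2)\<^sup>2" unfolding eventually_sequentially by blast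
      have "F \<subseteq> {..<N}"
      proof
        fix i assume "i \<in> F"
        then have "(r/2)\<^sup>2 \<le> (diameter (Q i))\<^sup>2" unfolding F_def using r by (intro power_mono) auto
        then show "i \<in> {..<N}" using N[of i] by (meson lessThan_iff not_le)
      qed
      then show ?thesis using finite_subset by blast
    qed
    let ?W = "ball x (r/2) - (\<Union>i\<in>F. closure (Q i))"
    have "open ?W" using finF by (intro open_Diff closed_UN) auto
    moreover have "x \<in> ?W" using xO closure_Q_subset r by auto
    ultimately obtain \<delta>' where d': "\<delta>' > 0" "tail \<gamma> e0 \<delta>' \<subseteq> ?W" using tail_near[OF x] by metis
    define m where "m = min \<delta> \<delta>'"
    have m: "m > 0" unfolding m_def using d d' by simp
    \<comment> \<open>The end of the path cannot run inside the carpet: it would be a connected null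
      set, hence a single point of the domain, but it converges to \<open>x\<close>, which is off
      the domain.\<close>
    have "\<exists>t\<in>fst \<gamma> \<inter> ball e0 m. snd \<gamma> t \<notin> S"
    proof (rule ccontr)
      assume "\<not> ?thesis"
      then have "tail \<gamma> e0 m \<subseteq> path_trace \<gamma> \<inter> S" unfolding tail_def path_trace_def by blast
      then have "hausdorff_measure 1 (tail \<gamma> e0 m) = 0" using hausdorff1_null_subset[OF H] by blast
      moreover have "connected (tail \<gamma> e0 m)" unfolding tail_def
        using tail_interval[OF p] continuous_on_subset[OF path_continuous[OF p]]
        by (intro connected_continuous_image is_interval_connected) auto
      ultimately have single: "\<And>y z. y \<in> tail \<gamma> e0 m \<Longrightarrow> z \<in> tail \<gamma> e0 m \<Longrightarrow> y = z" using hausdorff1_null_connected by blast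
      obtain t where tt: "t \<in> fst \<gamma> \<inter> ball e0 m" using tail_nonempty[OF x m] by blast
      then have y: "snd \<gamma> t \<in> tail \<gamma> e0 m" "snd \<gamma> t \<noteq> x" using path_range[OF p] xO unfolding tail_def by auto
      obtain \<delta>'' where d'': "\<delta>'' > 0" "tail \<gamma> e0 \<delta>'' \<subseteq> - {snd \<gamma> t}" using tail_near[OF x, of "- {snd \<gamma> t}"] y(2) by auto
      obtain t' where "t' \<in> fst \<gamma> \<inter> ball e0 (min m \<delta>'')" using tail_nonempty[OF x, of "min m \<delta>''"] m d''(1) by (metis all_not_in_conv min_less_iff_conj)
      then have "snd \<gamma> t' \<in> tail \<gamma> e0 m" "snd \<gamma> t' \<in> tail \<gamma> e0 \<delta>''" unfolding tail_def by auto
      moreover from this have "snd \<gamma> t' = snd \<gamma> t" using single y(1) by simp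
      ultimately show False using d''(2) by auto
    qed
    then obtain t where tt: "t \<in> fst \<gamma> \<inter> ball e0 m" "snd \<gamma> t \<notin> S" by blast
    then obtain i where i: "snd \<gamma> t \<in> Q i" using S_iff path_range[OF p] by blast
    have "snd \<gamma> t \<in> tail \<gamma> e0 \<delta>'" using tt(1) unfolding tail_def m_def by auto
    then have tW: "snd \<gamma> t \<in> ?W" using d'(2) by blast
    then have "i \<notin> F" using i closure_subset by blast
    have "Q i \<subseteq> ball x r"
    proof
      fix y assume "y \<in> Q i"
      then have "dist (snd \<gamma> t) y \<le> diameter (Q i)" using i bounded_Q diameter_bounded_bound by blast
      then show "y \<in> ball x r" using \<open>i \<notin> F\<close> tW dist_triangle[of x y "snd \<gamma> t"] unfolding F_def by auto
    qed
    then have "i \<in> ?A r" using i tt(1) unfolding meeting_def path_trace_def by blast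
    then have "(INF i \<in> ?A r. bdry_sup Q g i) \<le> bdry_sup Q g i" by (rule INF_lower)
    also have "\<dots> = ereal (hat g (snd \<gamma> t))" unfolding hat_Q[OF i] by (rule rMe)
    also have "\<dots> \<le> ereal L + ereal \<epsilon>" using d(2)[of t] tt(1) unfolding m_def by (auto simp: abs_less_iff)
    finally show "(INF i \<in> ?A r. bdry_sup Q g i) \<le> ereal L + ereal \<epsilon>" .
  qed
  have low: "ereal L \<le> (SUP r \<in> {0<..}. INF i \<in> ?A r. bdry_sup Q g i)"
  proof (rule ereal_le_epsilon2)
    fix \<epsilon> :: real assume \<epsilon>: "0 < \<epsilon>"
    obtain h where h: "continuous_on (closure (fst \<gamma>)) h" "\<forall>t\<in>fst \<gamma>. h t = snd \<gamma> t" and b: "bounded (fst \<gamma>)"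
      using p unfolding paths_in_def is_path_def by blast
    define \<delta> where "\<delta> e = (SOME \<delta>. \<delta> > 0 \<and> (\<forall>t\<in>fst \<gamma> \<inter> ball e \<delta>. \<bar>hat g (snd \<gamma> t) - L\<bar> < \<epsilon>))" for e
    have \<delta>: "\<delta> e > 0" "\<And>t. t \<in> fst \<gamma> \<inter> ball e (\<delta> e) \<Longrightarrow> \<bar>hat g (snd \<gamma> t) - L\<bar> < \<epsilon>" if e: "ends_at \<gamma> e x" for e
      using someI_ex[of "\<lambda>\<delta>. \<delta> > 0 \<and> (\<forall>t\<in>fst \<gamma> \<inter> ball e \<delta>. \<bar>hat g (snd \<gamma> t) - L\<bar> < \<epsilon>)"] close[OF e \<epsilon>] unfolding \<delta>_def by blast+
    \<comment> \<open>Parameters close to an end at \<open>x\<close>. The remaining set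
      \<open>K\<close> is compact, and its image under the extension \<open>h\<close> misses
      \<open>x\<close>.\<close>
    define W where "W = (\<Union>e\<in>{e. ends_at \<gamma> e x}. ball e (\<delta> e))"
    define K where "K = closure (fst \<gamma>) - W"
    have "open W" unfolding W_def by auto
    then have cK: "compact K" unfolding K_def using b by (intro compact_diff) (auto simp: compact_closure)
    have "compact (h ` K)" using cK h(1) unfolding K_def by (intro compact_continuous_image) (auto intro: continuous_on_subset)
    then have "open (- (h ` K))" using compact_imp_closed by blast
    moreover have "x \<in> - (h ` K)"
    proof
      assume "x \<in> h ` K"
      then obtain e where e: "e \<in> K" "x = h e" by blast
      have "e \<notin> fst \<gamma>" using h(2) path_range[OF p] xO e(2) by auto
      moreover have ec: "e \<in> closure (fst \<gamma>)" using e unfolding K_def by blast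
      moreover have "(h \<longlongrightarrow> h e) (at e within closure (fst \<gamma>))" using h(1) ec unfolding continuous_on_def by blast
      then have "(h \<longlongrightarrow> h e) (at e within fst \<gamma>)" by (rule tendsto_within_subset[OF _ closure_subset])
      then have "(snd \<gamma> \<longlongrightarrow> h e) (at e within fst \<gamma>)"
        by (rule Lim_transform_within[of _ _ _ _ 1]) (use h(2) in auto)
      ultimately have "ends_at \<gamma> e x" using x e(2) unfolding ends_at_def by blast
      then have "e \<in> W" unfolding W_def using \<delta>(1) by force
      then show False using e unfolding K_def by blast
    qed
    ultimately obtain r where r: "r > 0" "ball x r \<subseteq> - (h ` K)" unfolding open_contains_ball by blast
    have "ereal (L - \<epsilon>) \<le> (INF i \<in> ?A r. bdry_sup Q g i)"
    proof (rule INF_greatest)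
      fix i assume i: "i \<in> ?A r"
      then obtain t where t: "t \<in> fst \<gamma>" "snd \<gamma> t \<in> Q i" unfolding meeting_def path_trace_def by blast
      then have "h t \<in> ball x r" using i h(2) by auto
      then have "t \<notin> K" using r(2) by blast
      then have "t \<in> W" unfolding K_def using t(1) closure_subset by blast
      then obtain e where e: "ends_at \<gamma> e x" "t \<in> ball e (\<delta> e)" unfolding W_def by blast
      have "\<bar>rM g i - L\<bar> < \<epsilon>" using \<delta>(2)[OF e(1), of t] t e(2) hat_Q[OF t(2), of g] by simp
      then show "ereal (L - \<epsilon>) \<le> bdry_sup Q g i" by (subst rMe) (auto simp: abs_less_iff)
    qed
    also have "\<dots> \<le> (SUP r \<in> {0<..}. INF i \<in> ?A r. bdry_sup Q g i)" using r(1) by (intro SUP_upper) auto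
    finally have "ereal (L - \<epsilon>) + ereal \<epsilon> \<le> (SUP r \<in> {0<..}. INF i \<in> ?A r. bdry_sup Q g i) + ereal \<epsilon>"
      by (rule add_right_mono)
    then show "ereal L \<le> (SUP r \<in> {0<..}. INF i \<in> ?A r. bdry_sup Q g i) + ereal \<epsilon>" by simp
  qed
  show ?thesis unfolding liminf_along_def by (rule antisym[OF SUP_least low]) (use up in auto)
qed

text \<open>\<open>accessible_value\<close> uses an arbitrarily chosen good path. By
  \<open>end_limit_independent\<close> all ends of that path at \<open>x\<close> have the limit
  \<open>L\<close> of the given one, so \<open>liminf_along_eq\<close> applies to it.\<close>

lemma boundary_value_eq:
  assumes g: "g \<in> sobolev ver \<Omega> Q" and n: "nice (osc Q g) g \<gamma>" and op: "open (fst \<gamma>)"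
    and e: "ends_at \<gamma> e x" and L: "end_limit g \<gamma> e L"
  shows "boundary_value \<Omega> Q g x = ereal L"
proof -
  have x: "x \<in> frontier \<Omega>" using e unfolding ends_at_def by blast
  have p: "\<gamma> \<in> paths_in \<Omega>" using n unfolding nice_def by blast
  let ?good = "\<lambda>\<gamma>. good_path \<Omega> Q g \<gamma> \<and> accessible_by x \<gamma>"
  have ex: "?good \<gamma>" using n op e accessible_iff[OF p x] unfolding good_path_iff by blast
  define \<gamma>' where "\<gamma>' = (SOME \<gamma>. ?good \<gamma>)"
  have g': "?good \<gamma>'" unfolding \<gamma>'_def by (rule someI[of ?good, OF ex])
  then have n': "nice (osc Q g) g \<gamma>'" unfolding good_path_iff by blast
  have p': "\<gamma>' \<in> paths_in \<Omega>" using n' unfolding nice_def by blast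
  obtain e0 where e0: "ends_at \<gamma>' e0 x" using g' accessible_iff[OF p' x] by blast
  have "end_limit g \<gamma>' e' L" if e': "ends_at \<gamma>' e' x" for e'
  proof -
    obtain L' where L': "end_limit g \<gamma>' e' L'" using end_limit_exists[OF n' e'] by blast
    then show ?thesis using end_limit_independent[OF g n e L n' e' L'] by simp
  qed
  then have "liminf_along Q g \<gamma>' x = ereal L" by (rule liminf_along_eq[OF n' sobolev_fin[OF g] e0])
  moreover have "x \<in> accessible_good \<Omega> Q g" unfolding accessible_good_def using x ex by blast
  ultimately show ?thesis unfolding boundary_value_def accessible_value_def \<gamma>'_def by simp
qed

definition same_limits :: "(complex \<Rightarrow> ereal) \<Rightarrow> (complex \<Rightarrow> ereal) \<Rightarrow> cpath \<Rightarrow> bool" where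
  "same_limits g f \<gamma> \<longleftrightarrow> (\<forall>e x L L'. open (fst \<gamma>) \<longrightarrow> ends_at \<gamma> e x \<longrightarrow> end_limit g \<gamma> e L \<longrightarrow> end_limit f \<gamma> e L' \<longrightarrow> L = L')"

text \<open>A condition on boundary points becomes one on paths: almost every path is good for both
  functions, and at the points accessible by it both boundary values are limits along that very
  path.\<close>

lemma has_boundary_values_iff:
  assumes g: "g \<in> sobolev ver \<Omega> Q" and f: "f \<in> sobolev ver \<Omega> Q"
  shows "has_boundary_values ver \<Omega> Q g f \<longleftrightarrow> aep (same_limits g f)"
proof -
  let ?R = "\<lambda>\<gamma>. \<forall>x\<in>frontier \<Omega>. accessible_by x \<gamma> \<longrightarrow> boundary_value \<Omega> Q g x = boundary_value \<Omega> Q f x"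
  have "has_boundary_values ver \<Omega> Q g f \<longleftrightarrow> aep ?R"
  proof
    assume "has_boundary_values ver \<Omega> Q g f"
    then obtain G where G: "carpet_mod ver \<Omega> Q (paths_in \<Omega> - G) = 0"
      "\<forall>x\<in>frontier \<Omega>. (\<exists>\<gamma>\<in>G. accessible_by x \<gamma>) \<longrightarrow> boundary_value \<Omega> Q g x = boundary_value \<Omega> Q f x"
      unfolding has_boundary_values_def by blast
    show "aep ?R" unfolding aep_def by (rule carpet_mod_null_subset[OF G(1)]) (use G(2) in auto)
  next
    assume R: "aep ?R"
    have "paths_in \<Omega> - {\<gamma>\<in>paths_in \<Omega>. ?R \<gamma>} = {\<gamma>\<in>paths_in \<Omega>. \<not> ?R \<gamma>}" by auto
    then show "has_boundary_values ver \<Omega> Q g f" unfolding has_boundary_values_def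
      using R unfolding aep_def by (intro exI[of _ "{\<gamma>\<in>paths_in \<Omega>. ?R \<gamma>}"]) auto
  qed
  also have "aep ?R \<longleftrightarrow> aep (same_limits g f)"
  proof
    assume "aep ?R"
    from aep_conj[OF this aep_conj[OF sobolev_nice[OF g] sobolev_nice[OF f]]] show "aep (same_limits g f)"
    proof (rule aep_mono)
      fix \<gamma> assume p: "\<gamma> \<in> paths_in \<Omega>" and A: "?R \<gamma> \<and> nice (osc Q g) g \<gamma> \<and> nice (osc Q f) f \<gamma>"
      show "same_limits g f \<gamma>" unfolding same_limits_def
      proof (intro allI impI)
        fix e x L L' assume B: "open (fst \<gamma>)" "ends_at \<gamma> e x" "end_limit g \<gamma> e L" "end_limit f \<gamma> e L'"
        have x: "x \<in> frontier \<Omega>" using B(2) unfolding ends_at_def by blast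
        have "boundary_value \<Omega> Q g x = boundary_value \<Omega> Q f x" using A x accessible_iff[OF p x] B(1,2) by blast
        moreover have "boundary_value \<Omega> Q g x = ereal L" by (rule boundary_value_eq[OF g _ B(1-3)]) (use A in blast)
        moreover have "boundary_value \<Omega> Q f x = ereal L'" by (rule boundary_value_eq[OF f _ B(1,2,4)]) (use A in blast)
        ultimately show "L = L'" by simp
      qed
    qed
  next
    assume "aep (same_limits g f)"
    from aep_conj[OF this aep_conj[OF sobolev_nice[OF g] sobolev_nice[OF f]]] show "aep ?R"
    proof (rule aep_mono)
      fix \<gamma> assume p: "\<gamma> \<in> paths_in \<Omega>" and A: "same_limits g f \<gamma> \<and> nice (osc Q g) g \<gamma> \<and> nice (osc Q f) f \<gamma>"
      show "?R \<gamma>"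
      proof (intro ballI impI)
        fix x assume x: "x \<in> frontier \<Omega>" "accessible_by x \<gamma>"
        then obtain e where e: "open (fst \<gamma>)" "ends_at \<gamma> e x" using accessible_iff[OF p x(1)] by blast
        obtain L where L: "end_limit g \<gamma> e L" using end_limit_exists[OF _ e(2)] A by blast
        obtain L' where L': "end_limit f \<gamma> e L'" using end_limit_exists[OF _ e(2)] A by blast
        have "L = L'" using A e L L' unfolding same_limits_def by blast
        then show "boundary_value \<Omega> Q g x = boundary_value \<Omega> Q f x"
          using boundary_value_eq[OF g _ e L] boundary_value_eq[OF f _ e L'] A by simp
      qed
    qed
  qed
  finally show ?thesis .
qed

end

section \<open>Sequences of Sobolev functions\<close>

lemma bounded_diagonal_subsequence:
  fixes b :: "nat \<Rightarrow> nat \<Rightarrow> real"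
  assumes bd: "\<And>n i. \<bar>b n i\<bar> \<le> M"
  obtains r where "strict_mono r" "\<And>i. convergent (\<lambda>n. b (r n) i)"
proof -
  interpret subseqs "\<lambda>i s. convergent (\<lambda>n. b (s n) i)"
  proof
    fix i and s :: "nat \<Rightarrow> nat" assume "strict_mono s"
    have "bounded (range (\<lambda>n. b (s n) i))" using bd by (auto simp: bounded_iff)
    then obtain l r where "strict_mono r" "((\<lambda>n. b (s n) i) \<circ> r) \<longlonglongrightarrow> l"
      using bounded_imp_convergent_subsequence by blast
    then show "\<exists>r'. strict_mono r' \<and> convergent (\<lambda>n. b ((s \<circ> r') n) i)"
      unfolding convergent_def by (auto simp: o_def)
  qed
  have "convergent (\<lambda>n. b (diagseq n) i)" for i
  proof -
    have "convergent (\<lambda>n. b ((diagseq \<circ> (+) (Suc i)) n) i)"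
    proof (rule diagseq_holds)
      fix r s :: "nat \<Rightarrow> nat" and n assume "strict_mono r" "convergent (\<lambda>k. b (s k) n)"
      then show "convergent (\<lambda>k. b ((s \<circ> r) k) n)"
        using convergent_subseq_convergent[of "\<lambda>k. b (s k) n" r] by (simp add: o_def)
    qed
    then have "convergent (\<lambda>n. b (diagseq (n + Suc i)) i)" by (simp add: o_def add.commute)
    then show ?thesis using convergent_ignore_initial_segment[of "\<lambda>n. b (diagseq n) i" "Suc i"] by simp
  qed
  then show ?thesis using that subseq_diagseq by blast
qed

text \<open>Telescoping the squares dominates a fast Cauchy sequence of the Hilbert space by one element.\<close>

lemma fast_Cauchy_dominated:
  fixes a :: "nat \<Rightarrow> nat \<Rightarrow> real"
  assumes a0: "\<And>n i. a n i \<ge> 0" and sum: "\<And>n. summable (\<lambda>i. (a n i)\<^sup>2)" and E: "\<And>n. (\<Sum>i. (a n i)\<^sup>2) \<le> E"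
    and fast: "\<And>n. summable (\<lambda>i. (a (Suc n) i - a n i)\<^sup>2)" "\<And>n. (\<Sum>i. (a (Suc n) i - a n i)\<^sup>2) \<le> 4 * (1/8)^n"
  shows "(\<Sum>i. (SUP n. ennreal (a n i))\<^sup>2) < \<infinity>"
proof -
  have E0: "E \<ge> 0" using E[of 0] suminf_nonneg[OF sum[of 0]] by force
  let ?D = "\<lambda>n i. \<bar>(a (Suc n) i)\<^sup>2 - (a n i)\<^sup>2\<bar>"
  have le: "(SUP n. ennreal (a n i))\<^sup>2 \<le> ennreal ((a 0 i)\<^sup>2) + (\<Sum>n. ennreal (?D n i))" for i
  proof (rule SUP_square_leI)
    fix m
    have "(a m i)\<^sup>2 \<le> (a 0 i)\<^sup>2 + (\<Sum>n<m. ?D n i)"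
      by (induction m) (auto simp: abs_if split: if_splits)
    then have "(ennreal (a m i))\<^sup>2 \<le> ennreal ((a 0 i)\<^sup>2 + (\<Sum>n<m. ?D n i))"
      unfolding ennreal_power[OF a0] by (rule ennreal_leI)
    also have "\<dots> = ennreal ((a 0 i)\<^sup>2) + (\<Sum>n<m. ennreal (?D n i))" by (subst ennreal_plus) (auto simp: sum_nonneg sum_ennreal)
    also have "\<dots> \<le> ennreal ((a 0 i)\<^sup>2) + (\<Sum>n. ennreal (?D n i))" by (intro add_left_mono sum_le_suminf) auto
    finally show "(ennreal (a m i))\<^sup>2 \<le> ennreal ((a 0 i)\<^sup>2) + (\<Sum>n. ennreal (?D n i))" .
  qed
  have Dn: "(\<Sum>i. ennreal (?D n i)) \<le> ennreal ((4 + 4 * E) * (1/2)^n)" for n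
  proof -
    \<comment> \<open>The weight \<open>2^n\<close> is a compromise: it turns the bound
      \<open>4 * (1/8)^n\<close> on the differences into \<open>4 * (1/4)^n\<close> and damps the
      bounded energies by \<open>(1/2)^n\<close>.\<close>
    let ?k = "2^n :: real"
    let ?f = "\<lambda>i. ?k * (a (Suc n) i - a n i)\<^sup>2 + (1 / ?k) * (2 * (a (Suc n) i)\<^sup>2 + 2 * (a n i)\<^sup>2)"
    have "?D n i \<le> ?f i" for i
    proof -
      let ?x = "\<bar>a (Suc n) i - a n i\<bar>" and ?y = "a (Suc n) i + a n i"
      have "?D n i = ?x * ?y" proof -
        have "(a (Suc n) i)\<^sup>2 - (a n i)\<^sup>2 = (a (Suc n) i - a n i) * ?y" by (simp add: power2_eq_square algebra_simps)
        moreover have "\<bar>?y\<bar> = ?y" using a0[of "Suc n" i] a0[of n i] by simp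
        ultimately show ?thesis by (simp only: abs_mult)
      qed
      also have "\<dots> \<le> ?k * ?x\<^sup>2 + (1/?k) * ?y\<^sup>2"
      proof -
        have "0 \<le> (?k * ?x - ?y)\<^sup>2 + (?k * ?x)\<^sup>2 + ?y\<^sup>2" by simp
        then have "2 * (?k * ?x * ?y) \<le> 2 * ((?k * ?x)\<^sup>2 + ?y\<^sup>2)" by (simp add: power2_diff)
        then have "?k * (?x * ?y) \<le> ?k * (?k * ?x\<^sup>2 + 1/?k * ?y\<^sup>2)" by (simp add: algebra_simps power2_eq_square)
        then show ?thesis by (rule mult_left_le_imp_le) simp
      qed
      also have "\<dots> \<le> ?f i"
      proof -
        have "?y\<^sup>2 \<le> 2 * (a (Suc n) i)\<^sup>2 + 2 * (a n i)\<^sup>2"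
          using zero_le_power2[of "a (Suc n) i - a n i"] by (simp add: power2_eq_square algebra_simps)
        then show ?thesis by (intro add_mono mult_left_mono) auto
      qed
      finally show ?thesis .
    qed
    then have "(\<Sum>i. ennreal (?D n i)) \<le> (\<Sum>i. ennreal (?f i))" by (intro suminf_le ennreal_leI summableI)
    also have "\<dots> = ennreal (suminf ?f)"
      by (rule suminf_ennreal2) (use fast sum in \<open>auto intro!: summable_add summable_mult\<close>)
    also have "suminf ?f = ?k * (\<Sum>i. (a (Suc n) i - a n i)\<^sup>2) + (1 / ?k) * (2 * (\<Sum>i. (a (Suc n) i)\<^sup>2) + 2 * (\<Sum>i. (a n i)\<^sup>2))"
      by (subst suminf_add[symmetric] suminf_mult; (intro summable_add summable_mult fast sum)?)+ (rule refl)
    also have "ennreal \<dots> \<le> ennreal (?k * (4 * (1/8)^n) + (1 / ?k) * (2 * E + 2 * E))"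
      using fast(2)[of n] E[of n] E[of "Suc n"] by (intro ennreal_leI add_mono mult_left_mono) auto
    also have "\<dots> \<le> ennreal ((4 + 4 * E) * (1/2)^n)"
    proof (rule ennreal_leI)
      have "?k * (4 * (1/8)^n) = 4 * (1/4::real)^n" by (simp add: power_mult_distrib[symmetric] flip: power_divide)
      also have "\<dots> \<le> 4 * (1/2)^n" by (intro mult_left_mono power_mono) auto
      finally show "?k * (4 * (1/8)^n) + (1 / ?k) * (2 * E + 2 * E) \<le> (4 + 4 * E) * (1/2)^n"
        by (simp add: algebra_simps power_divide)
    qed
    finally show ?thesis .
  qed
  have "(\<Sum>i. \<Sum>n. ennreal (?D n i)) = (\<integral>\<^sup>+i. (\<Sum>n. ennreal (?D n i)) \<partial>count_space UNIV)" by (simp add: nn_integral_count_space_nat)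
  also have "\<dots> = (\<Sum>n. \<integral>\<^sup>+i. ennreal (?D n i) \<partial>count_space UNIV)" by (rule nn_integral_suminf) simp
  also have "\<dots> = (\<Sum>n. \<Sum>i. ennreal (?D n i))" by (simp add: nn_integral_count_space_nat)
  also have "\<dots> \<le> (\<Sum>n. ennreal ((4 + 4 * E) * (1/2)^n))" by (intro suminf_le summableI Dn)
  also have "\<dots> < \<infinity>" using E0 by (subst sum_finite_iff) (auto intro!: summable_mult summable_geometric)
  finally have fin2: "(\<Sum>i. \<Sum>n. ennreal (?D n i)) < \<infinity>" .
  have "(\<Sum>i. (SUP n. ennreal (a n i))\<^sup>2) \<le> (\<Sum>i. ennreal ((a 0 i)\<^sup>2) + (\<Sum>n. ennreal (?D n i)))" by (intro suminf_le summableI le)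
  also have "\<dots> = (\<Sum>i. ennreal ((a 0 i)\<^sup>2)) + (\<Sum>i. \<Sum>n. ennreal (?D n i))" by (rule suminf_add[symmetric]) auto
  also have "\<dots> < \<infinity>"
  proof -
    have "(\<Sum>i. ennreal ((a 0 i)\<^sup>2)) < \<infinity>" using sum[of 0] by (subst sum_finite_iff) auto
    then show ?thesis using fin2 by (simp add: less_top[symmetric])
  qed
  finally show ?thesis .
qed

text \<open>An upper limit is available at all of the uncountably many points without further
  extraction. It preserves inequalities up to a constant, which is what gradients, oscillations and
  boundary limits require.\<close>

definition lsup :: "(nat \<Rightarrow> real) \<Rightarrow> real" where "lsup a = real_of_ereal (limsup (\<lambda>n. ereal (a n)))"

lemma lsup_ereal:
  assumes "\<And>n. \<bar>a n\<bar> \<le> M" shows "limsup (\<lambda>n. ereal (a n)) = ereal (lsup a)"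
proof -
  have "ereal (- M) \<le> limsup (\<lambda>n. ereal (a n))" using assms by (intro le_Limsup always_eventually allI) (auto simp: abs_le_iff minus_le_iff)
  moreover have "limsup (\<lambda>n. ereal (a n)) \<le> ereal M" using assms by (intro Limsup_bounded always_eventually allI) (auto simp: abs_le_iff)
  ultimately show ?thesis unfolding lsup_def by (cases "limsup (\<lambda>n. ereal (a n))") auto
qed

lemma lsup_le:
  assumes a: "\<And>n. \<bar>a n\<bar> \<le> M" and b: "\<And>n. \<bar>b n\<bar> \<le> M'" and le: "\<And>n. a n \<le> b n + c"
  shows "lsup a \<le> lsup b + c"
proof -
  have "ereal (lsup a) \<le> ereal (lsup b + c)"
  proof (rule ereal_le_epsilon2)
    fix e :: real assume e: "0 < e"
    have "limsup (\<lambda>n. ereal (b n)) < ereal (lsup b + e)" using e by (simp add: lsup_ereal[OF b])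
    then have "eventually (\<lambda>n. ereal (b n) < ereal (lsup b + e)) sequentially" by (rule Limsup_lessD)
    then have "eventually (\<lambda>n. ereal (a n) \<le> ereal (lsup b + c) + ereal e) sequentially"
    proof eventually_elim
      case (elim n) then show ?case using le[of n] by simp
    qed
    then show "ereal (lsup a) \<le> ereal (lsup b + c) + ereal e"
      unfolding lsup_ereal[OF a, symmetric] by (rule Limsup_bounded)
  qed
  then show ?thesis by simp
qed

lemma lsup_limit: "b \<longlonglongrightarrow> l \<Longrightarrow> lsup b = l"
  unfolding lsup_def by (subst lim_imp_Limsup[of sequentially _ "ereal l"]) auto

lemma lsup_const: "lsup (\<lambda>_. c) = c" by (rule lsup_limit) simp

context carpet_domain
begin

text \<open>Janiszewski's theorem in an induction on \<open>F\<close>: the next closed disk and the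
  complement of the current domain are disjoint, their empty intersection is connected, and neither
  of them separates the two points.\<close>

lemma connected_remove_disks:
  assumes "finite F" shows "connected (\<Omega> - (\<Union>i\<in>F. closure (Q i)))"
  using assms
proof (induction F)
  case empty then show ?case using connected_Omega by simp
next
  case (insert j F)
  let ?U = "\<Omega> - (\<Union>i\<in>F. closure (Q i))"
  have op: "open ?U" using insert open_Omega by (intro open_Diff closed_UN) auto
  have sub: "closure (Q j) \<subseteq> ?U"
  proof -
    have "closure (Q j) \<inter> closure (Q i) = {}" if "i \<in> F" for i using disjoint_closure_Q[of j i] insert(2) that by blast
    then show ?thesis using closure_Q_subset[of j] by blast
  qed
  have "connected_component (?U - closure (Q j)) a b" if ab: "a \<in> ?U - closure (Q j)" "b \<in> ?U - closure (Q j)" for a b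
  proof -
    have "connected_component (- (closure (Q j) \<union> - ?U)) a b"
    proof (rule Janiszewski)
      show "compact (closure (Q j))" by (rule compact_closure_Q)
      show "closed (- ?U)" using op unfolding closed_def by (simp only: double_complement)
      have "closure (Q j) \<inter> - ?U = {}" using sub by blast
      then show "connected (closure (Q j) \<inter> - ?U)" by simp
      show "connected_component (- closure (Q j)) a b"
        unfolding connected_component_def using connected_Compl_closure_Q[of j] ab by (intro exI[of _ "- closure (Q j)"]) auto
      show "connected_component (- (- ?U)) a b"
        unfolding connected_component_def using insert.IH ab by (intro exI[of _ ?U]) auto
    qed
    moreover have "- (closure (Q j) \<union> - ?U) = ?U - closure (Q j)" by blast
    ultimately show ?thesis by simp
  qed
  then have "connected (?U - closure (Q j))" unfolding connected_iff_connected_component by blast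
  moreover have "\<Omega> - (\<Union>i\<in>insert j F. closure (Q i)) = ?U - closure (Q j)" by blast
  ultimately show ?case by simp
qed

text \<open>A set of full measure on the line is dense, and the two coordinates can be chosen
  independently.\<close>

lemma square_generic_dense:
  assumes P: "aep P" and d: "\<delta> > 0"
  obtains w where "snorm (w - z) < \<delta>" "generic_x P (Re w)" "generic_y P (Im w)"
proof -
  have *: "\<exists>x. \<bar>x - t\<bar> < \<delta> \<and> R x" if aeR: "AE x in lborel. R x" for R :: "real \<Rightarrow> bool" and t
  proof (rule ccontr)
    assume n: "\<not> ?thesis"
    obtain N where N: "N \<in> null_sets lborel" "{x \<in> space lborel. \<not> R x} \<subseteq> N"
      using aeR unfolding eventually_ae_filter by blast
    have "{t - \<delta><..<t + \<delta>} \<subseteq> N"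
    proof
      fix x assume "x \<in> {t - \<delta><..<t + \<delta>}"
      then have "\<bar>x - t\<bar> < \<delta>" by auto
      then have "\<not> R x" using n by blast
      then show "x \<in> N" using N(2) by auto
    qed
    then have "emeasure lborel {t - \<delta><..<t + \<delta>} \<le> emeasure lborel N" using N(1) by (intro emeasure_mono) auto
    then show False using N(1) d by (simp add: null_setsD1)
  qed
  obtain x y where "\<bar>x - Re z\<bar> < \<delta>" "generic_x P x" "\<bar>y - Im z\<bar> < \<delta>" "generic_y P y"
    using *[OF AE_generic(1)[OF P]] *[OF AE_generic(2)[OF P]] by metis
  then show ?thesis using that[of "Complex x y"] by (simp add: snorm_def)
qed

lemma sum_over_split: "(\<Sum>i. \<sigma> i) = sum_over I \<sigma> + sum_over (- I) (\<sigma> :: nat \<Rightarrow> ennreal)"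
proof -
  have "(\<Sum>i. \<sigma> i) = (\<Sum>i. (if i \<in> I then \<sigma> i else 0) + (if i \<in> - I then \<sigma> i else 0))"
    by (rule suminf_cong) auto
  also have "\<dots> = sum_over I \<sigma> + sum_over (- I) \<sigma>" unfolding sum_over_def by (rule suminf_add[symmetric]) auto
  finally show ?thesis .
qed

end

section \<open>Existence of minimizers\<close>

text \<open>Here \<open>c\<close> stands for the oscillations of an average, known only to be at
  most the mean of \<open>a\<close> and \<open>b\<close>. The parallelogram identity then becomes an
  inequality, in the direction that bounds the distance of \<open>a\<close> and
  \<open>b\<close>.\<close>

lemma parallelogram_sums:
  fixes a b c :: "nat \<Rightarrow> real"
  assumes a: "summable (\<lambda>i. (a i)\<^sup>2)" and b: "summable (\<lambda>i. (b i)\<^sup>2)"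
    and c: "\<And>i. 0 \<le> c i" "\<And>i. 2 * c i \<le> a i + b i"
  shows "summable (\<lambda>i. (a i - b i)\<^sup>2)" "(\<Sum>i. (a i - b i)\<^sup>2) + 4 * (\<Sum>i. (c i)\<^sup>2) \<le> 2 * (\<Sum>i. (a i)\<^sup>2) + 2 * (\<Sum>i. (b i)\<^sup>2)"
proof -
  have s: "summable (\<lambda>i. 2 * (a i)\<^sup>2 + 2 * (b i)\<^sup>2)" using a b by (intro summable_add summable_mult)
  have id: "(a i - b i)\<^sup>2 + (a i + b i)\<^sup>2 = 2 * (a i)\<^sup>2 + 2 * (b i)\<^sup>2" for i by (simp add: power2_eq_square algebra_simps)
  have c4: "4 * (c i)\<^sup>2 \<le> (a i + b i)\<^sup>2" for i
    using power_mono[OF c(2)[of i], of 2] c(1)[of i] by (simp add: power_mult_distrib)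
  show s1: "summable (\<lambda>i. (a i - b i)\<^sup>2)"
    by (rule summable_comparison_test_ev[OF always_eventually s], rule allI) (use id in \<open>metis abs_of_nonneg le_add_same_cancel1 real_norm_def zero_le_power2\<close>)
  have s2: "summable (\<lambda>i. (a i + b i)\<^sup>2)"
    by (rule summable_comparison_test_ev[OF always_eventually s], rule allI) (use id in \<open>metis abs_of_nonneg le_add_same_cancel2 real_norm_def zero_le_power2\<close>)
  have s3: "summable (\<lambda>i. 4 * (c i)\<^sup>2)"
    by (rule summable_comparison_test_ev[OF always_eventually s2], rule allI) (use c4 in simp)
  then have s4: "summable (\<lambda>i. (c i)\<^sup>2)" by simp
  have "4 * (\<Sum>i. (c i)\<^sup>2) \<le> (\<Sum>i. (a i + b i)\<^sup>2)"
    using suminf_le[OF c4 s3 s2] by (simp add: suminf_mult[OF s4])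
  moreover have "(\<Sum>i. (a i - b i)\<^sup>2) + (\<Sum>i. (a i + b i)\<^sup>2) = 2 * (\<Sum>i. (a i)\<^sup>2) + 2 * (\<Sum>i. (b i)\<^sup>2)"
    using suminf_add[OF s1 s2] suminf_add[OF summable_mult[OF a, of 2] summable_mult[OF b, of 2]] id
    by (simp add: suminf_mult[OF a] suminf_mult[OF b])
  ultimately show "(\<Sum>i. (a i - b i)\<^sup>2) + 4 * (\<Sum>i. (c i)\<^sup>2) \<le> 2 * (\<Sum>i. (a i)\<^sup>2) + 2 * (\<Sum>i. (b i)\<^sup>2)" by linarith
qed

locale dirichlet_problem = jordan_carpet_domain +
  fixes f :: "complex \<Rightarrow> ereal" and M :: real
  assumes f: "f \<in> sobolev ver \<Omega> Q" and M: "M > 0" and bdv: "\<And>x. x \<in> frontier \<Omega> \<Longrightarrow> \<bar>boundary_value \<Omega> Q f x\<bar> \<le> ereal M"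
begin

definition "competitors = {g \<in> sobolev ver \<Omega> Q. aep (same_limits g f)}"

lemma competitorsD: "g \<in> competitors \<Longrightarrow> g \<in> sobolev ver \<Omega> Q" "g \<in> competitors \<Longrightarrow> aep (same_limits g f)"
  "g \<in> competitors \<Longrightarrow> fin g" "g \<in> competitors \<Longrightarrow> summable (\<lambda>i. (ro g i)\<^sup>2)"
  unfolding competitors_def using sobolev_fin sobolev_iff by auto

lemma minimizer_iff:
  "dirichlet_minimizer ver \<Omega> Q f u \<longleftrightarrow> u \<in> competitors \<and> (\<forall>g\<in>competitors. En u \<le> En g)"
proof -
  have "g \<in> competitors \<longleftrightarrow> g \<in> sobolev ver \<Omega> Q \<and> has_boundary_values ver \<Omega> Q g f" for g
    unfolding competitors_def using has_boundary_values_iff[OF _ f] by blast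
  moreover have "dirichlet_energy Q \<Omega> u \<le> dirichlet_energy Q \<Omega> g \<longleftrightarrow> En u \<le> En g"
    if "u \<in> sobolev ver \<Omega> Q" "g \<in> sobolev ver \<Omega> Q" for g
    using that En_nonneg by (simp add: dirichlet_energy_eq ennreal_le_iff)
  ultimately show ?thesis unfolding dirichlet_minimizer_def by blast
qed

lemma limit_bounded:
  assumes "nice (osc Q f) f \<gamma>" "open (fst \<gamma>)" "ends_at \<gamma> e x" "end_limit f \<gamma> e L"
  shows "\<bar>L\<bar> \<le> M"
  using bdv[of x] boundary_value_eq[OF f assms] assms(3) unfolding ends_at_def by simp

text \<open>\<open>\<Phi>\<close> has to preserve only boundary limits \<open>L\<close> of
  \<open>f\<close> with \<open>\<bar>L\<bar> \<le> M\<close>, and by \<open>limit_bounded\<close>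
  there are no others along good open paths. This admits truncation at \<open>M\<close> as well as
  the addition of a function that vanishes near the boundary.\<close>

lemma competitors_compose:
  assumes g: "g \<in> competitors" and h: "h \<in> sobolev ver \<Omega> Q"
    and hlim: "aep (\<lambda>\<gamma>. \<forall>e x L L'. open (fst \<gamma>) \<longrightarrow> ends_at \<gamma> e x \<longrightarrow> end_limit f \<gamma> e L \<longrightarrow> end_limit h \<gamma> e L' \<longrightarrow> \<bar>L\<bar> \<le> M \<longrightarrow> \<Phi> L L' = L)"
    and \<Phi>: "\<And>a b a' b'. \<bar>\<Phi> a b - \<Phi> a' b'\<bar> \<le> \<bar>a - a'\<bar> + \<bar>b - b'\<bar>"
    and k: "\<And>x. \<bar>g x\<bar> \<noteq> \<infinity> \<Longrightarrow> \<bar>h x\<bar> \<noteq> \<infinity> \<Longrightarrow> k x = ereal (\<Phi> (val g x) (val h x))"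
  shows "k \<in> competitors"
proof -
  have gS: "g \<in> sobolev ver \<Omega> Q" using competitorsD g by blast
  have kS: "k \<in> sobolev ver \<Omega> Q" by (rule sobolev_compose[OF gS h \<Phi> k])
  have "aep (\<lambda>\<gamma>. (same_limits g f \<gamma> \<and>
      (\<forall>e x L L'. open (fst \<gamma>) \<longrightarrow> ends_at \<gamma> e x \<longrightarrow> end_limit f \<gamma> e L \<longrightarrow> end_limit h \<gamma> e L' \<longrightarrow> \<bar>L\<bar> \<le> M \<longrightarrow> \<Phi> L L' = L)) \<and>
      nice (osc Q g) g \<gamma> \<and> nice (osc Q h) h \<gamma> \<and> nice (osc Q f) f \<gamma>)"
    by (intro aep_conj hlim sobolev_nice gS h f competitorsD(2)[OF g])
  then have "aep (same_limits k f)"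
  proof (rule aep_mono)
    fix \<gamma> assume p: "\<gamma> \<in> paths_in \<Omega>" and A: "(same_limits g f \<gamma> \<and>
      (\<forall>e x L L'. open (fst \<gamma>) \<longrightarrow> ends_at \<gamma> e x \<longrightarrow> end_limit f \<gamma> e L \<longrightarrow> end_limit h \<gamma> e L' \<longrightarrow> \<bar>L\<bar> \<le> M \<longrightarrow> \<Phi> L L' = L)) \<and>
      nice (osc Q g) g \<gamma> \<and> nice (osc Q h) h \<gamma> \<and> nice (osc Q f) f \<gamma>"
    then have n: "nice (osc Q g) g \<gamma>" "nice (osc Q h) h \<gamma>" "nice (osc Q f) f \<gamma>" by blast+
    show "same_limits k f \<gamma>" unfolding same_limits_def
    proof (intro allI impI)
      fix e x Lk L assume o: "open (fst \<gamma>)" and e: "ends_at \<gamma> e x" and Lk: "end_limit k \<gamma> e Lk" and L: "end_limit f \<gamma> e L"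
      obtain Lg where Lg: "end_limit g \<gamma> e Lg" using end_limit_exists[OF n(1) e] by blast
      obtain Lh where Lh: "end_limit h \<gamma> e Lh" using end_limit_exists[OF n(2) e] by blast
      have "Lg = L" using A o e Lg L unfolding same_limits_def by blast
      have "end_limit k \<gamma> e (\<Phi> Lg Lh)" by (rule end_limit_compose[OF n(1,2) Lg Lh \<Phi> k])
      then have "Lk = \<Phi> Lg Lh" using end_limit_unique[OF p e Lk] by blast
      moreover have "\<Phi> L Lh = L" using A o e L Lh limit_bounded[OF n(3) o e L] by blast
      ultimately show "Lk = L" using \<open>Lg = L\<close> by simp
    qed
  qed
  then show ?thesis unfolding competitors_def using kS by blast
qed

lemma competitors_combine:
  assumes g: "g \<in> competitors" and h: "h \<in> competitors"
    and \<Phi>: "\<And>a b a' b'. \<bar>\<Phi> a b - \<Phi> a' b'\<bar> \<le> \<bar>a - a'\<bar> + \<bar>b - b'\<bar>" and diag: "\<And>t. \<bar>t\<bar> \<le> M \<Longrightarrow> \<Phi> t t = t"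
    and k: "\<And>x. \<bar>g x\<bar> \<noteq> \<infinity> \<Longrightarrow> \<bar>h x\<bar> \<noteq> \<infinity> \<Longrightarrow> k x = ereal (\<Phi> (val g x) (val h x))"
  shows "k \<in> competitors"
proof (rule competitors_compose[OF g competitorsD(1)[OF h] _ \<Phi> k])
  show "aep (\<lambda>\<gamma>. \<forall>e x L L'. open (fst \<gamma>) \<longrightarrow> ends_at \<gamma> e x \<longrightarrow> end_limit f \<gamma> e L \<longrightarrow> end_limit h \<gamma> e L' \<longrightarrow> \<bar>L\<bar> \<le> M \<longrightarrow> \<Phi> L L' = L)"
    using competitorsD(2)[OF h] by (rule aep_mono) (use diag in \<open>unfold same_limits_def, metis\<close>)
qed

lemma f_competitor: "f \<in> competitors"
proof -
  have "aep (same_limits f f)" using aep_hausdorff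
    by (rule aep_mono) (unfold same_limits_def, metis end_limit_unique)
  then show ?thesis unfolding competitors_def using f by blast
qed

definition average :: "(complex \<Rightarrow> ereal) \<Rightarrow> (complex \<Rightarrow> ereal) \<Rightarrow> complex \<Rightarrow> ereal" where
  "average g h x = ereal ((val g x + val h x) / 2)"

lemma average_competitor: "g \<in> competitors \<Longrightarrow> h \<in> competitors \<Longrightarrow> average g h \<in> competitors"
proof (rule competitors_combine[where \<Phi> = "\<lambda>a b. (a + b) / 2"])
  show "\<bar>(a + b) / 2 - (a' + b') / 2\<bar> \<le> \<bar>a - a'\<bar> + \<bar>b - b'\<bar>" for a b a' b' :: real by (simp add: abs_if field_simps)
qed (auto simp: average_def)

lemma ro_average:
  assumes g: "g \<in> competitors" and h: "h \<in> competitors"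
  shows "2 * ro (average g h) i \<le> ro g i + ro h i"
proof -
  have "ro (average g h) i \<le> (ro g i + ro h i) / 2"
  proof (rule ro_le[OF competitorsD(3)[OF average_competitor[OF g h]]])
    fix x y assume xy: "x \<in> frontier (Q i)" "y \<in> frontier (Q i)"
    show "val (average g h) x - val (average g h) y \<le> (ro g i + ro h i) / 2"
      using fin_bounds(2,3)[OF competitorsD(3)[OF g] xy(1)] fin_bounds(2,3)[OF competitorsD(3)[OF h] xy(1)]
        fin_bounds(2,3)[OF competitorsD(3)[OF g] xy(2)] fin_bounds(2,3)[OF competitorsD(3)[OF h] xy(2)]
      unfolding average_def real_of_ereal.simps by (simp add: field_simps)
  qed
  then show ?thesis by simp
qed

definition "minE = Inf (En ` competitors)"

lemma minE_le: "g \<in> competitors \<Longrightarrow> minE \<le> En g"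
  unfolding minE_def by (rule cInf_lower) (auto intro!: bdd_belowI[of _ 0] simp: En_nonneg competitorsD)

lemma parallelogram:
  assumes g: "g \<in> competitors" and h: "h \<in> competitors"
  shows "summable (\<lambda>i. (ro g i - ro h i)\<^sup>2)" "(\<Sum>i. (ro g i - ro h i)\<^sup>2) \<le> 2 * En g + 2 * En h - 4 * minE"
proof -
  note P = parallelogram_sums[OF competitorsD(4)[OF g] competitorsD(4)[OF h] ro_nonneg[OF competitorsD(3)[OF average_competitor[OF g h]]] ro_average[OF g h]]
  show "summable (\<lambda>i. (ro g i - ro h i)\<^sup>2)" by (rule P(1))
  have "minE \<le> En (average g h)" by (rule minE_le[OF average_competitor[OF g h]])
  then show "(\<Sum>i. (ro g i - ro h i)\<^sup>2) \<le> 2 * En g + 2 * En h - 4 * minE" using P(2) unfolding En_def by linarith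
qed

lemma truncate_competitor:
  assumes g: "g \<in> competitors"
  defines "h \<equiv> (\<lambda>x. ereal (max (- M) (min M (val g x))))"
  shows "h \<in> competitors" "En h \<le> En g"
proof -
  show h: "h \<in> competitors"
  proof (rule competitors_combine[OF g g, where \<Phi> = "\<lambda>a b. max (- M) (min M a)"])
    show "max (- M) (min M t) = t" if "\<bar>t\<bar> \<le> M" for t using that by auto
    show "\<bar>max (- M) (min M a) - max (- M) (min M a')\<bar> \<le> \<bar>a - a'\<bar> + \<bar>b - b'\<bar>" for a b a' b' :: real
      by (auto simp: max_def min_def abs_if)
  qed (simp add: h_def)
  have le: "ro h i \<le> ro g i" for i
  proof (rule ro_le[OF competitorsD(3)[OF h]])
    fix x y assume xy: "x \<in> frontier (Q i)" "y \<in> frontier (Q i)"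
    show "val h x - val h y \<le> ro g i"
      using fin_bounds(2,3)[OF competitorsD(3)[OF g] xy(1)] fin_bounds(2,3)[OF competitorsD(3)[OF g] xy(2)]
      unfolding h_def real_of_ereal.simps by (auto simp: max_def min_def)
  qed
  show "En h \<le> En g" unfolding En_def
    by (rule suminf_le[OF _ competitorsD(4)[OF h] competitorsD(4)[OF g]]) (use le ro_nonneg[OF competitorsD(3)[OF h]] in \<open>auto intro: power_mono\<close>)
qed

text \<open>The rate \<open>(1/8)^n\<close> is prescribed so that the parallelogram law directly
  yields the fast decay needed in \<open>fast_Cauchy_dominated\<close>.\<close>

lemma minimizing_sequence:
  obtains g where "\<And>n. g n \<in> competitors" "\<And>n. En (g n) \<le> minE + (1/8)^n" "\<And>n x. \<exists>t. g n x = ereal t \<and> \<bar>t\<bar> \<le> M"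
proof -
  have "\<exists>h. h \<in> competitors \<and> En h \<le> minE + (1/8)^n \<and> (\<forall>x. \<exists>t. h x = ereal t \<and> \<bar>t\<bar> \<le> M)" for n :: nat
  proof -
    have "En ` competitors \<noteq> {}" using f_competitor by blast
    moreover have "Inf (En ` competitors) < minE + (1/8)^n" unfolding minE_def by simp
    ultimately have "\<exists>y\<in>En ` competitors. y < minE + (1/8)^n" by (rule cInf_lessD)
    then obtain g where g: "g \<in> competitors" "En g < minE + (1/8)^n" by blast
    \<comment> \<open>At infinite values \<open>val\<close> is 0, so the truncation is real and
      bounded by \<open>M\<close> at every point, even where \<open>g\<close> is infinite.\<close>
    let ?h = "\<lambda>x. ereal (max (- M) (min M (val g x)))"
    have "\<exists>t. ?h x = ereal t \<and> \<bar>t\<bar> \<le> M" for x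
      by (rule exI[of _ "max (- M) (min M (val g x))"]) (use M in \<open>auto simp del: ereal_max ereal_min\<close>)
    moreover have "En ?h \<le> minE + (1/8)^n" using truncate_competitor(2)[OF g(1)] g(2) by linarith
    ultimately show ?thesis using truncate_competitor(1)[OF g(1)] by blast
  qed
  then show ?thesis using that by metis
qed

lemma minimizer_exists: "\<exists>u. dirichlet_minimizer ver \<Omega> Q f u"
proof -
  obtain g where g: "\<And>n. g n \<in> competitors" "\<And>n. En (g n) \<le> minE + (1/8)^n" "\<And>n x. \<exists>t. g n x = ereal t \<and> \<bar>t\<bar> \<le> M"
    using minimizing_sequence by metis
  have gv: "g n x = ereal (val (g n) x)" "\<bar>val (g n) x\<bar> \<le> M" for n x using g(3)[of n x] by auto
  have fg: "fin (g n)" for n using competitorsD(3)[OF g(1)] .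
  define \<sigma> where "\<sigma> i = (SUP n. ennreal (ro (g n) i))" for i
  have \<sigma>2: "(\<Sum>i. (\<sigma> i)\<^sup>2) < \<infinity>" unfolding \<sigma>_def
  proof (rule fast_Cauchy_dominated)
    show "0 \<le> ro (g n) i" for n i by (rule ro_nonneg[OF fg])
    show "summable (\<lambda>i. (ro (g n) i)\<^sup>2)" for n by (rule competitorsD(4)[OF g(1)])
    show "(\<Sum>i. (ro (g n) i)\<^sup>2) \<le> minE + 1" for n
    proof -
      have "(1/8)^n \<le> (1::real)" by (simp add: power_le_one)
      then show ?thesis using g(2)[of n] unfolding En_def by linarith
    qed
    show "summable (\<lambda>i. (ro (g (Suc n)) i - ro (g n) i)\<^sup>2)" for n by (rule parallelogram(1)[OF g(1) g(1)])
    show "(\<Sum>i. (ro (g (Suc n)) i - ro (g n) i)\<^sup>2) \<le> 4 * (1/8)^n" for n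
      using parallelogram(2)[OF g(1)[of "Suc n"] g(1)[of n]] g(2)[of n] g(2)[of "Suc n"] zero_le_power[of "1/8::real" n]
      unfolding power_Suc by linarith
  qed
  have \<sigma>ge: "osc Q (g n) i \<le> \<sigma> i" for n i unfolding osc_eq[OF fg] \<sigma>_def by (rule SUP_upper) simp
  have rMb: "\<bar>rM (g n) i\<bar> \<le> M" "\<bar>rm (g n) i\<bar> \<le> M" for n i
  proof -
    obtain x where x: "x \<in> frontier (Q i)" by (rule frontier_point)
    have "rM (g n) i \<le> M" by (rule rM_least[OF fg]) (use gv(2) in \<open>auto simp: abs_le_iff\<close>)
    moreover have "- M \<le> rm (g n) i" by (rule rm_greatest[OF fg]) (use gv(2) in \<open>auto simp: abs_le_iff minus_le_iff\<close>)
    moreover have "rm (g n) i \<le> rM (g n) i" using fin_bounds(2,3)[OF fg x, of n] by linarith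
    ultimately show "\<bar>rM (g n) i\<bar> \<le> M" "\<bar>rm (g n) i\<bar> \<le> M" by linarith+
  qed
  \<comment> \<open>Suprema and infima are interleaved into one array, so that a single diagonal
    extraction makes both converge on all disks.\<close>
  define b where "b n j = (if even j then rM (g n) (j div 2) else rm (g n) (j div 2))" for n j :: nat
  have "\<bar>b n j\<bar> \<le> M" for n j unfolding b_def using rMb by simp
  then obtain r where r: "strict_mono r" "\<And>j. convergent (\<lambda>n. b (r n) j)" using bounded_diagonal_subsequence by blast
  have cM: "convergent (\<lambda>n. rM (g (r n)) i)" and cm: "convergent (\<lambda>n. rm (g (r n)) i)" for i
    using r(2)[of "2 * i"] r(2)[of "2 * i + 1"] unfolding b_def by simp_all
  obtain MM where MM: "\<And>i. (\<lambda>n. rM (g (r n)) i) \<longlonglongrightarrow> MM i" using cM unfolding convergent_def by metis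
  obtain mm where mm: "\<And>i. (\<lambda>n. rm (g (r n)) i) \<longlonglongrightarrow> mm i" using cm unfolding convergent_def by metis
  define t where "t n x = val (g (r n)) x" for n x
  have tb: "\<bar>t n x\<bar> \<le> M" for n x unfolding t_def by (rule gv(2))
  define v where "v x = lsup (\<lambda>n. t n x)" for x
  define u where "u x = ereal (v x)" for x
  have vb: "\<bar>v x\<bar> \<le> M" for x
    using lsup_le[of "\<lambda>n. t n x" M "\<lambda>_. M" M 0] lsup_le[of "\<lambda>_. - M" M "\<lambda>n. t n x" M 0] tb[of _ x] M
    unfolding v_def lsup_const by (auto simp: abs_le_iff minus_le_iff)
  have vlip: "v x - v y \<le> c" if "\<And>n. t n x - t n y \<le> c" for x y c
  proof -
    have "lsup (\<lambda>n. t n x) \<le> lsup (\<lambda>n. t n y) + c" by (rule lsup_le[OF tb tb]) (use that in \<open>simp add: algebra_simps\<close>)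
    then show ?thesis unfolding v_def by simp
  qed
  have vnear: "\<bar>v x - L\<bar> \<le> c" if "\<And>n. \<bar>t n x - L\<bar> \<le> c" for x L c
  proof -
    have "t n x \<le> L + c" "L \<le> t n x + c" for n using that[of n] by linarith+
    then have "lsup (\<lambda>n. t n x) \<le> lsup (\<lambda>_. L) + c" "lsup (\<lambda>_. L) \<le> lsup (\<lambda>n. t n x) + c"
      using lsup_le[of "\<lambda>n. t n x" M "\<lambda>_. L" "\<bar>L\<bar>" c] lsup_le[of "\<lambda>_. L" "\<bar>L\<bar>" "\<lambda>n. t n x" M c] tb by auto
    then show ?thesis unfolding v_def lsup_const by linarith
  qed
  have fu: "fin u" by (rule finI, rule exI[of _ "- M"], rule exI[of _ M]) (use vb in \<open>auto simp: u_def abs_le_iff minus_le_iff\<close>)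
  \<comment> \<open>On a circle the upper limit is caught between the limits of the infima and of
    the suprema; convergence of the functions themselves is not at hand, so only an inequality
    results.\<close>
  have rou: "ro u i \<le> MM i - mm i" for i
  proof (rule ro_le[OF fu])
    fix x y assume xy: "x \<in> frontier (Q i)" "y \<in> frontier (Q i)"
    have "lsup (\<lambda>n. t n x) \<le> lsup (\<lambda>n. rM (g (r n)) i) + 0"
      by (rule lsup_le[OF tb rMb(1)]) (use fin_bounds(3)[OF fg xy(1)] in \<open>simp add: t_def\<close>)
    moreover have "lsup (\<lambda>n. rm (g (r n)) i) \<le> lsup (\<lambda>n. t n y) + 0"
      by (rule lsup_le[OF rMb(2) tb]) (use fin_bounds(2)[OF fg xy(2)] in \<open>simp add: t_def\<close>)
    ultimately show "val u x - val u y \<le> MM i - mm i"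
      unfolding u_def v_def real_of_ereal.simps using lsup_limit[OF MM[of i]] lsup_limit[OF mm[of i]] by linarith
  qed
  have niceg: "aep (\<lambda>\<gamma>. \<forall>n. nice \<sigma> (g (r n)) \<gamma>)"
  proof (rule aep_all_nat)
    fix n
    have "aep (\<lambda>\<gamma>. nice (osc Q (g (r n))) (g (r n)) \<gamma> \<and> sum_over (meeting Q (path_trace \<gamma>)) \<sigma> < \<infinity>)"
      by (intro aep_conj sobolev_nice competitorsD(1)[OF g(1)] aep_sum_finite[OF \<sigma>2])
    then show "aep (nice \<sigma> (g (r n)))"
    proof (rule aep_mono)
      fix \<gamma> assume A: "nice (osc Q (g (r n))) (g (r n)) \<gamma> \<and> sum_over (meeting Q (path_trace \<gamma>)) \<sigma> < \<infinity>"
      have "gradient_ineq \<Omega> Q \<sigma> (g (r n)) B" if B: "gradient_ineq \<Omega> Q (osc Q (g (r n))) (g (r n)) B" for B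
        unfolding gradient_ineq_def
      proof (intro ballI)
        fix x y assume "x \<in> B \<inter> S" "y \<in> B \<inter> S"
        note D = gradient_ineqD[OF B this]
        have "sum_over (meeting Q B) (osc Q (g (r n))) \<le> sum_over (meeting Q B) \<sigma>" by (rule sum_over_mono[OF order_refl \<sigma>ge])
        then show "\<bar>g (r n) x\<bar> \<noteq> \<infinity> \<and> \<bar>g (r n) y\<bar> \<noteq> \<infinity> \<and> e2ennreal \<bar>g (r n) x - g (r n) y\<bar> \<le> sum_over (meeting Q B) \<sigma>"
          using D order_trans by blast
      qed
      then show "nice \<sigma> (g (r n)) \<gamma>" using A unfolding nice_def by blast
    qed
  qed
  have "upper_gradient ver \<Omega> Q \<sigma> u" unfolding upper_gradient_iff using niceg
  proof (rule aep_mono)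
    fix \<gamma> assume p: "\<gamma> \<in> paths_in \<Omega>" and n: "\<forall>n. nice \<sigma> (g (r n)) \<gamma>"
    let ?X = "sum_over (meeting Q (path_trace \<gamma>)) \<sigma>"
    have fX: "?X < \<infinity>" using n unfolding nice_def by blast
    define c where "c = enn2real ?X"
    have c: "?X = ennreal c" "c \<ge> 0" unfolding c_def using fX by auto
    show "gradient_ineq \<Omega> Q \<sigma> u (path_trace \<gamma>)" unfolding gradient_ineq_def
    proof (intro ballI)
      fix x y assume xy: "x \<in> path_trace \<gamma> \<inter> S" "y \<in> path_trace \<gamma> \<inter> S"
      have "\<bar>t n x - t n y\<bar> \<le> c" for n
      proof -
        have "gradient_ineq \<Omega> Q \<sigma> (g (r n)) (path_trace \<gamma>)" using n path_interval[OF p] unfolding nice_def path_trace_def by blast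
        from gradient_ineqD[OF this xy] have "ennreal \<bar>t n x - t n y\<bar> \<le> ?X" unfolding t_def by (simp add: e2ennreal_abs_diff)
        then show ?thesis using c by (simp add: ennreal_le_iff)
      qed
      then have "t n x - t n y \<le> c" "t n y - t n x \<le> c" for n by (smt (verit))+
      then have "v x - v y \<le> c" "v y - v x \<le> c" using vlip by blast+
      then have "ennreal \<bar>v x - v y\<bar> \<le> ?X" unfolding c(1) by (intro ennreal_leI) linarith
      then show "\<bar>u x\<bar> \<noteq> \<infinity> \<and> \<bar>u y\<bar> \<noteq> \<infinity> \<and> e2ennreal \<bar>u x - u y\<bar> \<le> ?X" unfolding u_def by (simp add: e2ennreal_ereal)
    qed
  qed
  then have ug: "upper_gradient ver \<Omega> Q (osc Q u) u" using upper_gradient_osc[OF _ \<sigma>2 fu] by blast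
  \<comment> \<open>Lower semicontinuity of the energy: finite partial sums pass to the limit, which
    is at most \<open>minE\<close>.\<close>
  have part: "(\<Sum>i<N. (ro u i)\<^sup>2) \<le> minE" for N
  proof -
    have "(\<lambda>n. \<Sum>i<N. (ro (g (r n)) i)\<^sup>2) \<longlonglongrightarrow> (\<Sum>i<N. (MM i - mm i)\<^sup>2)" by (intro tendsto_intros MM mm)
    moreover have "(\<lambda>n. minE + (1/8)^(r n)) \<longlonglongrightarrow> minE + 0"
    proof (intro tendsto_add tendsto_const)
      have "(\<lambda>n. (1/8::real)^n) \<longlonglongrightarrow> 0" by (intro LIMSEQ_power_zero) simp
      from LIMSEQ_subseq_LIMSEQ[OF this r(1)] show "(\<lambda>n. (1/8::real)^(r n)) \<longlonglongrightarrow> 0" by (simp add: o_def)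
    qed
    moreover have "(\<Sum>i<N. (ro (g (r n)) i)\<^sup>2) \<le> minE + (1/8)^(r n)" for n
    proof -
      have "(\<Sum>i<N. (ro (g (r n)) i)\<^sup>2) \<le> En (g (r n))" unfolding En_def by (rule sum_le_suminf[OF competitorsD(4)[OF g(1)]]) auto
      then show ?thesis using g(2)[of "r n"] by linarith
    qed
    ultimately have "(\<Sum>i<N. (MM i - mm i)\<^sup>2) \<le> minE" using LIMSEQ_le[of _ _ "\<lambda>n. minE + (1/8)^(r n)" "minE + 0"] by auto
    moreover have "(\<Sum>i<N. (ro u i)\<^sup>2) \<le> (\<Sum>i<N. (MM i - mm i)\<^sup>2)" by (intro sum_mono power_mono rou ro_nonneg[OF fu])
    ultimately show ?thesis by linarith
  qed
  have su: "summable (\<lambda>i. (ro u i)\<^sup>2)" by (rule summableI_nonneg_bounded[of _ minE]) (use part in auto)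
  have Eu: "En u \<le> minE" unfolding En_def by (rule suminf_le_const[OF su part])
  have sM: "summable (\<lambda>i. (rM u i)\<^sup>2 * (diameter (Q i))\<^sup>2)"
  proof (rule summable_comparison_test_ev[OF always_eventually summable_mult[OF summable_diameter, of "M\<^sup>2"]], rule allI)
    fix i
    obtain x where x: "x \<in> frontier (Q i)" by (rule frontier_point)
    have "rM u i \<le> M" by (rule rM_least[OF fu]) (use vb in \<open>auto simp: u_def abs_le_iff\<close>)
    moreover have "- M \<le> rM u i" using fin_bounds(3)[OF fu x] vb[of x] unfolding u_def by auto
    ultimately have "\<bar>rM u i\<bar> \<le> \<bar>M\<bar>" by linarith
    then have "(rM u i)\<^sup>2 \<le> M\<^sup>2" by (rule abs_le_square_iff[THEN iffD1])
    then show "norm ((rM u i)\<^sup>2 * (diameter (Q i))\<^sup>2) \<le> M\<^sup>2 * (diameter (Q i))\<^sup>2" by (simp add: mult_right_mono)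
  qed
  have uS: "u \<in> sobolev ver \<Omega> Q" unfolding sobolev_iff using fu ug sM su by blast
  have "aep (\<lambda>\<gamma>. (\<forall>n. nice \<sigma> (g (r n)) \<gamma>) \<and> (\<forall>n. same_limits (g (r n)) f \<gamma>))"
    by (intro aep_conj niceg aep_all_nat competitorsD(2) g(1))
  then have "aep (same_limits u f)"
  proof (rule aep_mono)
    fix \<gamma> assume p: "\<gamma> \<in> paths_in \<Omega>" and A: "(\<forall>n. nice \<sigma> (g (r n)) \<gamma>) \<and> (\<forall>n. same_limits (g (r n)) f \<gamma>)"
    then have n: "\<And>n. nice \<sigma> (g (r n)) \<gamma>" and fs: "sum_over (meeting Q (path_trace \<gamma>)) \<sigma> < \<infinity>" unfolding nice_def by blast+
    show "same_limits u f \<gamma>" unfolding same_limits_def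
    proof (intro allI impI)
      fix e x Lu L assume o: "open (fst \<gamma>)" and e: "ends_at \<gamma> e x" and Lu: "end_limit u \<gamma> e Lu" and L: "end_limit f \<gamma> e L"
      have gl: "end_limit (g (r n)) \<gamma> e L" for n
      proof -
        obtain L' where L': "end_limit (g (r n)) \<gamma> e L'" using end_limit_exists[OF n e] by blast
        then have "L' = L" using A o e L unfolding same_limits_def by blast
        then show ?thesis using L' by simp
      qed
      \<comment> \<open>The tail sums of the common gradient \<open>\<sigma>\<close> make the
        convergence at the end of the path uniform in the index, so the upper limit inherits the
        limit \<open>L\<close>.\<close>
      have "end_limit u \<gamma> e L" unfolding end_limit_def tendsto_iff
      proof (intro allI impI)
        fix \<epsilon> :: real assume \<epsilon>: "\<epsilon> > 0"
        then have "\<epsilon>/2 > 0" by simp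
        from tail_sum[OF e fs this] obtain \<delta> where d: "\<delta> > 0" "sum_over (meeting Q (tail \<gamma> e \<delta>)) \<sigma> < ennreal (\<epsilon>/2)" by metis
        show "eventually (\<lambda>s. dist (val u (snd \<gamma> s)) L < \<epsilon>) (at e within stops \<gamma>)"
          using eventually_tail[OF d(1), of \<gamma> e]
        proof eventually_elim
          case (elim s)
          have "\<bar>t k (snd \<gamma> s) - L\<bar> \<le> \<epsilon>/2" for k
          proof -
            have "ennreal \<bar>t k (snd \<gamma> s) - L\<bar> \<le> sum_over (meeting Q (tail \<gamma> e \<delta>)) \<sigma>"
              unfolding t_def by (rule end_limit_bound[OF n e gl]) (use elim in auto)
            also note d(2)
            finally show ?thesis by (simp add: ennreal_less_iff)
          qed
          then have "\<bar>v (snd \<gamma> s) - L\<bar> \<le> \<epsilon>/2" by (rule vnear)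
          then show ?case using \<epsilon> unfolding u_def dist_real_def real_of_ereal.simps by linarith
        qed
      qed
      then show "Lu = L" using end_limit_unique[OF p e Lu] by blast
    qed
  qed
  then have uA: "u \<in> competitors" unfolding competitors_def using uS by blast
  have "En u \<le> En h" if "h \<in> competitors" for h using Eu minE_le[OF that] by linarith
  then show ?thesis unfolding minimizer_iff using uA by blast
qed

lemma minimizer_harmonic:
  assumes u: "dirichlet_minimizer ver \<Omega> Q f u" shows "carpet_harmonic ver \<Omega> Q u"
proof -
  have uc: "u \<in> competitors" "\<And>g. g \<in> competitors \<Longrightarrow> En u \<le> En g" using u unfolding minimizer_iff by auto
  note uS = competitorsD(1)[OF uc(1)]
  note fu = sobolev_fin[OF uS]
  have "dirichlet_energy Q V u \<le> dirichlet_energy Q V (\<lambda>x. u x + \<zeta> x)"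
    if V: "open V" "V \<subset>\<subset> \<Omega>" and \<zeta>: "\<zeta> \<in> sobolev ver \<Omega> Q" "\<forall>x\<in>S - V. \<zeta> x = 0" for V \<zeta>
  proof -
    let ?k = "\<lambda>x. u x + \<zeta> x"
    have kx: "?k x = ereal (val u x + val \<zeta> x)" if "\<bar>u x\<bar> \<noteq> \<infinity>" "\<bar>\<zeta> x\<bar> \<noteq> \<infinity>" for x
      using that by (cases "u x"; cases "\<zeta> x") auto
    have kc: "?k \<in> competitors"
    proof (rule competitors_compose[OF uc(1) \<zeta>(1), where \<Phi> = "\<lambda>a b. a + b"])
      show "aep (\<lambda>\<gamma>. \<forall>e x L L'. open (fst \<gamma>) \<longrightarrow> ends_at \<gamma> e x \<longrightarrow> end_limit f \<gamma> e L \<longrightarrow> end_limit \<zeta> \<gamma> e L' \<longrightarrow> \<bar>L\<bar> \<le> M \<longrightarrow> L + L' = L)"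
        using aep_hausdorff
      proof (rule aep_mono)
        fix \<gamma> assume p: "\<gamma> \<in> paths_in \<Omega>"
        \<comment> \<open>A path towards the boundary finally leaves \<open>closure V\<close>, after
          which \<open>\<zeta>\<close> vanishes at all stops.\<close>
        have "L' = 0" if e: "ends_at \<gamma> e x" and L': "end_limit \<zeta> \<gamma> e L'" for e x L'
        proof -
          have "closure V \<subseteq> \<Omega>" using V(2) unfolding compactly_contained_def by blast
          then have "x \<in> - closure V" using e frontier_disjoint unfolding ends_at_def by blast
          then obtain \<delta> where d: "\<delta> > 0" "tail \<gamma> e \<delta> \<subseteq> - closure V" using tail_near[OF e, of "- closure V"] by auto
          have "end_limit \<zeta> \<gamma> e 0" unfolding end_limit_def
          proof (rule tendsto_eventually)
            show "eventually (\<lambda>s. val \<zeta> (snd \<gamma> s) = 0) (at e within stops \<gamma>)"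
              using eventually_tail[OF d(1), of \<gamma> e]
            proof eventually_elim
              case (elim s)
              then have "snd \<gamma> s \<in> tail \<gamma> e \<delta>" unfolding tail_def by blast
              then have "snd \<gamma> s \<in> S - V" using d(2) elim closure_subset by blast
              then show ?case using \<zeta>(2) by simp
            qed
          qed
          then show ?thesis using end_limit_unique[OF p e L'] by blast
        qed
        then show "\<forall>e x L L'. open (fst \<gamma>) \<longrightarrow> ends_at \<gamma> e x \<longrightarrow> end_limit f \<gamma> e L \<longrightarrow> end_limit \<zeta> \<gamma> e L' \<longrightarrow> \<bar>L\<bar> \<le> M \<longrightarrow> L + L' = L"
          by simp
      qed
    qed (use kx in auto)
    note kS = competitorsD(1)[OF kc]
    let ?I = "meeting Q V"
    \<comment> \<open>Since \<open>V\<close> is open, a disk that misses \<open>V\<close> has its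
      whole frontier off \<open>V\<close>, where \<open>\<zeta>\<close> is zero.\<close>
    have same: "osc Q ?k i = osc Q u i" if i: "i \<in> - ?I" for i
    proof -
      have "Q i \<inter> V = {}" using i unfolding meeting_def by blast
      then have "closure (Q i) \<inter> V = {}" using V(1) open_Int_closure_eq_empty[of V "Q i"] by blast
      then have "\<zeta> x = 0" if "x \<in> frontier (Q i)" for x
        using that frontier_Q_subset[of i] \<zeta>(2) unfolding frontier_def by blast
      then have "?k x = u x" if "x \<in> frontier (Q i)" for x using that by simp
      then show ?thesis unfolding osc_def bdry_sup_def bdry_inf_def by simp
    qed
    have "(\<Sum>i. (osc Q u i)\<^sup>2) \<le> (\<Sum>i. (osc Q ?k i)\<^sup>2)"
      using uc(2)[OF kc] En_nonneg[OF uS] dirichlet_energy_eq[OF uS] dirichlet_energy_eq[OF kS]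
      unfolding dirichlet_energy_def meeting_Omega sum_over_UNIV by (simp add: ennreal_leI)
    then have le: "sum_over (- ?I) (\<lambda>i. (osc Q u i)\<^sup>2) + sum_over ?I (\<lambda>i. (osc Q u i)\<^sup>2) \<le> sum_over (- ?I) (\<lambda>i. (osc Q u i)\<^sup>2) + sum_over ?I (\<lambda>i. (osc Q ?k i)\<^sup>2)"
    proof -
      have "sum_over (- ?I) (\<lambda>i. (osc Q ?k i)\<^sup>2) = sum_over (- ?I) (\<lambda>i. (osc Q u i)\<^sup>2)"
        by (intro antisym sum_over_mono) (auto simp: same)
      then show ?thesis
        using \<open>(\<Sum>i. (osc Q u i)\<^sup>2) \<le> (\<Sum>i. (osc Q ?k i)\<^sup>2)\<close>
        unfolding sum_over_split[of "\<lambda>i. (osc Q u i)\<^sup>2" ?I] sum_over_split[of "\<lambda>i. (osc Q ?k i)\<^sup>2" ?I] by (simp add: add.commute)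
    qed
    have "sum_over (- ?I) (\<lambda>i. (osc Q u i)\<^sup>2) \<le> (\<Sum>i. (osc Q u i)\<^sup>2)" by (rule sum_over_le_suminf)
    also have "\<dots> < \<infinity>" using uS unfolding sobolev_iff osc_square_sum[OF fu] by (subst sum_finite_iff) auto
    finally have "sum_over (- ?I) (\<lambda>i. (osc Q u i)\<^sup>2) \<noteq> \<infinity>" by simp
    then show ?thesis using le unfolding dirichlet_energy_def by (simp add: ennreal_add_left_cancel_le)
  qed
  then show ?thesis using uS unfolding carpet_harmonic_def sobolev_def by blast
qed

end

section \<open>Uniqueness of minimizers\<close>

context carpet_domain
begin

lemma generic_mono:
  "generic_x P x \<Longrightarrow> (\<And>\<gamma>. P \<gamma> \<Longrightarrow> R \<gamma>) \<Longrightarrow> generic_x R x"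
  "generic_y P y \<Longrightarrow> (\<And>\<gamma>. P \<gamma> \<Longrightarrow> R \<gamma>) \<Longrightarrow> generic_y R y"
  unfolding generic_x_def generic_y_def by blast+

lemma open_contains_square:
  assumes "open U" "z \<in> U" obtains \<delta> where "\<delta> > 0" "{w. snorm (w - z) < \<delta>} \<subseteq> U"
proof -
  obtain e where e: "e > 0" "ball z e \<subseteq> U" using assms open_contains_ball by blast
  have "w \<in> ball z e" if "snorm (w - z) < e/2" for w
    using snorm_bounds(2)[of "w - z"] that by (simp add: dist_norm norm_minus_commute)
  then have "{w. snorm (w - z) < e/2} \<subseteq> U" using e(2) by blast
  moreover have "e/2 > 0" using e(1) by simp
  ultimately show ?thesis using that by blast
qed

text \<open>Generic points are dense, and two of them in a small square are joined by an L-shaped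
  polygon inside it: vertically at the generic abscissa of the one, then horizontally at the generic
  ordinate of the other. Both legs meet only disks of zero oscillation, so \<open>hat g\<close>
  agrees locally at generic points and, by connectedness of \<open>U\<close>, globally.\<close>

lemma hat_constant:
  assumes P: "aep P" "\<And>\<gamma>. P \<gamma> \<Longrightarrow> nice (osc Q g) g \<gamma>" and f: "fin g" and U: "open U" "connected U" "U \<subseteq> \<Omega>"
    and zero: "\<And>i. i \<in> meeting Q U \<Longrightarrow> osc Q g i = 0"
    and z: "z \<in> U" "generic_x P (Re z)" "generic_y P (Im z)" and w: "w \<in> U" "generic_x P (Re w)" "generic_y P (Im w)"
  shows "hat g w = hat g z"
proof (rule connected_induction[OF U(2), where P = "\<lambda>z. generic_x P (Re z) \<and> generic_y P (Im z)" and Q = "\<lambda>w. hat g w = hat g z"])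
  have s0: "sum_over (meeting Q U) (osc Q g) = 0" using zero by (rule sum_over_eq_0)
  fix T a
  {
    assume T: "openin (top_of_set U) T" "a \<in> T"
    then have "open T" using U(1) openin_open_eq by blast
    then obtain \<delta> where d: "\<delta> > 0" "{w. snorm (w - a) < \<delta>} \<subseteq> T" using open_contains_square T(2) by blast
    from square_generic_dense[OF P(1) d(1), of a]
    show "\<exists>z. z \<in> T \<and> generic_x P (Re z) \<and> generic_y P (Im z)" using d(2) by blast
  next
    assume a: "a \<in> U"
    obtain \<delta> where d: "\<delta> > 0" "{w. snorm (w - a) < \<delta>} \<subseteq> U" using open_contains_square[OF U(1) a] by blast
    let ?N = "{w. snorm (w - a) < \<delta>}"
    have "hat g y = hat g x" if x: "x \<in> ?N" "generic_x P (Re x)" and y: "y \<in> ?N" "generic_y P (Im y)" for x y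
    proof -
      let ?c = "Complex (Re x) (Im y)"
      have c: "?c \<in> ?N" using x y by (simp add: snorm_def)
      have *: "closed_segment p q \<subseteq> ?N" if "p \<in> ?N" "q \<in> ?N" for p q
        using that convex_open_square(1)[of a \<delta>] by (rule closed_segment_subset)
      have "ennreal \<bar>hat g (Complex (Re x) (Im x)) - hat g (Complex (Re x) (Im y))\<bar> \<le> 4 * sum_over (meeting Q U) (osc Q g)"
      proof (rule hat_segment[OF refl f, of "closed_segment (Im x) (Im y)" "Complex (Re x)"])
        have "Complex (Re x) ` closed_segment (Im x) (Im y) \<subseteq> ?N"
        proof
          fix v assume "v \<in> Complex (Re x) ` closed_segment (Im x) (Im y)"
          then obtain t where t: "t \<in> closed_segment (Im x) (Im y)" "v = Complex (Re x) t" by blast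
          then obtain u where u: "0 \<le> u" "u \<le> 1" "t = (1 - u) * Im x + u * Im y" unfolding closed_segment_def by auto
          have "v = (1 - u) *\<^sub>R x + u *\<^sub>R ?c" using t(2) u(3) by (auto simp: complex_eq_iff algebra_simps)
          then have "v \<in> closed_segment x ?c" using u(1,2) unfolding closed_segment_def by blast
          then show "v \<in> ?N" using *[OF x(1) c] by blast
        qed
        then show "Complex (Re x) ` closed_segment (Im x) (Im y) \<subseteq> U" "Complex (Re x) ` closed_segment (Im x) (Im y) \<subseteq> \<Omega>"
          using d(2) U(3) by blast+
        show "continuous_on (closed_segment (Im x) (Im y)) (Complex (Re x))"
          using continuous_on_subset[OF continuous_Complex(1)] by blast
        have "generic_x (\<lambda>\<gamma>. nice (osc Q g) g \<gamma>) (Re x)" by (rule generic_mono(1)[OF x(2) P(2)])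
        then show "(\<exists>u. generic_x (\<lambda>\<gamma>. nice (osc Q g) g \<gamma>) u \<and> (\<forall>\<tau>\<in>closed_segment (Im x) (Im y). Re (Complex (Re x) \<tau>) = u)) \<or>
          (\<exists>u. generic_y (\<lambda>\<gamma>. nice (osc Q g) g \<gamma>) u \<and> (\<forall>\<tau>\<in>closed_segment (Im x) (Im y). Im (Complex (Re x) \<tau>) = u))" by auto
      qed (auto simp: is_interval_connected_1)
      moreover have "ennreal \<bar>hat g (Complex (Re x) (Im y)) - hat g (Complex (Re y) (Im y))\<bar> \<le> 4 * sum_over (meeting Q U) (osc Q g)"
      proof (rule hat_segment[OF refl f, of "closed_segment (Re x) (Re y)" "\<lambda>t. Complex t (Im y)"])
        have "(\<lambda>t. Complex t (Im y)) ` closed_segment (Re x) (Re y) \<subseteq> ?N"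
        proof
          fix v assume "v \<in> (\<lambda>t. Complex t (Im y)) ` closed_segment (Re x) (Re y)"
          then obtain t where t: "t \<in> closed_segment (Re x) (Re y)" "v = Complex t (Im y)" by blast
          then obtain u where u: "0 \<le> u" "u \<le> 1" "t = (1 - u) * Re x + u * Re y" unfolding closed_segment_def by auto
          have "v = (1 - u) *\<^sub>R ?c + u *\<^sub>R y" using t(2) u(3) by (auto simp: complex_eq_iff algebra_simps)
          then have "v \<in> closed_segment ?c y" using u(1,2) unfolding closed_segment_def by blast
          then show "v \<in> ?N" using *[OF c y(1)] by blast
        qed
        then show "(\<lambda>t. Complex t (Im y)) ` closed_segment (Re x) (Re y) \<subseteq> U" "(\<lambda>t. Complex t (Im y)) ` closed_segment (Re x) (Re y) \<subseteq> \<Omega>"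
          using d(2) U(3) by blast+
        show "continuous_on (closed_segment (Re x) (Re y)) (\<lambda>t. Complex t (Im y))"
          using continuous_on_subset[OF continuous_Complex(2)] by blast
        have "generic_y (\<lambda>\<gamma>. nice (osc Q g) g \<gamma>) (Im y)" by (rule generic_mono(2)[OF y(2) P(2)])
        then show "(\<exists>u. generic_x (\<lambda>\<gamma>. nice (osc Q g) g \<gamma>) u \<and> (\<forall>\<tau>\<in>closed_segment (Re x) (Re y). Re (Complex \<tau> (Im y)) = u)) \<or>
          (\<exists>u. generic_y (\<lambda>\<gamma>. nice (osc Q g) g \<gamma>) u \<and> (\<forall>\<tau>\<in>closed_segment (Re x) (Re y). Im (Complex \<tau> (Im y)) = u))" by auto
      qed (auto simp: is_interval_connected_1)
      ultimately show ?thesis unfolding s0 by simp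
    qed
    moreover have "openin (top_of_set U) ?N" using d(2) convex_open_square(2)[of a \<delta>] U(1) openin_open_eq by blast
    moreover have "a \<in> ?N" using d(1) by (simp add: snorm_def)
    ultimately show "\<exists>T. openin (top_of_set U) T \<and> a \<in> T \<and>
      (\<forall>x\<in>T. \<forall>y\<in>T. (generic_x P (Re x) \<and> generic_y P (Im x)) \<and> (generic_x P (Re y) \<and> generic_y P (Im y)) \<and> hat g x = hat g z \<longrightarrow> hat g y = hat g z)"
      by (intro exI[of _ ?N] conjI ballI impI) metis+
  }
qed (use z w in auto)

text \<open>The domain is bounded, so the ray to the right leaves it; \<open>\<beta>\<close> is the
  first abscissa at which it does.\<close>

lemma horizontal_path_to_boundary:
  assumes w: "w \<in> \<Omega>"
  obtains \<beta> where "({Re w<..<\<beta>}, \<lambda>x. Complex x (Im w)) \<in> paths_in \<Omega>" "Re w < \<beta>"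
    "ends_at ({Re w<..<\<beta>}, \<lambda>x. Complex x (Im w)) \<beta> (Complex \<beta> (Im w))" "(\<lambda>x. Complex x (Im w)) ` {Re w..<\<beta>} \<subseteq> \<Omega>"
proof -
  let ?c = "\<lambda>x. Complex x (Im w)"
  let ?A = "{Re w..} \<inter> ?c -` (- \<Omega>)"
  have cl: "closed ?A"
    using closed_vimage[OF _ continuous_Complex(2), of "- \<Omega>" "Im w"] open_Omega by (auto intro!: closed_Int)
  obtain B where B: "\<And>z. z \<in> \<Omega> \<Longrightarrow> cmod z \<le> B" using bdd unfolding bounded_iff by blast
  have "?c (max (Re w) (B + 1)) \<notin> \<Omega>"
  proof
    assume "?c (max (Re w) (B + 1)) \<in> \<Omega>"
    from B[OF this] abs_Re_le_cmod[of "?c (max (Re w) (B + 1))"] show False by simp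
  qed
  then have "max (Re w) (B + 1) \<in> ?A" by simp
  then have ne: "?A \<noteq> {}" by blast
  have bb: "bdd_below ?A" by (rule bdd_belowI[of _ "Re w"]) auto
  define \<beta> where "\<beta> = Inf ?A"
  have bA: "\<beta> \<in> ?A" unfolding \<beta>_def by (rule closed_contains_Inf[OF ne bb cl])
  have "\<beta> \<noteq> Re w" using bA w by auto
  then have gt: "Re w < \<beta>" using bA by auto
  have sub: "?c ` {Re w..<\<beta>} \<subseteq> \<Omega>"
  proof (rule ccontr)
    assume "\<not> ?thesis"
    then obtain x where x: "Re w \<le> x" "x < \<beta>" "?c x \<notin> \<Omega>" unfolding image_subset_iff by force
    then have "\<beta> \<le> x" unfolding \<beta>_def by (intro cInf_lower bb) auto
    then show False using x by simp
  qed
  have p: "({Re w<..<\<beta>}, ?c) \<in> paths_in \<Omega>"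
  proof (rule line_path[OF continuous_Complex(2), where a = "Re w + (\<beta> - Re w) / 3" and b = "Re w + (\<beta> - Re w) / 2"])
    show "is_interval {Re w<..<\<beta>}" by (simp add: is_interval_connected_1)
    show "?c ` {Re w<..<\<beta>} \<subseteq> \<Omega>" using sub by force
  qed (use gt in \<open>auto simp: field_simps\<close>)
  have lim: "(?c \<longlongrightarrow> ?c \<beta>) (at \<beta> within {Re w<..<\<beta>})"
    using continuous_Complex(2)[of "Im w"] unfolding continuous_on_def by (meson UNIV_I subset_UNIV tendsto_within_subset)
  have b: "\<beta> \<in> closure {Re w<..<\<beta>}" using gt by simp
  have "?c \<beta> \<in> closure \<Omega>"
  proof -
    have nb: "at \<beta> within {Re w<..<\<beta>} \<noteq> bot" using gt by (simp add: at_within_eq_bot_iff)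
    have "eventually (\<lambda>x. ?c x \<in> closure \<Omega>) (at \<beta> within {Re w<..<\<beta>})"
      unfolding eventually_at using sub closure_subset by (intro exI[of _ 1]) force
    then show ?thesis by (rule Lim_in_closed_set[OF closed_closure _ nb lim])
  qed
  then have "?c \<beta> \<in> frontier \<Omega>" using bA open_Omega unfolding frontier_def by (auto simp: interior_open)
  then have "ends_at ({Re w<..<\<beta>}, ?c) \<beta> (?c \<beta>)" unfolding ends_at_def using lim b by auto
  then show ?thesis using that p gt sub by blast
qed

text \<open>A path may rest at \<open>snd \<gamma> t0\<close> for a while, so a short parameter
  interval could give a constant piece. Following the path towards \<open>t1\<close> until it first
  leaves a small ball that misses \<open>snd \<gamma> t1\<close> gives a piece that moves.\<close>

lemma small_subarc:
  assumes g: "\<gamma> \<in> paths_in \<Omega>" and t0: "t0 \<in> fst \<gamma>" and W: "open W" "snd \<gamma> t0 \<in> W"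
  obtains t where "closed_segment t0 t \<subseteq> fst \<gamma>" "snd \<gamma> ` closed_segment t0 t \<subseteq> W" "snd \<gamma> t \<noteq> snd \<gamma> t0"
proof -
  let ?x = "snd \<gamma> t0"
  obtain t1 where t1: "t1 \<in> fst \<gamma>" "snd \<gamma> t1 \<noteq> ?x"
  proof -
    obtain p q where "p \<in> fst \<gamma>" "q \<in> fst \<gamma>" "snd \<gamma> p \<noteq> snd \<gamma> q" using g unfolding paths_in_def is_path_def by blast
    then show ?thesis using that by (cases "snd \<gamma> p = ?x") auto
  qed
  obtain e where e: "e > 0" "cball ?x e \<subseteq> W" using W open_contains_cball by blast
  define r where "r = min e (dist ?x (snd \<gamma> t1) / 2)"
  have r: "r > 0" "cball ?x r \<subseteq> W" "snd \<gamma> t1 \<notin> ball ?x r" using e t1(2) unfolding r_def by (auto simp: subset_iff min_def)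
  \<comment> \<open>The affine parametrization from \<open>t0\<close> to \<open>t1\<close>,
    whichever of the two is larger, so that the first exit time of a path on \<open>{0..1}\<close>
    can be transferred to \<open>\<gamma>\<close>.\<close>
  define l where "l = (\<lambda>s::real. t0 + s * (t1 - t0))"
  have l: "l ` {0..s} \<subseteq> closed_segment t0 (l s)" "closed_segment t0 (l s) \<subseteq> l ` {0..s}" if "0 \<le> s" for s
  proof -
    show "l ` {0..s} \<subseteq> closed_segment t0 (l s)"
    proof
      fix v assume "v \<in> l ` {0..s}"
      then obtain q where q: "0 \<le> q" "q \<le> s" "v = t0 + q * (t1 - t0)" unfolding l_def by auto
      have "v = (1 - q/s) *\<^sub>R t0 + (q/s) *\<^sub>R l s" using q that unfolding l_def
      proof (cases "s = 0")
        case False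
        then have "q / s * (t0 + s * (t1 - t0)) = q / s * t0 + q * (t1 - t0)" by (simp add: distrib_left)
        then show "v = (1 - q / s) *\<^sub>R t0 + (q / s) *\<^sub>R (t0 + s * (t1 - t0))" using q(3) by (simp add: left_diff_distrib)
      qed (use q in auto)
      moreover have "0 \<le> q/s" "q/s \<le> 1" using q that by (auto simp: divide_simps)
      ultimately show "v \<in> closed_segment t0 (l s)" unfolding closed_segment_def by blast
    qed
    show "closed_segment t0 (l s) \<subseteq> l ` {0..s}"
    proof
      fix v assume "v \<in> closed_segment t0 (l s)"
      then obtain q where q: "0 \<le> q" "q \<le> 1" "v = (1 - q) *\<^sub>R t0 + q *\<^sub>R l s" unfolding closed_segment_def by blast
      have "v = l (q * s)" using q(3) unfolding l_def by (simp add: algebra_simps)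
      moreover have "q * s \<in> {0..s}" using q that by (auto simp: mult_left_le_one_le)
      ultimately show "v \<in> l ` {0..s}" by blast
    qed
  qed
  have l1: "l 1 = t1" "l 0 = t0" unfolding l_def by auto
  have seg: "closed_segment t0 t1 \<subseteq> fst \<gamma>" by (rule interval_segment[OF path_interval[OF g] t0 t1(1)])
  have "path (snd \<gamma> \<circ> l)" unfolding path_def
  proof (rule continuous_on_compose)
    show "continuous_on {0..1} l" unfolding l_def by (intro continuous_intros)
    have "l ` {0..1} \<subseteq> fst \<gamma>" using l(1)[of 1] seg l1 by simp
    then show "continuous_on (l ` {0..1}) (snd \<gamma>)" by (rule continuous_on_subset[OF path_continuous[OF g]])
  qed
  moreover have "pathfinish (snd \<gamma> \<circ> l) \<notin> ball ?x r" unfolding pathfinish_def using r l1 by simp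
  ultimately obtain s where s: "0 \<le> s" "s \<le> 1" "\<And>q. 0 \<le> q \<and> q < s \<Longrightarrow> (snd \<gamma> \<circ> l) q \<in> interior (ball ?x r)"
    "(snd \<gamma> \<circ> l) s \<notin> interior (ball ?x r)" "s = 0 \<or> (snd \<gamma> \<circ> l) s \<in> closure (ball ?x r)"
    using subpath_to_frontier_explicit[of "snd \<gamma> \<circ> l" "ball ?x r"] by metis
  have s0: "s \<noteq> 0" using s(4) r(1) l1 by auto
  have cb: "snd \<gamma> (l q) \<in> cball ?x r" if "q \<in> {0..s}" for q
  proof (cases "q = s")
    case True then show ?thesis using s(5) s0 r(1) by simp
  next
    case False then show ?thesis using s(3)[of q] that by (auto simp: less_imp_le)
  qed
  show ?thesis
  proof (rule that[of "l s"])
    show "snd \<gamma> ` closed_segment t0 (l s) \<subseteq> W" using l(2)[OF s(1)] cb r(2) by blast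
    have "l s \<in> closed_segment t0 t1" using l(1)[of 1] s l1 by auto
    then show "closed_segment t0 (l s) \<subseteq> fst \<gamma>" using interval_segment[OF path_interval[OF g] t0, of "l s"] seg by blast
    show "snd \<gamma> (l s) \<noteq> ?x" using s(4) r(1) by auto
  qed
qed

text \<open>A point off all closed disks is the start of a non-constant arc of
  \<open>\<gamma>\<close> that meets only disks of small total oscillation. The arc is not contained
  in the carpet, where the trace is null, so it visits a disk, and there \<open>hat u\<close> and
  \<open>hat v\<close> coincide.\<close>

lemma agree_on_nice_path:
  assumes u: "nice (osc Q u) u \<gamma>" "fin u" and v: "nice (osc Q v) v \<gamma>" "fin v" and eq: "\<And>i. rM u i = rM v i"
    and x: "x \<in> path_trace \<gamma> \<inter> S - (\<Union>i. frontier (Q i))"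
  shows "u x = v x"
proof -
  have g: "\<gamma> \<in> paths_in \<Omega>" using u unfolding nice_def by blast
  obtain t0 where t0: "t0 \<in> fst \<gamma>" "x = snd \<gamma> t0" using x unfolding path_trace_def by blast
  have xS: "snd \<gamma> t0 \<in> S" using x t0 by blast
  have fx: "\<bar>u x\<bar> \<noteq> \<infinity>" "\<bar>v x\<bar> \<noteq> \<infinity>" using nice_finite[OF u(1) t0(1) xS] nice_finite[OF v(1) t0(1) xS] t0(2) by auto
  have "val u x = val v x"
  proof (rule ccontr)
    assume ne: "val u x \<noteq> val v x"
    \<comment> \<open>Each function deviates at \<open>x\<close> from the common supremum on the
      visited disk by at most \<open>2 * e\<close>; a total of \<open>4 * e\<close> is less than the
      assumed difference \<open>5 * e\<close>.\<close>
    define e where "e = \<bar>val u x - val v x\<bar> / 5"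
    have e: "e > 0" using ne unfolding e_def by simp
    let ?T = "meeting Q (path_trace \<gamma>)"
    let ?\<sigma> = "\<lambda>i. osc Q u i + osc Q v i"
    have "sum_over ?T ?\<sigma> < \<infinity>" using u(1) v(1) unfolding nice_def sum_over_add by (simp add: less_top[symmetric])
    then obtain F where F: "finite F" "sum_over (?T - F) ?\<sigma> < ennreal e" using sum_over_tail e by blast
    let ?W = "- (\<Union>i\<in>F. closure (Q i))"
    have "x \<notin> closure (Q i)" for i
      using x open_Q[of i] unfolding frontier_def carpet_def by (auto simp: interior_open)
    then have xW: "snd \<gamma> t0 \<in> ?W" using t0(2) by blast
    have oW: "open ?W" using F(1) by (intro open_Compl closed_UN) auto
    obtain t where t: "closed_segment t0 t \<subseteq> fst \<gamma>" "snd \<gamma> ` closed_segment t0 t \<subseteq> ?W" "snd \<gamma> t \<noteq> snd \<gamma> t0"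
      by (rule small_subarc[OF g t0(1) oW xW])
    let ?J = "closed_segment t0 t"
    have "\<not> snd \<gamma> ` ?J \<subseteq> S"
    proof
      assume A: "snd \<gamma> ` ?J \<subseteq> S"
      have "hausdorff_measure 1 (path_trace \<gamma> \<inter> S) = 0" using u(1) unfolding nice_def by blast
      then have "hausdorff_measure 1 (snd \<gamma> ` ?J) = 0" by (rule hausdorff1_null_subset) (use A t(1) in \<open>auto simp: path_trace_def\<close>)
      moreover have "connected (snd \<gamma> ` ?J)"
        by (rule connected_continuous_image[OF continuous_on_subset[OF path_continuous[OF g] t(1)] connected_segment])
      ultimately have "snd \<gamma> t = snd \<gamma> t0" by (rule hausdorff1_null_connected) auto
      then show False using t(3) by simp
    qed
    then obtain s where s: "s \<in> ?J" "snd \<gamma> s \<notin> S" by blast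
    then obtain i where i: "snd \<gamma> s \<in> Q i" using S_iff path_range[OF g] t(1) by blast
    have iJ: "is_interval ?J" by (simp add: is_interval_connected_1)
    have sub: "meeting Q (snd \<gamma> ` ?J) \<subseteq> ?T - F"
    proof
      fix j assume j: "j \<in> meeting Q (snd \<gamma> ` ?J)"
      then have "j \<notin> F" using t(2) closure_subset[of "Q j"] unfolding meeting_def by blast
      then show "j \<in> ?T - F" using j t(1) unfolding meeting_def path_trace_def by blast
    qed
    have su: "sum_over (meeting Q (snd \<gamma> ` ?J)) (osc Q u) \<le> ennreal e" "sum_over (meeting Q (snd \<gamma> ` ?J)) (osc Q v) \<le> ennreal e"
      by (rule order_trans[OF sum_over_mono[OF sub] less_imp_le[OF F(2)]]; simp)+
    have two: "2 * ennreal e = ennreal (2 * e)" using e by (simp add: ennreal_mult)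
    have "ennreal \<bar>hat u (snd \<gamma> s) - val u (snd \<gamma> t0)\<bar> \<le> ennreal (2 * e)" "ennreal \<bar>hat v (snd \<gamma> s) - val v (snd \<gamma> t0)\<bar> \<le> ennreal (2 * e)"
      unfolding two[symmetric]
      by (rule order_trans[OF hat_near_stop[OF u t(1) iJ s(1) _ xS] mult_left_mono[OF su(1)]], simp, simp)
        (rule order_trans[OF hat_near_stop[OF v t(1) iJ s(1) _ xS] mult_left_mono[OF su(2)]], simp, simp)
    then have "\<bar>rM u i - val u x\<bar> \<le> 2 * e" "\<bar>rM v i - val v x\<bar> \<le> 2 * e"
      using e t0(2) by (simp_all add: hat_Q[OF i] ennreal_le_iff)
    then have "\<bar>val u x - val v x\<bar> \<le> 4 * e" using eq[of i] by linarith
    moreover have "\<bar>val u x - val v x\<bar> = 5 * e" unfolding e_def by simp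
    ultimately show False using e by linarith
  qed
  then show ?thesis using fx by (cases "u x"; cases "v x") auto
qed

end

context dirichlet_problem
begin

lemma minimizerD:
  assumes "dirichlet_minimizer ver \<Omega> Q f u"
  shows "u \<in> competitors" "En u = minE"
proof -
  show u: "u \<in> competitors" using assms unfolding minimizer_iff by blast
  have "En u \<le> minE" unfolding minE_def using assms u unfolding minimizer_iff by (intro cInf_greatest) auto
  then show "En u = minE" using minE_le[OF u] by linarith
qed

lemma minimizers_same_ro:
  assumes u: "u \<in> competitors" "En u = minE" and v: "v \<in> competitors" "En v = minE"
  shows "ro u i = ro v i"
proof -
  note P = parallelogram[OF u(1) v(1)]
  have "(\<Sum>i. (ro u i - ro v i)\<^sup>2) \<le> 0" using P(2) u(2) v(2) by simp
  moreover have "0 \<le> (\<Sum>i. (ro u i - ro v i)\<^sup>2)" by (rule suminf_nonneg[OF P(1)]) simp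
  ultimately have "(\<Sum>i. (ro u i - ro v i)\<^sup>2) = 0" by linarith
  then have "(ro u i - ro v i)\<^sup>2 = 0" using suminf_eq_zero_iff[OF P(1)] by simp
  then show ?thesis by simp
qed

text \<open>A strict drop on one disk, with no increase elsewhere, would undercut the least
  energy.\<close>

lemma minimizer_ro_minimal:
  assumes u: "u \<in> competitors" "En u = minE" and h: "h \<in> competitors" "\<And>j. ro h j \<le> ro u j"
  shows "ro h i = ro u i"
proof -
  have h0: "0 \<le> ro h j" for j using ro_nonneg[OF competitorsD(3)[OF h(1)]] .
  have d: "0 \<le> (ro u j)\<^sup>2 - (ro h j)\<^sup>2" for j using power_mono[OF h(2) h0, of j 2] by simp
  note s = summable_diff[OF competitorsD(4)[OF u(1)] competitorsD(4)[OF h(1)]]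
  have "(\<Sum>j. (ro u j)\<^sup>2 - (ro h j)\<^sup>2) = En u - En h"
    unfolding En_def by (rule suminf_diff[symmetric, OF competitorsD(4)[OF u(1)] competitorsD(4)[OF h(1)]])
  then have "(\<Sum>j. (ro u j)\<^sup>2 - (ro h j)\<^sup>2) \<le> 0" using u(2) minE_le[OF h(1)] by linarith
  moreover have "0 \<le> (\<Sum>j. (ro u j)\<^sup>2 - (ro h j)\<^sup>2)" by (rule suminf_nonneg[OF s d])
  ultimately have "(\<Sum>j. (ro u j)\<^sup>2 - (ro h j)\<^sup>2) = 0" by linarith
  then have "(ro u i)\<^sup>2 - (ro h i)\<^sup>2 = 0" using suminf_eq_zero_iff[OF s d] by blast
  then have "(ro u i)\<^sup>2 = (ro h i)\<^sup>2" by simp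
  then show ?thesis using power_eq_imp_eq_base[of "ro u i" 2 "ro h i"] h0[of i] h(2)[of i] by simp
qed

lemma rM_le_of_ro_pos:
  assumes u: "u \<in> competitors" "En u = minE" and v: "v \<in> competitors" "En v = minE" and pos: "ro u i > 0"
  shows "rM v i \<le> rM u i"
proof (rule ccontr)
  assume "\<not> ?thesis"
  then have lt: "rM u i < rM v i" by simp
  have ro: "ro u j = ro v j" for j by (rule minimizers_same_ro[OF u v])
  \<comment> \<open>On the disk \<open>i\<close> the competitor below equals \<open>min v k\<close>,
    with values between \<open>rm v i\<close> and \<open>k\<close>. As
    \<open>rM u i < rM v i\<close> and \<open>ro v i > 0\<close>, the number \<open>k\<close> is
    below \<open>rM v i\<close>, so this range is shorter than the oscillation of
    \<open>v\<close>.\<close>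
  define k where "k = max (rM u i) (rm v i)"
  define h where "h = (\<lambda>x. ereal (min (val v x) (max (val u x) k)))"
  have h: "h \<in> competitors"
  proof (rule competitors_combine[OF u(1) v(1), where \<Phi> = "\<lambda>a b. min b (max a k)"])
    show "\<bar>min b (max a k) - min b' (max a' k)\<bar> \<le> \<bar>a - a'\<bar> + \<bar>b - b'\<bar>" for a b a' b' :: real
      by (auto simp: max_def min_def abs_if)
  qed (auto simp: h_def max_def min_def)
  have bound: "ro h j \<le> min (rM v j) (max (rM u j) k) - min (rm v j) (max (rm u j) k)" for j
  proof (rule ro_le[OF competitorsD(3)[OF h]])
    fix x y assume xy: "x \<in> frontier (Q j)" "y \<in> frontier (Q j)"
    have "val h x \<le> min (rM v j) (max (rM u j) k)"
      using fin_bounds(3)[OF competitorsD(3)[OF u(1)] xy(1)] fin_bounds(3)[OF competitorsD(3)[OF v(1)] xy(1)]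
      unfolding h_def real_of_ereal.simps by (intro min.mono max.mono) auto
    moreover have "min (rm v j) (max (rm u j) k) \<le> val h y"
      using fin_bounds(2)[OF competitorsD(3)[OF u(1)] xy(2)] fin_bounds(2)[OF competitorsD(3)[OF v(1)] xy(2)]
      unfolding h_def real_of_ereal.simps by (intro min.mono max.mono) auto
    ultimately show "val h x - val h y \<le> min (rM v j) (max (rM u j) k) - min (rm v j) (max (rm u j) k)" by linarith
  qed
  have "ro h j \<le> ro u j" for j
  proof -
    \<comment> \<open>Passing from infima to suprema raises both arguments by the common amount
      \<open>ro u j = ro v j\<close>, and maximum and minimum raise their value by no more than
      that.\<close>
    have "min (rM v j) (max (rM u j) k) - min (rm v j) (max (rm u j) k) \<le> ro u j"
      using ro[of j] ro_nonneg[OF competitorsD(3)[OF u(1)], of j] by (auto simp: max_def min_def)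
    then show ?thesis using bound[of j] by linarith
  qed
  then have "ro h i = ro u i" by (rule minimizer_ro_minimal[OF u h])
  moreover have "min (rM v i) (max (rM u i) k) - min (rm v i) (max (rm u i) k) < ro u i"
    using ro[of i] pos lt unfolding k_def by (auto simp: max_def min_def)
  ultimately show False using bound[of i] by linarith
qed

lemma minimizers_rM_le:
  assumes u: "u \<in> competitors" "En u = minE" and v: "v \<in> competitors" "En v = minE"
  shows "rM v i0 \<le> rM u i0"
proof (rule ccontr)
  assume "\<not> ?thesis"
  then have lt: "rM u i0 < rM v i0" by simp
  note uS = competitorsD(1)[OF u(1)] and vS = competitorsD(1)[OF v(1)]
  note fu = competitorsD(3)[OF u(1)] and fv = competitorsD(3)[OF v(1)]
  have ro: "ro u j = ro v j" for j by (rule minimizers_same_ro[OF u v])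
  have rM: "rM u j = rM v j" if "ro u j > 0" for j
    using rM_le_of_ro_pos[OF u v that] rM_le_of_ro_pos[OF v u, of j] that ro[of j] by linarith
  define a where "a = rM v i0 - rM u i0"
  have a: "a > 0" using lt unfolding a_def by simp
  have r0: "ro u i0 = 0" using rM[of i0] lt ro_nonneg[OF fu, of i0] by linarith
  \<comment> \<open>On disks of positive oscillation the suprema of \<open>u\<close> and
    \<open>v\<close> agree, so if that oscillation is below \<open>a / 2\<close> the difference
    stays below \<open>a / 2\<close> and the cut makes \<open>\<theta>\<close> constant there. On
    disks without oscillation \<open>v - u\<close> is constant anyway. What remains is the finite
    set \<open>F\<close> of disks with large oscillation.\<close>
  define \<theta> where "\<theta> = (\<lambda>x. ereal (max (val v x - val u x) (a / 2)))"
  let ?\<Phi> = "\<lambda>p q. max (q - p) (a / 2)"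
  have \<Phi>: "\<bar>?\<Phi> p q - ?\<Phi> p' q'\<bar> \<le> \<bar>p - p'\<bar> + \<bar>q - q'\<bar>" for p q p' q' :: real
    by (auto simp: max_def abs_if)
  have \<theta>k: "\<theta> x = ereal (?\<Phi> (val u x) (val v x))" for x unfolding \<theta>_def ..
  have \<theta>S: "\<theta> \<in> sobolev ver \<Omega> Q" by (rule sobolev_compose[OF uS vS \<Phi> \<theta>k])
  note f\<theta> = sobolev_fin[OF \<theta>S]
  define F where "F = {i. a / 2 \<le> ro u i}"
  have "finite F"
  proof -
    have "(\<lambda>i. (ro u i)\<^sup>2) \<longlonglongrightarrow> 0" by (rule summable_LIMSEQ_zero[OF competitorsD(4)[OF u(1)]])
    then have "eventually (\<lambda>i. (ro u i)\<^sup>2 < (a / 2)\<^sup>2) sequentially" by (rule order_tendstoD(2)) (use a in simp)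
    then obtain N where N: "\<And>i. i \<ge> N \<Longrightarrow> (ro u i)\<^sup>2 < (a / 2)\<^sup>2" unfolding eventually_sequentially by blast
    have "i < N" if "i \<in> F" for i
    proof (rule ccontr)
      assume "\<not> i < N"
      then have "(ro u i)\<^sup>2 < (a / 2)\<^sup>2" using N by simp
      moreover have "(a / 2)\<^sup>2 \<le> (ro u i)\<^sup>2" using that a unfolding F_def by (intro power_mono) auto
      ultimately show False by linarith
    qed
    then show ?thesis by (meson finite_nat_set_iff_bounded)
  qed
  have zero: "osc Q \<theta> i = 0" if iF: "i \<notin> F" for i
  proof -
    have "ro \<theta> i \<le> 0"
    proof (rule ro_le[OF f\<theta>])
      fix x y assume xy: "x \<in> frontier (Q i)" "y \<in> frontier (Q i)"
      note B = fin_bounds(2,3)[OF fu xy(1)] fin_bounds(2,3)[OF fu xy(2)] fin_bounds(2,3)[OF fv xy(1)] fin_bounds(2,3)[OF fv xy(2)]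
      show "val \<theta> x - val \<theta> y \<le> 0"
      proof (cases "ro u i > 0")
        case True
        have "val v x - val u x < a / 2" "val v y - val u y < a / 2"
          using B rM[OF True] ro[of i] iF unfolding F_def by auto
        then show ?thesis unfolding \<theta>_def real_of_ereal.simps by simp
      next
        case False
        then have "val v x - val u x = val v y - val u y" using B ro[of i] by linarith
        then show ?thesis unfolding \<theta>_def real_of_ereal.simps by simp
      qed
    qed
    then show ?thesis by (simp add: osc_eq[OF f\<theta>] ennreal_neg)
  qed
  define U where "U = \<Omega> - (\<Union>i\<in>F. closure (Q i))"
  have U: "open U" "connected U" "U \<subseteq> \<Omega>"
    unfolding U_def using connected_remove_disks[OF \<open>finite F\<close>] \<open>finite F\<close> open_Omega by (auto intro!: open_Diff closed_UN)
  have zeroU: "osc Q \<theta> i = 0" if "i \<in> meeting Q U" for i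
    using that closure_subset[of "Q i"] by (intro zero) (auto simp: meeting_def U_def)
  define P where "P = (\<lambda>\<gamma>. (nice (osc Q \<theta>) \<theta> \<gamma> \<and> nice (osc Q u) u \<gamma> \<and> nice (osc Q v) v \<gamma> \<and> nice (osc Q f) f \<gamma>)
      \<and> same_limits u f \<gamma> \<and> same_limits v f \<gamma>)"
  have P: "aep P" unfolding P_def
    by (intro aep_conj sobolev_nice \<theta>S uS vS f competitorsD(2) u(1) v(1))
  have P\<theta>: "nice (osc Q \<theta>) \<theta> \<gamma>" if "P \<gamma>" for \<gamma> using that unfolding P_def by blast
  have i0: "i0 \<notin> F" using r0 a unfolding F_def by simp
  have Qi0: "Q i0 \<subseteq> U"
  proof -
    have "closure (Q i0) \<inter> closure (Q i) = {}" if "i \<in> F" for i using disjoint_closure_Q[of i0 i] i0 that by blast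
    then show ?thesis unfolding U_def using Q_subset[of i0] closure_subset[of "Q i0"] by blast
  qed
  obtain q where "q \<in> Q i0" using Q_nonempty[of i0] by blast
  then obtain \<delta> where d: "\<delta> > 0" "{w. snorm (w - q) < \<delta>} \<subseteq> Q i0" using open_contains_square[OF open_Q] by blast
  obtain z where "snorm (z - q) < \<delta>" and zg: "generic_x P (Re z)" "generic_y P (Im z)" by (rule square_generic_dense[OF P d(1)])
  then have zQ: "z \<in> Q i0" using d(2) by blast
  obtain x0 where x0: "x0 \<in> frontier (Q i0)" by (rule frontier_point)
  have "osc Q \<theta> i0 = 0" by (rule zero[OF i0])
  then have "ro \<theta> i0 = 0" using osc_eq[OF f\<theta>, of i0] ro_nonneg[OF f\<theta>, of i0] by (simp add: ennreal_eq_0_iff)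
  then have "rM \<theta> i0 = val \<theta> x0" using fin_bounds(2,3)[OF f\<theta> x0] by linarith
  also have "val v x0 - val u x0 = a"
    using fin_bounds(2,3)[OF fu x0] fin_bounds(2,3)[OF fv x0] r0 ro[of i0] unfolding a_def by linarith
  then have "val \<theta> x0 = a" using a unfolding \<theta>_def real_of_ereal.simps by simp
  finally have hz: "hat \<theta> z = a" by (simp add: hat_Q[OF zQ])
  \<comment> \<open>The disk \<open>i0\<close> keeps the set nonempty when \<open>F\<close> is
    empty. To the right of a rightmost point \<open>m\<close> of these closed disks none of the
    removed ones is met, so a horizontal ray from there stays in \<open>U\<close> until it reaches
    the boundary.\<close>
  let ?K = "\<Union>i\<in>insert i0 F. closure (Q i)"
  have "compact ?K" using \<open>finite F\<close> compact_closure_Q by (intro compact_UN) auto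
  moreover have "?K \<noteq> {}" using zQ closure_subset by blast
  moreover have "continuous_on ?K Re" by (intro continuous_on_Re continuous_on_id)
  ultimately have "\<exists>m\<in>?K. \<forall>y\<in>?K. Re y \<le> Re m" by (rule continuous_attains_sup)
  then obtain m where m: "m \<in> ?K" "\<And>y. y \<in> ?K \<Longrightarrow> Re y \<le> Re m" by blast
  have "m \<in> \<Omega>" using m(1) closure_Q_subset by blast
  then obtain \<eta> where eta: "\<eta> > 0" "{w. snorm (w - m) < \<eta>} \<subseteq> \<Omega>" using open_contains_square[OF open_Omega] by blast
  have "\<eta> / 2 > 0" using eta by simp
  \<comment> \<open>The centre is moved to the right by \<open>\<eta> / 2\<close>, so that the
    generic point \<open>w\<close> is strictly to the right of \<open>m\<close> and still in the
    domain.\<close>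
  from square_generic_dense[OF P this] obtain w where w: "snorm (w - (m + of_real (\<eta> / 2))) < \<eta> / 2"
    and wg: "generic_x P (Re w)" "generic_y P (Im w)" by metis
  have w': "\<bar>Re w - Re m - \<eta> / 2\<bar> < \<eta> / 2" "\<bar>Im w - Im m\<bar> < \<eta> / 2"
    using w unfolding snorm_def max_less_iff_conj by (simp_all add: algebra_simps)
  then have wRe: "Re w > Re m" by linarith
  have "\<bar>Re w - Re m\<bar> < \<eta>" "\<bar>Im w - Im m\<bar> < \<eta>" using w' eta(1) by linarith+
  then have "snorm (w - m) < \<eta>" by (simp add: snorm_def)
  then have w\<Omega>: "w \<in> \<Omega>" using eta(2) by blast
  have right: "y \<in> U" if "y \<in> \<Omega>" "Re w \<le> Re y" for y
    using that m(2)[of y] wRe unfolding U_def by fastforce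
  have hw: "hat \<theta> w = a"
    using hat_constant[OF P P\<theta> f\<theta> U zeroU _ zg _ wg] zQ Qi0 right[OF w\<Omega>] hz by auto
  let ?c = "\<lambda>x. Complex x (Im w)"
  obtain \<beta> where \<beta>: "({Re w<..<\<beta>}, ?c) \<in> paths_in \<Omega>" "Re w < \<beta>" "ends_at ({Re w<..<\<beta>}, ?c) \<beta> (?c \<beta>)" "?c ` {Re w..<\<beta>} \<subseteq> \<Omega>"
    by (rule horizontal_path_to_boundary[OF w\<Omega>])
  let ?\<gamma> = "({Re w<..<\<beta>}, ?c)"
  have const: "hat \<theta> (?c t) = a" if t: "t \<in> {Re w<..<\<beta>}" for t
  proof -
    have "ennreal \<bar>hat \<theta> (?c (Re w)) - hat \<theta> (?c t)\<bar> \<le> 4 * sum_over (meeting Q U) (osc Q \<theta>)"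
    proof (rule hat_segment[OF refl f\<theta>, of "{Re w..<\<beta>}" ?c])
      show "continuous_on {Re w..<\<beta>} ?c" using continuous_on_subset[OF continuous_Complex(2)] by blast
      show "?c ` {Re w..<\<beta>} \<subseteq> U" using \<beta>(4) right by (auto simp: image_subset_iff)
      have "generic_y (\<lambda>\<gamma>. nice (osc Q \<theta>) \<theta> \<gamma>) (Im w)" by (rule generic_mono(2)[OF wg(2) P\<theta>])
      then show "(\<exists>x. generic_x (\<lambda>\<gamma>. nice (osc Q \<theta>) \<theta> \<gamma>) x \<and> (\<forall>\<tau>\<in>{Re w..<\<beta>}. Re (?c \<tau>) = x)) \<or>
        (\<exists>y. generic_y (\<lambda>\<gamma>. nice (osc Q \<theta>) \<theta> \<gamma>) y \<and> (\<forall>\<tau>\<in>{Re w..<\<beta>}. Im (?c \<tau>) = y))" by auto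
    qed (use \<beta> t in \<open>auto simp: is_interval_connected_1\<close>)
    moreover have "sum_over (meeting Q U) (osc Q \<theta>) = 0" using zeroU by (rule sum_over_eq_0)
    ultimately have "hat \<theta> (?c (Re w)) = hat \<theta> (?c t)" by simp
    then show ?thesis using hw by simp
  qed
  have "end_limit \<theta> ?\<gamma> \<beta> a" unfolding end_limit_def
  proof (rule tendsto_eventually)
    show "eventually (\<lambda>t. val \<theta> (snd ?\<gamma> t) = a) (at \<beta> within stops ?\<gamma>)"
      unfolding eventually_at by (intro exI[of _ 1]) (auto simp: stops_def const hat_S[symmetric])
  qed
  moreover have "P ?\<gamma>" using wg(2) \<beta>(1) unfolding generic_y_def by blast
  then have n: "nice (osc Q u) u ?\<gamma>" "nice (osc Q v) v ?\<gamma>" "nice (osc Q f) f ?\<gamma>" "same_limits u f ?\<gamma>" "same_limits v f ?\<gamma>"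
    unfolding P_def by blast+
  obtain Lu where Lu: "end_limit u ?\<gamma> \<beta> Lu" using end_limit_exists[OF n(1) \<beta>(3)] by blast
  obtain Lv where Lv: "end_limit v ?\<gamma> \<beta> Lv" using end_limit_exists[OF n(2) \<beta>(3)] by blast
  obtain L where L: "end_limit f ?\<gamma> \<beta> L" using end_limit_exists[OF n(3) \<beta>(3)] by blast
  have "open (fst ?\<gamma>)" by simp
  then have "Lu = L" "Lv = L" using n(4,5) \<beta>(3) Lu Lv L unfolding same_limits_def by blast+
  then have "end_limit \<theta> ?\<gamma> \<beta> (a / 2)"
    using end_limit_compose[OF n(1,2) Lu Lv \<Phi> \<theta>k] a by simp
  ultimately have "a = a / 2" by (rule end_limit_unique[OF \<beta>(1,3)])
  then show False using a by simp
qed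

lemma minimizer_unique:
  assumes u: "dirichlet_minimizer ver \<Omega> Q f u" and v: "dirichlet_minimizer ver \<Omega> Q f v"
  shows "sobolev_eq ver \<Omega> Q u v"
proof -
  note U = minimizerD[OF u] and V = minimizerD[OF v]
  note fu = competitorsD(3)[OF U(1)] and fv = competitorsD(3)[OF V(1)]
  have rM: "rM u i = rM v i" for i using minimizers_rM_le[OF U V, of i] minimizers_rM_le[OF V U, of i] by linarith
  have rm: "rm u i = rm v i" for i using rM[of i] minimizers_same_ro[OF U V, of i] by linarith
  have *: "bdry_sup Q u i = bdry_sup Q v i" "bdry_inf Q u i = bdry_inf Q v i" for i
    using rM[of i] rm[of i] fu fv unfolding fin_def by (metis ereal_real')+
  have "aep (\<lambda>\<gamma>. nice (osc Q u) u \<gamma> \<and> nice (osc Q v) v \<gamma>)"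
    by (intro aep_conj sobolev_nice competitorsD(1) U V)
  then have "aep (\<lambda>\<gamma>. \<forall>x\<in>path_trace \<gamma> \<inter> S - (\<Union>i. frontier (Q i)). u x = v x)"
    by (rule aep_mono) (use agree_on_nice_path[OF _ fu _ fv rM] in blast)
  then show ?thesis unfolding sobolev_eq_def aep_ex_iff using * by blast
qed

end

theorem theorem2p58:
  fixes \<Omega> :: "complex set" and Q :: "nat \<Rightarrow> complex set"
    and f :: "complex \<Rightarrow> ereal" and ver :: version
  assumes "relative_sierpinski_carpet \<Omega> Q"
    and "bounded_by_jordan_curves \<Omega>"
    and "bounded \<Omega>"
    and "f \<in> sobolev ver \<Omega> Q"
    and "\<exists>M>0. \<forall>x\<in>frontier \<Omega>. \<bar>boundary_value \<Omega> Q f x\<bar> \<le> ereal M"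
  shows "(\<exists>u. dirichlet_minimizer ver \<Omega> Q f u) \<and>
         (\<forall>u v. dirichlet_minimizer ver \<Omega> Q f u \<longrightarrow> dirichlet_minimizer ver \<Omega> Q f v
                  \<longrightarrow> sobolev_eq ver \<Omega> Q u v) \<and>
         (\<forall>u. dirichlet_minimizer ver \<Omega> Q f u \<longrightarrow> carpet_harmonic ver \<Omega> Q u)"
proof -
  obtain M where M: "M > 0" "\<And>x. x \<in> frontier \<Omega> \<Longrightarrow> \<bar>boundary_value \<Omega> Q f x\<bar> \<le> ereal M"
    using assms(5) by blast
  interpret dirichlet_problem \<Omega> Q ver f M
    using assms(1-4) M by unfold_locales
  show ?thesis
    using minimizer_exists minimizer_unique minimizer_harmonic by blast
qed

end
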